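(* Let $s_0\in\mathbb{H}$ and $v_0\in L^1\cap L^\infty(\mathbb{R})$ with $\mathrm{supp}(v_0)\subseteq[s_0,\infty)$ and $v_0\le0$ a.e. Suppose that $$-\frac{1}{\lambda\kappa}\int_{s_0}^{s_0+y}v_0(x)\,\mathrm{d}x<y\quad\text{infinitely often, as } y\downarrow0$$ (i.e. for every $\eta>0$ the inequality holds for some $y\in(0,\eta)$). Then there exist càdlàg weak solutions $(v,s)\in\mathfrak{D}(v_0,s_0)$ to the supercooled Stefan problem with transport noise such that the following probabilistic representation holds globally in time: for all $t\ge0$, almost surely, $$v(t,x)\,\mathrm{d}x=\int_{s_0}^\infty \mathbb{P}(X^y_t\in\mathrm{d}x,\ t<\tau^y\mid\mathcal{F}_t)\,v_0(y)\,\mathrm{d}y,\qquad s(t)=s_0-\frac{1}{\lambda\kappa}\int_{s_0}^\infty\mathbb{P}(\tau^y\le t\mid\mathcal{F}_t)\,v_0(y)\,\mathrm{d}y,$$ where $\tau^y=\inf\{t\ge 0: X^y_t\le s(t)\}$ and $X^y_t=y+\sqrt{2\kappa-\theta^2}\,B_t+\theta W_t$ for a Brownian motion $B$ independent of $W$.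
   Context: Constants: $\kappa,\lambda>0$ and $\theta\in\mathbb{R}$ with $|\theta|<\sqrt{2\kappa}$. The equilibrium freezing temperature is $0$. $(\Omega,\mathcal{F},\mathbb{P})$ is a suitable complete probability space carrying a Brownian motion $W$ (and a Brownian motion $B$ independent of $W$), and $(\mathcal{F}_t)_{t\ge0}$ is the complete, right-continuous filtration generated by $W$. Write $\mathbb{H}=[0,\infty)$ and $\langle f,\phi\rangle=\int f\phi\,\mathrm{d}x$; "increasing" means non-decreasing. Path spaces: $\mathbf{D}_{\mathbb{R}}$ is the space of real-valued càdlàg paths on $[0,\infty)$. $f\in\mathbf{D}_{L^1(\mathbb{R})}$ iff $f(t,\cdot)\in L^1(\mathbb{R})$ for all $t\ge0$ and $t\mapsto\langle f(t,\cdot),\phi\rangle$ is in $\mathbf{D}_{\mathbb{R}}$ for all $\phi\in C_b(\mathbb{R})$. $\mathbf{D}^{\uparrow}_{\mathbb{H}}$ is the space of increasing càdlàg paths on $[0,\infty)$ with values in $\mathbb{H}$. Define $$\mathbf{D}(v_0,s_0)=\{(v,s)\in\mathbf{D}_{L^1(\mathbb{R})}\times\mathbf{D}^{\uparrow}_{\mathbb{H}}: s(0)=s_0,\ v(0,\cdot)=v_0,\ \mathrm{supp}(v(t,\cdot))\subseteq[s(t),\infty),\ \|v(t,\cdot)\|_{L^\infty}\le\|v_0\|_{L^\infty}\ \forall t\ge0\},$$ and let $\mathfrak{D}(v_0,s_0)$ be the space of $\mathcal{F}_t$-adapted processes with paths in $\mathbf{D}(v_0,s_0)$. Here $s(t-)$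 and $v(t-,\cdot)$ denote left limits in time (the latter tested against $C_b(\mathbb{R})$). Càdlàg weak solution: $(v,s)\in\mathfrak{D}(v_0,s_0)$ is a (global) càdlàg weak solution if, almost surely, $$\begin{aligned}\int_{s(t)}^{\infty}v(t,x)\phi(t,x)\,\mathrm{d}x-\int_{s_0}^{\infty}v_0(x)\phi(0,x)\,\mathrm{d}x=&\int_0^t\int_{s(r)}^{\infty}v(r,x)\partial_r\phi(r,x)\,\mathrm{d}x\,\mathrm{d}r+\kappa\int_0^t\int_{s(r)}^{\infty}v(r,x)\partial_{xx}\phi(r,x)\,\mathrm{d}x\,\mathrm{d}r\\&+\theta\int_0^t\int_{s(r)}^{\infty}v(r,x)\partial_x\phi(r,x)\,\mathrm{d}x\,\mathrm{d}W_r+\lambda\kappa\int_0^t\phi(r,s(r-))\,\mathrm{d}s(r)\\&+\sum_{0<r\le t}\int_{s(r-)}^{s(r)}v(r-,x)\bigl(\phi(r,s(r-))-\phi(r,x)\bigr)\,\mathrm{d}x\end{aligned}$$ for all $t>0$ and all $\phi\in C^{1,2}_b([0,\infty)\times\mathbb{R})$. *)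

theory Defs
  imports "HOL-Probability.Probability"
begin

section \<open>Brownian motion and its filtration\<close>

definition brownian_motion :: "'a measure \<Rightarrow> (real \<Rightarrow> 'a \<Rightarrow> real) \<Rightarrow> bool" where
  "brownian_motion M W \<longleftrightarrow>
     (\<forall>t\<ge>0. W t \<in> borel_measurable M) \<and>
     (AE \<omega> in M. W 0 \<omega> = 0) \<and>
     (AE \<omega> in M. continuous_on {0..} (\<lambda>t. W t \<omega>)) \<and>
     (\<forall>r t. 0 \<le> r \<longrightarrow> r < t \<longrightarrow>
        distributed M lborel (\<lambda>\<omega>. W t \<omega> - W r \<omega>) (normal_density 0 (sqrt (t - r)))) \<and>
     (\<forall>(n::nat) (p::nat \<Rightarrow> real). 0 \<le> p 0 \<longrightarrow> (\<forall>i<n. p i < p (Suc i)) \<longrightarrow>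
        prob_space.indep_vars M (\<lambda>_. borel) (\<lambda>i \<omega>. W (p (Suc i)) \<omega> - W (p i) \<omega>) {..<n})"

definition independent_processes ::
    "'a measure \<Rightarrow> (real \<Rightarrow> 'a \<Rightarrow> real) \<Rightarrow> (real \<Rightarrow> 'a \<Rightarrow> real) \<Rightarrow> bool" where
  "independent_processes M X Y \<longleftrightarrow>
     prob_space.indep_var M
       (\<Pi>\<^sub>M t\<in>{0..}. borel) (\<lambda>\<omega>. \<lambda>t\<in>{0..}. X t \<omega>)
       (\<Pi>\<^sub>M t\<in>{0..}. borel) (\<lambda>\<omega>. \<lambda>t\<in>{0..}. Y t \<omega>)"

definition completed_history :: "'a measure \<Rightarrow> (real \<Rightarrow> 'a \<Rightarrow> real) \<Rightarrow> real \<Rightarrow> 'a measure" where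
  "completed_history M W u =
     sigma (space M) ({W r -` A \<inter> space M |r A. 0 \<le> r \<and> r \<le> u \<and> A \<in> sets borel} \<union> null_sets M)"

text \<open>The complete, right-continuous filtration generated by \<open>W\<close>. As usual for sub-sigma-algebras
  in the library, only \<open>space\<close> and \<open>sets\<close> of these measures matter.\<close>

definition brownian_filtration :: "'a measure \<Rightarrow> (real \<Rightarrow> 'a \<Rightarrow> real) \<Rightarrow> real \<Rightarrow> 'a measure" where
  "brownian_filtration M W t = sigma (space M) (\<Inter>u\<in>{t<..}. sets (completed_history M W u))"


section \<open>The Ito integral\<close>

text \<open>A simple predictable process is \<open>\<Sum>i<n. \<xi> i \<cdot> 1\<^bsub>(p i, p (i+1)]\<^esub>\<close> with \<open>\<xi> i\<close> bounded and measurable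
  with respect to \<open>F (p i)\<close>.\<close>

definition simple_data ::
    "'a measure \<Rightarrow> (real \<Rightarrow> 'a measure) \<Rightarrow> nat \<Rightarrow> (nat \<Rightarrow> real) \<Rightarrow> (nat \<Rightarrow> 'a \<Rightarrow> real) \<Rightarrow> bool" where
  "simple_data M F n p \<xi> \<longleftrightarrow>
     0 \<le> p 0 \<and>
     (\<forall>i<n. p i < p (Suc i) \<and> \<xi> i \<in> borel_measurable (F (p i)) \<and>
            (\<exists>C. \<forall>\<omega>\<in>space M. \<bar>\<xi> i \<omega>\<bar> \<le> C))"

definition simple_process ::
    "nat \<Rightarrow> (nat \<Rightarrow> real) \<Rightarrow> (nat \<Rightarrow> 'a \<Rightarrow> real) \<Rightarrow> real \<Rightarrow> 'a \<Rightarrow> real" where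
  "simple_process n p \<xi> r \<omega> = (\<Sum>i<n. \<xi> i \<omega> * indicator {p i<..p (Suc i)} r)"

definition simple_integral ::
    "(real \<Rightarrow> 'a \<Rightarrow> real) \<Rightarrow> nat \<Rightarrow> (nat \<Rightarrow> real) \<Rightarrow> (nat \<Rightarrow> 'a \<Rightarrow> real) \<Rightarrow> real \<Rightarrow> 'a \<Rightarrow> real" where
  "simple_integral W n p \<xi> t \<omega> =
     (\<Sum>i<n. \<xi> i \<omega> * (W (min t (p (Suc i))) \<omega> - W (min t (p i)) \<omega>))"

definition progressive :: "(real \<Rightarrow> 'a measure) \<Rightarrow> (real \<Rightarrow> 'a \<Rightarrow> real) \<Rightarrow> bool" where
  "progressive F H \<longleftrightarrow>
     (\<forall>T\<ge>0. (\<lambda>(r, \<omega>). H r \<omega>) \<in> borel_measurable (restrict_space borel {0..T} \<Otimes>\<^sub>M F T))"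

text \<open>\<open>ito_integral M F W H I\<close>: the process \<open>I\<close> is a version of \<open>\<integral>\<^sub>0\<^sup>t H\<^sub>r dW\<^sub>r\<close>, \<open>t \<ge> 0\<close>, for a
  progressively measurable \<open>H\<close> that is almost surely locally square integrable (local square
  integrability is implied by the approximation property). Such an \<open>I\<close> is adapted and almost
  surely continuous, and the limit in probability determines it up to indistinguishability.\<close>

definition ito_integral ::
    "'a measure \<Rightarrow> (real \<Rightarrow> 'a measure) \<Rightarrow> (real \<Rightarrow> 'a \<Rightarrow> real) \<Rightarrow> (real \<Rightarrow> 'a \<Rightarrow> real) \<Rightarrow>
     (real \<Rightarrow> 'a \<Rightarrow> real) \<Rightarrow> bool" where
  "ito_integral M F W H I \<longleftrightarrow>
     progressive F H \<and>
     (\<forall>t\<ge>0. I t \<in> borel_measurable (F t)) \<and>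
     (AE \<omega> in M. continuous_on {0..} (\<lambda>t. I t \<omega>)) \<and>
     (\<exists>n p \<xi>. (\<forall>k::nat. simple_data M F (n k) (p k) (\<xi> k)) \<and>
        (\<forall>T>0. \<forall>\<epsilon>>0.
           (\<lambda>k. measure M {\<omega>\<in>space M.
              ennreal \<epsilon> < (\<integral>\<^sup>+r\<in>{0..T}. ennreal ((H r \<omega> - simple_process (n k) (p k) (\<xi> k) r \<omega>)\<^sup>2) \<partial>lborel)})
             \<longlonglongrightarrow> 0) \<and>
        (\<forall>t\<ge>0. \<forall>\<epsilon>>0.
           (\<lambda>k. measure M {\<omega>\<in>space M. \<epsilon> < \<bar>I t \<omega> - simple_integral W (n k) (p k) (\<xi> k) t \<omega>\<bar>})
             \<longlonglongrightarrow> 0))"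


section \<open>Path spaces\<close>

text \<open>Elements of \<open>L\<^sup>1(\<real>)\<close> are represented by Borel functions, with equality almost everywhere.
  Paths are functions on all of \<open>\<real>\<close> of which only the values at times \<open>t \<ge> 0\<close> matter;
  \<open>bcontfun\<close> is the set of bounded continuous functions.\<close>

definition ess_support :: "(real \<Rightarrow> real) \<Rightarrow> real set" where
  "ess_support f = - \<Union>{U. open U \<and> (AE x in lborel. x \<in> U \<longrightarrow> f x = 0)}"

definition Linf_norm :: "(real \<Rightarrow> real) \<Rightarrow> ereal" where
  "Linf_norm f = esssup lborel (\<lambda>x. ereal \<bar>f x\<bar>)"

definition cadlag :: "(real \<Rightarrow> real) \<Rightarrow> bool" where
  "cadlag f \<longleftrightarrow>
     (\<forall>t\<ge>0. continuous (at_right t) f) \<and> (\<forall>t>0. \<exists>l. (f \<longlongrightarrow> l) (at_left t))"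

definition D_L1 :: "(real \<Rightarrow> real \<Rightarrow> real) set" where
  "D_L1 = {f. (\<forall>t\<ge>0. integrable lborel (f t)) \<and>
              (\<forall>\<phi>\<in>bcontfun. cadlag (\<lambda>t. LINT x|lborel. f t x * \<phi> x))}"

definition D_up :: "(real \<Rightarrow> real) set" where
  "D_up = {s. cadlag s \<and> mono_on {0..} s \<and> (\<forall>t\<ge>0. 0 \<le> s t)}"

definition D_paths ::
    "(real \<Rightarrow> real) \<Rightarrow> real \<Rightarrow> ((real \<Rightarrow> real \<Rightarrow> real) \<times> (real \<Rightarrow> real)) set" where
  "D_paths v0 s0 = {(v, s). v \<in> D_L1 \<and> s \<in> D_up \<and> s 0 = s0 \<and>
     (AE x in lborel. v 0 x = v0 x) \<and>
     (\<forall>t\<ge>0. ess_support (v t) \<subseteq> {s t..} \<and> Linf_norm (v t) \<le> Linf_norm v0)}"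

text \<open>A process with values in the separable space \<open>L\<^sup>1(\<real>)\<close> is adapted iff its pairings with
  bounded continuous functions are.\<close>

definition D_processes ::
    "'a measure \<Rightarrow> (real \<Rightarrow> 'a measure) \<Rightarrow> (real \<Rightarrow> real) \<Rightarrow> real \<Rightarrow>
     (('a \<Rightarrow> real \<Rightarrow> real \<Rightarrow> real) \<times> ('a \<Rightarrow> real \<Rightarrow> real)) set" where
  "D_processes M F v0 s0 = {(v, s).
     (\<forall>\<omega>\<in>space M. (v \<omega>, s \<omega>) \<in> D_paths v0 s0) \<and>
     (\<forall>t\<ge>0. (\<lambda>\<omega>. s \<omega> t) \<in> borel_measurable (F t)) \<and>
     (\<forall>t\<ge>0. \<forall>\<phi>\<in>bcontfun. (\<lambda>\<omega>. LINT x|lborel. v \<omega> t x * \<phi> x) \<in> borel_measurable (F t))}"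

definition left_lim :: "(real \<Rightarrow> real) \<Rightarrow> real \<Rightarrow> real" where
  "left_lim s r = Lim (at_left r) s"

text \<open>The left limit tested against bounded continuous functions. On \<open>D_paths\<close> the uniform
  \<open>L\<^sup>\<infinity>\<close> bound makes this limit a function, unique up to null sets.\<close>

definition left_lim_L1 :: "(real \<Rightarrow> real \<Rightarrow> real) \<Rightarrow> real \<Rightarrow> real \<Rightarrow> real" where
  "left_lim_L1 v r = (SOME g. integrable lborel g \<and>
     (\<forall>\<phi>\<in>bcontfun. ((\<lambda>q. LINT x|lborel. v q x * \<phi> x) \<longlongrightarrow> (LINT x|lborel. g x * \<phi> x)) (at_left r)))"


section \<open>Cadlag weak solutions\<close>

text \<open>The time derivative is one-sided at time 0.\<close>

definition d_t :: "(real \<Rightarrow> real \<Rightarrow> real) \<Rightarrow> real \<Rightarrow> real \<Rightarrow> real" where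
  "d_t \<phi> r x = vector_derivative (\<lambda>q. \<phi> q x) (at r within {0..})"

definition d_x :: "(real \<Rightarrow> real \<Rightarrow> real) \<Rightarrow> real \<Rightarrow> real \<Rightarrow> real" where
  "d_x \<phi> r x = deriv (\<phi> r) x"

definition d_xx :: "(real \<Rightarrow> real \<Rightarrow> real) \<Rightarrow> real \<Rightarrow> real \<Rightarrow> real" where
  "d_xx \<phi> = d_x (d_x \<phi>)"

definition C12b :: "(real \<Rightarrow> real \<Rightarrow> real) set" where
  "C12b = {\<phi>.
     (\<forall>r\<ge>0. \<forall>x. (\<lambda>q. \<phi> q x) differentiable (at r within {0..})
        \<and> \<phi> r differentiable (at x) \<and> d_x \<phi> r differentiable (at x)) \<and>
     (\<forall>\<psi>\<in>{\<phi>, d_t \<phi>, d_x \<phi>, d_xx \<phi>}.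
        continuous_on ({0..} \<times> UNIV) (\<lambda>(r, x). \<psi> r x) \<and>
        bounded ((\<lambda>(r, x). \<psi> r x) ` ({0..} \<times> UNIV)))}"

text \<open>\<open>\<integral>\<^bsub>(0,t]\<^esub> g(r) ds(r)\<close>; extending \<open>s\<close> by \<open>s(0)\<close> to negative times makes \<open>interval_measure\<close>
  applicable.\<close>

definition stieltjes :: "(real \<Rightarrow> real) \<Rightarrow> (real \<Rightarrow> real) \<Rightarrow> real \<Rightarrow> real" where
  "stieltjes g s t = (LINT r:{0<..t}|interval_measure (\<lambda>r. s (max 0 r)). g r)"

text \<open>The weak formulation for one path \<open>(v, s)\<close>, with \<open>J\<close> standing for the value at time \<open>t\<close> of the
  stochastic integral.\<close>

definition weak_identity ::
    "real \<Rightarrow> real \<Rightarrow> real \<Rightarrow> (real \<Rightarrow> real) \<Rightarrow> real \<Rightarrow> (real \<Rightarrow> real \<Rightarrow> real) \<Rightarrow> (real \<Rightarrow> real) \<Rightarrow>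
     (real \<Rightarrow> real \<Rightarrow> real) \<Rightarrow> real \<Rightarrow> real \<Rightarrow> bool" where
  "weak_identity \<kappa> lam \<theta> v0 s0 v s \<phi> t J \<longleftrightarrow>
     (LINT x:{s t..}|lborel. v t x * \<phi> t x) - (LINT x:{s0..}|lborel. v0 x * \<phi> 0 x) =
       (LINT r:{0..t}|lborel. (LINT x:{s r..}|lborel. v r x * d_t \<phi> r x))
     + \<kappa> * (LINT r:{0..t}|lborel. (LINT x:{s r..}|lborel. v r x * d_xx \<phi> r x))
     + \<theta> * J
     + lam * \<kappa> * stieltjes (\<lambda>r. \<phi> r (left_lim s r)) s t
     + (\<Sum>\<^sub>\<infinity>r\<in>{0<..t}. LINT x:{left_lim s r..s r}|lborel.
            left_lim_L1 v r x * (\<phi> r (left_lim s r) - \<phi> r x))"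

text \<open>Since a stochastic integral is only defined up to null sets for each test function, while the
  identity is to hold almost surely for all test functions at once, a version \<open>J \<phi>\<close> of the stochastic
  integral is chosen for every \<open>\<phi>\<close>.\<close>

definition cadlag_weak_solution ::
    "'a measure \<Rightarrow> (real \<Rightarrow> 'a \<Rightarrow> real) \<Rightarrow> real \<Rightarrow> real \<Rightarrow> real \<Rightarrow> (real \<Rightarrow> real) \<Rightarrow> real \<Rightarrow>
     ('a \<Rightarrow> real \<Rightarrow> real \<Rightarrow> real) \<Rightarrow> ('a \<Rightarrow> real \<Rightarrow> real) \<Rightarrow> bool" where
  "cadlag_weak_solution M W \<kappa> lam \<theta> v0 s0 v s \<longleftrightarrow>
     (v, s) \<in> D_processes M (brownian_filtration M W) v0 s0 \<and>
     (\<exists>J. (\<forall>\<phi>\<in>C12b. ito_integral M (brownian_filtration M W) W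
              (\<lambda>r \<omega>. LINT x:{s \<omega> r..}|lborel. v \<omega> r x * d_x \<phi> r x) (J \<phi>)) \<and>
          (AE \<omega> in M. \<forall>t>0. \<forall>\<phi>\<in>C12b.
              weak_identity \<kappa> lam \<theta> v0 s0 (v \<omega>) (s \<omega>) \<phi> t (J \<phi> t \<omega>)))"


section \<open>The probabilistic representation\<close>

definition particle ::
    "real \<Rightarrow> real \<Rightarrow> (real \<Rightarrow> 'a \<Rightarrow> real) \<Rightarrow> (real \<Rightarrow> 'a \<Rightarrow> real) \<Rightarrow> real \<Rightarrow> real \<Rightarrow> 'a \<Rightarrow> real" where
  "particle \<kappa> \<theta> B W y t \<omega> = y + sqrt (2 * \<kappa> - \<theta>\<^sup>2) * B t \<omega> + \<theta> * W t \<omega>"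

definition hitting_time :: "(real \<Rightarrow> 'a \<Rightarrow> real) \<Rightarrow> ('a \<Rightarrow> real \<Rightarrow> real) \<Rightarrow> 'a \<Rightarrow> ereal" where
  "hitting_time X s \<omega> = Inf {ereal t |t. 0 \<le> t \<and> X t \<omega> \<le> s \<omega> t}"

text \<open>Integrating \<open>P(E y | G)\<close> in \<open>y\<close> needs a version that is jointly measurable in \<open>(\<omega>, y)\<close>. Two such
  versions agree almost everywhere on the product, so the integral is almost surely unique. In
  \<open>cond_kernel\<close> the version of \<open>P(X y \<in> dx, E y | G)\<close> is moreover a measure in \<open>dx\<close>.\<close>

definition cond_prob_version ::
    "'a measure \<Rightarrow> 'a measure \<Rightarrow> (real \<Rightarrow> 'a \<Rightarrow> bool) \<Rightarrow> ('a \<Rightarrow> real \<Rightarrow> real) \<Rightarrow> bool" where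
  "cond_prob_version M G E q \<longleftrightarrow>
     (\<lambda>(\<omega>, y). q \<omega> y) \<in> borel_measurable (G \<Otimes>\<^sub>M borel) \<and>
     (\<forall>y. {\<omega>\<in>space M. E y \<omega>} \<in> sets M \<and>
          (AE \<omega> in M. q \<omega> y = real_cond_exp M G (indicator {\<omega>\<in>space M. E y \<omega>}) \<omega>))"

definition cond_kernel ::
    "'a measure \<Rightarrow> 'a measure \<Rightarrow> (real \<Rightarrow> 'a \<Rightarrow> real) \<Rightarrow> (real \<Rightarrow> 'a \<Rightarrow> bool) \<Rightarrow>
     ('a \<Rightarrow> real \<Rightarrow> real measure) \<Rightarrow> bool" where
  "cond_kernel M G X E K \<longleftrightarrow>
     (\<lambda>(\<omega>, y). K \<omega> y) \<in> G \<Otimes>\<^sub>M borel \<rightarrow>\<^sub>M subprob_algebra borel \<and>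
     (\<forall>A\<in>sets borel. cond_prob_version M G (\<lambda>y \<omega>. X y \<omega> \<in> A \<and> E y \<omega>) (\<lambda>\<omega> y. measure (K \<omega> y) A))"

definition density_representation ::
    "'a measure \<Rightarrow> (real \<Rightarrow> 'a \<Rightarrow> real) \<Rightarrow> (real \<Rightarrow> 'a \<Rightarrow> real) \<Rightarrow> real \<Rightarrow> real \<Rightarrow>
     (real \<Rightarrow> real) \<Rightarrow> real \<Rightarrow> ('a \<Rightarrow> real \<Rightarrow> real \<Rightarrow> real) \<Rightarrow> ('a \<Rightarrow> real \<Rightarrow> real) \<Rightarrow> real \<Rightarrow> bool" where
  "density_representation M W B \<kappa> \<theta> v0 s0 v s t \<longleftrightarrow>
     (\<exists>K. cond_kernel M (brownian_filtration M W t)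
            (\<lambda>y. particle \<kappa> \<theta> B W y t)
            (\<lambda>y \<omega>. ereal t < hitting_time (particle \<kappa> \<theta> B W y) s \<omega>) K \<and>
          (AE \<omega> in M. \<forall>A\<in>sets borel.
             (LINT x:A|lborel. v \<omega> t x) = (LINT y:{s0..}|lborel. measure (K \<omega> y) A * v0 y)))"

definition front_representation ::
    "'a measure \<Rightarrow> (real \<Rightarrow> 'a \<Rightarrow> real) \<Rightarrow> (real \<Rightarrow> 'a \<Rightarrow> real) \<Rightarrow> real \<Rightarrow> real \<Rightarrow> real \<Rightarrow>
     (real \<Rightarrow> real) \<Rightarrow> real \<Rightarrow> ('a \<Rightarrow> real \<Rightarrow> real) \<Rightarrow> real \<Rightarrow> bool" where
  "front_representation M W B \<kappa> lam \<theta> v0 s0 s t \<longleftrightarrow>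
     (\<exists>q. cond_prob_version M (brownian_filtration M W t)
            (\<lambda>y \<omega>. hitting_time (particle \<kappa> \<theta> B W y) s \<omega> \<le> ereal t) q \<and>
          (AE \<omega> in M.
             s \<omega> t = s0 - 1 / (lam * \<kappa>) * (LINT y:{s0..}|lborel. q \<omega> y * v0 y)))"

end

theory Submission
  imports Defs
begin

text \<open>The front advances in proportion to the mass of the absorbed particles; hence it determines the solution,
  and the front is a fixed point: \<open>s(t) = s\<^sub>0 + E' F(sup\<^bsub>r\<le>t\<^esub> (s(r) - z\<^sub>r))\<close>, where \<open>z = \<sigma> B + \<theta> W\<close> with \<open>\<sigma>\<^sup>2 + \<theta>\<^sup>2 = 2 \<kappa>\<close>,
  \<open>E'\<close> averages over \<open>B\<close> alone and \<open>F\<close> is the primitive of \<open>- v\<^sub>0 / (\<lambda>\<kappa>)\<close>. To keep \<open>W\<close> frozen, \<open>B\<close> is evaluated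
  at a second sample point \<open>\<omega>'\<close>, so that \<open>E'\<close> is an integral over a copy of \<open>M\<close>. Monotone iteration from the
  constant path \<open>s\<^sub>0\<close>, followed by the right limit in time, gives such a fixed point; the hypothesis on \<open>v\<^sub>0\<close>
  near \<open>s\<^sub>0\<close> keeps it from jumping at time \<open>0\<close>.

  With \<open>Q\<close> the law of the pairs of a path \<open>\<omega>'\<close> and a starting point drawn from \<open>- v\<^sub>0\<close>, every term of the weak
  identity is a \<open>Q\<close>-integral along the absorbed particle \<open>X\<close>, and the identity says that \<open>\<theta>\<close> times the stochastic
  integral is \<open>- \<integral> N dQ\<close>, where \<open>N\<close> is the martingale part of \<open>\<phi>(t, X)\<close>. Ito's formula along the grid of mesh
  \<open>1/(k+1)\<close>, in mean with respect to \<open>M \<otimes> Q\<close>, approximates \<open>\<integral> N dQ\<close> by simple integrals of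
  \<open>- E'(\<partial>\<^sub>x\<phi>(X); alive)\<close> against \<open>\<theta> W\<close>. For \<open>\<theta> \<noteq> 0\<close> this exhibits \<open>- \<theta>\<^sup>-\<^sup>1 \<integral> N dQ\<close> as the stochastic
  integral; for \<open>\<theta> = 0\<close> the integrand is deterministic and a continuous version comes from Kolmogorov's maximal
  inequality. The representation holds because \<open>W\<close> and \<open>B\<close> are independent, so that conditioning on \<open>W\<close>
  amounts to integrating over \<open>\<omega>'\<close>.\<close>

text \<open>The fixed point encodes absorption: a particle started at \<open>y\<close> has met a
  right-continuous monotone barrier \<open>s\<close> by time \<open>t\<close> exactly when
  \<open>y\<close> is at most the running supremum of \<open>s - z\<close>, because
  \<open>s - z\<close> jumps only upwards and attains this supremum. The Stieltjes term of the weak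
  identity evaluates \<open>\<phi>\<close> at the left limit of the front; the jump sum replaces
  this by the position at which the particle really meets the front, so that together they describe
  a stopped particle. The obstacle is the filtration: the front at time \<open>t\<close> is known
  only immediately after \<open>t\<close>, while increments are shown to be independent of the
  completed history at their starting time. The discrete Ito formula therefore tests survival one
  grid point earlier. For \<open>\<theta> = 0\<close> the identity puts no condition on the
  stochastic integral, yet a continuous version of it must still be exhibited.\<close>

lemma tendsto_integral_within:
  fixes f :: "real \<Rightarrow> 'b \<Rightarrow> real"
  assumes "finite_measure N"
    and meas: "\<And>r. r \<in> S \<Longrightarrow> f r \<in> borel_measurable N"
    and lim: "\<And>x. x \<in> space N \<Longrightarrow> ((\<lambda>r. f r x) \<longlongrightarrow> g x) (at t within S)"
    and bound: "\<And>r x. r \<in> S \<Longrightarrow> x \<in> space N \<Longrightarrow> \<bar>f r x\<bar> \<le> C"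
  shows "((\<lambda>r. \<integral>x. f r x \<partial>N) \<longlongrightarrow> (\<integral>x. g x \<partial>N)) (at t within S)"
proof -
  interpret finite_measure N by fact
  show ?thesis
    unfolding tendsto_at_iff_sequentially
  proof (intro allI impI)
    fix X :: "nat \<Rightarrow> real" assume X: "\<forall>i. X i \<in> S - {t}" and Xt: "X \<longlonglongrightarrow> t"
    have l: "(\<lambda>i. f (X i) x) \<longlonglongrightarrow> g x" if "x \<in> space N" for x
      using lim[OF that] X Xt unfolding tendsto_at_iff_sequentially comp_def by blast
    have m: "f (X i) \<in> borel_measurable N" for i using X meas by auto
    have "g \<in> borel_measurable N"
      by (rule borel_measurable_LIMSEQ_real[OF l m])
    then show "((\<lambda>r. \<integral>x. f r x \<partial>N) \<circ> X) \<longlonglongrightarrow> (\<integral>x. g x \<partial>N)"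
      unfolding comp_def
      using X l m bound
      by (intro integral_dominated_convergence[where w="\<lambda>_. C"]) auto
  qed
qed

text \<open>The time is rounded up to the next point of a grid of mesh \<open>1/(k+1)\<close>,
  capped at \<open>T\<close>. The rounded time takes countably many values, so the approximation is
  jointly measurable, and right continuity gives pointwise convergence. The cap makes the
  approximation exact at \<open>T\<close>; no value after \<open>T\<close> enters, as progressive
  measurability requires.\<close>

lemma right_continuous_jointly_measurable:
  fixes f :: "real \<Rightarrow> 'b \<Rightarrow> real"
  assumes "0 \<le> T"
    and meas: "\<And>r. r \<in> {0..T} \<Longrightarrow> f r \<in> borel_measurable N"
    and lim: "\<And>x r. x \<in> space N \<Longrightarrow> 0 \<le> r \<Longrightarrow> r < T \<Longrightarrow> ((\<lambda>r. f r x) \<longlongrightarrow> f r x) (at_right r)"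
  shows "(\<lambda>(r, x). f r x) \<in> borel_measurable (restrict_space borel {0..T} \<Otimes>\<^sub>M N)"
proof -
  let ?P = "restrict_space borel {0..T} \<Otimes>\<^sub>M N"
  define d where "d k i = max 0 (min T ((of_int i + 1) / real (Suc k)))" for k :: nat and i :: int
  define fl where "fl k z = \<lfloor>fst z * real (Suc k)\<rfloor>" for k and z :: "real \<times> 'b"
  have m: "(\<lambda>z. f (d k (fl k z)) (snd z)) \<in> borel_measurable ?P" for k
  proof (rule measurable_compose_countable[where f="\<lambda>i z. f (d k i) (snd z)" and g="fl k"])
    fix i :: int
    have "d k i \<in> {0..T}" using \<open>0 \<le> T\<close> by (auto simp: d_def)
    then have [measurable]: "f (d k i) \<in> borel_measurable N" by (rule meas)
    show "(\<lambda>z. f (d k i) (snd z)) \<in> borel_measurable ?P" by measurable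
  next
    have [measurable]: "fst \<in> borel_measurable ?P"
      by (rule measurable_fst''[where N=borel and f="\<lambda>x. x", simplified])
         (simp add: measurable_restrict_space1)
    show "fl k \<in> measurable ?P (count_space UNIV)"
      unfolding fl_def by measurable
  qed
  show ?thesis
  proof (rule borel_measurable_LIMSEQ_real[OF _ m])
    fix z assume "z \<in> space ?P"
    then obtain r x where z: "z = (r, x)" "0 \<le> r" "r \<le> T" "x \<in> space N"
      by (auto simp: space_pair_measure space_restrict_space)
    show "(\<lambda>k. f (d k (fl k z)) (snd z)) \<longlonglongrightarrow> (case z of (r, x) \<Rightarrow> f r x)"
    proof (cases "r = T")
      case True
      have "d k (fl k z) = T" for k
      proof -
        have "r * real (Suc k) < of_int (fl k z) + 1" unfolding fl_def z(1) by simp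
        then have "r < (of_int (fl k z) + 1) / real (Suc k)" by (simp add: field_simps)
        then show ?thesis using True \<open>0 \<le> T\<close> by (auto simp: d_def)
      qed
      then show ?thesis by (simp add: z(1) True)
    next
      case False
      then have rT: "r < T" using z by simp
      have gt: "r < d k (fl k z)" for k
      proof -
        have "r * real (Suc k) < of_int (fl k z) + 1" unfolding fl_def z(1) by simp
        then have "r < (of_int (fl k z) + 1) / real (Suc k)" by (simp add: field_simps)
        then show ?thesis using rT z by (auto simp: d_def)
      qed
      have lt: "d k (fl k z) \<le> r + 1 / real (Suc k)" for k
      proof -
        have "of_int (fl k z) \<le> r * real (Suc k)" unfolding fl_def z(1) by simp
        then have "of_int (fl k z) / real (Suc k) \<le> r" by (subst pos_divide_le_eq) simp_all
        then have "(of_int (fl k z) + 1) / real (Suc k) \<le> r + 1 / real (Suc k)"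
          unfolding add_divide_distrib by linarith
        moreover have "0 \<le> r + 1 / real (Suc k)" using z by simp
        ultimately show ?thesis unfolding d_def by linarith
      qed
      have up: "(\<lambda>k. r + 1 / real (Suc k)) \<longlonglongrightarrow> r"
        using tendsto_add[OF tendsto_const LIMSEQ_inverse_real_of_nat[unfolded inverse_eq_divide], of r]
        by (simp only: add_0_right)
      have "(\<lambda>k. d k (fl k z)) \<longlonglongrightarrow> r"
        by (rule tendsto_sandwich[OF _ _ tendsto_const up])
          (simp_all only: lt gt[THEN less_imp_le] eventually_True)
      then have "filterlim (\<lambda>k. d k (fl k z)) (at_right r) sequentially"
        using gt by (auto simp: filterlim_at gt[THEN less_imp_neq, THEN not_sym])
      from filterlim_compose[OF lim[OF z(4) z(2) rT] this]
      show ?thesis by (simp add: z(1))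
    qed
  qed
qed

section \<open>Completed histories of Brownian motion\<close>

text \<open>The completion of \<open>\<A>\<close> by null sets, kept inside the events of
  \<open>M\<close>. Independence is insensitive to it, which carries independence from raw path
  events to completed histories.\<close>

definition almost_sets :: "'a measure \<Rightarrow> 'a set set \<Rightarrow> 'a set set" where
  "almost_sets M \<A> = {A \<in> sets M. \<exists>C\<in>\<A>. AE x in M. x \<in> A \<longleftrightarrow> x \<in> C}"

lemma sigma_algebra_almost_sets:
  assumes "sigma_algebra (space M) \<A>" "\<A> \<subseteq> sets M"
  shows "sigma_algebra (space M) (almost_sets M \<A>)"
proof -
  interpret A: sigma_algebra "space M" \<A> by fact
  show ?thesis
    unfolding sigma_algebra_iff2
  proof (intro conjI ballI allI impI)
    show "almost_sets M \<A> \<subseteq> Pow (space M)"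
      by (auto simp: almost_sets_def dest: sets.sets_into_space)
    show "{} \<in> almost_sets M \<A>"
      unfolding almost_sets_def by (auto intro!: bexI[of _ "{}"])
    fix a assume "a \<in> almost_sets M \<A>"
    then obtain c where "a \<in> sets M" "c \<in> \<A>" "AE x in M. x \<in> a \<longleftrightarrow> x \<in> c"
      by (auto simp: almost_sets_def)
    then show "space M - a \<in> almost_sets M \<A>"
      unfolding almost_sets_def by (auto intro!: bexI[of _ "space M - c"])
  next
    fix A :: "nat \<Rightarrow> _" assume "range A \<subseteq> almost_sets M \<A>"
    then have "\<forall>i. \<exists>c. A i \<in> sets M \<and> c \<in> \<A> \<and> (AE x in M. x \<in> A i \<longleftrightarrow> x \<in> c)"
      by (auto simp: almost_sets_def image_subset_iff)
    then obtain c where c: "\<And>i. A i \<in> sets M" "\<And>i. c i \<in> \<A>" "\<And>i. AE x in M. x \<in> A i \<longleftrightarrow> x \<in> c i"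
      by metis
    have "AE x in M. \<forall>i. x \<in> A i \<longleftrightarrow> x \<in> c i" using c(3) by (simp add: AE_all_countable)
    then have "AE x in M. x \<in> (\<Union>i. A i) \<longleftrightarrow> x \<in> (\<Union>i. c i)" by eventually_elim auto
    moreover have "(\<Union>i. c i) \<in> \<A>" using c(2) by auto
    ultimately show "(\<Union>i. A i) \<in> almost_sets M \<A>"
      using c(1) unfolding almost_sets_def by (auto intro: bexI[of _ "\<Union>i. c i"])
  qed
qed

text \<open>Both sides of the product formula see only the classes of events modulo null
  sets.\<close>

lemma (in prob_space) indep_almost_sets:
  assumes "\<A> \<subseteq> events" "\<B> \<subseteq> events"
    and ind: "\<And>a b. a \<in> \<A> \<Longrightarrow> b \<in> \<B> \<Longrightarrow> prob (a \<inter> b) = prob a * prob b"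
    and ab: "a \<in> almost_sets M \<A>" "b \<in> almost_sets M \<B>"
  shows "prob (a \<inter> b) = prob a * prob b"
proof -
  obtain c where c: "a \<in> events" "c \<in> \<A>" "AE x in M. x \<in> a \<longleftrightarrow> x \<in> c"
    using ab(1) by (auto simp: almost_sets_def)
  obtain d where d: "b \<in> events" "d \<in> \<B>" "AE x in M. x \<in> b \<longleftrightarrow> x \<in> d"
    using ab(2) by (auto simp: almost_sets_def)
  have ev: "c \<in> events" "d \<in> events" using c d assms by auto
  have "prob a = prob c" "prob b = prob d"
    using c d ev by (auto intro!: measure_eq_AE)
  moreover have "prob (a \<inter> b) = prob (c \<inter> d)"
    using c(1,3) d(1,3) ev by (intro measure_eq_AE) auto
  ultimately show ?thesis using ind[OF c(2) d(2)] by simp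
qed

lemma almost_sets_vimage_cong:
  assumes "X \<in> measurable M N" "Y \<in> measurable M N" "AE x in M. X x = Y x"
    and "Y -` A \<inter> space M \<in> \<A>" "A \<in> sets N"
  shows "X -` A \<inter> space M \<in> almost_sets M \<A>"
  unfolding almost_sets_def
proof (intro CollectI conjI bexI)
  show "X -` A \<inter> space M \<in> sets M" using assms by auto
  show "AE x in M. x \<in> X -` A \<inter> space M \<longleftrightarrow> x \<in> Y -` A \<inter> space M"
    using assms(3) by eventually_elim auto
qed (fact assms)

lemma in_almost_sets: "A \<in> \<A> \<Longrightarrow> \<A> \<subseteq> sets M \<Longrightarrow> A \<in> almost_sets M \<A>"
  unfolding almost_sets_def by auto

lemma null_sets_almost:
  assumes "{} \<in> \<A>" shows "null_sets M \<subseteq> almost_sets M \<A>"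
  unfolding almost_sets_def using assms
  by (auto intro!: bexI[of _ "{}"] intro: AE_not_in)

text \<open>It suffices to check the generators, since the completion is a sigma-algebra that
  contains the null sets. The family \<open>\<A>\<close> is left free: it may be generated by
  finite-dimensional events or consist of events of the whole path.\<close>

lemma completed_history_subset_almost:
  assumes \<A>: "sigma_algebra (space M) \<A>" "\<A> \<subseteq> sets M"
    and W: "\<And>r A. 0 \<le> r \<Longrightarrow> r \<le> u \<Longrightarrow> A \<in> sets borel \<Longrightarrow> W r -` A \<inter> space M \<in> almost_sets M \<A>"
  shows "sets (completed_history M W u) \<subseteq> almost_sets M \<A>"
proof -
  interpret \<A>: sigma_algebra "space M" \<A> by fact
  have "sets (completed_history M W u) =
    sigma_sets (space M) ({W r -` A \<inter> space M |r A. 0 \<le> r \<and> r \<le> u \<and> A \<in> sets borel} \<union> null_sets M)"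
    unfolding completed_history_def
    by (rule sets_measure_of) (auto dest: sets.sets_into_space[OF null_setsD2])
  also have "\<dots> \<subseteq> almost_sets M \<A>"
    using null_sets_almost[of \<A> M] W
    by (intro sigma_algebra.sigma_sets_subset[OF sigma_algebra_almost_sets[OF \<A>]]) auto
  finally show ?thesis .
qed

lemma sets_completed_history:
  "sets (completed_history M W u) =
    sigma_sets (space M) ({W r -` A \<inter> space M |r A. 0 \<le> r \<and> r \<le> u \<and> A \<in> sets borel} \<union> null_sets M)"
  unfolding completed_history_def
  by (rule sets_measure_of) (auto dest: sets.sets_into_space[OF null_setsD2])

lemma space_completed_history [simp]: "space (completed_history M W u) = space M"
  by (simp add: completed_history_def space_measure_of_conv)

text \<open>The definition of Brownian motion gives independence of increments along increasing
  grids only. So \<open>J\<close>, \<open>0\<close> and \<open>p\<close> are arranged into one grid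
  that ends with the step from \<open>p\<close> to \<open>t\<close>; the past is then a function of
  the earlier increments. Values are taken relative to \<open>W 0\<close>, because
  \<open>W 0 = 0\<close> holds only almost surely.\<close>

lemma (in prob_space) brownian_finite_past_indep:
  assumes bm: "brownian_motion M W" and J: "finite J" "J \<subseteq> {0..p}" and p: "0 \<le> p" "p < t"
    and C: "C \<in> sets (PiM J (\<lambda>_. borel))" and D: "D \<in> sets borel"
  defines "V \<equiv> \<lambda>\<omega>. \<lambda>r\<in>J. W r \<omega> - W 0 \<omega>"
  shows "prob (V -` C \<inter> (\<lambda>\<omega>. W t \<omega> - W p \<omega>) -` D \<inter> space M) =
    prob (V -` C \<inter> space M) * prob ((\<lambda>\<omega>. W t \<omega> - W p \<omega>) -` D \<inter> space M)"
proof -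
  define S where "S = insert 0 (insert p J)"
  define xs where "xs = sorted_list_of_set S"
  define m where "m = length xs - 1"
  \<comment> \<open>The sorted points of \<open>S\<close>, continued by \<open>t\<close>: increment
    number \<open>m\<close> is the one from \<open>p\<close> to \<open>t\<close>.\<close>
  define q where "q i = (if i < length xs then xs ! i else t)" for i
  have S: "finite S" "S \<subseteq> {0..p}" "0 \<in> S" "p \<in> S" using J p by (auto simp: S_def)
  have sx: "set xs = S" "sorted_wrt (<) xs" using S by (auto simp: xs_def)
  then have ne: "xs \<noteq> []" using S by auto
  then have len: "length xs = Suc m" by (simp add: m_def)
  have mono: "xs ! i < xs ! j" if "i < j" "j < length xs" for i j
    using sx(2) that by (simp add: sorted_wrt_iff_nth_less)
  have inS: "xs ! i \<in> {0..p}" if "i < length xs" for i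
    using that sx S(2) nth_mem[OF that] by auto
  obtain i0 where i0: "i0 < length xs" "xs ! i0 = 0" using S(3) sx by (metis in_set_conv_nth)
  obtain ip where ip: "ip < length xs" "xs ! ip = p" using S(4) sx by (metis in_set_conv_nth)
  have q0: "q 0 = 0"
    using mono[of 0 i0] i0 inS[of 0] ne by (cases "i0 = 0") (auto simp: q_def)
  have qm: "q m = p"
    using mono[of ip m] ip inS[of m] len by (cases "ip = m") (auto simp: q_def)
  have qt: "q (Suc m) = t" by (simp add: q_def len)
  have incr: "q i < q (Suc i)" if "i < Suc m" for i
    using that mono[of i "Suc i"] qm qt p len by (cases "i = m") (auto simp: q_def)
  define I where "I i \<omega> = W (q (Suc i)) \<omega> - W (q i) \<omega>" for i \<omega>
  have ind: "indep_vars (\<lambda>_. borel) I {..<Suc m}"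
    using bm incr q0 unfolding brownian_motion_def I_def by auto
  have 1: "indep_var (PiM {..<m} (\<lambda>_. borel)) (\<lambda>\<omega>. \<lambda>i\<in>{..<m}. I i \<omega>)
      (PiM {m} (\<lambda>_. borel)) (\<lambda>\<omega>. \<lambda>i\<in>{m}. I i \<omega>)"
    by (rule indep_var_restrict[OF ind]) auto
  have "\<forall>r\<in>J. \<exists>i. i \<le> m \<and> q i = r"
  proof
    fix r assume "r \<in> J"
    then have "r \<in> set xs" using sx by (simp add: S_def)
    then obtain i where "i < length xs" "xs ! i = r" by (metis in_set_conv_nth)
    then show "\<exists>i. i \<le> m \<and> q i = r" using len by (intro exI[of _ i]) (auto simp: q_def)
  qed
  then obtain idx where idx: "\<And>r. r \<in> J \<Longrightarrow> idx r \<le> m" "\<And>r. r \<in> J \<Longrightarrow> q (idx r) = r" by metis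
  \<comment> \<open>Recovers the path at the times in \<open>J\<close> from the increments by
    telescoping.\<close>
  define Y1 where "Y1 f = (\<lambda>r\<in>J. \<Sum>i<idx r. f i)" for f :: "nat \<Rightarrow> real"
  define Y2 where "Y2 f = f m" for f :: "nat \<Rightarrow> real"
  have Y1: "Y1 \<in> measurable (PiM {..<m} (\<lambda>_. borel)) (PiM J (\<lambda>_. borel))"
    unfolding Y1_def
  proof (rule measurable_restrict)
    fix r assume "r \<in> J"
    then show "(\<lambda>f :: nat \<Rightarrow> real. \<Sum>i<idx r. f i) \<in> borel_measurable (PiM {..<m} (\<lambda>_. borel))"
      using idx(1)[of r] by (intro borel_measurable_sum measurable_component_singleton) auto
  qed
  have Y2: "Y2 \<in> measurable (PiM {m} (\<lambda>_. borel)) borel"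
    unfolding Y2_def by (rule measurable_component_singleton) simp
  have e1: "Y1 (\<lambda>i\<in>{..<m}. I i \<omega>) = V \<omega>" for \<omega>
  proof
    fix r
    show "Y1 (\<lambda>i\<in>{..<m}. I i \<omega>) r = V \<omega> r"
    proof (cases "r \<in> J")
      case True
      have "(\<Sum>i<idx r. (\<lambda>i\<in>{..<m}. I i \<omega>) i) = (\<Sum>i<idx r. W (q (Suc i)) \<omega> - W (q i) \<omega>)"
        using idx(1)[OF True] by (intro sum.cong) (auto simp: I_def)
      also have "\<dots> = W (q (idx r)) \<omega> - W (q 0) \<omega>"
        by (rule sum_lessThan_telescope)
      finally show ?thesis using True by (simp add: Y1_def V_def idx(2) q0)
    qed (simp add: Y1_def V_def)
  qed
  have e2: "Y2 (\<lambda>i\<in>{m}. I i \<omega>) = W t \<omega> - W p \<omega>" for \<omega>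
    by (auto simp: Y2_def I_def qm qt)
  have s1: "(\<lambda>i\<in>{..<m}. I i \<omega>) \<in> space (PiM {..<m} (\<lambda>_. borel))"
    and s2: "(\<lambda>i\<in>{m}. I i \<omega>) \<in> space (PiM {m} (\<lambda>_. borel))" for \<omega>
    by (auto simp: space_PiM)
  note indep_varD[OF 1 measurable_sets[OF Y1 C] measurable_sets[OF Y2 D]]
  moreover have "(\<lambda>\<omega>. \<lambda>i\<in>{..<m}. I i \<omega>) -` (Y1 -` C \<inter> space (PiM {..<m} (\<lambda>_. borel))) \<inter> space M = V -` C \<inter> space M"
    using s1 by (auto simp: e1)
  moreover have "(\<lambda>\<omega>. \<lambda>i\<in>{m}. I i \<omega>) -` (Y2 -` D \<inter> space (PiM {m} (\<lambda>_. borel))) \<inter> space M =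
      (\<lambda>\<omega>. W t \<omega> - W p \<omega>) -` D \<inter> space M"
    using s2 by (auto simp: e2)
  moreover have "(\<lambda>x. (\<lambda>i\<in>{..<m}. I i x, \<lambda>i\<in>{m}. I i x)) -`
      ((Y1 -` C \<inter> space (PiM {..<m} (\<lambda>_. borel))) \<times> (Y2 -` D \<inter> space (PiM {m} (\<lambda>_. borel)))) \<inter> space M =
      V -` C \<inter> (\<lambda>\<omega>. W t \<omega> - W p \<omega>) -` D \<inter> space M"
    using s1 s2 by (auto simp: e1 e2)
  ultimately show ?thesis by simp
qed

text \<open>Finite-dimensional events form a family stable under intersections, so independence
  extends to the sigma-algebra they generate and then to its completion.\<close>

lemma (in prob_space) brownian_increment_indep_history:
  assumes bm: "brownian_motion M W" and p: "0 \<le> p" "p < t"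
    and A: "A \<in> sets (completed_history M W p)" and D: "D \<in> sets borel"
  shows "prob (A \<inter> ((\<lambda>\<omega>. W t \<omega> - W p \<omega>) -` D \<inter> space M)) =
    prob A * prob ((\<lambda>\<omega>. W t \<omega> - W p \<omega>) -` D \<inter> space M)"
proof -
  define V where "V J \<omega> = (\<lambda>r\<in>J. W r \<omega> - W 0 \<omega>)" for J \<omega>
  define PC where "PC = {V J -` C \<inter> space M | J C. finite J \<and> J \<subseteq> {0..p} \<and> C \<in> sets (PiM J (\<lambda>_. borel))}"
  define \<D> where "\<D> = {(\<lambda>\<omega>. W t \<omega> - W p \<omega>) -` D \<inter> space M | D. D \<in> sets borel}"
  have Wm [measurable]: "W r \<in> borel_measurable M" if "0 \<le> r" for r
    using bm that by (auto simp: brownian_motion_def)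
  have Vm [measurable]: "V J \<in> measurable M (PiM J (\<lambda>_. borel))" if "J \<subseteq> {0..p}" for J
    unfolding V_def using that by (intro measurable_restrict) auto
  have PC_ev: "PC \<subseteq> events" unfolding PC_def using measurable_sets[OF Vm] by blast
  have [measurable]: "(\<lambda>\<omega>. W t \<omega> - W p \<omega>) \<in> borel_measurable M"
    using p by (intro borel_measurable_diff Wm) auto
  have \<D>_ev: "\<D> \<subseteq> events" unfolding \<D>_def by auto
  have ind0: "indep_set PC \<D>"
    unfolding indep_sets2_eq
  proof (intro conjI PC_ev \<D>_ev ballI)
    fix a b assume "a \<in> PC" "b \<in> \<D>"
    then obtain J C D where *: "a = V J -` C \<inter> space M" "finite J" "J \<subseteq> {0..p}"
        "C \<in> sets (PiM J (\<lambda>_. borel))" "b = (\<lambda>\<omega>. W t \<omega> - W p \<omega>) -` D \<inter> space M" "D \<in> sets borel"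
      unfolding PC_def \<D>_def by auto
    have "a \<inter> b = V J -` C \<inter> (\<lambda>\<omega>. W t \<omega> - W p \<omega>) -` D \<inter> space M" using * by auto
    then show "prob (a \<inter> b) = prob a * prob b"
      using brownian_finite_past_indep[OF bm *(2,3) p *(4,6)] *(1,5) unfolding V_def by simp
  qed
  have stable: "Int_stable PC"
    unfolding Int_stable_def
  proof (intro ballI)
    fix a b assume "a \<in> PC" "b \<in> PC"
    then obtain J C K E where *: "a = V J -` C \<inter> space M" "finite J" "J \<subseteq> {0..p}" "C \<in> sets (PiM J (\<lambda>_. borel))"
       "b = V K -` E \<inter> space M" "finite K" "K \<subseteq> {0..p}" "E \<in> sets (PiM K (\<lambda>_. borel))"
      unfolding PC_def by blast
    let ?U = "PiM (J \<union> K) (\<lambda>_. borel :: real measure)"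
    define G where "G = ((\<lambda>f. restrict f J) -` C \<inter> space ?U) \<inter> ((\<lambda>f. restrict f K) -` E \<inter> space ?U)"
    have "G \<in> sets ?U"
      unfolding G_def using *(4,8) by (intro sets.Int measurable_sets[OF measurable_restrict_subset[OF Un_upper1]] measurable_sets[OF measurable_restrict_subset[OF Un_upper2]])
    moreover have "a \<inter> b = V (J \<union> K) -` G \<inter> space M"
    proof -
      have "restrict (V (J \<union> K) \<omega>) J = V J \<omega>" "restrict (V (J \<union> K) \<omega>) K = V K \<omega>" for \<omega>
        by (auto simp: V_def fun_eq_iff)
      moreover have "V (J \<union> K) \<omega> \<in> space ?U" for \<omega> by (auto simp: V_def space_PiM)
      ultimately show ?thesis unfolding *(1,5) G_def by auto
    qed
    ultimately show "a \<inter> b \<in> PC"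
      unfolding PC_def using *(2,3,6,7) by (intro CollectI exI[of _ "J \<union> K"] exI[of _ G] conjI) auto
  qed
  have stD: "Int_stable \<D>"
    unfolding Int_stable_def
  proof (intro ballI)
    fix a b assume "a \<in> \<D>" "b \<in> \<D>"
    then obtain D E where "a = (\<lambda>\<omega>. W t \<omega> - W p \<omega>) -` D \<inter> space M" "D \<in> sets borel"
      "b = (\<lambda>\<omega>. W t \<omega> - W p \<omega>) -` E \<inter> space M" "E \<in> sets borel" unfolding \<D>_def by blast
    then show "a \<inter> b \<in> \<D>" unfolding \<D>_def by (intro CollectI exI[of _ "D \<inter> E"]) auto
  qed
  have ind: "indep_set (sigma_sets (space M) PC) (sigma_sets (space M) \<D>)"
    by (rule indep_set_sigma_sets[OF ind0 stable stD])
  have sub: "sigma_sets (space M) PC \<subseteq> events" "sigma_sets (space M) \<D> \<subseteq> events"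
    by (rule sets.sigma_sets_subset[OF PC_ev], rule sets.sigma_sets_subset[OF \<D>_ev])
  have "A \<in> almost_sets M (sigma_sets (space M) PC)"
  proof (rule set_mp[OF completed_history_subset_almost A])
    show "sigma_algebra (space M) (sigma_sets (space M) PC)"
      using PC_ev by (intro sigma_algebra_sigma_sets) (auto dest: sets.sets_into_space)
    fix r and A :: "real set" assume r: "0 \<le> r" "r \<le> p" and A: "A \<in> sets borel"
    \<comment> \<open>The history is generated by \<open>W r\<close>, the family \<open>PC\<close>
      by \<open>W r - W 0\<close>; the two differ only on a null set.\<close>
    have "AE \<omega> in M. W 0 \<omega> = 0" using bm by (simp add: brownian_motion_def)
    then have ae: "AE \<omega> in M. W r \<omega> = W r \<omega> - W 0 \<omega>" by eventually_elim simp
    define C where "C = (\<lambda>f. f r) -` A \<inter> space (PiM {r} (\<lambda>_. borel :: real measure))"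
    have "C \<in> sets (PiM {r} (\<lambda>_. borel))"
      unfolding C_def using A by (intro measurable_sets[OF measurable_component_singleton]) auto
    moreover have "(\<lambda>\<omega>. W r \<omega> - W 0 \<omega>) -` A \<inter> space M = V {r} -` C \<inter> space M"
      by (auto simp: C_def V_def space_PiM)
    ultimately have "(\<lambda>\<omega>. W r \<omega> - W 0 \<omega>) -` A \<inter> space M \<in> PC"
      unfolding PC_def using r by (intro CollectI exI[of _ "{r}"] exI[of _ C]) auto
    then show "W r -` A \<inter> space M \<in> almost_sets M (sigma_sets (space M) PC)"
      using Wm[OF r(1)] r by (intro almost_sets_vimage_cong[OF Wm[OF r(1)] _ ae sigma_sets.Basic A] borel_measurable_diff Wm) auto
  qed (rule sub)
  moreover have "(\<lambda>\<omega>. W t \<omega> - W p \<omega>) -` D \<inter> space M \<in> sigma_sets (space M) \<D>"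
    using D by (intro sigma_sets.Basic) (auto simp: \<D>_def)
  then have "(\<lambda>\<omega>. W t \<omega> - W p \<omega>) -` D \<inter> space M \<in> almost_sets M (sigma_sets (space M) \<D>)"
    using sub(2) by (rule in_almost_sets)
  ultimately show ?thesis
    by (rule indep_almost_sets[OF sub, rotated]) (use ind in \<open>unfold indep_sets2_eq, blast\<close>)
qed

text \<open>Brownian motion with the regularity that in general holds only almost surely: every path
  is continuous and vanishes up to time \<open>0\<close>. Independence refers to \<open>H p\<close>
  itself, not to the right limit of the histories at \<open>p\<close>.\<close>

locale clean_bm = prob_space M for M :: "'a measure" +
  fixes W :: "real \<Rightarrow> 'a \<Rightarrow> real" and H :: "real \<Rightarrow> 'a measure"
  assumes path_cont: "continuous_on UNIV (\<lambda>t. W t \<omega>)"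
    and path_neg: "t \<le> 0 \<Longrightarrow> W t \<omega> = 0"
    and space_H: "space (H t) = space M"
    and sets_H: "sets (H t) \<subseteq> sets M"
    and adapted: "r \<le> t \<Longrightarrow> W r \<in> borel_measurable (H t)"
    and H_mono: "r \<le> t \<Longrightarrow> sets (H r) \<subseteq> sets (H t)"
    and incr_indep: "0 \<le> p \<Longrightarrow> p < t \<Longrightarrow> A \<in> sets (H p) \<Longrightarrow> D \<in> sets borel \<Longrightarrow>
      prob (A \<inter> ((\<lambda>\<omega>. W t \<omega> - W p \<omega>) -` D \<inter> space M)) =
      prob A * prob ((\<lambda>\<omega>. W t \<omega> - W p \<omega>) -` D \<inter> space M)"
    and incr_normal: "0 \<le> p \<Longrightarrow> p < t \<Longrightarrow>
      distributed M lborel (\<lambda>\<omega>. W t \<omega> - W p \<omega>) (normal_density 0 (sqrt (t - p)))"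
begin

lemma measurable_from_H: "f \<in> measurable (H t) N \<Longrightarrow> f \<in> measurable M N"
  by (rule measurable_from_subalg[of M "H t"]) (auto simp: subalgebra_def space_H sets_H[THEN subsetD])

lemma measurable_H_mono: "r \<le> t \<Longrightarrow> f \<in> measurable (H r) N \<Longrightarrow> f \<in> measurable (H t) N"
  by (rule measurable_from_subalg[of "H t" "H r"]) (auto simp: subalgebra_def space_H H_mono[THEN subsetD])

lemma measurable_path [measurable]: "W t \<in> borel_measurable M"
  by (rule measurable_from_H[OF adapted[OF order_refl]])

lemma indep_var_incr:
  fixes Z :: "'a \<Rightarrow> real"
  assumes Z: "Z \<in> borel_measurable (H p)" and p: "0 \<le> p" "p < t"
  shows "indep_var borel Z borel (\<lambda>\<omega>. W t \<omega> - W p \<omega>)"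
proof -
  let ?D = "\<lambda>\<omega>. W t \<omega> - W p \<omega>"
  let ?\<D> = "{?D -` D \<inter> space M | D. D \<in> sets borel}"
  have "indep_set (sets (H p)) ?\<D>"
    unfolding indep_sets2_eq using sets_H incr_indep[OF p] by auto
  then have "indep_set (sigma_sets (space M) (sets (H p))) (sigma_sets (space M) ?\<D>)"
  proof (rule indep_set_sigma_sets)
    show "Int_stable (sets (H p))" by (auto simp: Int_stable_def)
    show "Int_stable ?\<D>"
      unfolding Int_stable_def
    proof (intro ballI)
      fix a b assume "a \<in> ?\<D>" "b \<in> ?\<D>"
      then obtain A B where "a = ?D -` A \<inter> space M" "A \<in> sets borel"
        "b = ?D -` B \<inter> space M" "B \<in> sets borel" by blast
      then show "a \<inter> b \<in> ?\<D>" by (intro CollectI exI[of _ "A \<inter> B"]) auto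
    qed
  qed
  moreover have "sigma_sets (space M) {Z -` A \<inter> space M | A. A \<in> sets borel} \<subseteq> sigma_sets (space M) (sets (H p))"
    using measurable_sets[OF Z] unfolding space_H by (intro sigma_sets_subseteq) auto
  ultimately have "indep_set (sigma_sets (space M) {Z -` A \<inter> space M | A. A \<in> sets borel}) (sigma_sets (space M) ?\<D>)"
    unfolding indep_sets2_eq by blast
  then show ?thesis
    unfolding indep_var_eq using measurable_from_H[OF Z] by auto
qed

text \<open>Moments of the centred normal law; the fourth one controls squared increments in mean
  square. For \<open>p = t\<close> there is no normal density, but the increment vanishes.\<close>

lemma
  assumes "0 \<le> p" "p \<le> t"
  shows integrable_incr_power: "integrable M (\<lambda>\<omega>. (W t \<omega> - W p \<omega>) ^ k)"
    and integral_incr: "(\<integral>\<omega>. W t \<omega> - W p \<omega> \<partial>M) = 0"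
    and integral_incr_square: "(\<integral>\<omega>. (W t \<omega> - W p \<omega>)\<^sup>2 \<partial>M) = t - p"
    and integral_incr_fourth: "(\<integral>\<omega>. (W t \<omega> - W p \<omega>) ^ 4 \<partial>M) = 3 * (t - p)\<^sup>2"
proof -
  have "integrable M (\<lambda>\<omega>. (W t \<omega> - W p \<omega>) ^ k) \<and> (\<integral>\<omega>. W t \<omega> - W p \<omega> \<partial>M) = 0 \<and>
    (\<integral>\<omega>. (W t \<omega> - W p \<omega>)\<^sup>2 \<partial>M) = t - p \<and> (\<integral>\<omega>. (W t \<omega> - W p \<omega>) ^ 4 \<partial>M) = 3 * (t - p)\<^sup>2"
  proof (cases "p = t")
    case False
    then have pt: "p < t" and pos: "0 < sqrt (t - p)" using assms by auto
    note dist = incr_normal[OF assms(1) pt]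
    have 1: "integrable lborel (\<lambda>x. normal_density 0 (sqrt (t - p)) x * x ^ k)" for k
      using integrable_normal_moment[OF pos, of 0 k] by simp
    have i: "integrable M (\<lambda>\<omega>. (W t \<omega> - W p \<omega>) ^ k)"
      using distributed_integrable[OF dist, of "\<lambda>x. x ^ k"] 1[of k] pos
      by (simp add: normal_density_nonneg)
    have e: "(\<integral>\<omega>. (W t \<omega> - W p \<omega>) ^ j \<partial>M) = (\<integral>x. normal_density 0 (sqrt (t - p)) x * x ^ j \<partial>lborel)" for j
      using distributed_integral[OF dist, of "\<lambda>x. x ^ j"] pos by (simp add: normal_density_nonneg)
    have "(\<integral>\<omega>. W t \<omega> - W p \<omega> \<partial>M) = 0"
      using e[of 1] integral_normal_moment_nz_1[OF pos, of 0] by simp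
    moreover have "(\<integral>\<omega>. (W t \<omega> - W p \<omega>)\<^sup>2 \<partial>M) = t - p"
    proof -
      have "(\<integral>x. normal_density 0 (sqrt (t - p)) x * x\<^sup>2 \<partial>lborel) = t - p"
        using integral_normal_moment_even[OF pos, of 0 1] pt by simp
      then show ?thesis by (simp add: e)
    qed
    moreover have "(\<integral>\<omega>. (W t \<omega> - W p \<omega>) ^ 4 \<partial>M) = 3 * (t - p)\<^sup>2"
    proof -
      have "(\<integral>x. normal_density 0 (sqrt (t - p)) x * x ^ 4 \<partial>lborel) = 3 * (t - p)\<^sup>2"
        using integral_normal_moment_even[OF pos, of 0 2] pt by (simp add: fact_numeral power_divide)
      then show ?thesis by (simp add: e)
    qed
    ultimately show ?thesis using i by blast
  qed (simp add: zero_power2)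
  then show "integrable M (\<lambda>\<omega>. (W t \<omega> - W p \<omega>) ^ k)" "(\<integral>\<omega>. W t \<omega> - W p \<omega> \<partial>M) = 0"
    "(\<integral>\<omega>. (W t \<omega> - W p \<omega>)\<^sup>2 \<partial>M) = t - p" "(\<integral>\<omega>. (W t \<omega> - W p \<omega>) ^ 4 \<partial>M) = 3 * (t - p)\<^sup>2"
    by blast+
qed

lemma integral_mult_function_incr:
  fixes Z :: "'a \<Rightarrow> real"
  assumes Z: "Z \<in> borel_measurable (H p)" "integrable M Z" and p: "0 \<le> p" "p < t"
    and f: "(f :: real \<Rightarrow> real) \<in> borel_measurable borel" "integrable M (\<lambda>\<omega>. f (W t \<omega> - W p \<omega>))"
  shows "(\<integral>\<omega>. Z \<omega> * f (W t \<omega> - W p \<omega>) \<partial>M) = (\<integral>\<omega>. Z \<omega> \<partial>M) * (\<integral>\<omega>. f (W t \<omega> - W p \<omega>) \<partial>M)"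
proof -
  have "indep_var borel ((\<lambda>x. x) \<circ> Z) borel (f \<circ> (\<lambda>\<omega>. W t \<omega> - W p \<omega>))"
    by (rule indep_var_compose[OF indep_var_incr[OF Z(1) p]]) (use f in auto)
  then show ?thesis
    using indep_var_lebesgue_integral[of Z "\<lambda>\<omega>. f (W t \<omega> - W p \<omega>)"] Z(2) f(2) by (simp add: comp_def)
qed

lemma integral_mult_incr:
  fixes Z :: "'a \<Rightarrow> real"
  assumes Z: "Z \<in> borel_measurable (H p)" "integrable M Z" and p: "0 \<le> p" "p \<le> t"
  shows "(\<integral>\<omega>. Z \<omega> * (W t \<omega> - W p \<omega>) \<partial>M) = 0"
  using integral_mult_function_incr[OF Z p(1), of t "\<lambda>x. x"] integral_incr[OF p]
    integrable_incr_power[OF p, of 1] p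
  by (cases "p = t") auto

text \<open>The martingale property of the compensated square, in the incremental form that makes
  the quadratic errors of Ito's formula orthogonal.\<close>

lemma integral_mult_incr_square:
  fixes Z :: "'a \<Rightarrow> real"
  assumes Z: "Z \<in> borel_measurable (H p)" "integrable M Z" and p: "0 \<le> p" "p \<le> t"
  shows "(\<integral>\<omega>. Z \<omega> * ((W t \<omega> - W p \<omega>)\<^sup>2 - (t - p)) \<partial>M) = 0"
  using integral_mult_function_incr[OF Z p(1), of t "\<lambda>x. x\<^sup>2 - (t - p)"] integral_incr_square[OF p]
    integrable_incr_power[OF p, of 2] p
  by (cases "p = t") (auto simp: prob_space)

end

lemma sets_completed_history_subset:
  assumes "\<And>r. 0 \<le> r \<Longrightarrow> W r \<in> borel_measurable M"
  shows "sets (completed_history M W u) \<subseteq> sets M"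
  unfolding sets_completed_history
  using measurable_sets[OF assms] by (intro sets.sigma_sets_subset) auto

lemma completed_history_mono:
  "r \<le> u \<Longrightarrow> sets (completed_history M W r) \<subseteq> sets (completed_history M W u)"
  unfolding sets_completed_history by (intro sigma_sets_mono') fastforce

lemma null_sets_in_completed_history: "null_sets M \<subseteq> sets (completed_history M W u)"
  unfolding sets_completed_history by auto

lemma measurable_completed_history:
  "0 \<le> r \<Longrightarrow> r \<le> u \<Longrightarrow> W r \<in> borel_measurable (completed_history M W u)"
  by (rule measurableI) (auto simp: sets_completed_history intro!: sigma_sets.Basic)

definition good_path :: "(real \<Rightarrow> real) \<Rightarrow> bool" where
  "good_path w \<longleftrightarrow> continuous_on {0..} w \<and> w 0 = 0"

text \<open>Irregular paths are sent to the zero path and negative times to \<open>0\<close>, so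
  that continuity and the initial value hold without exception.\<close>

definition clean :: "(real \<Rightarrow> 'a \<Rightarrow> real) \<Rightarrow> real \<Rightarrow> 'a \<Rightarrow> real" where
  "clean W t \<omega> = (if good_path (\<lambda>t. W t \<omega>) then W (max 0 t) \<omega> else 0)"

lemma good_path_AE: "brownian_motion M W \<Longrightarrow> AE \<omega> in M. good_path (\<lambda>t. W t \<omega>)"
  unfolding brownian_motion_def good_path_def by auto

lemma clean_eq: "good_path (\<lambda>t. W t \<omega>) \<Longrightarrow> 0 \<le> t \<Longrightarrow> clean W t \<omega> = W t \<omega>"
  by (simp add: clean_def)

text \<open>The modified process keeps the completed histories of the original one: by completeness
  of \<open>M\<close> the exceptional paths form a null set, and this is an event of every history,
  even of those with negative index.\<close>

lemma clean_bm_clean: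
  assumes "prob_space M" "complete_measure M" and bm: "brownian_motion M W"
  shows "clean_bm M (clean W) (completed_history M W)"
proof -
  interpret prob_space M by fact
  interpret complete_measure M by fact
  let ?H = "completed_history M W"
  have Wm: "W r \<in> borel_measurable M" if "0 \<le> r" for r using bm that by (auto simp: brownian_motion_def)
  have good: "AE \<omega> in M. good_path (\<lambda>t. W t \<omega>)" by (rule good_path_AE[OF bm])
  have ae: "AE \<omega> in M. clean W t \<omega> = W t \<omega>" if "0 \<le> t" for t
    using good by eventually_elim (simp add: clean_eq that)
  let ?N = "{\<omega> \<in> space M. \<not> good_path (\<lambda>t. W t \<omega>)}"
  have N: "?N \<in> sets (?H u)" for u
    using good[unfolded AE_iff_null_sets] null_sets_in_completed_history[of M W u] by blast
  have meas: "clean W r \<in> borel_measurable (?H u)" if "r \<le> u" "0 \<le> u" for r u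
  proof -
    have "W (max 0 r) \<in> borel_measurable (?H u)"
      using that by (intro measurable_completed_history) auto
    moreover have "{\<omega> \<in> space (?H u). good_path (\<lambda>t. W t \<omega>)} = space (?H u) - ?N" by auto
    then have "{\<omega> \<in> space (?H u). good_path (\<lambda>t. W t \<omega>)} \<in> sets (?H u)"
      using sets.compl_sets[OF N[of u]] by simp
    ultimately show ?thesis
      unfolding clean_def by (intro measurable_If) auto
  qed
  have neg: "clean W t \<omega> = 0" if "t \<le> 0" for t \<omega>
    using that by (auto simp: clean_def good_path_def max_def)
  have incr_m [measurable]: "(\<lambda>\<omega>. W t \<omega> - W p \<omega>) \<in> borel_measurable M" if "0 \<le> p" "p < t" for p t
    using that by (intro borel_measurable_diff Wm) auto
  have meas': "clean W r \<in> borel_measurable M" for r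
  proof (cases "0 \<le> r")
    case True
    show ?thesis
      by (rule measurable_from_subalg[OF _ meas[OF order_refl True]])
        (use sets_completed_history_subset[of W M r] Wm in \<open>auto simp: subalgebra_def\<close>)
  next
    case False then show ?thesis using neg[of r] by (intro borel_measurable_const[THEN measurable_cong[THEN iffD1, rotated]]) auto
  qed
  have incr_ae: "AE \<omega> in M. clean W t \<omega> - clean W p \<omega> = W t \<omega> - W p \<omega>" if "0 \<le> p" "p < t" for p t
    using ae[of t] ae[of p] that by auto
  show ?thesis
  proof
    fix \<omega>
    show "continuous_on UNIV (\<lambda>t. clean W t \<omega>)"
    proof (cases "good_path (\<lambda>t. W t \<omega>)")
      case True
      have "continuous_on UNIV ((\<lambda>t. W t \<omega>) \<circ> (\<lambda>t. max 0 t))"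
        using True by (intro continuous_on_compose continuous_intros)
          (auto simp: good_path_def intro: continuous_on_subset)
      then show ?thesis using True by (simp add: clean_def comp_def)
    qed (simp add: clean_def)
  next
    fix r t :: real assume "r \<le> t"
    show "clean W r \<in> borel_measurable (?H t)"
    proof (cases "0 \<le> t")
      case False
      then have "clean W r = (\<lambda>_. 0)" using \<open>r \<le> t\<close> neg[of r] by auto
      then show ?thesis by simp
    qed (rule meas[OF \<open>r \<le> t\<close>])
  next
    fix p t :: real and A and D :: "real set" assume p: "0 \<le> p" "p < t" and A: "A \<in> sets (?H p)" and D: "D \<in> sets borel"
    have A': "A \<in> sets M" using A sets_completed_history_subset[of W M p] Wm by blast
    have [measurable]: "(\<lambda>\<omega>. clean W t \<omega> - clean W p \<omega>) \<in> borel_measurable M" using meas' by auto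
    have 1: "prob ((\<lambda>\<omega>. clean W t \<omega> - clean W p \<omega>) -` D \<inter> space M) = prob ((\<lambda>\<omega>. W t \<omega> - W p \<omega>) -` D \<inter> space M)"
      using incr_ae[OF p] incr_m[OF p] D by (intro measure_eq_AE) auto
    have 2: "prob (A \<inter> ((\<lambda>\<omega>. clean W t \<omega> - clean W p \<omega>) -` D \<inter> space M)) = prob (A \<inter> ((\<lambda>\<omega>. W t \<omega> - W p \<omega>) -` D \<inter> space M))"
      using incr_ae[OF p] incr_m[OF p] D A' by (intro measure_eq_AE) auto
    show "prob (A \<inter> ((\<lambda>\<omega>. clean W t \<omega> - clean W p \<omega>) -` D \<inter> space M)) =
      prob A * prob ((\<lambda>\<omega>. clean W t \<omega> - clean W p \<omega>) -` D \<inter> space M)"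
      unfolding 1 2 by (rule brownian_increment_indep_history[OF bm p A D])
  next
    fix p t :: real assume p: "0 \<le> p" "p < t"
    then have d: "distributed M lborel (\<lambda>\<omega>. W t \<omega> - W p \<omega>) (normal_density 0 (sqrt (t - p)))"
      using bm by (auto simp: brownian_motion_def)
    have m: "(\<lambda>\<omega>. clean W t \<omega> - clean W p \<omega>) \<in> borel_measurable M" using meas' by auto
    have "distr M lborel (\<lambda>\<omega>. clean W t \<omega> - clean W p \<omega>) = distr M lborel (\<lambda>\<omega>. W t \<omega> - W p \<omega>)"
      using incr_ae[OF p] m incr_m[OF p] by (intro distr_cong_AE) auto
    then show "distributed M lborel (\<lambda>\<omega>. clean W t \<omega> - clean W p \<omega>) (normal_density 0 (sqrt (t - p)))"
      using d m unfolding distributed_def by auto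
  next
    fix r t :: real assume "r \<le> t"
    then show "sets (?H r) \<subseteq> sets (?H t)" by (rule completed_history_mono)
  qed (use neg sets_completed_history_subset[of W M] Wm in auto)
qed

section \<open>Running maxima\<close>

text \<open>Clamping the time at \<open>0\<close> keeps the index set nonempty, so that the running
  maximum is constant before \<open>0\<close> and monotone on the whole line.\<close>

definition running_max :: "(real \<Rightarrow> real) \<Rightarrow> real \<Rightarrow> real" where
  "running_max g t = (SUP r\<in>{0..max 0 t}. g r)"

text \<open>A monotone barrier against a continuous path: \<open>s - z\<close> can jump only
  upwards. The properties below rest on this: moving slightly to the right loses no more than the
  oscillation of \<open>z\<close>.\<close>

locale barrier_path =
  fixes s z :: "real \<Rightarrow> real"
  assumes s_mono: "mono s" and z_cont: "continuous_on UNIV z"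
begin

abbreviation rm :: "real \<Rightarrow> real" where "rm \<equiv> running_max (\<lambda>r. s r - z r)"

lemma bdd: "bdd_above ((\<lambda>r. s r - z r) ` {0..t})"
proof -
  have "compact (z ` {0..t})"
    by (rule compact_continuous_image) (auto intro: continuous_on_subset[OF z_cont])
  then have "bounded (z ` {0..t})" by (rule compact_imp_bounded)
  then obtain B where "\<forall>x\<in>z ` {0..t}. norm x \<le> B" unfolding bounded_iff by blast
  then have B: "\<And>r. r \<in> {0..t} \<Longrightarrow> \<bar>z r\<bar> \<le> B" by auto
  have "s r - z r \<le> s t + B" if "r \<in> {0..t}" for r
    using B[OF that] monoD[OF s_mono, of r t] that by auto
  then show ?thesis by (intro bdd_aboveI[of _ "s t + B"]) auto
qed

lemma rm_upper: "0 \<le> r \<Longrightarrow> r \<le> t \<Longrightarrow> s r - z r \<le> rm t"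
  unfolding running_max_def by (intro cSUP_upper bdd) auto

lemma rm_least: "(\<And>r. 0 \<le> r \<Longrightarrow> r \<le> max 0 t \<Longrightarrow> s r - z r \<le> c) \<Longrightarrow> rm t \<le> c"
  unfolding running_max_def by (intro cSUP_least) auto

lemma rm_less_iff: "c < rm t \<longleftrightarrow> (\<exists>r\<in>{0..max 0 t}. c < s r - z r)"
  unfolding running_max_def by (intro less_cSUP_iff bdd) auto

lemma rm_mono: "mono rm"
proof
  fix t u :: real assume "t \<le> u"
  then show "rm t \<le> rm u"
    unfolding running_max_def by (intro cSUP_subset_mono bdd) auto
qed

text \<open>A countable supremum, for the sake of measurability. A time \<open>r\<close> before
  \<open>t\<close> can be moved to the right at the cost of the oscillation of \<open>z\<close>. The
  times are rational multiples of \<open>t\<close>, so that the end point \<open>t\<close> is kept,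
  where \<open>s\<close> may jump.\<close>

lemma rm_rational: "rm t = (SUP q\<in>\<rat> \<inter> {0..1}. s (max 0 t * q) - z (max 0 t * q))"
proof (rule antisym)
  have sub: "max 0 t * q \<in> {0..max 0 t}" if "q \<in> \<rat> \<inter> {0..1}" for q
    using that by (auto intro: mult_left_le)
  then have bdd': "bdd_above ((\<lambda>q. s (max 0 t * q) - z (max 0 t * q)) ` (\<rat> \<inter> {0..1}))"
    by (intro bdd_above_mono[OF bdd[of "max 0 t"]]) auto
  show "rm t \<le> (SUP q\<in>\<rat> \<inter> {0..1}. s (max 0 t * q) - z (max 0 t * q))" (is "_ \<le> ?R")
  proof (rule rm_least)
    fix r assume r: "0 \<le> r" "r \<le> max 0 t"
    have up: "s (max 0 t * q) - z (max 0 t * q) \<le> ?R" if "q \<in> \<rat> \<inter> {0..1}" for q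
      by (rule cSUP_upper[OF that bdd'])
    show "s r - z r \<le> ?R"
    proof (cases "r = max 0 t")
      case True then show ?thesis using up[of 1] by simp
    next
      case False
      then have rt: "r < max 0 t" "0 < t" using r by auto
      show ?thesis
      proof (rule field_le_epsilon)
        fix e :: real assume "0 < e"
        have "isCont z r" using z_cont by (simp add: continuous_on_eq_continuous_at)
        then obtain d where d: "0 < d" "\<And>x. \<bar>x - r\<bar> < d \<Longrightarrow> \<bar>z x - z r\<bar> < e"
          using \<open>0 < e\<close> unfolding continuous_at_eps_delta dist_real_def by blast
        \<comment> \<open>Room for a rational fraction just to the right of \<open>r / t\<close>,
          close enough for \<open>z\<close> to change by less than \<open>e\<close>.\<close>
        have "r / t < min 1 ((r + d) / t)" using rt r d(1) by (auto simp: field_simps)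
        then obtain q where q: "q \<in> \<rat>" "r / t < q" "q < min 1 ((r + d) / t)"
          using Rats_dense_in_real by blast
        then have q': "q \<in> \<rat> \<inter> {0..1}" "r < max 0 t * q" "max 0 t * q < r + d"
          using rt r by (auto simp: field_simps intro: order_trans[of 0 "r / t"])
        have "s r - z r \<le> s (max 0 t * q) - z (max 0 t * q) + e"
          using d(2)[of "max 0 t * q"] q'(2,3) monoD[OF s_mono, of r "max 0 t * q"] by auto
        then show "s r - z r \<le> ?R + e" using up[OF q'(1)] by simp
      qed
    qed
  qed
  show "?R \<le> rm t"
    using sub by (intro cSUP_least rm_upper[of _ "max 0 t", unfolded running_max_def, simplified, folded running_max_def])
      (auto intro!: exI[of _ 0] simp: running_max_def)
qed

text \<open>Just after \<open>t\<close> the new values of \<open>s - z\<close> approach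
  \<open>l - z t\<close>, so the running maximum can jump only to this value.\<close>

lemma rm_at_right:
  assumes t: "0 \<le> t" and l: "(s \<longlongrightarrow> l) (at_right t)"
  shows "(rm \<longlongrightarrow> max (rm t) (l - z t)) (at_right t)"
proof (rule order_tendstoI)
  have zt: "(z \<longlongrightarrow> z t) (at_right t)"
    using z_cont by (simp add: continuous_on_eq_continuous_at continuous_at_imp_continuous_at_within
      continuous_within[symmetric])
  have gt: "eventually (\<lambda>u. t < u) (at_right t)" by (simp add: eventually_at_filter)
  {
    fix a assume "a < max (rm t) (l - z t)"
    then consider "a < rm t" | "a < l - z t" by (auto simp: less_max_iff_disj)
    then show "eventually (\<lambda>u. a < rm u) (at_right t)"
    proof cases
      case 1
      show ?thesis using gt by eventually_elim (rule less_le_trans[OF 1 monoD[OF rm_mono less_imp_le]])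
    next
      case 2
      have "eventually (\<lambda>u. a < s u - z u) (at_right t)"
        by (rule order_tendstoD(1)[OF tendsto_diff[OF l zt] 2])
      then show ?thesis using gt
        by eventually_elim (use t rm_upper in \<open>meson less_imp_le less_le_trans order_refl order_trans\<close>)
    qed
  next
    fix a assume a: "max (rm t) (l - z t) < a"
    define e where "e = (a - (l - z t)) / 3"
    have e: "0 < e" using a by (simp add: e_def)
    have "isCont z t" using z_cont by (simp add: continuous_on_eq_continuous_at)
    then obtain d where d: "0 < d" "\<And>x. \<bar>x - t\<bar> < d \<Longrightarrow> \<bar>z x - z t\<bar> < e"
      using e unfolding continuous_at_eps_delta dist_real_def by blast
    have "eventually (\<lambda>u. s u < l + e) (at_right t)"
      by (rule order_tendstoD(2)[OF l]) (use e in simp)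
    moreover have "eventually (\<lambda>u. u < t + d) (at_right t)"
      using d(1) by (auto simp: eventually_at_right_field intro!: exI[of _ "t + d"])
    ultimately show "eventually (\<lambda>u. rm u < a) (at_right t)" using gt
    proof eventually_elim
      case (elim u)
      have "rm u \<le> max (rm t) (a - e)"
      proof (rule rm_least)
        fix r assume r: "0 \<le> r" "r \<le> max 0 u"
        show "s r - z r \<le> max (rm t) (a - e)"
        proof (cases "r \<le> t")
          case True then show ?thesis using rm_upper[OF r(1) True] by simp
        next
          case False
          have "s r \<le> s u" using r t elim by (intro monoD[OF s_mono]) auto
          moreover have "\<bar>z r - z t\<bar> < e" using False r t elim by (intro d(2)) auto
          ultimately have "s r - z r \<le> l + e - (z t - e)" using elim by linarith
          also have "\<dots> = a - e" by (simp add: e_def field_simps)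
          finally show ?thesis by simp
        qed
      qed
      then show ?case using a e by auto
    qed
  }
qed

text \<open>With a right-continuous \<open>s\<close>, a path that jumps only upwards is upper
  semicontinuous. A maximizing sequence has a cluster point \<open>r\<close>; monotonicity bounds
  \<open>s\<close> along the sequence by \<open>s (r + h)\<close>, and then \<open>h\<close> tends
  to \<open>0\<close>.\<close>

lemma rm_attained:
  assumes t: "0 \<le> t" and rc: "\<And>r. 0 \<le> r \<Longrightarrow> (s \<longlongrightarrow> s r) (at_right r)"
  obtains r where "0 \<le> r" "r \<le> t" "s r - z r = rm t"
proof -
  have "\<exists>r\<in>{0..max 0 t}. rm t - 1 / real (Suc k) < s r - z r" for k
    unfolding rm_less_iff[symmetric] by simp
  then obtain x where x: "\<And>k. x k \<in> {0..t}" "\<And>k. rm t - 1 / real (Suc k) < s (x k) - z (x k)"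
    using t by (metis max_absorb2)
  obtain r f where r: "r \<in> {0..t}" "strict_mono f" "(x \<circ> f) \<longlonglongrightarrow> r"
    using compact_Icc[of 0 t, unfolded compact_def] x(1) by blast
  have zl: "(\<lambda>k. z (x (f k))) \<longlonglongrightarrow> z r"
    using r(3) z_cont by (auto simp: comp_def continuous_on_eq_continuous_at intro: isCont_tendsto_compose)
  have inv: "(\<lambda>k. rm t - 1 / real (Suc (f k))) \<longlonglongrightarrow> rm t - 0"
    using LIMSEQ_subseq_LIMSEQ[OF LIMSEQ_inverse_real_of_nat r(2)]
    by (intro tendsto_diff tendsto_const) (simp add: comp_def inverse_eq_divide)
  have "rm t \<le> s (r + h) - z r" if "0 < h" for h
  proof -
    have "eventually (\<lambda>k. x (f k) < r + h) sequentially"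
      using order_tendstoD(2)[OF r(3), of "r + h"] that by (simp add: comp_def)
    then have "eventually (\<lambda>k. rm t - 1 / real (Suc (f k)) \<le> s (r + h) - z (x (f k))) sequentially"
    proof eventually_elim
      case (elim k)
      then show ?case using x(2)[of "f k"] monoD[OF s_mono, of "x (f k)" "r + h"] by linarith
    qed
    then have "rm t - 0 \<le> s (r + h) - z r"
      by (intro tendsto_le[OF _ tendsto_diff[OF tendsto_const zl] inv]) auto
    then show ?thesis by simp
  qed
  then have "rm t \<le> s u - z r" if "r < u" for u using that by (metis add.commute diff_add_cancel diff_gt_0_iff_gt)
  then have "eventually (\<lambda>u. rm t \<le> s u - z r) (at_right r)"
    by (simp add: eventually_at_filter)
  then have "rm t \<le> s r - z r"
    using rc[of r] r(1) by (intro tendsto_lowerbound[OF tendsto_diff[OF _ tendsto_const]]) auto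
  moreover have "s r - z r \<le> rm t" using r(1) by (intro rm_upper) auto
  ultimately show ?thesis using that r(1) by auto
qed

end

text \<open>For an approximation from below the upper bound is trivial; for the lower bound a single
  nearly maximizing time serves all large \<open>n\<close>.\<close>

lemma running_max_LIMSEQ:
  assumes b: "\<And>n. barrier_path (s n) z" "barrier_path s' z"
    and le: "\<And>n r. s n r \<le> s' r" and lim: "\<And>r. (\<lambda>n. s n r) \<longlonglongrightarrow> s' r"
  shows "(\<lambda>n. running_max (\<lambda>r. s n r - z r) t) \<longlonglongrightarrow> running_max (\<lambda>r. s' r - z r) t"
proof (rule order_tendstoI)
  have le': "running_max (\<lambda>r. s n r - z r) t \<le> running_max (\<lambda>r. s' r - z r) t" for n
    unfolding running_max_def
    by (intro cSUP_mono barrier_path.bdd[OF b(2)]) (auto intro: bexI diff_right_mono[OF le])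
  fix a assume "running_max (\<lambda>r. s' r - z r) t < a"
  then show "eventually (\<lambda>n. running_max (\<lambda>r. s n r - z r) t < a) sequentially"
    using le_less_trans[OF le'] by auto
next
  fix a assume "a < running_max (\<lambda>r. s' r - z r) t"
  then obtain r where r: "r \<in> {0..max 0 t}" "a < s' r - z r"
    unfolding barrier_path.rm_less_iff[OF b(2)] by auto
  have "eventually (\<lambda>n. a < s n r - z r) sequentially"
    by (rule order_tendstoD(1)[OF tendsto_diff[OF lim tendsto_const] r(2)])
  then show "eventually (\<lambda>n. a < running_max (\<lambda>r. s n r - z r) t) sequentially"
    by eventually_elim (use r(1) in \<open>auto simp: barrier_path.rm_less_iff[OF b(1)]\<close>)
qed

lemma running_max_measurable:
  fixes s z :: "'x \<Rightarrow> real \<Rightarrow> real"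
  assumes b: "\<And>x. x \<in> space N \<Longrightarrow> barrier_path (s x) (z x)"
    and s: "\<And>r. 0 \<le> r \<Longrightarrow> r \<le> max 0 t \<Longrightarrow> (\<lambda>x. s x r) \<in> borel_measurable N"
    and z: "\<And>r. 0 \<le> r \<Longrightarrow> r \<le> max 0 t \<Longrightarrow> (\<lambda>x. z x r) \<in> borel_measurable N"
  shows "(\<lambda>x. running_max (\<lambda>r. s x r - z x r) t) \<in> borel_measurable N"
proof -
  have sub: "max 0 t * q \<in> {0..max 0 t}" if "q \<in> \<rat> \<inter> {0..1}" for q
    using that by (auto intro: mult_left_le)
  have "(\<lambda>x. SUP q\<in>\<rat> \<inter> {0..1}. s x (max 0 t * q) - z x (max 0 t * q)) \<in> borel_measurable N"
  proof (rule borel_measurable_cSUP)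
    show "countable (\<rat> \<inter> {0..1::real})" by (auto intro: countable_rat)
    show "bdd_above ((\<lambda>q. s x (max 0 t * q) - z x (max 0 t * q)) ` (\<rat> \<inter> {0..1}))" if "x \<in> space N" for x
      using sub by (intro bdd_above_mono[OF barrier_path.bdd[OF b[OF that], of "max 0 t"]]) auto
  next
    fix q :: real assume q: "q \<in> \<rat> \<inter> {0..1}"
    show "(\<lambda>x. s x (max 0 t * q) - z x (max 0 t * q)) \<in> borel_measurable N"
      using sub[OF q] by (intro borel_measurable_diff s z) auto
  qed
  then show ?thesis
    by (rule measurable_cong[THEN iffD2, rotated]) (rule barrier_path.rm_rational[OF b])
qed

lemma mono_INF_at_right:
  fixes f :: "real \<Rightarrow> real"
  assumes f: "mono f" and b: "\<And>x. b \<le> f x"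
  shows "(f \<longlongrightarrow> (INF u\<in>{t<..}. f u)) (at_right t)"
proof (rule order_tendstoI)
  have bdd: "bdd_below (f ` {t<..})" by (rule bdd_belowI2) (rule b)
  have gt: "eventually (\<lambda>u. t < u) (at_right t)" by (simp add: eventually_at_filter)
  fix a assume "a < (INF u\<in>{t<..}. f u)"
  then show "eventually (\<lambda>u. a < f u) (at_right t)"
    using gt by (auto elim!: eventually_mono intro: less_le_trans[OF _ cINF_lower[OF bdd]])
next
  have bdd: "bdd_below (f ` {t<..})" by (rule bdd_belowI2) (rule b)
  fix a assume "(INF u\<in>{t<..}. f u) < a"
  then obtain u where u: "t < u" "f u < a"
    by (subst (asm) cINF_less_iff) (use bdd gt_ex[of t] in auto)
  have "eventually (\<lambda>x. x < u) (at_right t)" using u(1) by (auto simp: eventually_at_right_field)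
  then show "eventually (\<lambda>x. f x < a) (at_right t)"
    by eventually_elim (use u(2) monoD[OF f] in \<open>meson le_less_trans less_imp_le\<close>)
qed

text \<open>For \<open>r < t\<close> the regularized value at \<open>r\<close> is a limit of values
  of \<open>s - z\<close> between \<open>r\<close> and \<open>t\<close>, hence bounded by the old
  maximum. Only the final time can contribute something new.\<close>

lemma running_max_right_limit:
  assumes b: "barrier_path s z" "barrier_path s' z" and t: "0 \<le> t"
    and lim: "\<And>r. (s \<longlongrightarrow> s' r) (at_right r)"
  shows "running_max (\<lambda>r. s' r - z r) t = max (running_max (\<lambda>r. s r - z r) t) (s' t - z t)"
proof (rule antisym)
  interpret s: barrier_path s z by fact
  interpret s': barrier_path s' z by fact
  have le: "s r \<le> s' r" for r
  proof (rule tendsto_lowerbound[OF lim])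
    show "eventually (\<lambda>u. s r \<le> s u) (at_right r)"
      using monoD[OF s.s_mono, of r] by (auto simp: eventually_at_filter)
  qed simp
  show "running_max (\<lambda>r. s' r - z r) t \<le> max (running_max (\<lambda>r. s r - z r) t) (s' t - z t)"
  proof (rule s'.rm_least)
    fix r assume r: "0 \<le> r" "r \<le> max 0 t"
    show "s' r - z r \<le> max (s.rm t) (s' t - z t)"
    proof (cases "r = t")
      case False
      have zr: "(z \<longlongrightarrow> z r) (at_right r)"
        using s.z_cont by (simp add: continuous_on_eq_continuous_at continuous_at_imp_continuous_at_within
          continuous_within[symmetric])
      have "eventually (\<lambda>u. r < u) (at_right r)" by (simp add: eventually_at_filter)
      moreover have "eventually (\<lambda>u. u < t) (at_right r)"
        using False r t by (auto simp: eventually_at_right_field intro!: exI[of _ t])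
      ultimately have "eventually (\<lambda>u. s u - z u \<le> s.rm t) (at_right r)"
        by eventually_elim (use r in \<open>auto intro!: s.rm_upper\<close>)
      then have "s' r - z r \<le> s.rm t"
        by (intro tendsto_upperbound[OF tendsto_diff[OF lim zr]]) auto
      then show ?thesis by simp
    qed simp
  qed
  have "s.rm t \<le> s'.rm t"
    unfolding running_max_def
    by (intro cSUP_mono s'.bdd) (auto intro: bexI diff_right_mono[OF le])
  then show "max (s.rm t) (s' t - z t) \<le> s'.rm t" using s'.rm_upper[OF t] by simp
qed

section \<open>The minimal solution\<close>

text \<open>\<open>v0\<close> is a representative for which sign, bound and support hold at every
  point. Two families accompany \<open>W\<close>: increments are independent of \<open>HW\<close>,
  while the front is adapted to the right limits \<open>FW\<close>.\<close>

locale stefan = W: clean_bm M W HW + B: clean_bm M B HB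
  for M :: "'a measure" and W HW B HB +
  fixes FW :: "real \<Rightarrow> 'a measure" and \<kappa> lam \<theta> \<sigma> s0 C :: real and v0 :: "real \<Rightarrow> real"
  assumes space_FW: "space (FW t) = space M"
    and sets_FW: "sets (FW t) = (\<Inter>u\<in>{t<..}. sets (HW u))"
    and kappa_pos: "0 < \<kappa>" and lam_pos: "0 < lam" and s0_nonneg: "0 \<le> s0"
    and variance: "\<sigma>\<^sup>2 + \<theta>\<^sup>2 = 2 * \<kappa>"
    and v0_integrable: "integrable lborel v0"
    and v0_nonpos: "v0 x \<le> 0" and v0_bound: "- C \<le> v0 x" and v0_zero: "x \<le> s0 \<Longrightarrow> v0 x = 0"
    and dip: "\<exists>\<^sub>F y in at_right 0. - (1 / (lam * \<kappa>)) * (LINT x:{s0..s0 + y}|lborel. v0 x) < y"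
begin

lemma v0_measurable [measurable]: "v0 \<in> borel_measurable borel"
  using v0_integrable by auto

definition noise :: "real \<Rightarrow> 'a \<Rightarrow> 'a \<Rightarrow> real" where
  "noise r \<omega> \<omega>' = \<sigma> * B r \<omega>' + \<theta> * W r \<omega>"

text \<open>The distribution of the starting points; its total mass is that of \<open>- v0\<close>
  and in general not \<open>1\<close>.\<close>

definition \<nu> :: "real measure" where
  "\<nu> = density lborel (\<lambda>x. ennreal (- v0 x))"

lemma sets_\<nu> [measurable_cong, simp]: "sets \<nu> = sets borel"
  by (simp add: \<nu>_def)

lemma space_\<nu> [simp]: "space \<nu> = UNIV"
  by (simp add: \<nu>_def)

lemma integral_\<nu>: "f \<in> borel_measurable borel \<Longrightarrow> (\<integral>x. f x \<partial>\<nu>) = - (\<integral>x. v0 x * f x \<partial>lborel)" for f :: "real \<Rightarrow> real"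
  unfolding \<nu>_def by (subst integral_density) (auto simp: v0_nonpos)

sublocale \<nu>: finite_measure \<nu>
proof
  have "emeasure \<nu> (space \<nu>) = (\<integral>\<^sup>+x. ennreal (- v0 x) \<partial>lborel)"
    unfolding \<nu>_def by (subst emeasure_density) auto
  also have "\<dots> < \<infinity>"
    using v0_integrable integrable_iff_bounded[of lborel v0] v0_nonpos
    by (auto simp: real_norm_def abs_of_nonpos)
  finally show "emeasure \<nu> (space \<nu>) \<noteq> \<infinity>" by simp
qed

sublocale \<nu>b: finite_borel_measure \<nu>
  by standard simp

text \<open>The distance by which the front has advanced once all starting points up to
  \<open>x\<close> are absorbed.\<close>

definition F :: "real \<Rightarrow> real" where
  "F x = measure \<nu> {..x} / (lam * \<kappa>)"

definition Fmax :: real where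
  "Fmax = measure \<nu> UNIV / (lam * \<kappa>)"

lemma lk_pos: "0 < lam * \<kappa>"
  using lam_pos kappa_pos by simp

lemma F_eq: "F x = - (1 / (lam * \<kappa>)) * (LINT y:{s0..x}|lborel. v0 y)"
proof -
  have "measure \<nu> {..x} = (\<integral>y. indicator {..x} y \<partial>\<nu>)" by simp
  also have "\<dots> = - (\<integral>y. v0 y * indicator {..x} y \<partial>lborel)" by (rule integral_\<nu>) simp
  also have "(\<integral>y. v0 y * indicator {..x} y \<partial>lborel) = (LINT y:{s0..x}|lborel. v0 y)"
    unfolding set_lebesgue_integral_def
    by (intro Bochner_Integration.integral_cong) (auto simp: indicator_def v0_zero not_le)
  finally show ?thesis by (simp add: F_def)
qed

lemma F_mono: "mono F"
  unfolding F_def using lk_pos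
  by (intro monoI divide_right_mono \<nu>.finite_measure_mono) auto

lemma F_bounds: "0 \<le> F x" "F x \<le> Fmax"
  unfolding F_def Fmax_def using lk_pos
  by (auto intro!: divide_right_mono \<nu>.finite_measure_mono)

lemma Fmax_nonneg: "0 \<le> Fmax"
  using F_bounds order_trans by blast

lemma F_abs: "\<bar>F x\<bar> \<le> Fmax"
  using F_bounds[of x] by simp

text \<open>The starting points have a density, hence no atoms. Continuity lets limits pass through
  \<open>F\<close> in the fixed-point equation.\<close>

lemma F_isCont: "isCont F x"
proof -
  have "emeasure \<nu> {x} = 0"
    unfolding \<nu>_def by (subst emeasure_density) (auto intro!: nn_integral_0_iff_AE[THEN iffD2]
        simp: AE_lborel_singleton[of x] eventually_mono[OF AE_lborel_singleton[of x]] indicator_def)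
  then have "isCont (cdf \<nu>) x" by (simp add: \<nu>b.isCont_cdf measure_def)
  then have "isCont (\<lambda>x. cdf \<nu> x / (lam * \<kappa>)) x"
    using lk_pos by (intro continuous_intros) auto
  then show ?thesis by (simp add: F_def[abs_def] cdf_def)
qed

lemma F_measurable [measurable]: "F \<in> borel_measurable borel"
  by (intro borel_measurable_continuous_onI) (simp add: continuous_on_eq_continuous_at F_isCont)

lemma noise_cont: "continuous_on UNIV (\<lambda>r. noise r \<omega> \<omega>')"
  unfolding noise_def by (intro continuous_intros W.path_cont B.path_cont)

lemma noise_neg: "r \<le> 0 \<Longrightarrow> noise r \<omega> \<omega>' = 0"
  by (simp add: noise_def W.path_neg B.path_neg)

lemma barrier: "mono s \<Longrightarrow> barrier_path s (\<lambda>r. noise r \<omega> \<omega>')"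
  by standard (auto intro: noise_cont)

lemma noise_measurable:
  assumes "\<And>r. r \<le> u \<Longrightarrow> W r \<in> borel_measurable G" "\<And>r. r \<le> u \<Longrightarrow> B r \<in> borel_measurable K" "r \<le> u"
  shows "(\<lambda>(\<omega>, \<omega>'). noise r \<omega> \<omega>') \<in> borel_measurable (G \<Otimes>\<^sub>M K)"
proof -
  have [measurable]: "W r \<in> borel_measurable G" "B r \<in> borel_measurable K" using assms by auto
  show ?thesis unfolding noise_def by measurable
qed

text \<open>\<open>G\<close> and \<open>K\<close> are left free so that one argument serves the full
  space, the histories and the filtration.\<close>

lemma running_max_noise_measurable:
  assumes m: "\<And>\<omega>. mono (s \<omega>)" and u: "0 \<le> u" "t \<le> u"
    and W: "\<And>r. r \<le> u \<Longrightarrow> W r \<in> borel_measurable G" and B: "\<And>r. r \<le> u \<Longrightarrow> B r \<in> borel_measurable K"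
    and s: "\<And>r. 0 \<le> r \<Longrightarrow> r \<le> u \<Longrightarrow> (\<lambda>\<omega>. s \<omega> r) \<in> borel_measurable G"
  shows "(\<lambda>(\<omega>, \<omega>'). running_max (\<lambda>r. s \<omega> r - noise r \<omega> \<omega>') t) \<in> borel_measurable (G \<Otimes>\<^sub>M K)"
  unfolding split_beta
proof (rule running_max_measurable)
  show "barrier_path (s (fst x)) (\<lambda>r. noise r (fst x) (snd x))" for x by (rule barrier[OF m])
  fix r assume r: "0 \<le> r" "r \<le> max 0 t"
  then have ru: "r \<le> u" using u by auto
  have [measurable]: "(\<lambda>\<omega>. s \<omega> r) \<in> borel_measurable G" by (rule s[OF r(1) ru])
  show "(\<lambda>x. s (fst x) r) \<in> borel_measurable (G \<Otimes>\<^sub>M K)" by measurable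
  show "(\<lambda>x. noise r (fst x) (snd x)) \<in> borel_measurable (G \<Otimes>\<^sub>M K)"
    using noise_measurable[OF W B ru] by (simp add: split_beta)
qed

text \<open>The running maximum is the threshold below which starting points have been absorbed by
  the front \<open>S n\<close>; one step of the recursion is the front that these absorbed particles
  would produce. Starting from the lowest possible front makes the iteration increasing.\<close>

primrec S :: "nat \<Rightarrow> 'a \<Rightarrow> real \<Rightarrow> real" where
  "S 0 = (\<lambda>\<omega> t. s0)"
| "S (Suc n) = (\<lambda>\<omega> t. s0 + (\<integral>\<omega>'. F (running_max (\<lambda>r. S n \<omega> r - noise r \<omega> \<omega>') t) \<partial>M))"

lemma running_max_section_measurable:
  assumes "mono s" shows "(\<lambda>\<omega>'. running_max (\<lambda>r. s r - noise r \<omega> \<omega>') t) \<in> borel_measurable M"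
proof (rule running_max_measurable)
  show "barrier_path s (\<lambda>r. noise r \<omega> \<omega>')" for \<omega>' by (rule barrier[OF assms])
qed (auto simp: noise_def)

lemma F_running_max_integrable:
  assumes "mono s" shows "integrable M (\<lambda>\<omega>'. F (running_max (\<lambda>r. s r - noise r \<omega> \<omega>') t))"
  using running_max_section_measurable[OF assms]
  by (intro W.integrable_const_bound[of _ Fmax]) (auto simp: F_abs)

lemma S_mono: "mono (S n \<omega>)"
proof (induction n)
  case (Suc n)
  show ?case
    unfolding S.simps
    by (intro monoI add_left_mono integral_mono F_running_max_integrable[OF Suc] monoD[OF F_mono]
      monoD[OF barrier_path.rm_mono[OF barrier[OF Suc]]])
qed (simp add: mono_def)

lemma S_bounds: "s0 \<le> S n \<omega> t \<and> S n \<omega> t \<le> s0 + Fmax"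
proof (cases n)
  case (Suc k)
  have "(\<integral>\<omega>'. F (running_max (\<lambda>r. S k \<omega> r - noise r \<omega> \<omega>') t) \<partial>M) \<le> (\<integral>\<omega>'. Fmax \<partial>M)"
    by (intro integral_mono F_running_max_integrable S_mono) (auto simp: F_bounds)
  then show ?thesis using Suc F_bounds by (simp add: W.prob_space)
qed (simp add: Fmax_nonneg)

lemma running_max_le:
  assumes "mono s" "mono s'" "\<And>r. s r \<le> s' r"
  shows "running_max (\<lambda>r. s r - noise r \<omega> \<omega>') t \<le> running_max (\<lambda>r. s' r - noise r \<omega> \<omega>') t"
  unfolding running_max_def
  by (intro cSUP_mono barrier_path.bdd[OF barrier[OF assms(2)]]) (auto intro: bexI diff_right_mono[OF assms(3)])

lemma S_Suc_le: "S n \<omega> t \<le> S (Suc n) \<omega> t"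
proof (induction n arbitrary: t)
  case 0
  show ?case using S_bounds[of "Suc 0" \<omega> t] by simp
next
  case (Suc n)
  have "s0 + (\<integral>\<omega>'. F (running_max (\<lambda>r. S n \<omega> r - noise r \<omega> \<omega>') t) \<partial>M) \<le>
      s0 + (\<integral>\<omega>'. F (running_max (\<lambda>r. S (Suc n) \<omega> r - noise r \<omega> \<omega>') t) \<partial>M)"
    by (intro add_left_mono integral_mono F_running_max_integrable S_mono monoD[OF F_mono] running_max_le Suc)
  then show ?case by simp
qed

definition s_inf :: "'a \<Rightarrow> real \<Rightarrow> real" where
  "s_inf \<omega> t = (SUP n. S n \<omega> t)"

lemma S_bdd: "bdd_above (range (\<lambda>n. S n \<omega> t))"
  using S_bounds by (intro bdd_aboveI[of _ "s0 + Fmax"]) auto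

lemma S_LIMSEQ: "(\<lambda>n. S n \<omega> t) \<longlonglongrightarrow> s_inf \<omega> t"
  unfolding s_inf_def by (intro LIMSEQ_incseq_SUP S_bdd incseq_SucI S_Suc_le)

lemma S_le_inf: "S n \<omega> t \<le> s_inf \<omega> t"
  unfolding s_inf_def by (intro cSUP_upper S_bdd) simp

lemma s_inf_bounds: "s0 \<le> s_inf \<omega> t" "s_inf \<omega> t \<le> s0 + Fmax"
  using S_le_inf[of 0 \<omega> t] S_bounds[of _ \<omega> t] by (auto simp: s_inf_def intro: cSUP_least)

lemma s_inf_mono: "mono (s_inf \<omega>)"
proof
  fix t u :: real assume "t \<le> u"
  then show "s_inf \<omega> t \<le> s_inf \<omega> u"
    using monoD[OF S_mono] by (intro LIMSEQ_le[OF S_LIMSEQ S_LIMSEQ]) auto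
qed

text \<open>The monotone limit passes through the running maximum, through the continuous
  \<open>F\<close> and, by boundedness, through the average.\<close>

lemma s_inf_fixpoint: "s_inf \<omega> t = s0 + (\<integral>\<omega>'. F (running_max (\<lambda>r. s_inf \<omega> r - noise r \<omega> \<omega>') t) \<partial>M)"
proof (rule LIMSEQ_unique)
  show "(\<lambda>n. S (Suc n) \<omega> t) \<longlonglongrightarrow> s_inf \<omega> t" by (rule LIMSEQ_Suc[OF S_LIMSEQ])
  have "(\<lambda>n. \<integral>\<omega>'. F (running_max (\<lambda>r. S n \<omega> r - noise r \<omega> \<omega>') t) \<partial>M) \<longlonglongrightarrow>
      (\<integral>\<omega>'. F (running_max (\<lambda>r. s_inf \<omega> r - noise r \<omega> \<omega>') t) \<partial>M)"
  proof (rule integral_dominated_convergence[where w="\<lambda>_. Fmax"])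
    show "AE \<omega>' in M. (\<lambda>n. F (running_max (\<lambda>r. S n \<omega> r - noise r \<omega> \<omega>') t)) \<longlonglongrightarrow>
      F (running_max (\<lambda>r. s_inf \<omega> r - noise r \<omega> \<omega>') t)"
      by (intro AE_I2 isCont_tendsto_compose[OF F_isCont] running_max_LIMSEQ barrier S_mono s_inf_mono
        S_le_inf S_LIMSEQ)
  qed (use running_max_section_measurable[OF S_mono] running_max_section_measurable[OF s_inf_mono] F_abs in auto)
  then show "(\<lambda>n. S (Suc n) \<omega> t) \<longlonglongrightarrow> s0 + (\<integral>\<omega>'. F (running_max (\<lambda>r. s_inf \<omega> r - noise r \<omega> \<omega>') t) \<partial>M)"
    unfolding S.simps by (intro tendsto_add tendsto_const)
qed

text \<open>A supremum of increasing paths need not be right-continuous; the right limit restores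
  this.\<close>

definition front :: "'a \<Rightarrow> real \<Rightarrow> real" where
  "front \<omega> t = (INF u\<in>{t<..}. s_inf \<omega> u)"

lemma s_inf_front: "(s_inf \<omega> \<longlongrightarrow> front \<omega> t) (at_right t)"
  unfolding front_def by (rule mono_INF_at_right[OF s_inf_mono s_inf_bounds(1)])

lemma front_le_s_inf: "t < u \<Longrightarrow> front \<omega> t \<le> s_inf \<omega> u"
  unfolding front_def using s_inf_bounds(1) by (intro cINF_lower bdd_belowI[of _ s0]) auto

lemma front_bounds: "s0 \<le> front \<omega> t" "front \<omega> t \<le> s0 + Fmax"
  using order_trans[OF front_le_s_inf s_inf_bounds(2), of t "t + 1"] s_inf_bounds(1)
  by (auto simp: front_def intro!: cINF_greatest)

lemma s_inf_le_front: "s_inf \<omega> t \<le> front \<omega> t"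
  unfolding front_def using monoD[OF s_inf_mono] by (intro cINF_greatest) auto

lemma front_mono: "mono (front \<omega>)"
proof
  fix t u :: real assume "t \<le> u"
  then consider "t = u" | "t < u" by linarith
  then show "front \<omega> t \<le> front \<omega> u"
    by cases (use front_le_s_inf s_inf_le_front order_trans in blast)+
qed

lemma front_right_cont: "(front \<omega> \<longlongrightarrow> front \<omega> t) (at_right t)"
proof (rule order_tendstoI)
  have gt: "eventually (\<lambda>u. t < u) (at_right t)" by (simp add: eventually_at_filter)
  fix a assume "a < front \<omega> t"
  with gt show "eventually (\<lambda>u. a < front \<omega> u) (at_right t)"
    by (elim eventually_mono)
      (use \<open>a < front \<omega> t\<close> monoD[OF front_mono, of t] in \<open>meson less_le_trans less_imp_le\<close>)
next
  fix a assume a: "front \<omega> t < a"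
  have "eventually (\<lambda>u. s_inf \<omega> u < a) (at_right t)"
    by (rule order_tendstoD(2)[OF s_inf_front a])
  then obtain b where b: "t < b" "\<And>u. t < u \<Longrightarrow> u < b \<Longrightarrow> s_inf \<omega> u < a"
    by (auto simp: eventually_at_right_field)
  show "eventually (\<lambda>u. front \<omega> u < a) (at_right t)"
    unfolding eventually_at_right_field
  proof (intro exI[of _ b] conjI allI impI)
    fix u assume "t < u" "u < b"
    then show "front \<omega> u < a"
      using b(2)[of "(u + b) / 2"] front_le_s_inf[of u "(u + b) / 2" \<omega>] by auto
  qed (use b in auto)
qed

definition mx :: "'a \<Rightarrow> 'a \<Rightarrow> real \<Rightarrow> real" where
  "mx \<omega> \<omega>' = running_max (\<lambda>r. front \<omega> r - noise r \<omega> \<omega>')"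

text \<open>Both sides of the equation for \<open>s_inf\<close> are taken to their right limit at
  \<open>t\<close>. The running maximum of \<open>s_inf\<close> tends to that of the regularized
  front, since the two differ only through the value at the final time.\<close>

lemma front_fixpoint:
  assumes t: "0 \<le> t"
  shows "front \<omega> t = s0 + (\<integral>\<omega>'. F (mx \<omega> \<omega>' t) \<partial>M)"
proof (rule tendsto_unique[OF _ s_inf_front])
  have "((\<lambda>u. \<integral>\<omega>'. F (running_max (\<lambda>r. s_inf \<omega> r - noise r \<omega> \<omega>') u) \<partial>M) \<longlongrightarrow>
    (\<integral>\<omega>'. F (mx \<omega> \<omega>' t) \<partial>M)) (at_right t)"
  proof (rule tendsto_integral_within[where C=Fmax])
    fix \<omega>'
    have "mx \<omega> \<omega>' t = max (running_max (\<lambda>r. s_inf \<omega> r - noise r \<omega> \<omega>') t) (front \<omega> t - noise t \<omega> \<omega>')"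
      unfolding mx_def
      by (rule running_max_right_limit[OF barrier[OF s_inf_mono] barrier[OF front_mono] t s_inf_front])
    then show "((\<lambda>u. F (running_max (\<lambda>r. s_inf \<omega> r - noise r \<omega> \<omega>') u)) \<longlongrightarrow> F (mx \<omega> \<omega>' t)) (at_right t)"
      using barrier_path.rm_at_right[OF barrier[OF s_inf_mono] t s_inf_front]
      by (intro isCont_tendsto_compose[OF F_isCont]) simp
  qed (use running_max_section_measurable[OF s_inf_mono] F_abs W.finite_measure_axioms in auto)
  then have "((\<lambda>u. s0 + (\<integral>\<omega>'. F (running_max (\<lambda>r. s_inf \<omega> r - noise r \<omega> \<omega>') u) \<partial>M)) \<longlongrightarrow>
    s0 + (\<integral>\<omega>'. F (mx \<omega> \<omega>' t) \<partial>M)) (at_right t)"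
    by (intro tendsto_add tendsto_const)
  then show "(s_inf \<omega> \<longlongrightarrow> s0 + (\<integral>\<omega>'. F (mx \<omega> \<omega>' t) \<partial>M)) (at_right t)"
    unfolding s_inf_fixpoint[symmetric] .
qed simp

text \<open>If \<open>F (s0 + y) < y\<close>, the level \<open>s0 + y\<close> traps the iteration
  for a short time: while the old front stays below it, the new one stays below \<open>s0\<close>
  plus the average of \<open>F (s0 + y + R)\<close>, with \<open>R\<close> the running maximum of
  the negative of the noise, and for short times this is below \<open>s0 + y\<close>. By
  \<open>dip\<close> such \<open>y\<close> exist arbitrarily close to \<open>0\<close>.\<close>

lemma front_0: "front \<omega> 0 = s0"
proof (rule antisym)
  show "front \<omega> 0 \<le> s0"
  proof (rule field_le_epsilon)
    fix e :: real assume "0 < e"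
    then have "eventually (\<lambda>y. 0 < y \<and> y < e) (at_right 0)"
      by (auto simp: eventually_at_right_field)
    with dip obtain y where y: "0 < y" "y < e" "- (1 / (lam * \<kappa>)) * (LINT x:{s0..s0 + y}|lborel. v0 x) < y"
      using frequently_ex[OF frequently_eventually_frequently] by blast
    then have Fy: "F (s0 + y) < y" by (simp add: F_eq)
    define R where "R \<omega>' u = running_max (\<lambda>r. 0 - noise r \<omega> \<omega>') u" for \<omega>' u
    have b: "barrier_path (\<lambda>_. 0) (\<lambda>r. noise r \<omega> \<omega>')" for \<omega>' by (rule barrier) (simp add: mono_def)
    have R0: "R \<omega>' 0 = 0" for \<omega>' by (simp add: R_def running_max_def noise_neg)
    have R_m [measurable]: "(\<lambda>\<omega>'. R \<omega>' u) \<in> borel_measurable M" for u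
      unfolding R_def by (rule running_max_section_measurable) (simp add: mono_def)
    have "((\<lambda>u. \<integral>\<omega>'. F (s0 + y + R \<omega>' u) \<partial>M) \<longlongrightarrow> (\<integral>\<omega>'. F (s0 + y + 0) \<partial>M)) (at_right 0)"
    proof (rule tendsto_integral_within[where C=Fmax])
      fix \<omega>'
      have "(R \<omega>' \<longlongrightarrow> max (R \<omega>' 0) (0 - noise 0 \<omega> \<omega>')) (at_right 0)"
        unfolding R_def by (rule barrier_path.rm_at_right[OF b]) auto
      then have "(R \<omega>' \<longlongrightarrow> 0) (at_right 0)" by (simp add: R0 noise_neg)
      then show "((\<lambda>u. F (s0 + y + R \<omega>' u)) \<longlongrightarrow> F (s0 + y + 0)) (at_right 0)"
        by (intro isCont_tendsto_compose[OF F_isCont] tendsto_add tendsto_const)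
    qed (use F_abs W.finite_measure_axioms in auto)
    \<comment> \<open>Yields a time \<open>u\<close> up to which the noise leaves the strict
      inequality intact.\<close>
    then have "eventually (\<lambda>u. (\<integral>\<omega>'. F (s0 + y + R \<omega>' u) \<partial>M) < y) (at_right 0)"
      using Fy by (intro order_tendstoD(2)) (auto simp: W.prob_space)
    moreover have "eventually (\<lambda>u::real. 0 < u) (at_right 0)" by (simp add: eventually_at_filter)
    ultimately have "eventually (\<lambda>u. 0 < u \<and> (\<integral>\<omega>'. F (s0 + y + R \<omega>' u) \<partial>M) < y) (at_right 0)"
      by eventually_elim simp
    then obtain u where u: "0 < u" "(\<integral>\<omega>'. F (s0 + y + R \<omega>' u) \<partial>M) < y"
      using eventually_happens'[of "at_right (0::real)"] by auto
    have Sle: "S n \<omega> r \<le> s0 + y" if "r \<le> u" for n r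
      using that
    proof (induction n arbitrary: r)
      case 0 then show ?case using y by simp
    next
      case (Suc n)
      have "(\<integral>\<omega>'. F (running_max (\<lambda>r. S n \<omega> r - noise r \<omega> \<omega>') r) \<partial>M) \<le> (\<integral>\<omega>'. F (s0 + y + R \<omega>' u) \<partial>M)"
      proof (intro integral_mono F_running_max_integrable S_mono monoD[OF F_mono])
        show "integrable M (\<lambda>\<omega>'. F (s0 + y + R \<omega>' u))"
          by (intro W.integrable_const_bound[of _ Fmax]) (auto simp: F_abs)
        fix \<omega>'
        show "running_max (\<lambda>r. S n \<omega> r - noise r \<omega> \<omega>') r \<le> s0 + y + R \<omega>' u"
        proof (rule barrier_path.rm_least[OF barrier[OF S_mono]])
          fix q assume q: "0 \<le> q" "q \<le> max 0 r"
          then have "q \<le> u" using Suc.prems u by auto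
          then show "S n \<omega> q - noise q \<omega> \<omega>' \<le> s0 + y + R \<omega>' u"
            using Suc.IH[of q] barrier_path.rm_upper[OF b q(1), of u \<omega>'] by (simp add: R_def)
        qed
      qed
      then show ?case using u by simp
    qed
    have "s_inf \<omega> u \<le> s0 + y" unfolding s_inf_def by (intro cSUP_least Sle) auto
    then show "front \<omega> 0 \<le> s0 + e" using front_le_s_inf[OF u(1), of \<omega>] y by simp
  qed
qed (rule front_bounds)

lemma front_neg: "t \<le> 0 \<Longrightarrow> front \<omega> t = s0"
  using monoD[OF front_mono, of t 0 \<omega>] front_0[of \<omega>] front_bounds(1)[of \<omega> t] by simp

lemma S_measurable:
  assumes W: "\<And>r. r \<le> u \<Longrightarrow> W r \<in> borel_measurable G" and u: "0 \<le> u" "r \<le> u"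
  shows "(\<lambda>\<omega>. S n \<omega> r) \<in> borel_measurable G"
  using u(2)
proof (induction n arbitrary: r)
  case (Suc n)
  have "(\<lambda>(\<omega>, \<omega>'). running_max (\<lambda>r. S n \<omega> r - noise r \<omega> \<omega>') r) \<in> borel_measurable (G \<Otimes>\<^sub>M M)"
    by (rule running_max_noise_measurable[OF S_mono u(1) Suc.prems W _ Suc.IH]) auto
  then have [measurable]: "(\<lambda>x. running_max (\<lambda>r. S n (fst x) r - noise r (fst x) (snd x)) r) \<in> borel_measurable (G \<Otimes>\<^sub>M M)"
    by (simp add: split_beta)
  have "(\<lambda>\<omega>. \<integral>\<omega>'. F (running_max (\<lambda>r. S n \<omega> r - noise r \<omega> \<omega>') r) \<partial>M) \<in> borel_measurable G"
    by (rule W.borel_measurable_lebesgue_integral) (simp add: split_beta)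
  then show ?case by simp
qed simp

text \<open>The value at \<open>t\<close> is a limit of values of \<open>s_inf\<close> strictly
  after \<open>t\<close>. It is therefore known in every history after \<open>t\<close>, which is
  adaptedness to \<open>FW\<close> rather than to \<open>HW\<close>.\<close>

lemma front_measurable:
  assumes W: "\<And>r. r \<le> u \<Longrightarrow> W r \<in> borel_measurable G" and t: "t < u" "0 \<le> u"
  shows "(\<lambda>\<omega>. front \<omega> t) \<in> borel_measurable G"
proof -
  have inf: "(\<lambda>\<omega>. s_inf \<omega> r) \<in> borel_measurable G" if "r \<le> u" for r
    using S_LIMSEQ by (rule borel_measurable_LIMSEQ_real) (rule S_measurable[OF W t(2) that])
  define r where "r k = t + (u - t) / real (Suc k)" for k
  have r: "t < r k" "r k \<le> u" for k
  proof -
    have "(u - t) / real (Suc k) \<le> (u - t) / 1" using t by (intro divide_left_mono) auto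
    then show "t < r k" "r k \<le> u" unfolding r_def using t by auto
  qed
  have "(\<lambda>k. (u - t) / real (Suc k)) \<longlonglongrightarrow> (u - t) * 0"
    unfolding divide_inverse by (rule tendsto_mult[OF tendsto_const LIMSEQ_inverse_real_of_nat])
  then have "r \<longlonglongrightarrow> t + 0" unfolding r_def by (intro tendsto_add tendsto_const) simp
  then have "filterlim r (at_right t) sequentially"
    using r(1) by (auto simp: filterlim_at r(1)[THEN less_imp_neq, THEN not_sym])
  from filterlim_compose[OF s_inf_front this]
  show ?thesis by (rule borel_measurable_LIMSEQ_real) (rule inf[OF r(2)])
qed

lemma measurable_FW_iff: "f \<in> borel_measurable (FW t) \<longleftrightarrow> (\<forall>u>t. f \<in> borel_measurable (HW u))" for f :: "'a \<Rightarrow> real"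
  unfolding measurable_def by (auto simp: space_FW W.space_H sets_FW)

lemma W_FW: "r \<le> t \<Longrightarrow> W r \<in> borel_measurable (FW t)"
  by (simp add: measurable_FW_iff W.adapted)

lemma front_FW: "0 \<le> t \<Longrightarrow> (\<lambda>\<omega>. front \<omega> t) \<in> borel_measurable (FW t)"
  unfolding measurable_FW_iff using front_measurable[OF W.adapted] by auto

lemma FW_mono: "r \<le> t \<Longrightarrow> f \<in> borel_measurable (FW r) \<Longrightarrow> f \<in> borel_measurable (FW t)" for f :: "'a \<Rightarrow> real"
  by (simp add: measurable_FW_iff)

lemma FW_M: "f \<in> measurable (FW t) N \<Longrightarrow> f \<in> measurable M N"
proof (rule measurable_from_subalg[of M "FW t"])
  have "sets (FW t) \<subseteq> sets (HW (t + 1))" unfolding sets_FW by auto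
  then show "subalgebra M (FW t)"
    using W.sets_H[of "t + 1"] by (auto simp: subalgebra_def space_FW)
qed

lemma front_M [measurable]: "(\<lambda>\<omega>. front \<omega> t) \<in> borel_measurable M"
proof (cases "0 \<le> t")
  case True show ?thesis by (rule FW_M[OF front_FW[OF True]])
next
  case False then show ?thesis by (simp add: front_neg)
qed

lemma mx_measurable_general:
  assumes "0 \<le> u" "t \<le> u"
    and "\<And>r. r \<le> u \<Longrightarrow> W r \<in> borel_measurable G" and "\<And>r. r \<le> u \<Longrightarrow> B r \<in> borel_measurable K"
    and "\<And>r. 0 \<le> r \<Longrightarrow> r \<le> u \<Longrightarrow> (\<lambda>\<omega>. front \<omega> r) \<in> borel_measurable G"
  shows "(\<lambda>(\<omega>, \<omega>'). mx \<omega> \<omega>' t) \<in> borel_measurable (G \<Otimes>\<^sub>M K)"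
  unfolding mx_def by (rule running_max_noise_measurable[OF front_mono assms])

lemma mx_barrier: "barrier_path (front \<omega>) (\<lambda>r. noise r \<omega> \<omega>')"
  by (rule barrier[OF front_mono])

lemma mx_mono: "mono (mx \<omega> \<omega>')"
  unfolding mx_def by (rule barrier_path.rm_mono[OF mx_barrier])

text \<open>The only value to which the running maximum could jump is
  \<open>front \<omega> t - noise t \<omega> \<omega>'\<close>, which it dominates already.\<close>

lemma mx_right_cont: "0 \<le> t \<Longrightarrow> (mx \<omega> \<omega>' \<longlongrightarrow> mx \<omega> \<omega>' t) (at_right t)"
  using barrier_path.rm_at_right[OF mx_barrier _ front_right_cont, of t \<omega> \<omega>']
    barrier_path.rm_upper[OF mx_barrier, of t t \<omega> \<omega>']
  by (simp add: mx_def max_absorb1)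

lemma mx_upper: "0 \<le> r \<Longrightarrow> r \<le> t \<Longrightarrow> front \<omega> r - noise r \<omega> \<omega>' \<le> mx \<omega> \<omega>' t"
  unfolding mx_def by (rule barrier_path.rm_upper[OF mx_barrier])

lemma mx_attained:
  assumes "0 \<le> t" obtains r where "0 \<le> r" "r \<le> t" "front \<omega> r - noise r \<omega> \<omega>' = mx \<omega> \<omega>' t"
  using barrier_path.rm_attained[OF mx_barrier assms front_right_cont] unfolding mx_def by blast

lemma mx_0: "t \<le> 0 \<Longrightarrow> mx \<omega> \<omega>' t = s0"
  by (simp add: mx_def running_max_def front_0 noise_neg)

lemma mx_section [measurable]: "(\<lambda>\<omega>'. mx \<omega> \<omega>' t) \<in> borel_measurable M"
  unfolding mx_def by (rule running_max_section_measurable[OF front_mono])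

end

section \<open>Left limits of the front, and absorbed particles under the measure
  \<open>Q\<close>\<close>

lemma mono_SUP_at_left:
  fixes f :: "real \<Rightarrow> real"
  assumes f: "mono f"
  shows "(f \<longlongrightarrow> (SUP u\<in>{..<t}. f u)) (at_left t)"
proof (rule order_tendstoI)
  have bdd: "bdd_above (f ` {..<t})"
    using monoD[OF f, of _ t] by (intro bdd_aboveI2[of _ _ "f t"]) auto
  have lt: "eventually (\<lambda>u. u < t) (at_left t)" by (simp add: eventually_at_filter)
  fix a assume a: "(SUP u\<in>{..<t}. f u) < a"
  show "eventually (\<lambda>u. f u < a) (at_left t)"
    using lt
  proof eventually_elim
    case (elim u)
    then have "f u \<le> (SUP u\<in>{..<t}. f u)" by (intro cSUP_upper bdd) auto
    then show ?case using a by simp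
  qed
next
  have bdd: "bdd_above (f ` {..<t})"
    using monoD[OF f, of _ t] by (intro bdd_aboveI2[of _ _ "f t"]) auto
  fix a assume "a < (SUP u\<in>{..<t}. f u)"
  then obtain u where u: "u < t" "a < f u"
    by (subst (asm) less_cSUP_iff) (use bdd lt_ex[of t] in auto)
  have "eventually (\<lambda>x. u < x) (at_left t)" using u(1) by (auto simp: eventually_at_left_field)
  then show "eventually (\<lambda>x. a < f x) (at_left t)"
    by eventually_elim (use u(2) monoD[OF f] in \<open>meson less_le_trans less_imp_le\<close>)
qed

lemma left_lim_eqI: "(f \<longlongrightarrow> l) (at_left t) \<Longrightarrow> left_lim f t = l"
  unfolding left_lim_def by (rule tendsto_Lim) auto

context stefan
begin

lemma front_left_lim: "(front \<omega> \<longlongrightarrow> left_lim (front \<omega>) t) (at_left t)"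
  using mono_SUP_at_left[OF front_mono] left_lim_eqI by metis

lemma left_lim_front_le: "left_lim (front \<omega>) t \<le> front \<omega> t"
proof (rule tendsto_upperbound[OF front_left_lim])
  show "eventually (\<lambda>u. front \<omega> u \<le> front \<omega> t) (at_left t)"
    using monoD[OF front_mono, of _ t] by (auto simp: eventually_at_filter)
qed simp

definition Q :: "('a \<times> real) measure" where
  "Q = M \<Otimes>\<^sub>M \<nu>"

lemma sets_Q [measurable_cong]: "sets Q = sets (M \<Otimes>\<^sub>M borel)"
  unfolding Q_def by (rule sets_pair_measure_cong) auto

lemma space_Q: "space Q = space M \<times> UNIV"
  unfolding Q_def by (simp add: space_pair_measure)

sublocale Q: finite_measure Q
  unfolding Q_def by (intro finite_measure_pair_measure W.finite_measure_axioms \<nu>.finite_measure_axioms)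

sublocale M\<nu>: pair_sigma_finite M \<nu> ..

definition X :: "'a \<Rightarrow> real \<Rightarrow> 'a \<times> real \<Rightarrow> real" where
  "X \<omega> t x = snd x + noise t \<omega> (fst x)"

text \<open>Survival is encoded by the running maximum instead of a condition at all earlier times;
  in this form it is measurable at once and monotone in the starting point.\<close>

definition live :: "'a \<Rightarrow> real \<Rightarrow> 'a \<times> real \<Rightarrow> bool" where
  "live \<omega> t x \<longleftrightarrow> mx \<omega> (fst x) t < snd x"

lemma X_cont: "continuous_on UNIV (\<lambda>t. X \<omega> t x)"
  unfolding X_def by (intro continuous_intros noise_cont)

lemma X_isCont: "isCont (\<lambda>t. X \<omega> t x) t"
  using X_cont by (simp add: continuous_on_eq_continuous_at)

lemma X_tendsto: "((\<lambda>t. X \<omega> t x) \<longlongrightarrow> X \<omega> t x) (at t within A)"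
  by (rule tendsto_within_subset[OF X_isCont[unfolded isCont_def]]) simp

lemma live_antimono: "r \<le> t \<Longrightarrow> live \<omega> t x \<Longrightarrow> live \<omega> r x"
  unfolding live_def using monoD[OF mx_mono] by (meson le_less_trans)

lemma live_0: "t \<le> 0 \<Longrightarrow> live \<omega> t x \<longleftrightarrow> s0 < snd x"
  by (simp add: live_def mx_0)

lemma live_s0: "live \<omega> t x \<Longrightarrow> s0 < snd x"
  using live_antimono[of "min t 0" t] live_0[of "min t 0"] by auto

lemma live_right: "0 \<le> t \<Longrightarrow> eventually (\<lambda>u. live \<omega> u x \<longleftrightarrow> live \<omega> t x) (at_right t)"
proof (cases "live \<omega> t x")
  case True
  assume "0 \<le> t"
  have "eventually (\<lambda>u. mx \<omega> (fst x) u < snd x) (at_right t)"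
    by (rule order_tendstoD(2)[OF mx_right_cont[OF \<open>0 \<le> t\<close>]]) (use True in \<open>simp add: live_def\<close>)
  then show ?thesis by eventually_elim (use True in \<open>simp add: live_def\<close>)
next
  case False
  have "eventually (\<lambda>u. t < u) (at_right t)" by (simp add: eventually_at_filter)
  then show ?thesis by eventually_elim (use False live_antimono in \<open>meson less_imp_le\<close>)
qed

text \<open>The implication towards survival rests on the running maximum being attained: a starting
  point equal to an unattained supremum would never meet the front.\<close>

lemma live_iff: "0 \<le> t \<Longrightarrow> live \<omega> t x \<longleftrightarrow> (\<forall>r\<in>{0..t}. front \<omega> r < X \<omega> r x)"
proof
  assume "live \<omega> t x"
  then show "\<forall>r\<in>{0..t}. front \<omega> r < X \<omega> r x"
    using mx_upper[of _ t \<omega> "fst x"] by (fastforce simp: live_def X_def)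
next
  assume t: "0 \<le> t" and "\<forall>r\<in>{0..t}. front \<omega> r < X \<omega> r x"
  moreover obtain r where "0 \<le> r" "r \<le> t" "front \<omega> r - noise r \<omega> (fst x) = mx \<omega> (fst x) t"
    by (rule mx_attained[OF t])
  ultimately show "live \<omega> t x" by (force simp: live_def X_def)
qed

lemma X_measurable_general:
  assumes "\<And>r. r \<le> u \<Longrightarrow> W r \<in> borel_measurable G" "\<And>r. r \<le> u \<Longrightarrow> B r \<in> borel_measurable K" "t \<le> u"
  shows "(\<lambda>(\<omega>, x). X \<omega> t x) \<in> borel_measurable (G \<Otimes>\<^sub>M (K \<Otimes>\<^sub>M borel))"
proof -
  have [measurable]: "W t \<in> borel_measurable G" "B t \<in> borel_measurable K" using assms by auto
  show ?thesis unfolding X_def noise_def by measurable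
qed

lemma live_measurable_general:
  assumes "0 \<le> u" "t \<le> u"
    and "\<And>r. r \<le> u \<Longrightarrow> W r \<in> borel_measurable G" and "\<And>r. r \<le> u \<Longrightarrow> B r \<in> borel_measurable K"
    and "\<And>r. 0 \<le> r \<Longrightarrow> r \<le> u \<Longrightarrow> (\<lambda>\<omega>. front \<omega> r) \<in> borel_measurable G"
  shows "Measurable.pred (G \<Otimes>\<^sub>M (K \<Otimes>\<^sub>M borel)) (\<lambda>(\<omega>, x). live \<omega> t x)"
proof -
  have [measurable]: "(\<lambda>z. mx (fst z) (snd z) t) \<in> borel_measurable (G \<Otimes>\<^sub>M K)"
    using mx_measurable_general[OF assms] by (simp add: split_beta)
  have "(\<lambda>z. mx (fst (fst z, fst (snd z))) (snd (fst z, fst (snd z))) t) \<in> borel_measurable (G \<Otimes>\<^sub>M (K \<Otimes>\<^sub>M (borel :: real measure)))"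
    by measurable
  then have [measurable]: "(\<lambda>z. mx (fst z) (fst (snd z)) t) \<in> borel_measurable (G \<Otimes>\<^sub>M (K \<Otimes>\<^sub>M (borel :: real measure)))"
    by simp
  show ?thesis unfolding live_def split_beta by measurable
qed

lemma X_FW: "t \<le> u \<Longrightarrow> (\<lambda>(\<omega>, x). X \<omega> t x) \<in> borel_measurable (FW u \<Otimes>\<^sub>M Q)"
proof -
  assume "t \<le> u"
  then have "(\<lambda>(\<omega>, x). X \<omega> t x) \<in> borel_measurable (FW u \<Otimes>\<^sub>M (M \<Otimes>\<^sub>M borel))"
    by (intro X_measurable_general[of u]) (auto intro: W_FW)
  then show ?thesis by (simp cong: measurable_cong_sets add: sets_pair_measure_cong[OF refl sets_Q])
qed

lemma live_FW: "0 \<le> u \<Longrightarrow> t \<le> u \<Longrightarrow> Measurable.pred (FW u \<Otimes>\<^sub>M Q) (\<lambda>(\<omega>, x). live \<omega> t x)"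
proof -
  assume "0 \<le> u" "t \<le> u"
  then have "Measurable.pred (FW u \<Otimes>\<^sub>M (M \<Otimes>\<^sub>M borel)) (\<lambda>(\<omega>, x). live \<omega> t x)"
    by (intro live_measurable_general[of u]) (auto intro: W_FW FW_mono[OF _ front_FW])
  then show ?thesis by (simp cong: measurable_cong_sets add: sets_pair_measure_cong[OF refl sets_Q])
qed

lemma X_Q [measurable]: "X \<omega> t \<in> borel_measurable Q"
  unfolding X_def noise_def Q_def by measurable

lemma live_Q [measurable]: "Measurable.pred Q (live \<omega> t)"
  unfolding live_def Q_def by measurable

section \<open>The density\<close>

text \<open>For the sample \<open>\<omega>'\<close>, a particle found at \<open>x\<close> started
  from \<open>x - z \<omega>'\<close>. Averaging \<open>v0\<close> at that point over the event
  \<open>A\<close> gives a density defined at every point, which inherits sign and bound from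
  \<open>v0\<close>. With \<open>A\<close> free it describes the surviving particles as well as
  their left limits in time.\<close>

definition dens :: "('a \<Rightarrow> real) \<Rightarrow> ('a \<times> real) set \<Rightarrow> real \<Rightarrow> real" where
  "dens z A x = (\<integral>\<omega>'. v0 (x - z \<omega>') * indicator A (\<omega>', x - z \<omega>') \<partial>M)"

text \<open>Fubini's theorem and the translation by \<open>z \<omega>'\<close> turn the density into
  an integral over starting points; the sign comes from \<open>\<nu>\<close> having density
  \<open>- v0\<close>.\<close>

lemma
  assumes z [measurable]: "z \<in> borel_measurable M" and A: "A \<in> sets Q"
    and \<psi> [measurable]: "\<psi> \<in> borel_measurable borel" and c: "\<And>x. \<bar>\<psi> x\<bar> \<le> c"
  shows integrable_dens: "integrable lborel (\<lambda>x. dens z A x * \<psi> x)"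
    and integral_dens: "(\<integral>x. dens z A x * \<psi> x \<partial>lborel) = - (\<integral>x. indicator A x * \<psi> (snd x + z (fst x)) \<partial>Q)"
proof -
  have [measurable]: "A \<in> sets (M \<Otimes>\<^sub>M borel)" using A by (simp add: sets_Q)
  interpret P: pair_sigma_finite M lborel ..
  define h where "h \<omega>' x = v0 (x - z \<omega>') * indicator A (\<omega>', x - z \<omega>') * \<psi> x" for \<omega>' x
  have hm: "case_prod h \<in> borel_measurable (M \<Otimes>\<^sub>M lborel)"
    unfolding h_def by measurable
  have c0: "0 \<le> c" using c[of 0] by simp
  have shift: "integrable lborel (\<lambda>x. v0 (x - a))" for a
    using lborel_integrable_real_affine[OF v0_integrable, of 1 "-a"] by simp
  have hb: "\<bar>h \<omega>' x\<bar> \<le> c * \<bar>v0 (x - z \<omega>')\<bar>" for \<omega>' x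
    unfolding h_def abs_mult using mult_mono[OF _ c, of "\<bar>v0 (x - z \<omega>') * indicator A (\<omega>', x - z \<omega>')\<bar>" "\<bar>v0 (x - z \<omega>')\<bar>" x]
    by (auto simp: abs_mult indicator_def mult.commute split: if_splits)
  have hsec [measurable]: "h \<omega>' \<in> borel_measurable borel" if "\<omega>' \<in> space M" for \<omega>'
    using measurable_Pair2[OF hm that] by simp
  have hi: "integrable lborel (h \<omega>')" if "\<omega>' \<in> space M" for \<omega>'
    using hsec[OF that] hb c0
    by (intro Bochner_Integration.integrable_bound[OF integrable_mult_right[OF integrable_abs[OF shift[of "z \<omega>'"]], of c]])
       (auto simp: abs_mult)
  have H: "integrable (M \<Otimes>\<^sub>M lborel) (case_prod h)"
  proof (rule P.Fubini_integrable[OF hm])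
    show "AE x in M. integrable lborel (\<lambda>y. case (x, y) of (x, xa) \<Rightarrow> h x xa)" using hi by auto
    have "(\<integral>y. \<bar>h x y\<bar> \<partial>lborel) \<le> c * (\<integral>y. \<bar>v0 y\<bar> \<partial>lborel)" if "x \<in> space M" for x
    proof -
      have "(\<integral>y. \<bar>h x y\<bar> \<partial>lborel) \<le> (\<integral>y. c * \<bar>v0 (y - z x)\<bar> \<partial>lborel)"
        using hi[OF that] shift[of "z x"] by (intro integral_mono hb) auto
      also have "\<dots> = c * (\<integral>y. \<bar>v0 (y - z x)\<bar> \<partial>lborel)" by simp
      also have "(\<integral>y. \<bar>v0 (y - z x)\<bar> \<partial>lborel) = (\<integral>y. \<bar>v0 y\<bar> \<partial>lborel)"
        using lborel_integral_real_affine[of 1 "\<lambda>y. \<bar>v0 y\<bar>" "- z x"] by simp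
      finally show ?thesis .
    qed
    then show "integrable M (\<lambda>x. \<integral>y. norm (case (x, y) of (x, xa) \<Rightarrow> h x xa) \<partial>lborel)"
      using hm by (intro W.integrable_const_bound[of _ "c * (\<integral>y. \<bar>v0 y\<bar> \<partial>lborel)"]) (auto intro!: AE_I2)
  qed
  have eq: "dens z A x * \<psi> x = (\<integral>\<omega>'. h \<omega>' x \<partial>M)" for x
    unfolding dens_def h_def by simp
  show "integrable lborel (\<lambda>x. dens z A x * \<psi> x)"
    unfolding eq using P.integrable_snd[OF H] .
  have "(\<integral>x. dens z A x * \<psi> x \<partial>lborel) = (\<integral>\<omega>'. (\<integral>x. h \<omega>' x \<partial>lborel) \<partial>M)"
    unfolding eq by (rule P.Fubini_integral[OF H])
  also have "\<dots> = (\<integral>\<omega>'. - (\<integral>y. indicator A (\<omega>', y) * \<psi> (y + z \<omega>') \<partial>\<nu>) \<partial>M)"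
  proof (rule Bochner_Integration.integral_cong[OF refl])
    fix \<omega>' assume w: "\<omega>' \<in> space M"
    have [measurable]: "(\<lambda>y. indicator A (\<omega>', y) :: real) \<in> borel_measurable borel"
      using measurable_Pair2[OF borel_measurable_indicator[of A "M \<Otimes>\<^sub>M borel"] w] by simp
    have "(\<integral>x. h \<omega>' x \<partial>lborel) = (\<integral>y. h \<omega>' (z \<omega>' + 1 * y) \<partial>lborel)"
      by (subst lborel_integral_real_affine[of 1 _ "z \<omega>'"]) auto
    also have "\<dots> = (\<integral>y. v0 y * (indicator A (\<omega>', y) * \<psi> (y + z \<omega>')) \<partial>lborel)"
      by (simp add: h_def add.commute mult.assoc)
    also have "\<dots> = - (\<integral>y. indicator A (\<omega>', y) * \<psi> (y + z \<omega>') \<partial>\<nu>)"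
      by (subst integral_\<nu>) auto
    finally show "(\<integral>x. h \<omega>' x \<partial>lborel) = - (\<integral>y. indicator A (\<omega>', y) * \<psi> (y + z \<omega>') \<partial>\<nu>)" .
  qed
  also have "\<dots> = - (\<integral>\<omega>'. (\<integral>y. indicator A (\<omega>', y) * \<psi> (y + z \<omega>') \<partial>\<nu>) \<partial>M)" by simp
  also have "(\<integral>\<omega>'. (\<integral>y. indicator A (\<omega>', y) * \<psi> (y + z \<omega>') \<partial>\<nu>) \<partial>M) = (\<integral>x. indicator A x * \<psi> (snd x + z (fst x)) \<partial>Q)"
  proof -
    have "integrable Q (\<lambda>x. indicator A x * \<psi> (snd x + z (fst x)))"
      using A c by (intro Q.integrable_const_bound[of _ c]) (auto simp: indicator_def sets_Q intro: order_trans[OF abs_ge_zero c])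
    from M\<nu>.integral_fst'[OF this[unfolded Q_def]] show ?thesis by (simp add: Q_def)
  qed
  finally show "(\<integral>x. dens z A x * \<psi> x \<partial>lborel) = - (\<integral>x. indicator A x * \<psi> (snd x + z (fst x)) \<partial>Q)" .
qed

lemma dens_bounds:
  assumes [measurable]: "z \<in> borel_measurable M" and A: "A \<in> sets Q"
  shows "dens z A x \<le> 0" "- C \<le> dens z A x"
proof -
  have [measurable]: "A \<in> sets (M \<Otimes>\<^sub>M borel)" using A by (simp add: sets_Q)
  have C0: "0 \<le> C" using v0_bound[of 0] v0_nonpos[of 0] by simp
  have b: "- C \<le> v0 y * indicator A w" "v0 y * indicator A w \<le> 0" for y w
    using v0_bound[of y] v0_nonpos[of y] C0 by (auto simp: indicator_def)
  have i: "integrable M (\<lambda>\<omega>'. v0 (x - z \<omega>') * indicator A (\<omega>', x - z \<omega>'))"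
    using b C0 by (intro W.integrable_const_bound[of _ C]) (auto intro!: AE_I2 simp: abs_le_iff minus_le_iff intro: order_trans)
  show "dens z A x \<le> 0" "- C \<le> dens z A x"
    using integral_mono[OF i, of "\<lambda>_. 0"] integral_mono[OF _ i, of "\<lambda>_. - C"] b
    by (auto simp: dens_def W.prob_space)
qed

lemma dens_measurable [measurable]:
  assumes [measurable]: "z \<in> borel_measurable M" and A: "A \<in> sets Q"
  shows "dens z A \<in> borel_measurable borel"
  using integrable_dens[OF assms, of "\<lambda>_. 1" 1] by simp

definition v :: "'a \<Rightarrow> real \<Rightarrow> real \<Rightarrow> real" where
  "v \<omega> t = dens (noise t \<omega>) {x \<in> space Q. live \<omega> t x}"

lemma noise_M [measurable]: "noise t \<omega> \<in> borel_measurable M"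
  unfolding noise_def by measurable

lemma live_sets: "{x \<in> space Q. live \<omega> t x} \<in> sets Q"
  by measurable

lemma
  assumes "\<psi> \<in> borel_measurable borel" and "\<And>x. \<bar>\<psi> x\<bar> \<le> c"
  shows integrable_v: "integrable lborel (\<lambda>x. v \<omega> t x * \<psi> x)"
    and integral_v: "(\<integral>x. v \<omega> t x * \<psi> x \<partial>lborel) = - (\<integral>x. (if live \<omega> t x then \<psi> (X \<omega> t x) else 0) \<partial>Q)"
proof -
  show "integrable lborel (\<lambda>x. v \<omega> t x * \<psi> x)"
    unfolding v_def by (rule integrable_dens[OF noise_M live_sets assms])
  show "(\<integral>x. v \<omega> t x * \<psi> x \<partial>lborel) = - (\<integral>x. (if live \<omega> t x then \<psi> (X \<omega> t x) else 0) \<partial>Q)"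
    unfolding v_def integral_dens[OF noise_M live_sets assms]
    by (intro arg_cong[where f=uminus] Bochner_Integration.integral_cong) (auto simp: X_def)
qed

lemma v_measurable [measurable]: "v \<omega> t \<in> borel_measurable borel"
  unfolding v_def by (rule dens_measurable[OF noise_M live_sets])

lemma v_bounds: "v \<omega> t x \<le> 0" "- C \<le> v \<omega> t x"
  unfolding v_def by (rule dens_bounds[OF noise_M live_sets])+

lemma v_zero: "0 \<le> t \<Longrightarrow> x \<le> front \<omega> t \<Longrightarrow> v \<omega> t x = 0"
proof -
  assume "0 \<le> t" "x \<le> front \<omega> t"
  then have "\<not> live \<omega> t (\<omega>', x - noise t \<omega> \<omega>')" for \<omega>'
    using mx_upper[of t t \<omega> \<omega>'] by (simp add: live_def)
  then show ?thesis by (simp add: v_def dens_def)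
qed

lemma v_0: "v \<omega> 0 x = v0 x"
proof -
  have "v \<omega> 0 x = (\<integral>\<omega>'. v0 x \<partial>M)"
    unfolding v_def dens_def
    by (intro Bochner_Integration.integral_cong refl)
      (auto simp: noise_neg live_0 indicator_def space_Q v0_zero not_less)
  then show ?thesis by (simp add: W.prob_space)
qed

section \<open>Path properties\<close>

text \<open>Survival is decreasing in time, so close to \<open>t\<close> from the left it settles to
  survival at all times before \<open>t\<close>.\<close>

lemma live_left: "eventually (\<lambda>u. live \<omega> u x \<longleftrightarrow> (\<forall>u<t. live \<omega> u x)) (at_left t)"
proof (cases "\<forall>u<t. live \<omega> u x")
  case True
  then show ?thesis by (auto simp: eventually_at_filter)
next
  case False
  then obtain u where u: "u < t" "\<not> live \<omega> u x" by auto
  have "eventually (\<lambda>w. u < w) (at_left t)" using u(1) by (auto simp: eventually_at_left_field)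
  then show ?thesis by eventually_elim (use u live_antimono in \<open>meson less_imp_le\<close>)
qed

lemma live_left_Q [measurable]: "Measurable.pred Q (\<lambda>x. \<forall>u<t. live \<omega> u x)"
proof -
  have "(\<forall>u<t. live \<omega> u x) \<longleftrightarrow> (\<forall>k. live \<omega> (t - inverse (real (Suc k))) x)" for x
  proof safe
    fix u assume *: "\<forall>k. live \<omega> (t - inverse (real (Suc k))) x" and "u < t"
    then obtain k where "inverse (real (Suc k)) < t - u" using reals_Archimedean[of "t - u"] by auto
    then show "live \<omega> u x" using * live_antimono[of u "t - inverse (real (Suc k))"] by auto
  qed simp
  then show ?thesis by (subst measurable_cong[where g="\<lambda>x. \<forall>k. live \<omega> (t - inverse (real (Suc k))) x"]) auto
qed

text \<open>For each particle both the position and the survival are right-continuous, and bounded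
  convergence applies. The function may depend on time, so that derivatives of test functions are
  covered.\<close>

lemma pairing_right:
  fixes \<psi> :: "real \<Rightarrow> real \<Rightarrow> real"
  assumes \<psi>: "continuous_on ({0..} \<times> UNIV) (\<lambda>(r, x). \<psi> r x)" "\<And>r x. 0 \<le> r \<Longrightarrow> \<bar>\<psi> r x\<bar> \<le> c" and t: "0 \<le> t"
  shows "((\<lambda>u. \<integral>x. (if live \<omega> u x then \<psi> u (X \<omega> u x) else 0) \<partial>Q) \<longlongrightarrow>
     (\<integral>x. (if live \<omega> t x then \<psi> t (X \<omega> t x) else 0) \<partial>Q)) (at_right t)"
proof (rule tendsto_integral_within[OF Q.finite_measure_axioms, where C=c])
  have sec: "\<psi> r \<in> borel_measurable borel" if "0 \<le> r" for r
  proof -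
    have "continuous_on UNIV (\<lambda>x. (\<lambda>(r, x). \<psi> r x) (r, x))"
      by (rule continuous_on_compose2[OF \<psi>(1)]) (use that in \<open>auto intro!: continuous_intros\<close>)
    then show ?thesis by (auto intro: borel_measurable_continuous_onI)
  qed
  fix r assume "r \<in> {t<..}"
  then have [measurable]: "\<psi> r \<in> borel_measurable borel" using t by (intro sec) auto
  show "(\<lambda>x. if live \<omega> r x then \<psi> r (X \<omega> r x) else 0) \<in> borel_measurable Q" by measurable
  fix x show "\<bar>if live \<omega> r x then \<psi> r (X \<omega> r x) else 0\<bar> \<le> c"
    using \<psi>(2)[of r] \<open>r \<in> {t<..}\<close> t order_trans[OF abs_ge_zero, of "\<psi> r 0" c] by auto
next
  fix x
  have "((\<lambda>u. (\<lambda>(r, x). \<psi> r x) (u, X \<omega> u x)) \<longlongrightarrow> (\<lambda>(r, x). \<psi> r x) (t, X \<omega> t x)) (at_right t)"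
  proof (rule continuous_on_tendsto_compose[OF \<psi>(1)])
    show "((\<lambda>u. (u, X \<omega> u x)) \<longlongrightarrow> (t, X \<omega> t x)) (at_right t)"
      by (intro tendsto_Pair X_tendsto tendsto_ident_at)
    show "eventually (\<lambda>u. (u, X \<omega> u x) \<in> {0..} \<times> UNIV) (at_right t)"
      using t by (auto simp: eventually_at_filter)
  qed (use t in auto)
  then have "((\<lambda>u. if live \<omega> t x then \<psi> u (X \<omega> u x) else 0) \<longlongrightarrow> (if live \<omega> t x then \<psi> t (X \<omega> t x) else 0)) (at_right t)"
    by auto
  then show "((\<lambda>u. if live \<omega> u x then \<psi> u (X \<omega> u x) else 0) \<longlongrightarrow> (if live \<omega> t x then \<psi> t (X \<omega> t x) else 0)) (at_right t)"
    by (rule Lim_transform_eventually) (use live_right[OF t, of \<omega> x] in \<open>auto elim!: eventually_mono\<close>)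
qed

text \<open>The left limit still counts the particles absorbed exactly at time \<open>t\<close>;
  these are the ones that the jump term collects.\<close>

lemma pairing_left:
  fixes \<psi> :: "real \<Rightarrow> real"
  assumes \<psi>: "continuous_on UNIV \<psi>" "\<And>x. \<bar>\<psi> x\<bar> \<le> c"
  shows "((\<lambda>u. \<integral>x. (if live \<omega> u x then \<psi> (X \<omega> u x) else 0) \<partial>Q) \<longlongrightarrow>
     (\<integral>x. (if \<forall>u<t. live \<omega> u x then \<psi> (X \<omega> t x) else 0) \<partial>Q)) (at_left t)"
proof (rule tendsto_integral_within[OF Q.finite_measure_axioms, where C=c])
  have [measurable]: "\<psi> \<in> borel_measurable borel" using \<psi>(1) by (rule borel_measurable_continuous_onI)
  fix r
  show "(\<lambda>x. if live \<omega> r x then \<psi> (X \<omega> r x) else 0) \<in> borel_measurable Q" by measurable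
  fix x show "\<bar>if live \<omega> r x then \<psi> (X \<omega> r x) else 0\<bar> \<le> c"
    using \<psi>(2) order_trans[OF abs_ge_zero, of "\<psi> 0" c] by auto
next
  fix x
  have "((\<lambda>u. \<psi> (X \<omega> u x)) \<longlongrightarrow> \<psi> (X \<omega> t x)) (at_left t)"
    by (rule isCont_tendsto_compose[OF _ X_tendsto]) (use \<psi>(1) in \<open>simp add: continuous_on_eq_continuous_at\<close>)
  then have "((\<lambda>u. if L then \<psi> (X \<omega> u x) else 0) \<longlongrightarrow> (if L then \<psi> (X \<omega> t x) else 0)) (at_left t)" for L
    by auto
  then show "((\<lambda>u. if live \<omega> u x then \<psi> (X \<omega> u x) else 0) \<longlongrightarrow> (if \<forall>u<t. live \<omega> u x then \<psi> (X \<omega> t x) else 0)) (at_left t)"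
    by (rule Lim_transform_eventually) (use live_left[of \<omega> x t] in \<open>auto elim!: eventually_mono\<close>)
qed

lemma bcontfun_bound:
  fixes \<psi> :: "real \<Rightarrow> real"
  assumes "\<psi> \<in> bcontfun"
  obtains c where "continuous_on UNIV \<psi>" "\<psi> \<in> borel_measurable borel" "\<And>x. \<bar>\<psi> x\<bar> \<le> c"
proof -
  have "continuous_on UNIV \<psi>" "bounded (range \<psi>)" using assms by (auto simp: bcontfun_def)
  moreover then obtain c where "\<forall>y\<in>range \<psi>. norm y \<le> c" unfolding bounded_iff by blast
  ultimately show ?thesis using that[of c] by (auto intro: borel_measurable_continuous_onI)
qed

lemma integrable_v': "integrable lborel (v \<omega> t)"
  using integrable_v[of "\<lambda>_. 1" 1 \<omega> t] by simp

lemma v_D_L1: "v \<omega> \<in> D_L1"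
  unfolding D_L1_def
proof (intro CollectI conjI ballI allI impI)
  show "integrable lborel (v \<omega> t)" for t by (rule integrable_v')
  fix \<psi> :: "real \<Rightarrow> real" assume "\<psi> \<in> bcontfun"
  then obtain c where \<psi>: "continuous_on UNIV \<psi>" "\<psi> \<in> borel_measurable borel" "\<And>x. \<bar>\<psi> x\<bar> \<le> c"
    using bcontfun_bound by blast
  have \<psi>2: "continuous_on ({0..} \<times> UNIV) (\<lambda>(r::real, x). \<psi> x)"
    unfolding split_beta by (intro continuous_on_compose2[OF \<psi>(1)] continuous_intros) auto
  show "cadlag (\<lambda>t. LINT x|lborel. v \<omega> t x * \<psi> x)"
    unfolding cadlag_def integral_v[OF \<psi>(2,3)] continuous_within
    using tendsto_minus[OF pairing_right[OF \<psi>2, of c]] tendsto_minus[OF pairing_left[OF \<psi>(1,3)]] \<psi>(3) by blast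
qed

lemma front_D_up: "front \<omega> \<in> D_up"
  unfolding D_up_def cadlag_def continuous_within
  using front_right_cont front_left_lim order_trans[OF s0_nonneg front_bounds(1)] mono_imp_mono_on[OF front_mono]
  by blast

lemma v_front_D_paths: "ereal C \<le> Linf_norm u0 \<Longrightarrow> AE x in lborel. v0 x = u0 x \<Longrightarrow> (v \<omega>, front \<omega>) \<in> D_paths u0 s0"
  unfolding D_paths_def
proof (intro CollectI case_prodI conjI allI impI v_D_L1 front_D_up front_0)
  assume "AE x in lborel. v0 x = u0 x"
  then show "AE x in lborel. v \<omega> 0 x = u0 x" by (simp add: v_0)
  assume C: "ereal C \<le> Linf_norm u0"
  fix t :: real assume t: "0 \<le> t"
  show "ess_support (v \<omega> t) \<subseteq> {front \<omega> t..}"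
  proof
    fix x assume x: "x \<in> ess_support (v \<omega> t)"
    have "open {..<front \<omega> t} \<and> (AE x in lborel. x \<in> {..<front \<omega> t} \<longrightarrow> v \<omega> t x = 0)"
      using v_zero[OF t, of _ \<omega>] by auto
    then have "x \<notin> {..<front \<omega> t}" using x unfolding ess_support_def by blast
    then show "x \<in> {front \<omega> t..}" by simp
  qed
  have "\<bar>v \<omega> t x\<bar> \<le> C" for x using v_bounds[of \<omega> t x] by auto
  then have "Linf_norm (v \<omega> t) \<le> ereal C"
    unfolding Linf_norm_def by (intro esssup_I) auto
  then show "Linf_norm (v \<omega> t) \<le> Linf_norm u0" using C by (rule order_trans)
qed

lemma pairing_FW:
  assumes [measurable]: "(\<psi> :: real \<Rightarrow> real) \<in> borel_measurable borel" and t: "0 \<le> t"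
  shows "(\<lambda>\<omega>. \<integral>x. (if live \<omega> t x then \<psi> (X \<omega> t x) else 0) \<partial>Q) \<in> borel_measurable (FW t)"
proof (rule Q.borel_measurable_lebesgue_integral)
  have [measurable]: "(\<lambda>z. X (fst z) t (snd z)) \<in> borel_measurable (FW t \<Otimes>\<^sub>M Q)"
    using X_FW[of t t] by (simp add: split_beta)
  have [measurable]: "Measurable.pred (FW t \<Otimes>\<^sub>M Q) (\<lambda>z. live (fst z) t (snd z))"
    using live_FW[OF t order_refl] by (simp add: split_beta)
  show "(\<lambda>(\<omega>, x). if live \<omega> t x then \<psi> (X \<omega> t x) else 0) \<in> borel_measurable (FW t \<Otimes>\<^sub>M Q)"
    unfolding split_beta by measurable
qed

lemma v_front_D_processes:
  assumes "ereal C \<le> Linf_norm u0" "AE x in lborel. v0 x = u0 x"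
  shows "(v, front) \<in> D_processes M FW u0 s0"
  unfolding D_processes_def
proof (intro CollectI case_prodI conjI allI impI ballI v_front_D_paths[OF assms])
  fix t :: real assume t: "0 \<le> t"
  show "(\<lambda>\<omega>. front \<omega> t) \<in> borel_measurable (FW t)" by (rule front_FW[OF t])
  fix \<psi> :: "real \<Rightarrow> real" assume "\<psi> \<in> bcontfun"
  then obtain c where \<psi>: "\<psi> \<in> borel_measurable borel" "\<And>x. \<bar>\<psi> x\<bar> \<le> c"
    using bcontfun_bound by blast
  show "(\<lambda>\<omega>. LINT x|lborel. v \<omega> t x * \<psi> x) \<in> borel_measurable (FW t)"
    unfolding integral_v[OF \<psi>] using pairing_FW[OF \<psi>(1) t] by measurable
qed

end

section \<open>Integrable functions are determined by bounded continuous test functions\<close>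

lemma cts_step_abs_le: "a < b \<Longrightarrow> \<bar>cts_step a b x\<bar> \<le> 1"
  by (auto simp: cts_step_def divide_simps)

lemma cts_step_bcontfun: "a < b \<Longrightarrow> cts_step a b \<in> bcontfun"
proof -
  assume ab: "a < b"
  then have "bounded (range (cts_step a b))" using cts_step_abs_le by (auto simp: bounded_iff)
  then show ?thesis
    using uniformly_continuous_imp_continuous[OF cts_step_uniformly_continuous[OF ab]] by (simp add: bcontfun_def)
qed

text \<open>Test functions that fall linearly from \<open>1\<close> to \<open>0\<close> just after
  \<open>a\<close> approximate the half-line up to \<open>a\<close>. So the positive and the
  negative part of \<open>h\<close> have equal distribution functions, hence equal densities, and
  both must vanish.\<close>

lemma AE_eq_0_of_bcontfun_pairing:
  fixes h :: "real \<Rightarrow> real"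
  assumes h: "integrable lborel h" and eq: "\<And>\<psi>. \<psi> \<in> bcontfun \<Longrightarrow> (\<integral>x. h x * \<psi> x \<partial>lborel) = 0"
  shows "AE x in lborel. h x = 0"
proof -
  have hm [measurable]: "h \<in> borel_measurable borel" using h by auto
  have half: "(\<integral>x. h x * indicator {..a} x \<partial>lborel) = 0" for a
  proof (rule LIMSEQ_unique[OF _ tendsto_const])
    have "(\<lambda>n. \<integral>x. h x * cts_step a (a + 1 / real (Suc n)) x \<partial>lborel) \<longlonglongrightarrow> (\<integral>x. h x * indicator {..a} x \<partial>lborel)"
    proof (rule integral_dominated_convergence[where w="\<lambda>x. \<bar>h x\<bar>"])
      have [measurable]: "cts_step a (a + 1 / real (Suc n)) \<in> borel_measurable borel" for n
        using cts_step_bcontfun[of a "a + 1 / real (Suc n)"] by (auto simp: bcontfun_def intro: borel_measurable_continuous_onI)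
      show "(\<lambda>x. h x * cts_step a (a + 1 / real (Suc n)) x) \<in> borel_measurable lborel" for n by measurable
      show "AE x in lborel. norm (h x * cts_step a (a + 1 / real (Suc n)) x) \<le> \<bar>h x\<bar>" for n
      proof (rule AE_I2)
        fix x have "\<bar>cts_step a (a + 1 / real (Suc n)) x\<bar> \<le> 1"
          by (rule cts_step_abs_le) simp
        then show "norm (h x * cts_step a (a + 1 / real (Suc n)) x) \<le> \<bar>h x\<bar>"
          by (simp add: abs_mult mult_left_le)
      qed
      show "AE x in lborel. (\<lambda>n. h x * cts_step a (a + 1 / real (Suc n)) x) \<longlonglongrightarrow> h x * indicator {..a} x"
      proof (rule AE_I2)
        fix x
        show "(\<lambda>n. h x * cts_step a (a + 1 / real (Suc n)) x) \<longlonglongrightarrow> h x * indicator {..a} x"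
        proof (cases "x \<le> a")
          case False
          then obtain N where N: "1 / real (Suc N) < x - a"
            using reals_Archimedean[of "x - a"] by (auto simp: inverse_eq_divide)
          have "cts_step a (a + 1 / real (Suc n)) x = 0" if "N \<le> n" for n
          proof -
            have "1 / real (Suc n) \<le> 1 / real (Suc N)" using that by (intro divide_left_mono) auto
            then show ?thesis using N False by (auto simp: cts_step_def)
          qed
          then have "eventually (\<lambda>n. h x * cts_step a (a + 1 / real (Suc n)) x = h x * indicator {..a} x) sequentially"
            using False by (auto simp: eventually_sequentially)
          then show ?thesis by (rule tendsto_eventually)
        qed (auto simp: cts_step_def)
      qed
    qed (use h in auto)
    moreover have "(\<integral>x. h x * cts_step a (a + 1 / real (Suc n)) x \<partial>lborel) = 0" for n
      by (intro eq cts_step_bcontfun) simp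
    ultimately show "(\<lambda>n. 0) \<longlonglongrightarrow> (\<integral>x. h x * indicator {..a} x \<partial>lborel)" by simp
  qed
  \<comment> \<open>The conversion to \<open>ennreal\<close> cuts off negative values, so the
    density is the positive part of \<open>f\<close>.\<close>
  define \<mu> where "\<mu> f = density lborel (\<lambda>x. ennreal (f x))" for f :: "real \<Rightarrow> real"
  have fin: "finite_borel_measure (\<mu> f)" and cdf: "cdf (\<mu> f) a = (\<integral>x. max 0 (f x) * indicator {..a} x \<partial>lborel)"
    if f: "integrable lborel f" for f a
  proof -
    have [measurable]: "f \<in> borel_measurable borel" using f by auto
    have e: "emeasure (\<mu> f) A = ennreal (\<integral>x. max 0 (f x) * indicator A x \<partial>lborel)" if [measurable]: "A \<in> sets borel" for A
    proof -
      have "emeasure (\<mu> f) A = (\<integral>\<^sup>+x. ennreal (max 0 (f x) * indicator A x) \<partial>lborel)"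
        unfolding \<mu>_def by (subst emeasure_density) (auto intro!: nn_integral_cong simp: indicator_def max_def ennreal_neg)
      also have "\<dots> = ennreal (\<integral>x. max 0 (f x) * indicator A x \<partial>lborel)"
        using f by (intro nn_integral_eq_integral integrable_real_mult_indicator) auto
      finally show ?thesis .
    qed
    show "finite_borel_measure (\<mu> f)"
    proof (intro finite_borel_measure.intro finite_borel_measure_axioms.intro finite_measureI)
      have "emeasure (\<mu> f) UNIV \<noteq> \<infinity>" by (subst e) auto
      then show "emeasure (\<mu> f) (space (\<mu> f)) \<noteq> \<infinity>" by (simp add: \<mu>_def)
      show "sets (\<mu> f) = sets borel" by (simp add: \<mu>_def)
    qed
    show "cdf (\<mu> f) a = (\<integral>x. max 0 (f x) * indicator {..a} x \<partial>lborel)"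
      unfolding cdf_def measure_def by (subst e) (auto intro!: integral_nonneg_AE)
  qed
  have hn: "integrable lborel (\<lambda>x. - h x)" using h by simp
  have "cdf (\<mu> h) a = cdf (\<mu> (\<lambda>x. - h x)) a" for a
  proof -
    have "(\<integral>x. max 0 (h x) * indicator {..a} x \<partial>lborel) - (\<integral>x. max 0 (- h x) * indicator {..a} x \<partial>lborel) =
      (\<integral>x. max 0 (h x) * indicator {..a} x - max 0 (- h x) * indicator {..a} x \<partial>lborel)"
      using h by (intro Bochner_Integration.integral_diff[symmetric] integrable_real_mult_indicator) auto
    also have "\<dots> = (\<integral>x. h x * indicator {..a} x \<partial>lborel)"
      by (intro Bochner_Integration.integral_cong) (auto simp: indicator_def max_def)
    finally show ?thesis unfolding cdf[OF h] cdf[OF hn] half by simp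
  qed
  then have "\<mu> h = \<mu> (\<lambda>x. - h x)" by (intro cdf_unique' fin h hn ext)
  then have "AE x in lborel. ennreal (h x) = ennreal (- h x)"
    unfolding \<mu>_def by (intro sigma_finite_measure.density_unique[OF sigma_finite_lborel]) auto
  then show ?thesis
  proof eventually_elim
    case (elim x)
    show ?case
    proof (cases "0 \<le> h x")
      case True
      then have "ennreal (- h x) = 0" by (intro ennreal_neg) simp
      then have "h x \<le> 0" using elim ennreal_eq_0_iff by metis
      then show ?thesis using True by simp
    next
      case False
      then have "ennreal (h x) = 0" by (intro ennreal_neg) simp
      then have "- h x \<le> 0" using elim ennreal_eq_0_iff by metis
      then show ?thesis using False by simp
    qed
  qed
qed

lemma AE_eq_of_bcontfun_pairing:
  fixes g h :: "real \<Rightarrow> real"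
  assumes "integrable lborel g" "integrable lborel h"
    and "\<And>\<psi>. \<psi> \<in> bcontfun \<Longrightarrow> (\<integral>x. g x * \<psi> x \<partial>lborel) = (\<integral>x. h x * \<psi> x \<partial>lborel)"
  shows "AE x in lborel. g x = h x"
proof -
  have "AE x in lborel. g x - h x = 0"
  proof (rule AE_eq_0_of_bcontfun_pairing)
    fix \<psi> :: "real \<Rightarrow> real" assume \<psi>: "\<psi> \<in> bcontfun"
    then have \<psi>_m [measurable]: "\<psi> \<in> borel_measurable borel" by (auto simp: bcontfun_def intro: borel_measurable_continuous_onI)
    obtain c where c: "\<And>x. \<bar>\<psi> x\<bar> \<le> c" using \<psi> by (auto simp: bcontfun_def bounded_iff)
    have "integrable lborel (\<lambda>x. f x * \<psi> x)" if f: "integrable lborel f" for f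
    proof (rule Bochner_Integration.integrable_bound[OF integrable_mult_right[OF f, of c]])
      show "(\<lambda>x. f x * \<psi> x) \<in> borel_measurable lborel" using f by auto
      show "AE x in lborel. norm (f x * \<psi> x) \<le> norm (c * f x)"
        using c order_trans[OF abs_ge_zero c] by (auto simp: abs_mult mult.commute intro!: mult_right_mono AE_I2)
    qed
    from this[OF assms(1)] this[OF assms(2)] show "(\<integral>x. (g x - h x) * \<psi> x \<partial>lborel) = 0"
      using assms(3)[OF \<psi>] by (simp add: left_diff_distrib)
  qed (use assms in auto)
  then show ?thesis by eventually_elim simp
qed

lemma C12b_bound:
  assumes "\<phi> \<in> C12b"
  obtains c where "\<And>\<psi>. \<psi> \<in> {\<phi>, d_t \<phi>, d_x \<phi>, d_xx \<phi>} \<Longrightarrow> continuous_on ({0..} \<times> UNIV) (\<lambda>(r, x). \<psi> r x)"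
    "\<And>\<psi> r x. \<psi> \<in> {\<phi>, d_t \<phi>, d_x \<phi>, d_xx \<phi>} \<Longrightarrow> 0 \<le> r \<Longrightarrow> \<bar>\<psi> r x\<bar> \<le> c"
proof -
  let ?A = "{\<phi>, d_t \<phi>, d_x \<phi>, d_xx \<phi>}"
  have C: "\<forall>\<psi>\<in>?A. continuous_on ({0..} \<times> UNIV) (\<lambda>(r, x). \<psi> r x) \<and>
    bounded ((\<lambda>(r, x). \<psi> r x) ` ({0..} \<times> UNIV))"
    using assms unfolding C12b_def by blast
  have "bounded (\<Union>\<psi>\<in>?A. (\<lambda>(r, x). \<psi> r x) ` ({0..} \<times> UNIV))"
    by (rule bounded_UN) (use C in auto)
  then obtain c where c: "\<forall>y\<in>(\<Union>\<psi>\<in>?A. (\<lambda>(r, x). \<psi> r x) ` ({0..} \<times> UNIV)). norm y \<le> c"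
    unfolding bounded_iff by blast
  show ?thesis
  proof (rule that)
    fix \<psi> assume "\<psi> \<in> ?A" then show "continuous_on ({0..} \<times> UNIV) (\<lambda>(r, x). \<psi> r x)" using C by blast
  next
    fix \<psi> r x assume "\<psi> \<in> ?A" "(0::real) \<le> r"
    then have "\<psi> r x \<in> (\<Union>\<psi>\<in>?A. (\<lambda>(r, x). \<psi> r x) ` ({0..} \<times> UNIV))"
      by (intro UN_I[of \<psi>]) (auto intro!: image_eqI[of _ _ "(r, x)"])
    then show "\<bar>\<psi> r x\<bar> \<le> c" using c by auto
  qed
qed

lemma continuous_on_section:
  assumes "continuous_on ({0..} \<times> UNIV) (\<lambda>(r, x). \<psi> r x)" "0 \<le> r"
  shows "continuous_on UNIV (\<psi> r :: real \<Rightarrow> real)"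
proof -
  have "continuous_on UNIV (\<lambda>x. (\<lambda>(r, x). \<psi> r x) (r, x))"
    by (rule continuous_on_compose2[OF assms(1)]) (use assms(2) in \<open>auto intro!: continuous_intros\<close>)
  then show ?thesis by simp
qed

lemma measurable_section:
  assumes "continuous_on ({0..} \<times> UNIV) (\<lambda>(r, x). \<psi> r x)" "0 \<le> r"
  shows "(\<psi> r :: real \<Rightarrow> real) \<in> borel_measurable borel"
  by (rule borel_measurable_continuous_onI[OF continuous_on_section[OF assms]])

context stefan
begin

section \<open>The absorption time\<close>

text \<open>The infimum of an empty set of reals is unspecified, so every use is guarded by the
  particle being dead at some time.\<close>

definition tau :: "'a \<Rightarrow> 'a \<times> real \<Rightarrow> real" where
  "tau \<omega> x = Inf {t. 0 \<le> t \<and> \<not> live \<omega> t x}"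

text \<open>Survival is right-continuous, so the infimum is the first time at which the particle is
  dead. Before it the particle is strictly above the front, which bounds the position from below by
  left limits; at that time it must be at or below the front, not having met it earlier. The
  position at absorption thus lies in the interval swept by the front.\<close>

lemma
  assumes x: "s0 < snd x" and t: "0 \<le> t" "\<not> live \<omega> t x"
  shows tau_pos: "0 < tau \<omega> x" and tau_le: "tau \<omega> x \<le> t"
    and live_iff_tau: "\<And>u. live \<omega> u x \<longleftrightarrow> u < tau \<omega> x"
    and X_tau_le: "X \<omega> (tau \<omega> x) x \<le> front \<omega> (tau \<omega> x)"
    and X_tau_ge: "left_lim (front \<omega>) (tau \<omega> x) \<le> X \<omega> (tau \<omega> x) x"
proof -
  let ?A = "{t. 0 \<le> t \<and> \<not> live \<omega> t x}"
  have bdd: "bdd_below ?A" by (auto intro: bdd_belowI[of _ 0])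
  have tA: "t \<in> ?A" using t by simp
  show le: "tau \<omega> x \<le> t" unfolding tau_def by (rule cInf_lower[OF tA bdd])
  have ge0: "0 \<le> tau \<omega> x" unfolding tau_def using tA by (intro cInf_greatest) auto
  have before: "live \<omega> u x" if "u < tau \<omega> x" for u
  proof (cases "0 \<le> u")
    case True
    show ?thesis
    proof (rule ccontr)
      assume "\<not> live \<omega> u x"
      then have "tau \<omega> x \<le> u" unfolding tau_def using True by (intro cInf_lower bdd) auto
      then show False using that by simp
    qed
  next
    case False then show ?thesis using live_0[of u \<omega> x] x by simp
  qed
  have dead: "\<not> live \<omega> (tau \<omega> x) x"
  proof
    assume l: "live \<omega> (tau \<omega> x) x"
    then have "eventually (\<lambda>u. live \<omega> u x) (at_right (tau \<omega> x))" using live_right[OF ge0, of \<omega> x] by simp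
    then obtain b where b: "tau \<omega> x < b" "\<And>u. tau \<omega> x < u \<Longrightarrow> u < b \<Longrightarrow> live \<omega> u x"
      unfolding eventually_at_right_field by blast
    have "b \<le> u" if "u \<in> ?A" for u
    proof (rule ccontr)
      assume "\<not> b \<le> u"
      moreover have "tau \<omega> x \<le> u" unfolding tau_def by (rule cInf_lower[OF that bdd])
      ultimately have "live \<omega> u x" using b(2)[of u] l by (cases "u = tau \<omega> x") auto
      then show False using that by simp
    qed
    then have "b \<le> tau \<omega> x" unfolding tau_def using tA by (intro cInf_greatest) auto
    then show False using b by simp
  qed
  show iff: "live \<omega> u x \<longleftrightarrow> u < tau \<omega> x" for u
    using before dead live_antimono[of "tau \<omega> x" u \<omega> x] by (meson not_le)
  have "live \<omega> 0 x" using live_0[of 0] x by simp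
  then show pos: "0 < tau \<omega> x" unfolding iff .
  have above: "front \<omega> u < X \<omega> u x" if "0 \<le> u" "u < tau \<omega> x" for u
    using live_iff[OF that(1), of \<omega> x] before[OF that(2)] that(1) by auto
  obtain r where r: "r \<in> {0..tau \<omega> x}" "\<not> front \<omega> r < X \<omega> r x"
    using dead live_iff[OF ge0, of \<omega> x] by blast
  with above[of r] have "r = tau \<omega> x" by force
  then show "X \<omega> (tau \<omega> x) x \<le> front \<omega> (tau \<omega> x)" using r by simp
  show "left_lim (front \<omega>) (tau \<omega> x) \<le> X \<omega> (tau \<omega> x) x"
  proof (rule tendsto_le[OF _ X_tendsto front_left_lim])
    have "eventually (\<lambda>u. 0 < u) (at_left (tau \<omega> x))" using pos by (auto simp: eventually_at_left_field intro!: exI[of _ 0])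
    moreover have "eventually (\<lambda>u. u < tau \<omega> x) (at_left (tau \<omega> x))" by (simp add: eventually_at_filter)
    ultimately show "eventually (\<lambda>u. front \<omega> u \<le> X \<omega> u x) (at_left (tau \<omega> x))"
      by eventually_elim (use above less_imp_le in auto)
  qed simp
qed

text \<open>Particles that start at or below \<open>s0\<close> are never alive and are excluded;
  they form a null set.\<close>

definition absorbed :: "'a \<Rightarrow> real \<Rightarrow> 'a \<times> real \<Rightarrow> bool" where
  "absorbed \<omega> t x \<longleftrightarrow> s0 < snd x \<and> \<not> live \<omega> t x"

lemma absorbed_Q [measurable]: "Measurable.pred Q (absorbed \<omega> t)"
proof -
  have [measurable]: "snd \<in> borel_measurable Q" unfolding Q_def by measurable
  show ?thesis unfolding absorbed_def by measurable
qed

lemma absorbed_tau: "absorbed \<omega> t x \<Longrightarrow> 0 \<le> t \<Longrightarrow> 0 \<le> u \<Longrightarrow> absorbed \<omega> u x \<longleftrightarrow> tau \<omega> x \<le> u"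
  using live_iff_tau[of x t \<omega> u] by (auto simp: absorbed_def)

lemma tau_measurable [measurable]: "0 \<le> t \<Longrightarrow> (\<lambda>x. if absorbed \<omega> t x then tau \<omega> x else 0) \<in> borel_measurable Q"
proof (rule borel_measurableI_le)
  fix y :: real assume t: "0 \<le> t"
  show "{x \<in> space Q. (if absorbed \<omega> t x then tau \<omega> x else 0) \<le> y} \<in> sets Q"
  proof (cases "0 \<le> y")
    case True
    have "{x \<in> space Q. (if absorbed \<omega> t x then tau \<omega> x else 0) \<le> y} = {x \<in> space Q. absorbed \<omega> t x \<longrightarrow> absorbed \<omega> y x}"
      using absorbed_tau[OF _ t True] True by auto
    also have "\<dots> \<in> sets Q" by measurable
    finally show ?thesis .
  next
    case False
    have "\<not> (if absorbed \<omega> t x then tau \<omega> x else 0) \<le> y" for x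
      using False t tau_pos[of x t \<omega>] by (auto simp: absorbed_def)
    then show ?thesis by simp
  qed
qed

lemma AE_start: "AE x in Q. s0 < snd x"
proof -
  have "s0 < x" if "v0 x < 0" for x using v0_zero[of x] that by (cases "x \<le> s0") auto
  then have "AE y in \<nu>. s0 < y"
    unfolding \<nu>_def by (subst AE_density) (auto intro!: AE_I2)
  then show ?thesis
    unfolding Q_def
  proof (intro M\<nu>.AE_pair_measure)
    show "{x \<in> space (M \<Otimes>\<^sub>M \<nu>). s0 < snd x} \<in> sets (M \<Otimes>\<^sub>M \<nu>)" by measurable
  qed (auto intro!: AE_I2)
qed

text \<open>The fixed-point equation read as mass balance: for fixed \<open>\<omega>'\<close> the
  dead starting points are those up to \<open>mx \<omega> \<omega>' t\<close>, and \<open>F\<close>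
  measures them.\<close>

lemma measure_absorbed: "0 \<le> t \<Longrightarrow> measure Q {x \<in> space Q. absorbed \<omega> t x} = lam * \<kappa> * (front \<omega> t - s0)"
proof -
  assume t: "0 \<le> t"
  have "measure Q {x \<in> space Q. absorbed \<omega> t x} = measure Q {x \<in> space Q. \<not> live \<omega> t x}"
    using AE_start by (intro measure_eq_AE) (auto simp: absorbed_def elim: eventually_mono)
  also have "\<dots> = (\<integral>x. indicator {x \<in> space Q. \<not> live \<omega> t x} x \<partial>Q)"
    by simp
  also have "\<dots> = (\<integral>\<omega>'. (\<integral>y. indicator {x \<in> space Q. \<not> live \<omega> t x} (\<omega>', y) \<partial>\<nu>) \<partial>M)"
    unfolding Q_def
    by (rule M\<nu>.integral_fst'[symmetric], fold Q_def) (auto simp: Q.emeasure_finite less_top[symmetric])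
  also have "\<dots> = (\<integral>\<omega>'. lam * \<kappa> * F (mx \<omega> \<omega>' t) \<partial>M)"
  proof (rule Bochner_Integration.integral_cong[OF refl])
    fix \<omega>' assume w: "\<omega>' \<in> space M"
    have "(\<integral>y. indicator {x \<in> space Q. \<not> live \<omega> t x} (\<omega>', y) \<partial>\<nu>) = (\<integral>y. indicator {..mx \<omega> \<omega>' t} y \<partial>\<nu>)"
      using w by (intro Bochner_Integration.integral_cong) (auto simp: indicator_def live_def space_Q)
    also have "\<dots> = lam * \<kappa> * F (mx \<omega> \<omega>' t)" using lam_pos kappa_pos by (simp add: F_def)
    finally show "(\<integral>y. indicator {x \<in> space Q. \<not> live \<omega> t x} (\<omega>', y) \<partial>\<nu>) = lam * \<kappa> * F (mx \<omega> \<omega>' t)" .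
  qed
  also have "\<dots> = lam * \<kappa> * (front \<omega> t - s0)" by (simp add: front_fixpoint[OF t, of \<omega>])
  finally show ?thesis .
qed

text \<open>On \<open>(0,t]\<close> the Stieltjes measure of the front, times
  \<open>lam * \<kappa>\<close>, is the law of the absorption time of the absorbed particles: by the
  mass balance both have the same distribution function.\<close>

lemma stieltjes_front:
  assumes t: "0 < t" and g [measurable]: "g \<in> borel_measurable borel"
  shows "lam * \<kappa> * stieltjes g (front \<omega>) t = (\<integral>x. (if absorbed \<omega> t x then g (tau \<omega> x) else 0) \<partial>Q)"
proof -
  let ?I = "interval_measure (front \<omega>)"
  define \<mu>1 where "\<mu>1 = density ?I (\<lambda>r. ennreal (lam * \<kappa> * indicator {0<..t} r))"
  define E where "E = {x \<in> space Q. absorbed \<omega> t x}"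
  define T where "T x = (if absorbed \<omega> t x then tau \<omega> x else 0)" for x
  define \<mu>2 where "\<mu>2 = distr (density Q (indicator E)) borel T"
  have E [measurable]: "E \<in> sets Q" unfolding E_def by measurable
  have T [measurable]: "T \<in> borel_measurable Q" unfolding T_def using t by (intro tau_measurable) simp
  have Ioc: "emeasure ?I {a<..b} = front \<omega> b - front \<omega> a" if "a \<le> b" for a b
    by (rule emeasure_interval_measure_Ioc[OF that])
      (use front_right_cont monoD[OF front_mono] in \<open>auto simp: continuous_within\<close>)
  have e1: "emeasure \<mu>1 A = ennreal (lam * \<kappa>) * emeasure ?I (A \<inter> {0<..t})" if [measurable]: "A \<in> sets borel" for A
  proof -
    have "emeasure \<mu>1 A = (\<integral>\<^sup>+r. ennreal (lam * \<kappa>) * indicator (A \<inter> {0<..t}) r \<partial>?I)"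
      unfolding \<mu>1_def using lk_pos
      by (subst emeasure_density) (auto intro!: nn_integral_cong simp: indicator_def)
    also have "\<dots> = ennreal (lam * \<kappa>) * emeasure ?I (A \<inter> {0<..t})"
      by (rule nn_integral_cmult_indicator) simp
    finally show ?thesis .
  qed
  have e2: "emeasure \<mu>2 A = emeasure Q {x \<in> space Q. absorbed \<omega> t x \<and> tau \<omega> x \<in> A}" if [measurable]: "A \<in> sets borel" for A
  proof -
    have "emeasure \<mu>2 A = (\<integral>\<^sup>+x. indicator E x * indicator (T -` A \<inter> space Q) x \<partial>Q)"
      unfolding \<mu>2_def by (subst emeasure_distr) (auto simp: emeasure_density)
    also have "\<dots> = (\<integral>\<^sup>+x. indicator (E \<inter> (T -` A \<inter> space Q)) x \<partial>Q)"
      by (intro nn_integral_cong) (auto simp: indicator_def)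
    also have "\<dots> = emeasure Q (E \<inter> (T -` A \<inter> space Q))" by simp
    also have "E \<inter> (T -` A \<inter> space Q) = {x \<in> space Q. absorbed \<omega> t x \<and> tau \<omega> x \<in> A}"
      by (auto simp: E_def T_def)
    finally show ?thesis .
  qed
  have "\<mu>1 = \<mu>2"
  proof (rule cdf_unique')
    show "finite_borel_measure \<mu>1"
    proof (intro finite_borel_measure.intro finite_borel_measure_axioms.intro finite_measureI)
      have "emeasure ?I {0<..t} = ennreal (front \<omega> t - front \<omega> 0)" using t by (intro Ioc) simp
      then have "emeasure \<mu>1 UNIV \<noteq> \<infinity>" using e1[of UNIV] by (simp add: ennreal_mult_eq_top_iff)
      then show "emeasure \<mu>1 (space \<mu>1) \<noteq> \<infinity>" by (simp add: \<mu>1_def)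
      show "sets \<mu>1 = sets borel" by (simp add: \<mu>1_def)
    qed
    show "finite_borel_measure \<mu>2"
    proof (intro finite_borel_measure.intro finite_borel_measure_axioms.intro finite_measureI)
      have "emeasure \<mu>2 UNIV \<noteq> \<infinity>" using e2[of UNIV] Q.emeasure_finite by simp
      then show "emeasure \<mu>2 (space \<mu>2) \<noteq> \<infinity>" by (simp add: \<mu>2_def)
      show "sets \<mu>2 = sets borel" by (simp add: \<mu>2_def)
    qed
    show "cdf \<mu>1 = cdf \<mu>2"
    proof
      fix y
      show "cdf \<mu>1 y = cdf \<mu>2 y"
      proof (cases "0 < y")
        case True
        let ?m = "min t y"
        have m: "0 < ?m" using True t by simp
        have "{..y} \<inter> {0<..t} = {0<..?m}" by auto
        then have "emeasure \<mu>1 {..y} = ennreal (lam * \<kappa>) * ennreal (front \<omega> ?m - s0)"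
          using e1[of "{..y}"] Ioc[of 0 ?m] m by (simp add: front_0)
        also have "\<dots> = ennreal (lam * \<kappa> * (front \<omega> ?m - s0))"
          using lk_pos front_bounds(1)[of \<omega> ?m] by (simp add: ennreal_mult)
        also have "\<dots> = emeasure Q {x \<in> space Q. absorbed \<omega> ?m x}"
          using measure_absorbed[of ?m \<omega>] m by (simp add: Q.emeasure_eq_measure)
        also have "{x \<in> space Q. absorbed \<omega> ?m x} = {x \<in> space Q. absorbed \<omega> t x \<and> tau \<omega> x \<in> {..y}}"
        proof -
          have "absorbed \<omega> ?m x \<longleftrightarrow> absorbed \<omega> t x \<and> tau \<omega> x \<le> y" for x
          proof -
            have "absorbed \<omega> ?m x \<Longrightarrow> absorbed \<omega> t x"
              using live_antimono[of ?m t \<omega> x] by (auto simp: absorbed_def)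
            moreover have "absorbed \<omega> t x \<Longrightarrow> tau \<omega> x \<le> t"
              using absorbed_tau[of \<omega> t x t] t by auto
            ultimately show ?thesis using absorbed_tau[of \<omega> t x ?m] t m by auto
          qed
          then show ?thesis by auto
        qed
        also have "emeasure Q \<dots> = emeasure \<mu>2 {..y}" using e2[of "{..y}"] by simp
        finally show ?thesis by (simp add: cdf_def measure_def)
      next
        case False
        then have "{..y} \<inter> {0<..t} = {}" by auto
        then have "emeasure \<mu>1 {..y} = 0" using e1[of "{..y}"] by simp
        moreover have "{x \<in> space Q. absorbed \<omega> t x \<and> tau \<omega> x \<in> {..y}} = {}"
          using False tau_pos[of _ t \<omega>] t by (force simp: absorbed_def)
        then have "emeasure \<mu>2 {..y} = 0" by (subst e2) (auto simp only: emeasure_empty intro!: atMost_borel)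
        ultimately show ?thesis by (simp add: cdf_def measure_def)
      qed
    qed
  qed
  \<comment> \<open>The front is constant before time \<open>0\<close>, so the extension used by
    \<open>stieltjes\<close> is the front itself.\<close>
  have "(\<lambda>r. front \<omega> (max 0 r)) = front \<omega>"
    using front_neg[of _ \<omega>] front_0[of \<omega>] by (auto simp: max_def)
  then have "lam * \<kappa> * stieltjes g (front \<omega>) t = (\<integral>r. (lam * \<kappa> * indicator {0<..t} r) *\<^sub>R g r \<partial>?I)"
    unfolding stieltjes_def set_lebesgue_integral_def by (simp add: mult.assoc)
  also have "\<dots> = (\<integral>r. g r \<partial>\<mu>1)"
    unfolding \<mu>1_def using lk_pos by (intro integral_density[symmetric]) auto
  also have "\<dots> = (\<integral>x. g (T x) \<partial>density Q (indicator E))"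
    unfolding \<open>\<mu>1 = \<mu>2\<close> \<mu>2_def by (rule integral_distr) auto
  also have "\<dots> = (\<integral>x. g (T x) \<partial>density Q (\<lambda>x. ennreal (indicator E x)))"
    by (simp add: ennreal_indicator)
  also have "\<dots> = (\<integral>x. indicator E x *\<^sub>R g (T x) \<partial>Q)"
    by (rule integral_density) auto
  also have "\<dots> = (\<integral>x. (if absorbed \<omega> t x then g (tau \<omega> x) else 0) \<partial>Q)"
    by (intro Bochner_Integration.integral_cong) (auto simp: E_def T_def indicator_def)
  finally show ?thesis .
qed

end

text \<open>Test functions are controlled only from time \<open>0\<close> on; clamping the time
  gives a function continuous on the whole plane, which can be composed with measurable
  functions.\<close>

lemma continuous_clamped:
  fixes \<psi> :: "real \<Rightarrow> real \<Rightarrow> real"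
  assumes "continuous_on ({0..} \<times> UNIV) (\<lambda>(r, x). \<psi> r x)"
  shows "continuous_on UNIV (\<lambda>z. \<psi> (max 0 (fst z)) (snd z))"
proof -
  have "continuous_on UNIV (\<lambda>z :: real \<times> real. (\<lambda>(r, x). \<psi> r x) (max 0 (fst z), snd z))"
    by (rule continuous_on_compose2[OF assms]) (auto intro!: continuous_intros)
  then show ?thesis by simp
qed

lemma measurable_clamped:
  fixes \<psi> :: "real \<Rightarrow> real \<Rightarrow> real" and f g :: "'b \<Rightarrow> real"
  assumes "continuous_on ({0..} \<times> UNIV) (\<lambda>(r, x). \<psi> r x)"
    and f: "f \<in> borel_measurable N" and g: "g \<in> borel_measurable N"
  shows "(\<lambda>x. \<psi> (max 0 (f x)) (g x)) \<in> borel_measurable N"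
  using measurable_compose[OF borel_measurable_Pair[OF f g]
      borel_measurable_continuous_onI[OF continuous_clamped[OF assms(1)]]] by simp

context stefan
begin

lemma X_joint:
  assumes "0 \<le> t"
  shows "(\<lambda>(r, x). X \<omega> r x) \<in> borel_measurable (restrict_space borel {0..t} \<Otimes>\<^sub>M Q)"
  by (rule right_continuous_jointly_measurable[OF assms]) (auto intro: X_tendsto)

lemma X_at_measurable:
  assumes t: "0 \<le> t" and T: "T \<in> borel_measurable Q" and r: "\<And>x. T x \<in> {0..t}"
  shows "(\<lambda>x. X \<omega> (T x) x) \<in> borel_measurable Q"
proof -
  have "(\<lambda>x. (T x, x)) \<in> measurable Q (restrict_space borel {0..t} \<Otimes>\<^sub>M Q)"
    using T r by (intro measurable_Pair measurable_restrict_space2) auto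
  from measurable_compose[OF this X_joint[OF t]] show ?thesis by simp
qed

text \<open>The earlier of \<open>t\<close> and the absorption time. The value \<open>0\<close> for
  particles that start at or below \<open>s0\<close> is a default that keeps the time in
  \<open>[0,t]\<close>.\<close>

definition stop :: "'a \<Rightarrow> real \<Rightarrow> 'a \<times> real \<Rightarrow> real" where
  "stop \<omega> t x = (if live \<omega> t x then t else if absorbed \<omega> t x then tau \<omega> x else 0)"

lemma stop_range: "0 \<le> t \<Longrightarrow> stop \<omega> t x \<in> {0..t}"
  using tau_pos[of x t \<omega>] tau_le[of x t \<omega>] by (auto simp: stop_def absorbed_def)

lemma stop_measurable [measurable]:
  assumes "0 \<le> t" shows "stop \<omega> t \<in> borel_measurable Q"
proof -
  have "stop \<omega> t = (\<lambda>x. if live \<omega> t x then t else (if absorbed \<omega> t x then tau \<omega> x else 0))"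
    by (auto simp: stop_def)
  also have "\<dots> \<in> borel_measurable Q"
    using tau_measurable[OF assms] by measurable
  finally show ?thesis .
qed

lemma left_lim_front_measurable [measurable]: "left_lim (front \<omega>) \<in> borel_measurable borel"
proof (rule borel_measurable_mono)
  show "mono (left_lim (front \<omega>))"
  proof
    fix x y :: real assume xy: "x \<le> y"
    show "left_lim (front \<omega>) x \<le> left_lim (front \<omega>) y"
    proof (cases "x = y")
      case False
      then have "x < y" using xy by simp
      have "left_lim (front \<omega>) x \<le> front \<omega> x" by (rule left_lim_front_le)
      also have "front \<omega> x \<le> left_lim (front \<omega>) y"
      proof (rule tendsto_lowerbound[OF front_left_lim])
        show "eventually (\<lambda>u. front \<omega> x \<le> front \<omega> u) (at_left y)"
          unfolding eventually_at_left_field using \<open>x < y\<close> monoD[OF front_mono, of x]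
          by (intro exI[of _ x]) auto
      qed simp
      finally show ?thesis .
    qed simp
  qed
qed

text \<open>The space-time generator of the particle: its quadratic variation grows at rate
  \<open>2 * \<kappa>\<close>, hence the coefficient \<open>\<kappa>\<close>.\<close>

definition gen :: "(real \<Rightarrow> real \<Rightarrow> real) \<Rightarrow> real \<Rightarrow> real \<Rightarrow> real" where
  "gen \<phi> r x = d_t \<phi> r x + \<kappa> * d_xx \<phi> r x"

text \<open>Given \<open>\<omega>\<close>, this is the martingale part \<open>\<integral>\<^sub>0\<^sup>t \<partial>\<^sub>x\<phi> dX\<close> of the absorbed particle.\<close>

definition N :: "(real \<Rightarrow> real \<Rightarrow> real) \<Rightarrow> real \<Rightarrow> 'a \<Rightarrow> 'a \<times> real \<Rightarrow> real" where
  "N \<phi> t \<omega> x = (if s0 < snd x then \<phi> (stop \<omega> t x) (X \<omega> (stop \<omega> t x) x) - \<phi> 0 (snd x) else 0)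
     - (LINT r:{0..t}|lborel. if live \<omega> r x then gen \<phi> r (X \<omega> r x) else 0)"

text \<open>The density vanishes up to the front, so restricting the integral to the half-line
  beyond it changes nothing.\<close>

lemma front_set_integral:
  assumes "\<psi> \<in> borel_measurable borel" and "\<And>x. \<bar>\<psi> x\<bar> \<le> c" and t: "0 \<le> t"
  shows "set_integrable lborel {front \<omega> t..} (\<lambda>x. v \<omega> t x * \<psi> x)"
    and "(LINT x:{front \<omega> t..}|lborel. v \<omega> t x * \<psi> x) = - (\<integral>x. (if live \<omega> t x then \<psi> (X \<omega> t x) else 0) \<partial>Q)"
proof -
  have e: "(\<lambda>x. indicator {front \<omega> t..} x *\<^sub>R (v \<omega> t x * \<psi> x)) = (\<lambda>x. v \<omega> t x * \<psi> x)"
  proof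
    fix x show "indicator {front \<omega> t..} x *\<^sub>R (v \<omega> t x * \<psi> x) = v \<omega> t x * \<psi> x"
      using v_zero[OF t, of x \<omega>] by (cases "front \<omega> t \<le> x") (auto simp: indicator_def)
  qed
  show "set_integrable lborel {front \<omega> t..} (\<lambda>x. v \<omega> t x * \<psi> x)"
    unfolding set_integrable_def e by (rule integrable_v[OF assms(1,2)])
  show "(LINT x:{front \<omega> t..}|lborel. v \<omega> t x * \<psi> x) = - (\<integral>x. (if live \<omega> t x then \<psi> (X \<omega> t x) else 0) \<partial>Q)"
    unfolding set_lebesgue_integral_def e by (rule integral_v[OF assms(1,2)])
qed

lemma live_joint:
  assumes \<psi>: "continuous_on ({0..} \<times> UNIV) (\<lambda>(r, x). \<psi> r x)" and t: "0 \<le> t"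
  shows "(\<lambda>(r, x). if live \<omega> r x then \<psi> r (X \<omega> r x) else 0 :: real) \<in> borel_measurable (restrict_space borel {0..t} \<Otimes>\<^sub>M Q)"
proof (rule right_continuous_jointly_measurable[OF t])
  fix r assume "r \<in> {0..t}"
  then have [measurable]: "\<psi> r \<in> borel_measurable borel" by (intro measurable_section[OF \<psi>]) auto
  show "(\<lambda>x. if live \<omega> r x then \<psi> r (X \<omega> r x) else 0) \<in> borel_measurable Q" by measurable
next
  fix x and r :: real assume r: "0 \<le> r"
  have "((\<lambda>u. (\<lambda>(r, x). \<psi> r x) (u, X \<omega> u x)) \<longlongrightarrow> (\<lambda>(r, x). \<psi> r x) (r, X \<omega> r x)) (at_right r)"
  proof (rule continuous_on_tendsto_compose[OF \<psi>])
    show "((\<lambda>u. (u, X \<omega> u x)) \<longlongrightarrow> (r, X \<omega> r x)) (at_right r)"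
      by (intro tendsto_Pair X_tendsto tendsto_ident_at)
    show "eventually (\<lambda>u. (u, X \<omega> u x) \<in> {0..} \<times> UNIV) (at_right r)"
      using r by (auto simp: eventually_at_filter)
  qed (use r in auto)
  then have "((\<lambda>u. if live \<omega> r x then \<psi> u (X \<omega> u x) else 0) \<longlongrightarrow> (if live \<omega> r x then \<psi> r (X \<omega> r x) else 0)) (at_right r)"
    by auto
  then show "((\<lambda>u. if live \<omega> u x then \<psi> u (X \<omega> u x) else 0) \<longlongrightarrow> (if live \<omega> r x then \<psi> r (X \<omega> r x) else 0)) (at_right r)"
    by (rule Lim_transform_eventually) (use live_right[OF r, of \<omega> x] in \<open>auto elim!: eventually_mono\<close>)
qed

text \<open>Fubini's theorem on \<open>[0,t]\<close> times \<open>Q\<close>; joint measurability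
  comes from right continuity in time.\<close>

lemma drift_integral:
  assumes \<psi>: "continuous_on ({0..} \<times> UNIV) (\<lambda>(r, x). \<psi> r x)" "\<And>r x. 0 \<le> r \<Longrightarrow> \<bar>\<psi> r x\<bar> \<le> c" and t: "0 \<le> t"
  shows "set_integrable lborel {0..t} (\<lambda>r. LINT x:{front \<omega> r..}|lborel. v \<omega> r x * \<psi> r x)" (is ?A)
    and "(LINT r:{0..t}|lborel. (LINT x:{front \<omega> r..}|lborel. v \<omega> r x * \<psi> r x)) =
      - (\<integral>x. (LINT r:{0..t}|lborel. if live \<omega> r x then \<psi> r (X \<omega> r x) else 0) \<partial>Q)" (is ?B)
    and "integrable Q (\<lambda>x. LINT r:{0..t}|lborel. if live \<omega> r x then \<psi> r (X \<omega> r x) else 0)" (is ?C)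
proof -
  let ?L = "restrict_space lborel {0..t}"
  have fin: "finite_measure ?L" by (intro finite_measureI) (simp add: emeasure_restrict_space space_restrict_space emeasure_lborel_Icc_eq)
  interpret L: finite_measure ?L by (rule fin)
  interpret P: pair_sigma_finite ?L Q ..
  interpret LQ: finite_measure "?L \<Otimes>\<^sub>M Q" by (intro finite_measure_pair_measure fin Q.finite_measure_axioms)
  define f where "f r x = (if live \<omega> r x then \<psi> r (X \<omega> r x) else 0)" for r x
  have fm: "case_prod f \<in> borel_measurable (?L \<Otimes>\<^sub>M Q)"
    using live_joint[OF \<psi>(1) t, of \<omega>] unfolding f_def
    by (simp cong: measurable_cong_sets add: sets_pair_measure_cong[OF sets_restrict_space_cong[OF sets_lborel] refl])
  have c0: "0 \<le> c" using \<psi>(2)[of 0 0] by simp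
  have fi: "integrable (?L \<Otimes>\<^sub>M Q) (case_prod f)"
    using c0 by (intro LQ.integrable_const_bound[of _ c] fm AE_I2)
      (auto simp: f_def space_pair_measure space_restrict_space intro!: \<psi>(2))
  have inner: "(LINT x:{front \<omega> r..}|lborel. v \<omega> r x * \<psi> r x) = - (\<integral>x. f r x \<partial>Q)" if "r \<in> {0..t}" for r
    unfolding f_def using that by (intro front_set_integral(2)[where c=c] measurable_section[OF \<psi>(1)] \<psi>(2)) auto
  have S: "{0..t} \<inter> space lborel \<in> sets lborel" by simp
  have "integrable ?L (\<lambda>r. - (\<integral>x. f r x \<partial>Q))" using P.integrable_fst'[OF fi] by simp
  then have "integrable ?L (\<lambda>r. LINT x:{front \<omega> r..}|lborel. v \<omega> r x * \<psi> r x)"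
    by (rule Bochner_Integration.integrable_cong[THEN iffD1, rotated 2]) (auto simp: inner space_restrict_space)
  then show ?A unfolding set_integrable_def integrable_restrict_space[OF S] .
  have "(LINT r:{0..t}|lborel. (LINT x:{front \<omega> r..}|lborel. v \<omega> r x * \<psi> r x)) =
      (\<integral>r. (LINT x:{front \<omega> r..}|lborel. v \<omega> r x * \<psi> r x) \<partial>?L)"
    unfolding set_lebesgue_integral_def[of lborel "{0..t}"] integral_restrict_space[OF S] ..
  also have "\<dots> = (\<integral>r. - (\<integral>x. f r x \<partial>Q) \<partial>?L)"
    by (intro Bochner_Integration.integral_cong) (auto simp: inner space_restrict_space)
  also have "\<dots> = - (\<integral>x. (\<integral>r. f r x \<partial>?L) \<partial>Q)"
    using P.Fubini_integral[OF fi] by simp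
  also have "(\<integral>x. (\<integral>r. f r x \<partial>?L) \<partial>Q) = (\<integral>x. (LINT r:{0..t}|lborel. f r x) \<partial>Q)"
    unfolding set_lebesgue_integral_def integral_restrict_space[OF S] ..
  finally show ?B unfolding f_def .
  have "integrable Q (\<lambda>x. \<integral>r. f r x \<partial>?L)" using P.integrable_snd[OF fi] .
  then show ?C unfolding set_lebesgue_integral_def integral_restrict_space[OF S] f_def .
qed

text \<open>\<open>left_lim_L1\<close> is an arbitrary choice among the possible limits. The density
  of the particles alive at all times before \<open>r\<close> is such a limit, and limits tested
  against bounded continuous functions are unique almost everywhere.\<close>

lemma left_lim_v:
  "integrable lborel (left_lim_L1 (v \<omega>) r)"
  "AE x in lborel. left_lim_L1 (v \<omega>) r x = dens (noise r \<omega>) {x \<in> space Q. \<forall>u<r. live \<omega> u x} x"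
proof -
  let ?A = "{x \<in> space Q. \<forall>u<r. live \<omega> u x}"
  let ?g = "dens (noise r \<omega>) ?A"
  let ?P = "\<lambda>g. integrable lborel g \<and>
     (\<forall>\<psi>\<in>bcontfun. ((\<lambda>q. LINT x|lborel. v \<omega> q x * \<psi> x) \<longlongrightarrow> (LINT x|lborel. g x * \<psi> x)) (at_left r))"
  have A: "?A \<in> sets Q" by measurable
  have g: "?P ?g"
  proof (intro conjI ballI)
    show "integrable lborel ?g" using integrable_dens[OF noise_M A, of "\<lambda>_. 1" 1] by simp
    fix \<psi> :: "real \<Rightarrow> real" assume "\<psi> \<in> bcontfun"
    then obtain c where \<psi>: "continuous_on UNIV \<psi>" "\<psi> \<in> borel_measurable borel" "\<And>x. \<bar>\<psi> x\<bar> \<le> c"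
      using bcontfun_bound by blast
    have "(\<integral>x. ?g x * \<psi> x \<partial>lborel) = - (\<integral>x. (if \<forall>u<r. live \<omega> u x then \<psi> (X \<omega> r x) else 0) \<partial>Q)"
      unfolding integral_dens[OF noise_M A \<psi>(2,3)]
      by (intro arg_cong[where f=uminus] Bochner_Integration.integral_cong) (auto simp: X_def)
    then show "((\<lambda>q. LINT x|lborel. v \<omega> q x * \<psi> x) \<longlongrightarrow> (LINT x|lborel. ?g x * \<psi> x)) (at_left r)"
      unfolding integral_v[OF \<psi>(2,3)] by (simp only:) (rule tendsto_minus[OF pairing_left[OF \<psi>(1,3)]])
  qed
  then have l: "?P (left_lim_L1 (v \<omega>) r)"
    unfolding left_lim_L1_def by (rule someI[of ?P])
  then show "integrable lborel (left_lim_L1 (v \<omega>) r)" by blast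
  show "AE x in lborel. left_lim_L1 (v \<omega>) r x = ?g x"
  proof (rule AE_eq_of_bcontfun_pairing)
    fix \<psi> :: "real \<Rightarrow> real" assume "\<psi> \<in> bcontfun"
    then show "(LINT x|lborel. left_lim_L1 (v \<omega>) r x * \<psi> x) = (LINT x|lborel. ?g x * \<psi> x)"
      using l g by (blast intro: tendsto_unique[OF trivial_limit_at_left_real])
  qed (use l g in blast)+
qed

text \<open>Identifies the particles counted by the jump term at time \<open>r\<close> with those
  whose absorption time is \<open>r\<close>.\<close>

lemma absorbed_at_iff:
  assumes r: "0 < r"
  shows "(\<forall>u<r. live \<omega> u x) \<and> left_lim (front \<omega>) r \<le> X \<omega> r x \<and> X \<omega> r x \<le> front \<omega> r \<longleftrightarrow>
    absorbed \<omega> r x \<and> tau \<omega> x = r"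
proof safe
  assume l: "\<forall>u<r. live \<omega> u x" and "X \<omega> r x \<le> front \<omega> r"
  then have dead: "\<not> live \<omega> r x" using live_iff[of r \<omega> x] r by (auto simp: not_less)
  have s: "s0 < snd x" using l live_s0 r by blast
  show "absorbed \<omega> r x" using dead s by (simp add: absorbed_def)
  note iff = live_iff_tau[OF s less_imp_le[OF r] dead]
  have "tau \<omega> x \<le> r" using dead iff by auto
  moreover have "r \<le> tau \<omega> x"
  proof (rule ccontr)
    assume "\<not> r \<le> tau \<omega> x"
    then have "live \<omega> (tau \<omega> x) x" using l by auto
    then show False unfolding iff by simp
  qed
  ultimately show "tau \<omega> x = r" by simp
next
  assume "absorbed \<omega> (tau \<omega> x) x" "r = tau \<omega> x"
  then have a: "s0 < snd x" "0 \<le> tau \<omega> x" "\<not> live \<omega> (tau \<omega> x) x" using r by (auto simp: absorbed_def)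
  show "live \<omega> u x" if "u < tau \<omega> x" for u using that live_iff_tau[OF a] by blast
  show "left_lim (front \<omega>) (tau \<omega> x) \<le> X \<omega> (tau \<omega> x) x" "X \<omega> (tau \<omega> x) x \<le> front \<omega> (tau \<omega> x)"
    by (rule X_tau_ge[OF a], rule X_tau_le[OF a])
qed

lemma jump_term:
  assumes r: "0 < r" and \<psi> [measurable]: "\<psi> \<in> borel_measurable borel" and c: "\<And>x. \<bar>\<psi> x\<bar> \<le> c"
  shows "(LINT x:{left_lim (front \<omega>) r..front \<omega> r}|lborel. left_lim_L1 (v \<omega>) r x * \<psi> x) =
    - (\<integral>x. (if absorbed \<omega> r x \<and> tau \<omega> x = r then \<psi> (X \<omega> r x) else 0) \<partial>Q)"
proof -
  let ?A = "{x \<in> space Q. \<forall>u<r. live \<omega> u x}"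
  let ?S = "{left_lim (front \<omega>) r..front \<omega> r}"
  have A: "?A \<in> sets Q" by measurable
  have c0: "0 \<le> c" using c[of 0] by simp
  have c': "\<bar>indicator ?S x * \<psi> x\<bar> \<le> c" for x using c c0 by (auto simp: indicator_def)
  have "(LINT x:?S|lborel. left_lim_L1 (v \<omega>) r x * \<psi> x) =
     (\<integral>x. dens (noise r \<omega>) ?A x * (indicator ?S x * \<psi> x) \<partial>lborel)"
    unfolding set_lebesgue_integral_def
    using left_lim_v[of \<omega> r] dens_measurable[OF noise_M A]
    by (intro integral_cong_AE) (auto elim!: eventually_mono)
  also have "\<dots> = - (\<integral>x. indicator ?A x * (indicator ?S (snd x + noise r \<omega> (fst x)) * \<psi> (snd x + noise r \<omega> (fst x))) \<partial>Q)"
    by (rule integral_dens[OF noise_M A _ c']) measurable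
  also have "\<dots> = - (\<integral>x. (if absorbed \<omega> r x \<and> tau \<omega> x = r then \<psi> (X \<omega> r x) else 0) \<partial>Q)"
    unfolding absorbed_at_iff[OF r, symmetric]
    by (intro arg_cong[where f=uminus] Bochner_Integration.integral_cong) (auto simp: X_def indicator_def)
  finally show ?thesis .
qed

text \<open>Absorption at a time where the front is continuous happens at the front itself, and
  there the integrand vanishes. So only the countably many jump times matter, and the sum over them
  is exchanged with the integral over particles by Fubini's theorem for a counting measure.\<close>

lemma jump_sum:
  assumes t: "0 < t" and \<phi>: "continuous_on ({0..} \<times> UNIV) (\<lambda>(r, x). \<phi> r x)" "\<And>r x. 0 \<le> r \<Longrightarrow> \<bar>\<phi> r x\<bar> \<le> c"
  shows "(\<Sum>\<^sub>\<infinity>r\<in>{0<..t}. LINT x:{left_lim (front \<omega>) r..front \<omega> r}|lborel.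
            left_lim_L1 (v \<omega>) r x * (\<phi> r (left_lim (front \<omega>) r) - \<phi> r x)) =
    - (\<integral>x. (if absorbed \<omega> t x then \<phi> (tau \<omega> x) (left_lim (front \<omega>) (tau \<omega> x)) - \<phi> (tau \<omega> x) (X \<omega> (tau \<omega> x) x) else 0) \<partial>Q)"
    (is "infsum ?a _ = - (\<integral>x. ?h x \<partial>Q)")
proof -
  \<comment> \<open>The jump times; a monotone path has only countably many.\<close>
  define D where "D = {r \<in> {0<..t}. left_lim (front \<omega>) r < front \<omega> r}"
  have "D \<subseteq> {a. \<not> isCont (front \<omega>) a}"
  proof (safe)
    fix r assume "r \<in> D" "isCont (front \<omega>) r"
    have "(front \<omega> \<longlongrightarrow> front \<omega> r) (at_left r)"
      using \<open>isCont (front \<omega>) r\<close> unfolding isCont_def by (rule tendsto_within_subset) simp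
    then show False using left_lim_eqI \<open>r \<in> D\<close> by (auto simp: D_def)
  qed
  then have cD: "countable D" using mono_ctble_discont[OF front_mono] countable_subset by blast
  interpret CD: sigma_finite_measure "count_space D" by (rule sigma_finite_measure_count_space_countable[OF cD])
  interpret P: pair_sigma_finite Q "count_space D" ..
  define h where "h x = ?h x" for x
  define T where "T x = (if absorbed \<omega> t x then tau \<omega> x else 0)" for x
  have T [measurable]: "T \<in> borel_measurable Q" unfolding T_def using t by (intro tau_measurable) simp
  have Tr: "T x \<in> {0..t}" for x
    using tau_pos[of x t \<omega>] tau_le[of x t \<omega>] t by (auto simp: T_def absorbed_def)
  have [measurable]: "(\<lambda>x. \<phi> (max 0 (T x)) (left_lim (front \<omega>) (T x))) \<in> borel_measurable Q"
    by (intro measurable_clamped[OF \<phi>(1)]) measurable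
  have [measurable]: "(\<lambda>x. \<phi> (max 0 (T x)) (X \<omega> (T x) x)) \<in> borel_measurable Q"
    using t Tr by (intro measurable_clamped[OF \<phi>(1)] X_at_measurable[of t]) auto
  have h_eq: "h x = (if absorbed \<omega> t x then \<phi> (max 0 (T x)) (left_lim (front \<omega>) (T x)) - \<phi> (max 0 (T x)) (X \<omega> (T x) x) else 0)" for x
    using Tr[of x] by (auto simp: h_def T_def)
  have h_m [measurable]: "h \<in> borel_measurable Q" unfolding h_eq by measurable
  have h_b: "\<bar>h x\<bar> \<le> 2 * c" for x
  proof -
    have "\<bar>\<phi> (max 0 (T x)) y\<bar> \<le> c" for y by (rule \<phi>(2)) simp
    then show ?thesis unfolding h_eq using abs_triangle_ineq4 order_trans[OF abs_ge_zero \<phi>(2)[of 0 0]]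
      by (smt (verit))
  qed
  have h_D: "h x = 0" if "T x \<notin> D" for x
  proof (cases "absorbed \<omega> t x")
    case True
    then have a: "s0 < snd x" "0 \<le> t" "\<not> live \<omega> t x" using t by (auto simp: absorbed_def)
    have "T x = tau \<omega> x" using True by (simp add: T_def)
    then have "left_lim (front \<omega>) (tau \<omega> x) = front \<omega> (tau \<omega> x)"
      using that left_lim_front_le[of \<omega> "tau \<omega> x"] tau_pos[OF a] tau_le[OF a] by (auto simp: D_def)
    then have "X \<omega> (tau \<omega> x) x = left_lim (front \<omega>) (tau \<omega> x)" using X_tau_ge[OF a] X_tau_le[OF a] by simp
    then show ?thesis by (simp add: h_def)
  qed (simp add: h_def)
  have summand: "?a r = - (\<integral>x. (if T x = r then h x else 0) \<partial>Q)" if r: "r \<in> {0<..t}" for r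
  proof -
    have r0: "0 < r" using r by simp
    have [measurable]: "\<phi> r \<in> borel_measurable borel" using r0 by (intro measurable_section[OF \<phi>(1)]) auto
    have "\<bar>\<phi> r (left_lim (front \<omega>) r) - \<phi> r x\<bar> \<le> 2 * c" for x
      using \<phi>(2)[of r "left_lim (front \<omega>) r"] \<phi>(2)[of r x] r0 by linarith
    then have "?a r = - (\<integral>x. (if absorbed \<omega> r x \<and> tau \<omega> x = r then \<phi> r (left_lim (front \<omega>) r) - \<phi> r (X \<omega> r x) else 0) \<partial>Q)"
      by (intro jump_term[OF r0]) auto
    also have "(\<lambda>x. if absorbed \<omega> r x \<and> tau \<omega> x = r then \<phi> r (left_lim (front \<omega>) r) - \<phi> r (X \<omega> r x) else 0) =
      (\<lambda>x. if T x = r then h x else 0)"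
    proof
      fix x
      have "absorbed \<omega> r x \<and> tau \<omega> x = r \<longleftrightarrow> absorbed \<omega> t x \<and> tau \<omega> x = r"
        using r live_antimono[of r t \<omega> x] absorbed_tau[of \<omega> t x r] by (auto simp: absorbed_def)
      then show "(if absorbed \<omega> r x \<and> tau \<omega> x = r then \<phi> r (left_lim (front \<omega>) r) - \<phi> r (X \<omega> r x) else 0) =
        (if T x = r then h x else 0)"
        using r0 by (auto simp: h_def T_def)
    qed
    finally show ?thesis .
  qed
  have [measurable]: "(\<lambda>(x, r). if T x = r then h x else 0) \<in> borel_measurable (Q \<Otimes>\<^sub>M count_space D)"
  proof -
    have [measurable]: "(\<lambda>z. snd z) \<in> borel_measurable (Q \<Otimes>\<^sub>M count_space D)"
      by (rule measurable_snd'') simp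
    show ?thesis unfolding split_beta by measurable
  qed
  have single: "(\<lambda>r. if T x = r then h x else 0) = (\<lambda>r. h x * indicator {T x} r)" for x
    by (auto simp: indicator_def)
  \<comment> \<open>For a fixed particle only the single time \<open>T x\<close> can contribute; if
    it is not a jump time, then \<open>h x = 0\<close>.\<close>
  have int_D: "(\<integral>r. (if T x = r then h x else 0) \<partial>count_space D) = h x"
    "integrable (count_space D) (\<lambda>r. if T x = r then h x else 0)"
    "(\<integral>r. \<bar>if T x = r then h x else 0\<bar> \<partial>count_space D) = \<bar>h x\<bar>" for x
  proof -
    have ind: "integrable (count_space D) (indicator {T x} :: _ \<Rightarrow> real)"
      "(\<integral>r. indicator {T x} r \<partial>count_space D) = (if T x \<in> D then 1 else 0 :: real)"
    proof -
      have "emeasure (count_space D) ({T x} \<inter> D) < \<infinity>" by (subst emeasure_count_space_finite) (auto simp: of_nat_less_top)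
      then show "integrable (count_space D) (indicator {T x} :: _ \<Rightarrow> real)"
        by (simp add: integrable_indicator_iff)
      have "(\<integral>r. indicator {T x} r \<partial>count_space D) = measure (count_space D) ({T x} \<inter> D)"
        by (simp add: Int_commute)
      also have "\<dots> = (if T x \<in> D then 1 else 0)" by (auto simp: measure_count_space)
      finally show "(\<integral>r. indicator {T x} r \<partial>count_space D) = (if T x \<in> D then 1 else 0 :: real)" .
    qed
    show "(\<integral>r. (if T x = r then h x else 0) \<partial>count_space D) = h x"
      unfolding single using ind h_D[of x] by auto
    show "integrable (count_space D) (\<lambda>r. if T x = r then h x else 0)"
      unfolding single using ind by auto
    have "(\<lambda>r. \<bar>if T x = r then h x else 0\<bar>) = (\<lambda>r. \<bar>h x\<bar> * indicator {T x} r)" by (auto simp: indicator_def)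
    then show "(\<integral>r. \<bar>if T x = r then h x else 0\<bar> \<partial>count_space D) = \<bar>h x\<bar>"
      using ind h_D[of x] by auto
  qed
  have int: "integrable (Q \<Otimes>\<^sub>M count_space D) (\<lambda>(x, r). if T x = r then h x else 0)"
  proof (rule P.Fubini_integrable)
    show "integrable Q (\<lambda>x. \<integral>y. norm (case (x, y) of (x, r) \<Rightarrow> if T x = r then h x else 0) \<partial>count_space D)"
      using h_b by (simp add: int_D) (intro Q.integrable_const_bound[of _ "2 * c"], auto)
  qed (use int_D in auto)
  have "infsum ?a {0<..t} = infsum (\<lambda>r. - (\<integral>x. (if T x = r then h x else 0) \<partial>Q)) D"
  proof (rule infsum_cong_neutral)
    fix r assume "r \<in> {0<..t} - D"
    then have "(if T x = r then h x else 0) = 0" for x using h_D[of x] by auto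
    then show "?a r = 0" using summand[of r] \<open>r \<in> {0<..t} - D\<close> by simp
  qed (auto simp: summand D_def)
  also have "\<dots> = infsetsum (\<lambda>r. - (\<integral>x. (if T x = r then h x else 0) \<partial>Q)) D"
  proof (rule infsetsum_infsum[symmetric])
    have "integrable (count_space D) (\<lambda>r. \<integral>x. (if T x = r then h x else 0) \<partial>Q)"
      by (rule P.integrable_snd[OF int])
    then show "Infinite_Set_Sum.abs_summable_on (\<lambda>r. - (\<integral>x. (if T x = r then h x else 0) \<partial>Q)) D"
      by (simp add: Infinite_Set_Sum.abs_summable_on_def)
  qed
  also have "\<dots> = - (\<integral>r. (\<integral>x. (if T x = r then h x else 0) \<partial>Q) \<partial>count_space D)"
    by (simp add: infsetsum_def)
  also have "\<dots> = - (\<integral>x. (\<integral>r. (if T x = r then h x else 0) \<partial>count_space D) \<partial>Q)"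
    using P.Fubini_integral[OF int] by simp
  also have "\<dots> = - (\<integral>x. h x \<partial>Q)" by (simp add: int_D)
  finally show ?thesis unfolding h_def .
qed

section \<open>The weak formulation, path by path\<close>

lemma C12b_gen:
  assumes "\<phi> \<in> C12b"
  obtains c where "continuous_on ({0..} \<times> UNIV) (\<lambda>(r, x). gen \<phi> r x)" "\<And>r x. 0 \<le> r \<Longrightarrow> \<bar>gen \<phi> r x\<bar> \<le> c"
proof -
  obtain c where c: "\<And>\<psi>. \<psi> \<in> {\<phi>, d_t \<phi>, d_x \<phi>, d_xx \<phi>} \<Longrightarrow> continuous_on ({0..} \<times> UNIV) (\<lambda>(r, x). \<psi> r x)"
    "\<And>\<psi> r x. \<psi> \<in> {\<phi>, d_t \<phi>, d_x \<phi>, d_xx \<phi>} \<Longrightarrow> 0 \<le> r \<Longrightarrow> \<bar>\<psi> r x\<bar> \<le> c"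
    using C12b_bound[OF assms] by blast
  show ?thesis
  proof (rule that[of "c + \<kappa> * c"])
    have "continuous_on ({0..} \<times> UNIV) (\<lambda>z. (\<lambda>(r, x). d_t \<phi> r x) z + \<kappa> * (\<lambda>(r, x). d_xx \<phi> r x) z)"
      by (intro continuous_intros c) auto
    then show "continuous_on ({0..} \<times> UNIV) (\<lambda>(r, x). gen \<phi> r x)"
      by (simp add: gen_def split_beta)
    fix r x :: real assume "0 \<le> r"
    then have "\<bar>d_t \<phi> r x\<bar> \<le> c" "\<bar>\<kappa> * d_xx \<phi> r x\<bar> \<le> \<kappa> * c"
      using c(2)[of _ r x] kappa_pos by (auto simp: abs_mult)
    then show "\<bar>gen \<phi> r x\<bar> \<le> c + \<kappa> * c" unfolding gen_def by linarith
  qed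
qed

text \<open>Every term becomes an integral over particles: \<open>L\<close> for survivors,
  \<open>Z\<close> for initial values, \<open>A\<close> and \<open>G\<close> for absorbed particles
  with \<open>\<phi>\<close> taken at their position and at the left limit of the front. The
  Stieltjes term contributes \<open>G\<close> and the jump sum \<open>A - G\<close>; so
  \<open>G\<close> cancels, and what is left is the integral of \<open>N\<close>. Here
  \<open>u0\<close> is the given datum and \<open>v0\<close> its representative.\<close>

lemma weak_identity_if_martingale_part:
  assumes \<phi>: "\<phi> \<in> C12b" and t: "0 < t" and u0: "AE x in lborel. v0 x = u0 x" "u0 \<in> borel_measurable borel"
    and J: "\<theta> * J = - (\<integral>x. N \<phi> t \<omega> x \<partial>Q)"
  shows "weak_identity \<kappa> lam \<theta> u0 s0 (v \<omega>) (front \<omega>) \<phi> t J"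
proof -
  obtain c where c: "\<And>\<psi>. \<psi> \<in> {\<phi>, d_t \<phi>, d_x \<phi>, d_xx \<phi>} \<Longrightarrow> continuous_on ({0..} \<times> UNIV) (\<lambda>(r, x). \<psi> r x)"
    "\<And>\<psi> r x. \<psi> \<in> {\<phi>, d_t \<phi>, d_x \<phi>, d_xx \<phi>} \<Longrightarrow> 0 \<le> r \<Longrightarrow> \<bar>\<psi> r x\<bar> \<le> c"
    using C12b_bound[OF \<phi>] by blast
  have t0: "0 \<le> t" using t by simp
  have \<phi>c: "continuous_on ({0..} \<times> UNIV) (\<lambda>(r, x). \<phi> r x)" "\<And>r x. 0 \<le> r \<Longrightarrow> \<bar>\<phi> r x\<bar> \<le> c"
    using c[of \<phi>] by auto
  have c0: "0 \<le> c" using \<phi>c(2)[of 0 0] by simp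
  have [measurable]: "snd \<in> borel_measurable Q" unfolding Q_def by measurable
  have sec [measurable]: "\<phi> r \<in> borel_measurable borel" if "0 \<le> r" for r by (rule measurable_section[OF \<phi>c(1) that])
  define D where "D \<psi> = (\<integral>x. (LINT r:{0..t}|lborel. if live \<omega> r x then \<psi> r (X \<omega> r x) else 0) \<partial>Q)" for \<psi> :: "real \<Rightarrow> real \<Rightarrow> real"
  define L where "L x = (if live \<omega> t x then \<phi> t (X \<omega> t x) else 0)" for x
  define Z where "Z x = (if s0 < snd x then \<phi> 0 (snd x) else 0)" for x :: "'a \<times> real"
  define A where "A x = (if absorbed \<omega> t x then \<phi> (tau \<omega> x) (X \<omega> (tau \<omega> x) x) else 0)" for x
  define G where "G x = (if absorbed \<omega> t x then \<phi> (tau \<omega> x) (left_lim (front \<omega>) (tau \<omega> x)) else 0)" for x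
  have T1: "(LINT x:{front \<omega> t..}|lborel. v \<omega> t x * \<phi> t x) = - (\<integral>x. L x \<partial>Q)"
    unfolding L_def using t \<phi>c(2) by (intro front_set_integral(2)[of _ c] sec) auto
  have T2: "(LINT x:{s0..}|lborel. u0 x * \<phi> 0 x) = - (\<integral>x. Z x \<partial>Q)"
  proof -
    have [measurable]: "u0 \<in> borel_measurable borel" by (rule u0(2))
    have "(LINT x:{s0..}|lborel. u0 x * \<phi> 0 x) = (\<integral>x. v0 x * (if s0 < x then \<phi> 0 x else 0) \<partial>lborel)"
      unfolding set_lebesgue_integral_def
    proof (rule integral_cong_AE)
      show "AE x in lborel. indicator {s0..} x *\<^sub>R (u0 x * \<phi> 0 x) = v0 x * (if s0 < x then \<phi> 0 x else 0)"
        using u0(1) by eventually_elim (use v0_zero in \<open>auto simp: indicator_def not_less\<close>)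
    qed (use sec[of 0] in auto)
    also have "\<dots> = - (\<integral>x. (if s0 < x then \<phi> 0 x else 0) \<partial>\<nu>)"
      using sec[of 0] by (subst integral_\<nu>) auto
    also have "(\<integral>x. (if s0 < x then \<phi> 0 x else 0) \<partial>\<nu>) = (\<integral>\<omega>'. (\<integral>y. Z (\<omega>', y) \<partial>\<nu>) \<partial>M)"
    proof -
      have "(\<lambda>y. Z (\<omega>', y)) = (\<lambda>x. if s0 < x then \<phi> 0 x else 0)" for \<omega>' by (auto simp: Z_def)
      then show ?thesis by (simp add: W.prob_space)
    qed
    also have "\<dots> = (\<integral>x. Z x \<partial>Q)"
    proof -
      have "integrable Q Z"
        unfolding Z_def using sec[of 0] \<phi>c(2)[of 0] c0 by (intro Q.integrable_const_bound[of _ c]) auto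
      then show ?thesis unfolding Q_def by (rule M\<nu>.integral_fst')
    qed
    finally show ?thesis by simp
  qed
  have drift: "(LINT r:{0..t}|lborel. (LINT x:{front \<omega> r..}|lborel. v \<omega> r x * \<psi> r x)) = - D \<psi>"
    "set_integrable lborel {0..t} (\<lambda>r. LINT x:{front \<omega> r..}|lborel. v \<omega> r x * \<psi> r x)"
    if "\<psi> \<in> {\<phi>, d_t \<phi>, d_x \<phi>, d_xx \<phi>}" for \<psi>
    unfolding D_def by (rule drift_integral[OF c(1)[OF that] c(2)[OF that] t0]; assumption)+
  obtain c' where gen: "continuous_on ({0..} \<times> UNIV) (\<lambda>(r, x). gen \<phi> r x)" "\<And>r x. 0 \<le> r \<Longrightarrow> \<bar>gen \<phi> r x\<bar> \<le> c'"
    using C12b_gen[OF \<phi>] by blast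
  have T3: "- D (d_t \<phi>) + \<kappa> * - D (d_xx \<phi>) = - D (gen \<phi>)"
  proof -
    have "- D (d_t \<phi>) + \<kappa> * - D (d_xx \<phi>) =
      (LINT r:{0..t}|lborel. (LINT x:{front \<omega> r..}|lborel. v \<omega> r x * d_t \<phi> r x) + \<kappa> * (LINT x:{front \<omega> r..}|lborel. v \<omega> r x * d_xx \<phi> r x))"
      using drift[of "d_t \<phi>"] drift[of "d_xx \<phi>"] by (subst set_integral_add(2)) auto
    also have "\<dots> = (LINT r:{0..t}|lborel. (LINT x:{front \<omega> r..}|lborel. v \<omega> r x * gen \<phi> r x))"
    proof (rule set_lebesgue_integral_cong)
      show "\<forall>r. r \<in> {0..t} \<longrightarrow> (LINT x:{front \<omega> r..}|lborel. v \<omega> r x * d_t \<phi> r x) + \<kappa> * (LINT x:{front \<omega> r..}|lborel. v \<omega> r x * d_xx \<phi> r x) =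
        (LINT x:{front \<omega> r..}|lborel. v \<omega> r x * gen \<phi> r x)"
      proof (intro allI impI)
        fix r assume "r \<in> {0..t}"
        then have r: "0 \<le> r" by simp
        have i: "set_integrable lborel {front \<omega> r..} (\<lambda>x. v \<omega> r x * \<psi> r x)" if "\<psi> \<in> {\<phi>, d_t \<phi>, d_x \<phi>, d_xx \<phi>}" for \<psi>
          by (rule front_set_integral(1)[OF measurable_section[OF c(1)[OF that] r] c(2)[OF that r] r])
        have "(LINT x:{front \<omega> r..}|lborel. v \<omega> r x * d_t \<phi> r x) + \<kappa> * (LINT x:{front \<omega> r..}|lborel. v \<omega> r x * d_xx \<phi> r x) =
          (LINT x:{front \<omega> r..}|lborel. v \<omega> r x * d_t \<phi> r x + \<kappa> * (v \<omega> r x * d_xx \<phi> r x))"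
          using i[of "d_t \<phi>"] i[of "d_xx \<phi>"] by (subst set_integral_add(2)) auto
        then show "(LINT x:{front \<omega> r..}|lborel. v \<omega> r x * d_t \<phi> r x) + \<kappa> * (LINT x:{front \<omega> r..}|lborel. v \<omega> r x * d_xx \<phi> r x) =
          (LINT x:{front \<omega> r..}|lborel. v \<omega> r x * gen \<phi> r x)"
          by (simp add: gen_def algebra_simps)
      qed
    qed simp
    also have "\<dots> = - D (gen \<phi>)" unfolding D_def by (rule drift_integral(2)[OF gen t0])
    finally show ?thesis .
  qed
  have T4: "lam * \<kappa> * stieltjes (\<lambda>r. \<phi> r (left_lim (front \<omega>) r)) (front \<omega>) t = (\<integral>x. G x \<partial>Q)"
  proof -
    have [measurable]: "(\<lambda>r. \<phi> (max 0 r) (left_lim (front \<omega>) r)) \<in> borel_measurable borel"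
      by (intro measurable_clamped[OF \<phi>c(1)]) auto
    have "stieltjes (\<lambda>r. \<phi> r (left_lim (front \<omega>) r)) (front \<omega>) t = stieltjes (\<lambda>r. \<phi> (max 0 r) (left_lim (front \<omega>) r)) (front \<omega>) t"
      unfolding stieltjes_def set_lebesgue_integral_def
      by (intro Bochner_Integration.integral_cong) (auto simp: indicator_def max_def)
    then have "lam * \<kappa> * stieltjes (\<lambda>r. \<phi> r (left_lim (front \<omega>) r)) (front \<omega>) t =
      (\<integral>x. (if absorbed \<omega> t x then \<phi> (max 0 (tau \<omega> x)) (left_lim (front \<omega>) (tau \<omega> x)) else 0) \<partial>Q)"
      using stieltjes_front[OF t, of "\<lambda>r. \<phi> (max 0 r) (left_lim (front \<omega>) r)"] by simp
    also have "\<dots> = (\<integral>x. G x \<partial>Q)"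
      unfolding G_def using tau_pos[of _ t \<omega>] t
      by (intro Bochner_Integration.integral_cong) (auto simp: absorbed_def max_absorb2)
    finally show ?thesis .
  qed
  have int: "integrable Q L" "integrable Q Z" "integrable Q A" "integrable Q G"
  proof -
    define T where "T x = (if absorbed \<omega> t x then tau \<omega> x else 0)" for x
    have T [measurable]: "T \<in> borel_measurable Q" unfolding T_def using t by (intro tau_measurable) simp
    have Tr: "T x \<in> {0..t}" for x
      using tau_pos[of x t \<omega>] tau_le[of x t \<omega>] t by (auto simp: T_def absorbed_def)
    have [measurable]: "(\<lambda>x. \<phi> (max 0 (T x)) (left_lim (front \<omega>) (T x))) \<in> borel_measurable Q"
      by (intro measurable_clamped[OF \<phi>c(1)]) measurable
    have [measurable]: "(\<lambda>x. \<phi> (max 0 (T x)) (X \<omega> (T x) x)) \<in> borel_measurable Q"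
      using t Tr by (intro measurable_clamped[OF \<phi>c(1)] X_at_measurable[of t]) auto
    have A: "A x = (if absorbed \<omega> t x then \<phi> (max 0 (T x)) (X \<omega> (T x) x) else 0)"
      and G: "G x = (if absorbed \<omega> t x then \<phi> (max 0 (T x)) (left_lim (front \<omega>) (T x)) else 0)" for x
      using Tr[of x] by (auto simp: A_def G_def T_def)
    show "integrable Q L" unfolding L_def
      using sec[OF t0] \<phi>c(2)[OF t0] c0 by (intro Q.integrable_const_bound[of _ c]) auto
    show "integrable Q Z" unfolding Z_def
      using sec[of 0] \<phi>c(2)[of 0] c0 by (intro Q.integrable_const_bound[of _ c]) auto
    show "integrable Q A" unfolding A
      using \<phi>c(2) c0 by (intro Q.integrable_const_bound[of _ c]) auto
    show "integrable Q G" unfolding G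
      using \<phi>c(2) c0 by (intro Q.integrable_const_bound[of _ c]) auto
  qed
  have T5: "(\<Sum>\<^sub>\<infinity>r\<in>{0<..t}. LINT x:{left_lim (front \<omega>) r..front \<omega> r}|lborel.
            left_lim_L1 (v \<omega>) r x * (\<phi> r (left_lim (front \<omega>) r) - \<phi> r x)) = - (\<integral>x. G x - A x \<partial>Q)"
    by (subst jump_sum[OF t \<phi>c(1) \<phi>c(2)], assumption)
      (intro arg_cong[where f=uminus] Bochner_Integration.integral_cong, auto simp: G_def A_def)
  have "(\<integral>x. N \<phi> t \<omega> x \<partial>Q) = (\<integral>x. (L x + A x - Z x) - (LINT r:{0..t}|lborel. if live \<omega> r x then gen \<phi> r (X \<omega> r x) else 0) \<partial>Q)"
    by (intro Bochner_Integration.integral_cong refl)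
      (auto simp: N_def L_def A_def Z_def stop_def absorbed_def live_s0)
  also have "\<dots> = (\<integral>x. L x \<partial>Q) + (\<integral>x. A x \<partial>Q) - (\<integral>x. Z x \<partial>Q) - D (gen \<phi>)"
    using int drift_integral(3)[OF gen t0] by (simp add: D_def)
  finally have "\<theta> * J = - ((\<integral>x. L x \<partial>Q) + (\<integral>x. A x \<partial>Q) - (\<integral>x. Z x \<partial>Q) - D (gen \<phi>))" using J by simp
  then show ?thesis
    unfolding weak_identity_def T1 T2 T4 T5 using drift(1)[of "d_t \<phi>"] drift(1)[of "d_xx \<phi>"] T3 int
    by simp
qed

end

section \<open>Taylor expansion along a grid\<close>

text \<open>The grids have mesh \<open>1/(k+1)\<close> and, with \<open>gn k\<close> cells, reach
  time \<open>k + 1\<close>; every fixed time is eventually covered.\<close>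

definition gp :: "nat \<Rightarrow> nat \<Rightarrow> real" where
  "gp k i = real i / real (Suc k)"

definition gn :: "nat \<Rightarrow> nat" where
  "gn k = Suc k * Suc k"

text \<open>The grid stopped at \<open>t\<close>, which is how simple integrals truncate their
  increments. Cells beyond \<open>t\<close> degenerate to a point.\<close>

definition gq :: "real \<Rightarrow> nat \<Rightarrow> nat \<Rightarrow> real" where
  "gq t k i = min t (gp k i)"

lemma gp_0 [simp]: "gp k 0 = 0" by (simp add: gp_def)

lemma gp_nonneg: "0 \<le> gp k i" by (simp add: gp_def)

lemma gp_Suc: "gp k (Suc i) = gp k i + 1 / real (Suc k)"
  by (simp add: gp_def add_divide_distrib)

lemma gp_mono: "i \<le> j \<Longrightarrow> gp k i \<le> gp k j"
  unfolding gp_def by (intro divide_right_mono) auto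

lemma gp_strict_mono: "i < j \<Longrightarrow> gp k i < gp k j"
  unfolding gp_def by (intro divide_strict_right_mono) auto

lemma gp_gn: "gp k (gn k) = real (Suc k)"
  unfolding gp_def gn_def of_nat_mult by simp

lemma gq_range: "0 \<le> t \<Longrightarrow> 0 \<le> gq t k i" "0 \<le> t \<Longrightarrow> gq t k i \<le> t"
  using gp_nonneg[of k i] by (auto simp: gq_def)

lemma gq_mono: "i \<le> j \<Longrightarrow> gq t k i \<le> gq t k j"
  unfolding gq_def using gp_mono[of i j k] by auto

lemma gq_Suc_le: "gq t k (Suc i) \<le> gq t k i + 1 / real (Suc k)"
proof -
  have "0 \<le> 1 / real (Suc k)" by simp
  then show ?thesis unfolding gq_def gp_Suc by linarith
qed

lemma gq_cases:
  obtains "gq t k i = gp k i" "gp k i < t" | "gq t k i = t" "gq t k (Suc i) = t" "t \<le> gp k i"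
  using gp_mono[of i "Suc i" k] by (cases "gp k i < t") (auto simp: gq_def)

lemma sum_gq_le: "0 \<le> t \<Longrightarrow> (\<Sum>i<n. gq t k (Suc i) - gq t k i) \<le> t"
  using gq_range[of t k n] gq_range[of t k 0] by (simp add: sum_lessThan_telescope)

lemma mesh_tendsto: "(\<lambda>k. 1 / real (Suc k)) \<longlonglongrightarrow> 0"
  using LIMSEQ_inverse_real_of_nat by (simp only: inverse_eq_divide)

lemma eventually_mesh: "0 < d \<Longrightarrow> eventually (\<lambda>k. 1 / real (Suc k) < d) sequentially"
  by (rule order_tendstoD(2)[OF mesh_tendsto])

text \<open>Uniform continuity of \<open>\<psi>\<close> on a compact set around the graph of
  \<open>g\<close>. The condition on \<open>z\<close> is the one satisfied by the intermediate point
  in Taylor's formula, which is no farther away than the increment of the path.\<close>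

lemma path_modulus:
  fixes \<psi> :: "real \<Rightarrow> real \<Rightarrow> real" and g :: "real \<Rightarrow> real"
  assumes \<psi>: "continuous_on ({0..} \<times> UNIV) (\<lambda>(r, x). \<psi> r x)" and g: "continuous_on UNIV g" and e: "0 < e"
  obtains d where "0 < d"
    "\<And>r r' u z. r \<in> {0..t} \<Longrightarrow> r' \<in> {0..t} \<Longrightarrow> u \<in> {0..t} \<Longrightarrow> \<bar>r' - r\<bar> < d \<Longrightarrow> \<bar>u - r\<bar> < d \<Longrightarrow>
      \<bar>z - g r\<bar> \<le> \<bar>g u - g r\<bar> \<Longrightarrow> \<bar>\<psi> r' z - \<psi> r (g r)\<bar> < e"
proof -
  have gt: "continuous_on {0..t} g" using g by (rule continuous_on_subset) simp
  have "bounded (g ` {0..t})"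
    by (intro compact_imp_bounded compact_continuous_image gt) simp
  then obtain b where "\<forall>x\<in>g ` {0..t}. norm x \<le> b" unfolding bounded_iff by blast
  then have b: "\<And>r. r \<in> {0..t} \<Longrightarrow> \<bar>g r\<bar> \<le> b" by auto
  let ?K = "{0..t} \<times> {-b - 1..b + 1}"
  have "uniformly_continuous_on ?K (\<lambda>(r, x). \<psi> r x)"
    by (intro compact_uniformly_continuous compact_Times continuous_on_subset[OF \<psi>]) auto
  then obtain d1 where d1: "0 < d1" "\<And>z w. z \<in> ?K \<Longrightarrow> w \<in> ?K \<Longrightarrow> dist w z < d1 \<Longrightarrow>
      dist ((\<lambda>(r, x). \<psi> r x) w) ((\<lambda>(r, x). \<psi> r x) z) < e"
    using e unfolding uniformly_continuous_on_def by meson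
  define d2 where "d2 = min 1 (d1 / 2)"
  have d2: "0 < d2" using d1 by (simp add: d2_def)
  have "uniformly_continuous_on {0..t} g" by (rule compact_uniformly_continuous[OF gt]) simp
  then obtain d3 where d3: "0 < d3" "\<And>r u. r \<in> {0..t} \<Longrightarrow> u \<in> {0..t} \<Longrightarrow> dist u r < d3 \<Longrightarrow> dist (g u) (g r) < d2"
    using d2 unfolding uniformly_continuous_on_def by meson
  show ?thesis
  proof (rule that[of "min d3 (d1 / 2)"])
    show "0 < min d3 (d1 / 2)" using d1 d3 by simp
    fix r r' u z assume *: "r \<in> {0..t}" "r' \<in> {0..t}" "u \<in> {0..t}" "\<bar>r' - r\<bar> < min d3 (d1 / 2)"
      "\<bar>u - r\<bar> < min d3 (d1 / 2)" "\<bar>z - g r\<bar> \<le> \<bar>g u - g r\<bar>"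
    have z: "\<bar>z - g r\<bar> < d2" using d3(2)[OF *(1,3)] *(5,6) by (simp add: dist_real_def)
    have K: "(r, g r) \<in> ?K" "(r', z) \<in> ?K"
      using b[OF *(1)] z *(1,2) by (auto simp: d2_def)
    have "dist (r', z) (r, g r) \<le> \<bar>r' - r\<bar> + \<bar>z - g r\<bar>"
      unfolding dist_Pair_Pair dist_real_def by (metis abs_ge_zero power2_abs sqrt_sum_squares_le_sum)
    also have "\<dots> < d1" using *(4) z unfolding d2_def by linarith
    finally have "dist (r', z) (r, g r) < d1" .
    from d1(2)[OF K this] show "\<bar>\<psi> r' z - \<psi> r (g r)\<bar> < e" by (simp add: dist_real_def)
  qed
qed

lemma C12b_derivatives:
  assumes "\<phi> \<in> C12b" "0 \<le> r"
  shows "((\<lambda>q. \<phi> q x) has_real_derivative d_t \<phi> r x) (at r within {0..})"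
    and "(\<phi> r has_real_derivative d_x \<phi> r x) (at x)"
    and "(d_x \<phi> r has_real_derivative d_xx \<phi> r x) (at x)"
proof -
  have "(\<lambda>q. \<phi> q x) differentiable (at r within {0..})" "\<phi> r differentiable (at x)" "d_x \<phi> r differentiable (at x)"
    using assms unfolding C12b_def by blast+
  note d = this
  show "((\<lambda>q. \<phi> q x) has_real_derivative d_t \<phi> r x) (at r within {0..})"
    using d(1) unfolding d_t_def has_real_derivative_iff_has_vector_derivative vector_derivative_works .
  show "(\<phi> r has_real_derivative d_x \<phi> r x) (at x)" "(d_x \<phi> r has_real_derivative d_xx \<phi> r x) (at x)"
    using d(2,3) unfolding d_xx_def d_x_def[of \<phi> r x] d_x_def[of "d_x \<phi>" r x] DERIV_deriv_iff_real_differentiable .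
qed

lemma mean_value_within:
  fixes f f' :: "real \<Rightarrow> real"
  assumes "0 \<le> r" "r \<le> u" and f: "\<And>q. 0 \<le> q \<Longrightarrow> q \<le> u \<Longrightarrow> (f has_real_derivative f' q) (at q within {0..u})"
  shows "\<exists>\<rho>\<in>{r..u}. f u - f r = f' \<rho> * (u - r)"
proof (rule mvt_very_simple[OF assms(2), of f "\<lambda>q h. f' q * h"])
  fix q assume "r \<le> q" "q \<le> u"
  then have "(f has_real_derivative f' q) (at q within {r..u})"
    using assms(1) by (intro DERIV_subset[OF f]) auto
  then show "(f has_derivative (*) (f' q)) (at q within {r..u})"
    by (simp add: has_field_derivative_def)
qed

lemma taylor_second_order:
  assumes "\<phi> \<in> C12b" "0 \<le> r"
  shows "\<exists>\<eta>. \<bar>\<eta> - x\<bar> \<le> \<bar>y - x\<bar> \<and>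
    \<phi> r y - \<phi> r x - d_x \<phi> r x * (y - x) - d_xx \<phi> r x / 2 * (y - x)\<^sup>2 = (d_xx \<phi> r \<eta> - d_xx \<phi> r x) / 2 * (y - x)\<^sup>2"
proof (cases "y = x")
  case False
  define D where "D m = (if m = 0 then \<phi> r else if m = 1 then d_x \<phi> r else d_xx \<phi> r)" for m :: nat
  have "\<exists>\<eta>. (if y < x then y < \<eta> \<and> \<eta> < x else x < \<eta> \<and> \<eta> < y) \<and>
    \<phi> r y = (\<Sum>m<2. (D m x / fact m) * (y - x) ^ m) + (D 2 \<eta> / fact 2) * (y - x) ^ 2"
  proof (rule Taylor[where a="min x y" and b="max x y"])
    show "\<forall>m t. m < 2 \<and> min x y \<le> t \<and> t \<le> max x y \<longrightarrow> DERIV (D m) t :> D (Suc m) t"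
    proof (intro allI impI)
      fix m t assume "m < (2::nat) \<and> min x y \<le> t \<and> t \<le> max x y"
      then have "m = 0 \<or> m = 1" by auto
      then show "DERIV (D m) t :> D (Suc m) t"
        using C12b_derivatives(2,3)[OF assms, of t] by (auto simp: D_def)
    qed
  qed (use False in \<open>auto simp: D_def\<close>)
  then obtain \<eta> where \<eta>: "if y < x then y < \<eta> \<and> \<eta> < x else x < \<eta> \<and> \<eta> < y"
    "\<phi> r y = (\<Sum>m<2. (D m x / fact m) * (y - x) ^ m) + (D 2 \<eta> / fact 2) * (y - x) ^ 2" by blast
  have "\<phi> r y = \<phi> r x + d_x \<phi> r x * (y - x) + d_xx \<phi> r \<eta> / 2 * (y - x)\<^sup>2"
    using \<eta>(2) by (simp add: D_def numeral_2_eq_2)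
  moreover have "\<bar>\<eta> - x\<bar> \<le> \<bar>y - x\<bar>" using \<eta>(1) by (auto split: if_splits)
  ultimately show ?thesis by (intro exI[of _ \<eta>]) (simp add: algebra_simps diff_divide_distrib)
qed simp

text \<open>An increment of \<open>\<phi>\<close> over a cell is split into a step in time at the
  new position and a step in space at the old time; \<open>errT\<close> is the first-order remainder
  of the former and \<open>errR\<close> the second-order remainder of the latter. Derivatives are
  taken at the unstopped grid point, which differs from the stopped one only on degenerate cells,
  where the increments vanish.\<close>

definition errT :: "(real \<Rightarrow> real \<Rightarrow> real) \<Rightarrow> (real \<Rightarrow> real) \<Rightarrow> real \<Rightarrow> nat \<Rightarrow> nat \<Rightarrow> real" where
  "errT \<phi> g t k i = \<phi> (gq t k (Suc i)) (g (gq t k (Suc i))) - \<phi> (gq t k i) (g (gq t k (Suc i)))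
     - (gq t k (Suc i) - gq t k i) * d_t \<phi> (gp k i) (g (gp k i))"

definition errR :: "(real \<Rightarrow> real \<Rightarrow> real) \<Rightarrow> (real \<Rightarrow> real) \<Rightarrow> real \<Rightarrow> nat \<Rightarrow> nat \<Rightarrow> real" where
  "errR \<phi> g t k i = \<phi> (gq t k i) (g (gq t k (Suc i))) - \<phi> (gq t k i) (g (gq t k i))
     - d_x \<phi> (gp k i) (g (gp k i)) * (g (gq t k (Suc i)) - g (gq t k i))
     - d_xx \<phi> (gp k i) (g (gp k i)) / 2 * (g (gq t k (Suc i)) - g (gq t k i))\<^sup>2"

lemma errT_mean_value:
  assumes "\<phi> \<in> C12b" "0 \<le> t"
  shows "\<exists>\<rho>\<in>{gq t k i..gq t k (Suc i)}. errT \<phi> g t k i =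
    (gq t k (Suc i) - gq t k i) * (d_t \<phi> \<rho> (g (gq t k (Suc i))) - d_t \<phi> (gp k i) (g (gp k i)))"
proof -
  let ?q = "gq t k i" and ?q' = "gq t k (Suc i)"
  have "\<exists>\<rho>\<in>{?q..?q'}. \<phi> ?q' (g ?q') - \<phi> ?q (g ?q') = d_t \<phi> \<rho> (g ?q') * (?q' - ?q)"
  proof (rule mean_value_within)
    fix q assume "0 \<le> q" "q \<le> ?q'"
    then show "((\<lambda>q. \<phi> q (g ?q')) has_real_derivative d_t \<phi> q (g ?q')) (at q within {0..?q'})"
      by (intro DERIV_subset[OF C12b_derivatives(1)[OF assms(1)]]) auto
  qed (use gq_range[OF assms(2)] gq_mono[of i "Suc i" t k] in auto)
  then show ?thesis by (auto simp: errT_def algebra_simps)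
qed

lemma errR_taylor:
  assumes "\<phi> \<in> C12b" "0 \<le> t"
  shows "\<exists>\<eta>. \<bar>\<eta> - g (gq t k i)\<bar> \<le> \<bar>g (gq t k (Suc i)) - g (gq t k i)\<bar> \<and> errR \<phi> g t k i =
    (d_xx \<phi> (gq t k i) \<eta> - d_xx \<phi> (gq t k i) (g (gq t k i))) / 2 * (g (gq t k (Suc i)) - g (gq t k i))\<^sup>2"
proof (cases rule: gq_cases[of t k i])
  case 1
  show ?thesis
    using taylor_second_order[OF assms(1) gp_nonneg, of "g (gq t k i)" "g (gq t k (Suc i))" k i] 1
    unfolding errR_def by simp
next
  case 2
  then show ?thesis unfolding errR_def by auto
qed

lemma errT_bound:
  assumes "\<phi> \<in> C12b" "0 \<le> t" and c: "\<And>r x. 0 \<le> r \<Longrightarrow> \<bar>d_t \<phi> r x\<bar> \<le> c"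
  shows "\<bar>errT \<phi> g t k i\<bar> \<le> 2 * c * (gq t k (Suc i) - gq t k i)"
proof -
  obtain \<rho> where \<rho>: "\<rho> \<in> {gq t k i..gq t k (Suc i)}" "errT \<phi> g t k i =
    (gq t k (Suc i) - gq t k i) * (d_t \<phi> \<rho> (g (gq t k (Suc i))) - d_t \<phi> (gp k i) (g (gp k i)))"
    using errT_mean_value[OF assms(1,2)] by blast
  have "0 \<le> \<rho>" using \<rho>(1) gq_range(1)[OF assms(2), of k i] by auto
  then have "\<bar>d_t \<phi> \<rho> (g (gq t k (Suc i))) - d_t \<phi> (gp k i) (g (gp k i))\<bar> \<le> 2 * c"
    using c[of \<rho> "g (gq t k (Suc i))"] c[OF gp_nonneg, of k i "g (gp k i)"] by linarith
  moreover have d: "0 \<le> gq t k (Suc i) - gq t k i" using gq_mono[of i "Suc i" t k] by simp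
  ultimately have "(gq t k (Suc i) - gq t k i) * \<bar>d_t \<phi> \<rho> (g (gq t k (Suc i))) - d_t \<phi> (gp k i) (g (gp k i))\<bar>
    \<le> (gq t k (Suc i) - gq t k i) * (2 * c)" by (rule mult_left_mono)
  then show ?thesis
    unfolding \<rho>(2) abs_mult using d by (simp only: abs_of_nonneg mult.commute)
qed

lemma errR_bound:
  assumes "\<phi> \<in> C12b" "0 \<le> t" and c: "\<And>r x. 0 \<le> r \<Longrightarrow> \<bar>d_xx \<phi> r x\<bar> \<le> c"
  shows "\<bar>errR \<phi> g t k i\<bar> \<le> c * (g (gq t k (Suc i)) - g (gq t k i))\<^sup>2"
proof -
  obtain \<eta> where \<eta>: "errR \<phi> g t k i =
    (d_xx \<phi> (gq t k i) \<eta> - d_xx \<phi> (gq t k i) (g (gq t k i))) / 2 * (g (gq t k (Suc i)) - g (gq t k i))\<^sup>2"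
    using errR_taylor[OF assms(1,2)] by blast
  have "\<bar>(d_xx \<phi> (gq t k i) \<eta> - d_xx \<phi> (gq t k i) (g (gq t k i))) / 2\<bar> \<le> c"
    using c[OF gq_range(1)[OF assms(2)], of k i \<eta>] c[OF gq_range(1)[OF assms(2)], of k i "g (gq t k i)"]
      abs_triangle_ineq4[of "d_xx \<phi> (gq t k i) \<eta>" "d_xx \<phi> (gq t k i) (g (gq t k i))"] by simp
  then show ?thesis
    unfolding \<eta> abs_mult abs_of_nonneg[OF zero_le_power2] by (rule mult_right_mono) simp
qed

text \<open>Mean value and Taylor forms compare derivatives at times at most one mesh apart and at
  positions within the increment of the path, so one modulus of continuity along the path serves all
  cells.\<close>

lemma errors_small:
  assumes \<phi>: "\<phi> \<in> C12b" and t: "0 \<le> t" and g: "continuous_on UNIV g" and e: "0 < e"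
  shows "eventually (\<lambda>k. \<forall>i. \<bar>errT \<phi> g t k i\<bar> \<le> e * (gq t k (Suc i) - gq t k i) \<and>
    \<bar>errR \<phi> g t k i\<bar> \<le> e * (g (gq t k (Suc i)) - g (gq t k i))\<^sup>2) sequentially"
proof -
  have c: "continuous_on ({0..} \<times> UNIV) (\<lambda>(r, x). d_t \<phi> r x)" "continuous_on ({0..} \<times> UNIV) (\<lambda>(r, x). d_xx \<phi> r x)"
    using C12b_bound[OF \<phi>] by blast+
  obtain d1 where d1: "0 < d1"
    "\<And>r r' u z. r \<in> {0..t} \<Longrightarrow> r' \<in> {0..t} \<Longrightarrow> u \<in> {0..t} \<Longrightarrow> \<bar>r' - r\<bar> < d1 \<Longrightarrow> \<bar>u - r\<bar> < d1 \<Longrightarrow>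
      \<bar>z - g r\<bar> \<le> \<bar>g u - g r\<bar> \<Longrightarrow> \<bar>d_t \<phi> r' z - d_t \<phi> r (g r)\<bar> < e"
    using path_modulus[OF c(1) g e] by blast
  obtain d2 where d2: "0 < d2"
    "\<And>r r' u z. r \<in> {0..t} \<Longrightarrow> r' \<in> {0..t} \<Longrightarrow> u \<in> {0..t} \<Longrightarrow> \<bar>r' - r\<bar> < d2 \<Longrightarrow> \<bar>u - r\<bar> < d2 \<Longrightarrow>
      \<bar>z - g r\<bar> \<le> \<bar>g u - g r\<bar> \<Longrightarrow> \<bar>d_xx \<phi> r' z - d_xx \<phi> r (g r)\<bar> < e"
    using path_modulus[OF c(2) g e] by blast
  have "eventually (\<lambda>k. 1 / real (Suc k) < min d1 d2) sequentially"
    using d1 d2 by (intro eventually_mesh) auto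
  then show ?thesis
  proof eventually_elim
    case (elim k)
    show ?case
    proof (intro allI conjI)
      fix i
      let ?q = "gq t k i" and ?q' = "gq t k (Suc i)"
      have q: "?q \<in> {0..t}" "?q' \<in> {0..t}" "?q \<le> ?q'" "?q' - ?q < min d1 d2"
        using gq_range[OF t] gq_mono[of i "Suc i" t k] gq_Suc_le[of t k i] elim by auto
      obtain \<rho> where \<rho>: "\<rho> \<in> {?q..?q'}" "errT \<phi> g t k i =
        (?q' - ?q) * (d_t \<phi> \<rho> (g ?q') - d_t \<phi> (gp k i) (g (gp k i)))"
        using errT_mean_value[OF \<phi> t] by blast
      show "\<bar>errT \<phi> g t k i\<bar> \<le> e * (?q' - ?q)"
      proof (cases rule: gq_cases[of t k i])
        case 1
        have "\<bar>d_t \<phi> \<rho> (g ?q') - d_t \<phi> ?q (g ?q)\<bar> < e"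
          by (rule d1(2)[where u="?q'"]) (use q \<rho> in auto)
        then show ?thesis
          unfolding \<rho>(2) abs_mult using q(3) 1 by (simp add: mult.commute[of e] mult_left_mono)
      next
        case 2
        then show ?thesis by (simp add: errT_def)
      qed
      obtain \<eta> where \<eta>: "\<bar>\<eta> - g ?q\<bar> \<le> \<bar>g ?q' - g ?q\<bar>" "errR \<phi> g t k i =
        (d_xx \<phi> ?q \<eta> - d_xx \<phi> ?q (g ?q)) / 2 * (g ?q' - g ?q)\<^sup>2"
        using errR_taylor[OF \<phi> t] by blast
      have "\<bar>d_xx \<phi> ?q \<eta> - d_xx \<phi> ?q (g ?q)\<bar> < e"
        by (rule d2(2)[where u="?q'"]) (use q \<eta> in auto)
      then show "\<bar>errR \<phi> g t k i\<bar> \<le> e * (g ?q' - g ?q)\<^sup>2"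
        unfolding \<eta>(2) abs_mult abs_of_nonneg[OF zero_le_power2] by (intro mult_right_mono) auto
    qed
  qed
qed

text \<open>A sum over the grid cells entered before \<open>\<sigma>\<close> telescopes; the lag \<open>i - 1\<close> only delays the stopping
  by one cell. For \<open>i = 0\<close> the truncated difference makes the lagged grid point \<open>0\<close>.\<close>

lemma telescoping_stopped_sum:
  fixes g :: "real \<Rightarrow> real"
  assumes t: "0 \<le> t" and \<sigma>: "\<sigma> \<in> {0..t}" and g: "continuous_on {0..} g"
    and L: "\<And>u. 0 \<le> u \<Longrightarrow> u < \<sigma> \<Longrightarrow> L u" "\<And>u. \<sigma> \<le> u \<Longrightarrow> \<sigma> < t \<Longrightarrow> \<not> L u" "\<And>r u. r \<le> u \<Longrightarrow> L u \<Longrightarrow> L r"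
  shows "(\<lambda>k. \<Sum>i<gn k. (if L (gp k (i - 1)) then g (gq t k (Suc i)) - g (gq t k i) else 0)) \<longlonglongrightarrow> g \<sigma> - g 0"
proof -
  define A where "A k i = L (gp k (i - 1))" for k i
  \<comment> \<open>The number of cells over which the sum really runs: the first excluded index, or
    \<open>gn k\<close> if there is none.\<close>
  define j where "j k = (if \<forall>i<gn k. A k i then gn k else (LEAST i. \<not> A k i))" for k
  have anti: "A k i" if "i \<le> i'" "A k i'" for k i i'
    using L(3)[OF gp_mono[of "i - 1" "i' - 1" k]] that unfolding A_def by (simp add: diff_le_mono)
  have j_le: "j k \<le> gn k" for k
    unfolding j_def by (auto intro: order_trans[OF Least_le] less_imp_le)
  have A_j: "\<not> A k (j k)" if ex: "\<not> (\<forall>i<gn k. A k i)" for k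
  proof -
    have "j k = (LEAST i. \<not> A k i)" using ex by (auto simp: j_def)
    moreover obtain i where "\<not> A k i" using ex by blast
    then have "\<not> A k (LEAST i. \<not> A k i)" by (rule LeastI)
    ultimately show ?thesis by simp
  qed
  have A_iff: "A k i \<longleftrightarrow> i < j k" if "i < gn k" for k i
  proof (cases "\<forall>i<gn k. A k i")
    case True then show ?thesis using that by (simp add: j_def)
  next
    case False
    then have "\<not> A k (j k)" by (rule A_j)
    moreover have "A k i" if "i < j k" using that False not_less_Least[of i "\<lambda>i. \<not> A k i"] by (auto simp: j_def)
    ultimately show ?thesis using anti[of "j k" i k] by (meson not_le)
  qed
  have sum: "(\<Sum>i<gn k. (if L (gp k (i - 1)) then g (gq t k (Suc i)) - g (gq t k i) else 0)) = g (gq t k (j k)) - g 0" for k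
  proof -
    have "(\<Sum>i<gn k. (if L (gp k (i - 1)) then g (gq t k (Suc i)) - g (gq t k i) else 0)) =
      (\<Sum>i<gn k. if i < j k then g (gq t k (Suc i)) - g (gq t k i) else 0)"
      using A_iff[of _ k] by (intro sum.cong) (auto simp: A_def)
    also have "\<dots> = (\<Sum>i<j k. g (gq t k (Suc i)) - g (gq t k i))"
      using j_le[of k] by (intro sum.mono_neutral_cong_right) auto
    also have "\<dots> = g (gq t k (j k)) - g (gq t k 0)" by (rule sum_lessThan_telescope)
    finally show ?thesis using t by (simp add: gq_def)
  qed
  \<comment> \<open>One mesh is the lag, the other the length of the last cell. If
    \<open>\<sigma> = t\<close>, the bound holds because the grid is stopped at
    \<open>t\<close>.\<close>
  have up: "gq t k (j k) \<le> \<sigma> + 2 * (1 / real (Suc k))" for k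
  proof (cases "\<sigma> < t")
    case True
    have h: "0 \<le> 1 / real (Suc k)" by simp
    show ?thesis
    proof (cases "j k \<le> 1")
      case True
      then have "gp k (j k) \<le> gp k 1" by (rule gp_mono)
      also have "gp k 1 = 1 / real (Suc k)" by (simp add: gp_def)
      finally have "gp k (j k) \<le> 1 / real (Suc k)" .
      then show ?thesis using \<sigma> h unfolding gq_def atLeastAtMost_iff by linarith
    next
      case False
      then obtain m where m: "j k = Suc (Suc m)" by (metis One_nat_def Suc_le_eq less_Suc0 not_less_eq_eq old.nat.exhaust zero_le)
      have "A k (Suc m)" using A_iff[of "Suc m" k] j_le[of k] m by simp
      then have "L (gp k m)" by (simp add: A_def)
      then have "gp k m < \<sigma>" using L(2)[of "gp k m"] True by (meson not_le)
      moreover have "gp k (j k) = gp k m + 2 * (1 / real (Suc k))" unfolding m gp_Suc by simp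
      ultimately show ?thesis unfolding gq_def by linarith
    qed
  next
    case False
    have h: "0 \<le> 2 * (1 / real (Suc k))" by simp
    have "gq t k (j k) \<le> t" by (rule gq_range[OF t])
    then show ?thesis using False h by linarith
  qed
  \<comment> \<open>Once the grid covers \<open>[0,t]\<close>, either no cell is excluded or the
    lagged point of the first excluded cell is already at or beyond \<open>\<sigma>\<close>.\<close>
  have low: "eventually (\<lambda>k. \<sigma> \<le> gq t k (j k)) sequentially"
  proof -
    obtain k0 where k0: "t \<le> real k0" using real_arch_simple by blast
    have "\<sigma> \<le> gq t k (j k)" if k: "k0 \<le> k" for k
    proof (cases "\<forall>i<gn k. A k i")
      case True
      then have "gp k (j k) = real (Suc k)" by (simp add: j_def gp_gn)
      then show ?thesis using k k0 \<sigma> by (simp add: gq_def)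
    next
      case False
      then have "\<not> A k (j k)" by (rule A_j)
      then have "\<sigma> \<le> gp k (j k - 1)" using L(1)[OF gp_nonneg] unfolding A_def by (meson not_le)
      also have "\<dots> \<le> gp k (j k)" by (rule gp_mono) simp
      finally show ?thesis using \<sigma> by (simp add: gq_def)
    qed
    then show ?thesis unfolding eventually_sequentially by blast
  qed
  have lim2: "(\<lambda>k. \<sigma> + 2 * (1 / real (Suc k))) \<longlonglongrightarrow> \<sigma> + 2 * 0"
    by (intro tendsto_add tendsto_mult tendsto_const mesh_tendsto)
  have "(\<lambda>k. gq t k (j k)) \<longlonglongrightarrow> \<sigma>"
    by (rule tendsto_sandwich[OF low _ tendsto_const]) (use up lim2 in auto)
  then have "(\<lambda>k. g (gq t k (j k))) \<longlonglongrightarrow> g \<sigma>"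
    by (rule continuous_on_tendsto_compose[OF g]) (use \<sigma> gq_range(1)[OF t] in auto)
  then show ?thesis unfolding sum by (intro tendsto_diff tendsto_const)
qed

text \<open>The terms are compared with increments of the primitive of \<open>G\<close>, whose
  stopped sum telescopes; uniform continuity of \<open>G\<close> controls the differences.\<close>

lemma telescoping_riemann_sum:
  fixes G :: "real \<Rightarrow> real"
  assumes t: "0 \<le> t" and \<sigma>: "\<sigma> \<in> {0..t}" and G: "continuous_on {0..} G"
    and L: "\<And>u. 0 \<le> u \<Longrightarrow> u < \<sigma> \<Longrightarrow> L u" "\<And>u. \<sigma> \<le> u \<Longrightarrow> \<sigma> < t \<Longrightarrow> \<not> L u" "\<And>r u. r \<le> u \<Longrightarrow> L u \<Longrightarrow> L r"
  shows "(\<lambda>k. \<Sum>i<gn k. (if L (gp k (i - 1)) then (gq t k (Suc i) - gq t k i) * G (gp k i) else 0)) \<longlonglongrightarrow>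
    (LINT r:{0..t}|lborel. if L r then G r else 0)"
proof -
  define \<Gamma> where "\<Gamma> r = integral {0..r} G" for r
  have Gt: "continuous_on {0..u} G" for u by (rule continuous_on_subset[OF G]) auto
  have D: "(\<Gamma> has_real_derivative G q) (at q within {0..u})" if "0 \<le> q" "q \<le> u" for q u
    unfolding \<Gamma>_def using that by (intro integral_has_real_derivative[OF Gt]) auto
  have cont: "continuous_on {0..} \<Gamma>"
  proof (unfold continuous_on_def, safe)
    fix q :: real assume q: "0 \<le> q"
    have "(\<Gamma> \<longlongrightarrow> \<Gamma> q) (at q within {0..q + 1})"
      using DERIV_continuous[OF D[of q "q + 1"]] q by (simp add: continuous_within)
    moreover have "at q within {0..q + 1} = at q within {0..}"
      using q by (intro at_within_nhd[of _ "{..<q + 1}"]) auto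
    ultimately show "(\<Gamma> \<longlongrightarrow> \<Gamma> q) (at q within {0..})" by simp
  qed
  have tel: "(\<lambda>k. \<Sum>i<gn k. (if L (gp k (i - 1)) then \<Gamma> (gq t k (Suc i)) - \<Gamma> (gq t k i) else 0)) \<longlonglongrightarrow> \<Gamma> \<sigma> - \<Gamma> 0"
    by (rule telescoping_stopped_sum[OF t \<sigma> cont L])
  have err: "(\<lambda>k. \<Sum>i<gn k. (if L (gp k (i - 1)) then (gq t k (Suc i) - gq t k i) * G (gp k i) - (\<Gamma> (gq t k (Suc i)) - \<Gamma> (gq t k i)) else 0)) \<longlonglongrightarrow> 0"
  proof (rule LIMSEQ_I)
    fix e :: real assume e: "0 < e"
    define e' where "e' = e / (t + 1)"
    have e': "0 < e'" "e' * t < e" using e t by (auto simp: e'_def field_simps)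
    have "uniformly_continuous_on {0..t} G" by (intro compact_uniformly_continuous Gt) simp
    then obtain d where d: "0 < d" "\<And>r u. r \<in> {0..t} \<Longrightarrow> u \<in> {0..t} \<Longrightarrow> dist u r < d \<Longrightarrow> dist (G u) (G r) < e'"
      using e' unfolding uniformly_continuous_on_def by meson
    obtain k0 where k0: "\<And>k. k0 \<le> k \<Longrightarrow> 1 / real (Suc k) < d"
      using eventually_mesh[OF d(1)] unfolding eventually_sequentially by blast
    have "norm ((\<Sum>i<gn k. (if L (gp k (i - 1)) then (gq t k (Suc i) - gq t k i) * G (gp k i) - (\<Gamma> (gq t k (Suc i)) - \<Gamma> (gq t k i)) else 0)) - 0) < e" if k: "k0 \<le> k" for k
    proof -
      have one: "\<bar>(gq t k (Suc i) - gq t k i) * G (gp k i) - (\<Gamma> (gq t k (Suc i)) - \<Gamma> (gq t k i))\<bar> \<le> e' * (gq t k (Suc i) - gq t k i)" for i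
      proof (cases rule: gq_cases[of t k i])
        case 1
        let ?q = "gq t k i" and ?q' = "gq t k (Suc i)"
        have q: "?q \<in> {0..t}" "?q' \<in> {0..t}" "?q \<le> ?q'" "?q' - ?q < d"
          using gq_range[OF t] gq_mono[of i "Suc i" t k] gq_Suc_le[of t k i] k0[OF k] by auto
        obtain \<rho> where \<rho>: "\<rho> \<in> {?q..?q'}" "\<Gamma> ?q' - \<Gamma> ?q = G \<rho> * (?q' - ?q)"
          using mean_value_within[of ?q ?q' \<Gamma> G] D q by auto
        have "dist (G \<rho>) (G ?q) < e'" by (rule d(2)) (use q \<rho> in \<open>auto simp: dist_real_def\<close>)
        then have "\<bar>G ?q - G \<rho>\<bar> \<le> e'" by (simp add: dist_real_def abs_minus_commute)
        moreover have "(?q' - ?q) * G (gp k i) - (\<Gamma> ?q' - \<Gamma> ?q) = (G ?q - G \<rho>) * (?q' - ?q)"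
          unfolding \<rho>(2) 1(1)[symmetric] by (simp add: algebra_simps)
        ultimately show ?thesis using q(3) by (simp add: abs_mult mult_right_mono)
      next
        case 2 then show ?thesis by simp
      qed
      have "\<bar>\<Sum>i<gn k. (if L (gp k (i - 1)) then (gq t k (Suc i) - gq t k i) * G (gp k i) - (\<Gamma> (gq t k (Suc i)) - \<Gamma> (gq t k i)) else 0)\<bar>
        \<le> (\<Sum>i<gn k. e' * (gq t k (Suc i) - gq t k i))"
        using one gq_mono[of _ "Suc _" t k] e'(1) by (intro order_trans[OF sum_abs] sum_mono) auto
      also have "\<dots> \<le> e' * t"
        unfolding sum_distrib_left[symmetric] using sum_gq_le[OF t] e'(1) by (intro mult_left_mono) auto
      finally show ?thesis using e' by simp
    qed
    then show "\<exists>no. \<forall>k\<ge>no. norm ((\<Sum>i<gn k. (if L (gp k (i - 1)) then (gq t k (Suc i) - gq t k i) * G (gp k i) - (\<Gamma> (gq t k (Suc i)) - \<Gamma> (gq t k i)) else 0)) - 0) < e"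
      by blast
  qed
  have sum_eq: "(\<Sum>i<gn k. (if L (gp k (i - 1)) then (gq t k (Suc i) - gq t k i) * G (gp k i) else 0)) =
    (\<Sum>i<gn k. (if L (gp k (i - 1)) then (gq t k (Suc i) - gq t k i) * G (gp k i) - (\<Gamma> (gq t k (Suc i)) - \<Gamma> (gq t k i)) else 0)) +
    (\<Sum>i<gn k. (if L (gp k (i - 1)) then \<Gamma> (gq t k (Suc i)) - \<Gamma> (gq t k i) else 0))" for k
    unfolding sum.distrib[symmetric] by (intro sum.cong) auto
  have "(LINT r:{0..t}|lborel. if L r then G r else 0) = (LINT r:{0..\<sigma>}|lborel. G r)"
  proof -
    have i1: "set_integrable lborel {0..\<sigma>} G" using Gt by (rule borel_integrable_atLeastAtMost')
    have meas: "(\<lambda>r. indicator {0..\<sigma>} r *\<^sub>R G r) \<in> borel_measurable lborel"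
      using i1 unfolding set_integrable_def by auto
    \<comment> \<open>The value of \<open>L\<close> at \<open>\<sigma>\<close> itself may be
      unknown, but a single point does not affect the integral.\<close>
    have pt: "indicator {0..t} r *\<^sub>R (if L r then G r else 0) = indicator {0..\<sigma>} r *\<^sub>R G r" if "r \<noteq> \<sigma>" for r
    proof (cases "r < \<sigma>")
      case True then show ?thesis using L(1)[of r] \<sigma> by (auto simp: indicator_def)
    next
      case False
      then have "\<sigma> < r" using that by simp
      then show ?thesis using L(2)[of r] \<sigma> by (auto simp: indicator_def)
    qed
    define f where "f r = indicator {0..t} r *\<^sub>R (if L r then G r else 0)" for r
    have "f = (\<lambda>r. if r = \<sigma> then f \<sigma> else indicator {0..\<sigma>} r *\<^sub>R G r)" using pt by (auto simp: f_def)
    also have "\<dots> \<in> borel_measurable lborel" using meas by measurable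
    finally have "f \<in> borel_measurable lborel" .
    then show ?thesis
      unfolding set_lebesgue_integral_def f_def[symmetric]
      by (intro integral_cong_AE meas eventually_mono[OF AE_lborel_singleton[of \<sigma>]]) (auto simp: pt[folded f_def])
  qed
  also have "\<dots> = \<Gamma> \<sigma> - \<Gamma> 0"
    unfolding \<Gamma>_def using set_borel_integral_eq_integral(2)[OF borel_integrable_atLeastAtMost'[OF Gt]] by simp
  finally show ?thesis
    unfolding sum_eq using tendsto_add[OF err tel] by simp
qed

text \<open>Made for bounds by the weighted Young inequality: for fixed \<open>e\<close> the term
  \<open>b k / e\<close> becomes negligible, and \<open>e\<close> is arbitrary.\<close>

lemma tendsto_zero_of_split_bound:
  fixes a b :: "nat \<Rightarrow> real"
  assumes le: "\<And>e k. 0 < e \<Longrightarrow> a k \<le> b k / e + e * K" and a: "\<And>k. 0 \<le> a k" and b: "b \<longlonglongrightarrow> 0" and K: "0 \<le> K"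
  shows "a \<longlonglongrightarrow> 0"
proof (rule order_tendstoI)
  fix y :: real assume "y < 0"
  then show "eventually (\<lambda>k. y < a k) sequentially" using less_le_trans[OF _ a] by simp
next
  fix y :: real assume y: "0 < y"
  define e where "e = y / (2 * (K + 1))"
  have e: "0 < e" "e * K \<le> y / 2" using y K by (auto simp: e_def field_simps)
  have "eventually (\<lambda>k. b k < e * (y / 2)) sequentially"
    using y e by (intro order_tendstoD(2)[OF b]) auto
  then show "eventually (\<lambda>k. a k < y) sequentially"
  proof eventually_elim
    case (elim k)
    then have "b k / e < y / 2" using e by (simp add: divide_less_eq mult.commute)
    then show ?case using le[OF e(1), of k] e(2) by linarith
  qed
qed

lemma young: "0 < e \<Longrightarrow> \<bar>x * y\<bar> \<le> x\<^sup>2 / e + e * y\<^sup>2" for x y e :: real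
proof -
  assume e: "0 < e"
  have "0 \<le> (\<bar>x\<bar> - e * \<bar>y\<bar>)\<^sup>2" by simp
  then have "2 * e * \<bar>x * y\<bar> \<le> x\<^sup>2 + e\<^sup>2 * y\<^sup>2"
    by (simp add: power2_eq_square algebra_simps abs_mult)
  moreover have "e * \<bar>x * y\<bar> \<le> 2 * e * \<bar>x * y\<bar>" using e by simp
  moreover have "x\<^sup>2 + e\<^sup>2 * y\<^sup>2 = e * (x\<^sup>2 / e + e * y\<^sup>2)"
    using e by (simp add: power2_eq_square algebra_simps)
  ultimately have "e * \<bar>x * y\<bar> \<le> e * (x\<^sup>2 / e + e * y\<^sup>2)" by linarith
  then show ?thesis using e by simp
qed

lemma
  fixes f :: "'b \<Rightarrow> real"
  assumes "finite_measure N1" "finite_measure N2" and f: "integrable N1 f"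
  shows integrable_pair_fst: "integrable (N1 \<Otimes>\<^sub>M N2) (\<lambda>z. f (fst z))"
    and integral_pair_fst: "(\<integral>z. f (fst z) \<partial>(N1 \<Otimes>\<^sub>M N2)) = measure N2 (space N2) * (\<integral>x. f x \<partial>N1)"
proof -
  interpret N1: finite_measure N1 by fact
  interpret N2: finite_measure N2 by fact
  interpret P: pair_sigma_finite N1 N2 ..
  show i: "integrable (N1 \<Otimes>\<^sub>M N2) (\<lambda>z. f (fst z))"
    using f by (intro P.Fubini_integrable) auto
  show "(\<integral>z. f (fst z) \<partial>(N1 \<Otimes>\<^sub>M N2)) = measure N2 (space N2) * (\<integral>x. f x \<partial>N1)"
    using P.integral_fst'[OF i] by (simp add: mult.commute)
qed

lemma
  fixes f :: "'b \<Rightarrow> real"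
  assumes "finite_measure N1" "finite_measure N2" and f: "integrable N2 f"
  shows integrable_pair_snd: "integrable (N1 \<Otimes>\<^sub>M N2) (\<lambda>z. f (snd z))"
    and integral_pair_snd: "(\<integral>z. f (snd z) \<partial>(N1 \<Otimes>\<^sub>M N2)) = measure N1 (space N1) * (\<integral>x. f x \<partial>N2)"
proof -
  interpret N1: finite_measure N1 by fact
  interpret N2: finite_measure N2 by fact
  interpret P: pair_sigma_finite N1 N2 ..
  show i: "integrable (N1 \<Otimes>\<^sub>M N2) (\<lambda>z. f (snd z))"
    using f by (intro P.Fubini_integrable) auto
  show "(\<integral>z. f (snd z) \<partial>(N1 \<Otimes>\<^sub>M N2)) = measure N1 (space N1) * (\<integral>x. f x \<partial>N2)"
    using P.integral_fst'[OF i] by simp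
qed

context stefan
begin

section \<open>Ito's formula in mean\<close>

definition MQ :: "('a \<times> 'a \<times> real) measure" where
  "MQ = M \<Otimes>\<^sub>M Q"

lemma sets_MQ [measurable_cong]: "sets MQ = sets (M \<Otimes>\<^sub>M (M \<Otimes>\<^sub>M borel))"
  unfolding MQ_def by (rule sets_pair_measure_cong[OF refl sets_Q])

sublocale MQ: finite_measure MQ
  unfolding MQ_def by (intro finite_measure_pair_measure W.finite_measure_axioms Q.finite_measure_axioms)

sublocale PQ: pair_sigma_finite M Q ..

abbreviation mass :: real where "mass \<equiv> measure \<nu> UNIV"

lemma measure_Q: "measure Q (space Q) = mass"
  using integral_pair_snd[OF W.finite_measure_axioms \<nu>.finite_measure_axioms, of "\<lambda>_. 1"]
  by (simp add: Q_def W.prob_space)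

lemma measure_MQ: "measure MQ (space MQ) = mass"
  using integral_pair_snd[OF W.finite_measure_axioms Q.finite_measure_axioms, of "\<lambda>_. 1"]
  by (simp add: MQ_def W.prob_space measure_Q)

lemma X_MQ [measurable]: "(\<lambda>z. X (fst z) t (snd z)) \<in> borel_measurable MQ"
proof -
  have "(\<lambda>(\<omega>, x). X \<omega> t x) \<in> borel_measurable (M \<Otimes>\<^sub>M (M \<Otimes>\<^sub>M borel))"
    by (rule X_measurable_general) auto
  then show ?thesis by (simp add: split_beta cong: measurable_cong_sets add: sets_MQ)
qed

lemma live_MQ [measurable]: "Measurable.pred MQ (\<lambda>z. live (fst z) t (snd z))"
proof -
  have "Measurable.pred (M \<Otimes>\<^sub>M (M \<Otimes>\<^sub>M borel)) (\<lambda>(\<omega>, x). live \<omega> t x)"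
    by (rule live_measurable_general[of "max 0 t"]) auto
  then show ?thesis by (simp add: split_beta cong: measurable_cong_sets add: sets_MQ)
qed

text \<open>What is known at time \<open>p\<close>: both histories and the starting point. The two
  sample points are separate coordinates, so \<open>W\<close> and \<open>B\<close> are independent
  by the product structure.\<close>

abbreviation Hist :: "real \<Rightarrow> ('a \<times> 'a \<times> real) measure" where
  "Hist p \<equiv> HW p \<Otimes>\<^sub>M (HB p \<Otimes>\<^sub>M borel)"

lemma Hist_MQ: "f \<in> measurable (Hist p) L \<Longrightarrow> f \<in> measurable MQ L"
proof -
  assume f: "f \<in> measurable (Hist p) L"
  have [measurable]: "(\<lambda>x. x) \<in> measurable M (HW p)" "(\<lambda>x. x) \<in> measurable M (HB p)"
    by (rule W.measurable_from_H[of _ p], simp, rule B.measurable_from_H[of _ p], simp)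
  have "(\<lambda>z. ((\<lambda>x. x) (fst z), ((\<lambda>x. x) (fst (snd z)), snd (snd z)))) \<in> measurable MQ (Hist p)"
    by measurable
  from measurable_compose[OF this f] show ?thesis by simp
qed

lemma X_Hist: "r \<le> p \<Longrightarrow> (\<lambda>z. X (fst z) r (snd z)) \<in> borel_measurable (Hist p)"
  using X_measurable_general[of p "HW p" "HB p" r] W.adapted B.adapted by (simp add: split_beta)

text \<open>Survival at \<open>r\<close> involves the front at \<open>r\<close>, which is known only
  after \<open>r\<close>; hence the strict inequality. At time \<open>0\<close> survival depends on
  the starting point alone.\<close>

lemma live_Hist:
  assumes "r < p \<or> r = 0" "0 \<le> r" "0 \<le> p" shows "Measurable.pred (Hist p) (\<lambda>z. live (fst z) r (snd z))"
proof (cases "r = 0")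
  case True
  then show ?thesis by (simp add: live_0)
next
  case False
  then have rp: "r < p" using assms by simp
  have "Measurable.pred (Hist p) (\<lambda>(\<omega>, x). live \<omega> r x)"
  proof (rule live_measurable_general[of r])
    show "W q \<in> borel_measurable (HW p)" "B q \<in> borel_measurable (HB p)" if "q \<le> r" for q
      using that rp W.adapted[of q p] B.adapted[of q p] by auto
    show "(\<lambda>\<omega>. front \<omega> q) \<in> borel_measurable (HW p)" if "0 \<le> q" "q \<le> r" for q
      using that rp assms by (intro front_measurable[of p]) (auto intro: W.adapted)
  qed (use assms in auto)
  then show ?thesis by (simp add: split_beta)
qed

definition dW :: "real \<Rightarrow> real \<Rightarrow> 'a \<times> 'a \<times> real \<Rightarrow> real" where
  "dW p u z = W u (fst z) - W p (fst z)"

definition dB :: "real \<Rightarrow> real \<Rightarrow> 'a \<times> 'a \<times> real \<Rightarrow> real" where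
  "dB p u z = B u (fst (snd z)) - B p (fst (snd z))"

definition dX :: "real \<Rightarrow> real \<Rightarrow> 'a \<times> 'a \<times> real \<Rightarrow> real" where
  "dX p u z = X (fst z) u (snd z) - X (fst z) p (snd z)"

lemma dX_eq: "dX p u z = \<sigma> * dB p u z + \<theta> * dW p u z"
  by (simp add: dX_def dB_def dW_def X_def noise_def algebra_simps)

lemma dW_measurable [measurable]: "dW p u \<in> borel_measurable MQ"
  unfolding dW_def by measurable

lemma dB_measurable [measurable]: "dB p u \<in> borel_measurable MQ"
  unfolding dB_def by measurable

lemma dX_measurable [measurable]: "dX p u \<in> borel_measurable MQ"
  unfolding dX_def by measurable

lemma
  assumes "0 \<le> p" "p \<le> u"
  shows dW_fourth: "integrable MQ (\<lambda>z. dW p u z ^ 4)" "(\<integral>z. dW p u z ^ 4 \<partial>MQ) = mass * (3 * (u - p)\<^sup>2)"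
    and dB_fourth: "integrable MQ (\<lambda>z. dB p u z ^ 4)" "(\<integral>z. dB p u z ^ 4 \<partial>MQ) = mass * (3 * (u - p)\<^sup>2)"
proof -
  note fin = W.finite_measure_axioms Q.finite_measure_axioms \<nu>.finite_measure_axioms
  show "integrable MQ (\<lambda>z. dW p u z ^ 4)" "(\<integral>z. dW p u z ^ 4 \<partial>MQ) = mass * (3 * (u - p)\<^sup>2)"
    using integrable_pair_fst[OF fin(1,2) W.integrable_incr_power[OF assms, of 4]]
      integral_pair_fst[OF fin(1,2) W.integrable_incr_power[OF assms, of 4]]
      W.integral_incr_fourth[OF assms] by (simp_all add: MQ_def dW_def measure_Q)
  have i: "integrable Q (\<lambda>x. (B u (fst x) - B p (fst x)) ^ 4)"
    and e: "(\<integral>x. (B u (fst x) - B p (fst x)) ^ 4 \<partial>Q) = mass * (3 * (u - p)\<^sup>2)"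
    using integrable_pair_fst[OF fin(1,3) B.integrable_incr_power[OF assms, of 4]]
      integral_pair_fst[OF fin(1,3) B.integrable_incr_power[OF assms, of 4]]
      B.integral_incr_fourth[OF assms] by (simp_all add: Q_def)
  show "integrable MQ (\<lambda>z. dB p u z ^ 4)" "(\<integral>z. dB p u z ^ 4 \<partial>MQ) = mass * (3 * (u - p)\<^sup>2)"
    using integrable_pair_snd[OF fin(1,2) i] integral_pair_snd[OF fin(1,2) i] e
    by (simp_all add: MQ_def dB_def W.prob_space)
qed

text \<open>The factor \<open>24\<close> is \<open>8 * 3\<close>: \<open>8\<close> from the fourth
  power of a sum, \<open>3\<close> from the fourth moment of the standard normal law. The total mass
  appears because \<open>MQ\<close> is not normalized.\<close>

definition K4 :: real where "K4 = 24 * (\<sigma> ^ 4 + \<theta> ^ 4) * mass"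

lemma K4_nonneg: "0 \<le> K4"
  by (simp add: K4_def)

lemma fourth_power_sum: "(a + b) ^ 4 \<le> 8 * (a ^ 4 + b ^ 4)" for a b :: real
proof -
  have 1: "(a + b)\<^sup>2 \<le> 2 * (a\<^sup>2 + b\<^sup>2)" using sum_squares_bound[of a b] by (simp add: power2_sum)
  have "(a + b) ^ 4 = ((a + b)\<^sup>2)\<^sup>2" by simp
  also have "\<dots> \<le> (2 * (a\<^sup>2 + b\<^sup>2))\<^sup>2" using 1 by (intro power_mono) auto
  also have "\<dots> = 4 * (a\<^sup>2 + b\<^sup>2)\<^sup>2" unfolding power_mult_distrib by simp
  also have "(a\<^sup>2 + b\<^sup>2)\<^sup>2 \<le> 2 * ((a\<^sup>2)\<^sup>2 + (b\<^sup>2)\<^sup>2)"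
    using sum_squares_bound[of "a\<^sup>2" "b\<^sup>2"] by (simp add: power2_sum)
  finally show ?thesis by simp
qed

lemma
  assumes "0 \<le> p" "p \<le> u"
  shows dX_fourth_integrable: "integrable MQ (\<lambda>z. dX p u z ^ 4)"
    and dX_fourth: "(\<integral>z. dX p u z ^ 4 \<partial>MQ) \<le> K4 * (u - p)\<^sup>2"
proof -
  let ?b = "\<lambda>z. 8 * (\<sigma> ^ 4 * dB p u z ^ 4 + \<theta> ^ 4 * dW p u z ^ 4)"
  have b: "dX p u z ^ 4 \<le> ?b z" for z
    using fourth_power_sum[of "\<sigma> * dB p u z" "\<theta> * dW p u z"] by (simp add: dX_eq power_mult_distrib)
  have i: "integrable MQ ?b" using dB_fourth(1)[OF assms] dW_fourth(1)[OF assms] by simp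
  show i4: "integrable MQ (\<lambda>z. dX p u z ^ 4)"
    by (rule Bochner_Integration.integrable_bound[OF i]) (use b in \<open>auto intro!: AE_I2 order_trans[OF b]\<close>)
  have "(\<integral>z. dX p u z ^ 4 \<partial>MQ) \<le> (\<integral>z. ?b z \<partial>MQ)"
    by (rule integral_mono[OF i4 i b])
  also have "\<dots> = K4 * (u - p)\<^sup>2"
    using dB_fourth[OF assms] dW_fourth[OF assms] by (simp add: K4_def algebra_simps)
  finally show "(\<integral>z. dX p u z ^ 4 \<partial>MQ) \<le> K4 * (u - p)\<^sup>2" .
qed

lemma power2_le_fourth: "x\<^sup>2 \<le> 1 + x ^ 4" for x :: real
proof -
  have "0 \<le> (x\<^sup>2 - 1)\<^sup>2" by simp
  then have "2 * x\<^sup>2 \<le> 1 + x ^ 4" by (simp add: power2_diff)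
  then show ?thesis using zero_le_power2[of x] by linarith
qed

lemma dX_square_integrable: "0 \<le> p \<Longrightarrow> p \<le> u \<Longrightarrow> integrable MQ (\<lambda>z. (dX p u z)\<^sup>2)"
  by (rule Bochner_Integration.integrable_bound[of _ "\<lambda>z. 1 + dX p u z ^ 4"])
    (use dX_fourth_integrable[of p u] power2_le_fourth in \<open>auto intro!: AE_I2\<close>)

text \<open>With the starting point frozen, the factor \<open>Y\<close> is a random variable of the
  history of \<open>B\<close>, to which \<open>f\<close> applies.\<close>

lemma integral_Q_mult_incr:
  assumes Y: "Y \<in> borel_measurable (HB p \<Otimes>\<^sub>M borel)" "integrable Q Y" "integrable Q (\<lambda>x. Y x * f (B u (fst x) - B p (fst x)))"
    and f: "\<And>Z. Z \<in> borel_measurable (HB p) \<Longrightarrow> integrable M Z \<Longrightarrow> (\<integral>\<omega>. Z \<omega> * f (B u \<omega> - B p \<omega>) \<partial>M) = 0"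
  shows "(\<integral>x. Y x * f (B u (fst x) - B p (fst x)) \<partial>Q) = (0::real)"
proof -
  have i1: "integrable (M \<Otimes>\<^sub>M \<nu>) (\<lambda>(\<omega>, y). Y (\<omega>, y))" using Y(2) by (simp add: Q_def)
  have i2: "integrable (M \<Otimes>\<^sub>M \<nu>) (\<lambda>(\<omega>, y). Y (\<omega>, y) * f (B u \<omega> - B p \<omega>))"
    using Y(3) by (simp add: Q_def case_prod_unfold)
  have "(\<integral>x. Y x * f (B u (fst x) - B p (fst x)) \<partial>Q) = (\<integral>y. (\<integral>\<omega>. Y (\<omega>, y) * f (B u \<omega> - B p \<omega>) \<partial>M) \<partial>\<nu>)"
    using M\<nu>.integral_snd[OF i2] by (simp add: Q_def case_prod_unfold)
  also have "\<dots> = 0"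
  proof (rule integral_eq_zero_AE)
    show "AE y in \<nu>. (\<integral>\<omega>. Y (\<omega>, y) * f (B u \<omega> - B p \<omega>) \<partial>M) = 0"
      using M\<nu>.AE_integrable_snd[OF i1]
    proof eventually_elim
      case (elim y)
      have "(\<lambda>\<omega>. Y (\<omega>, y)) \<in> borel_measurable (HB p)"
        by (rule measurable_compose[OF _ Y(1)]) auto
      then show ?case by (rule f) fact
    qed
  qed
  finally show ?thesis .
qed

text \<open>The square is expanded into the squares of \<open>dB\<close> and \<open>dW\<close> and a
  mixed term. With the other coordinates frozen each centred term has mean zero, and the variances
  add up to \<open>2 * \<kappa>\<close>. Square integrability of \<open>Z\<close> and the fourth
  moments make all products integrable.\<close>

lemma integral_mult_dX_square:
  assumes Z: "Z \<in> borel_measurable (Hist p)" "integrable MQ (\<lambda>z. (Z z)\<^sup>2)" and p: "0 \<le> p" "p \<le> u"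
  shows "(\<integral>z. Z z * ((dX p u z)\<^sup>2 - 2 * \<kappa> * (u - p)) \<partial>MQ) = (0::real)"
proof -
  note [measurable] = Hist_MQ[OF Z(1)]
  let ?b = "\<lambda>z. (Z z)\<^sup>2 + dB p u z ^ 4 + dW p u z ^ 4 + 1"
  have ib: "integrable MQ ?b" using Z(2) dB_fourth(1)[OF p] dW_fourth(1)[OF p] by simp
  have y: "\<bar>x * y\<bar> \<le> x\<^sup>2 + y\<^sup>2" for x y :: real using young[of 1 x y] by simp
  have mono4: "0 \<le> dB p u z ^ 4" "0 \<le> dW p u z ^ 4" for z by auto
  have "norm (Z z) \<le> norm (?b z)" for z
  proof -
    have "\<bar>Z z\<bar> \<le> (Z z)\<^sup>2 + 1" using y[of "Z z" 1] by simp
    then have "\<bar>Z z\<bar> \<le> ?b z" using mono4[of z] by linarith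
    then show ?thesis unfolding real_norm_def by (rule order_trans) (rule abs_ge_self)
  qed
  then have i1: "integrable MQ Z"
    by (intro Bochner_Integration.integrable_bound[OF ib] AE_I2) auto
  have i2: "integrable MQ (\<lambda>z. Z z * (dB p u z)\<^sup>2)"
    by (rule Bochner_Integration.integrable_bound[OF ib])
      (use mono4 in \<open>auto intro!: AE_I2 order_trans[OF y[of "Z _" "(dB p u _)\<^sup>2"]] simp: abs_mult[symmetric]\<close>)
  have i3: "integrable MQ (\<lambda>z. Z z * (dW p u z)\<^sup>2)"
    by (rule Bochner_Integration.integrable_bound[OF ib])
      (use mono4 in \<open>auto intro!: AE_I2 order_trans[OF y[of "Z _" "(dW p u _)\<^sup>2"]] simp: abs_mult[symmetric]\<close>)
  have bw: "(dB p u z * dW p u z)\<^sup>2 \<le> dB p u z ^ 4 + dW p u z ^ 4" for z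
    using y[of "(dB p u z)\<^sup>2" "(dW p u z)\<^sup>2"] by (simp add: power_mult_distrib abs_mult)
  have i4: "integrable MQ (\<lambda>z. Z z * dB p u z * dW p u z)"
  proof (rule Bochner_Integration.integrable_bound[OF ib])
    show "AE z in MQ. norm (Z z * dB p u z * dW p u z) \<le> norm (?b z)"
      using y[of "Z _" "dB p u _ * dW p u _"] bw mono4 by (intro AE_I2) (smt (verit) mult.assoc real_norm_def zero_le_power2)
  qed measurable
  have i5: "integrable MQ (\<lambda>z. Z z * ((dB p u z)\<^sup>2 - (u - p)))" "integrable MQ (\<lambda>z. Z z * ((dW p u z)\<^sup>2 - (u - p)))"
    using i1 i2 i3 by (simp_all add: right_diff_distrib)
  have Zs: "(\<lambda>x. Z (\<omega>, x)) \<in> borel_measurable (HB p \<Otimes>\<^sub>M borel)" if "\<omega> \<in> space M" for \<omega>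
    using measurable_Pair2[OF Z(1), of \<omega>] that by (simp add: W.space_H)
  have Zf: "(\<lambda>\<omega>. Z (\<omega>, x)) \<in> borel_measurable (HW p)" if "x \<in> space Q" for x
    using measurable_Pair1[OF Z(1), of x] that by (simp add: B.space_H space_Q space_pair_measure)
  have e1: "(\<integral>z. Z z * ((dB p u z)\<^sup>2 - (u - p)) \<partial>MQ) = 0"
  proof -
    have "(\<integral>z. Z z * ((dB p u z)\<^sup>2 - (u - p)) \<partial>MQ) = (\<integral>\<omega>. (\<integral>x. Z (\<omega>, x) * ((B u (fst x) - B p (fst x))\<^sup>2 - (u - p)) \<partial>Q) \<partial>M)"
      using PQ.integral_fst'[of "\<lambda>z. Z z * ((dB p u z)\<^sup>2 - (u - p))"] i5(1) by (simp add: MQ_def dB_def)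
    also have "\<dots> = 0"
    proof (rule integral_eq_zero_AE)
      show "AE \<omega> in M. (\<integral>x. Z (\<omega>, x) * ((B u (fst x) - B p (fst x))\<^sup>2 - (u - p)) \<partial>Q) = 0"
        using PQ.AE_integrable_fst'[OF i1[unfolded MQ_def]] PQ.AE_integrable_fst'[OF i5(1)[unfolded MQ_def]] AE_space
      proof eventually_elim
        case (elim \<omega>)
        show ?case
          by (rule integral_Q_mult_incr[where f="\<lambda>h. h\<^sup>2 - (u - p)", OF Zs[OF elim(3)] elim(1)])
            (use elim(2) B.integral_mult_incr_square[OF _ _ p] in \<open>auto simp: dB_def\<close>)
      qed
    qed
    finally show ?thesis .
  qed
  have e2: "(\<integral>z. Z z * dB p u z * dW p u z \<partial>MQ) = 0"
  proof -
    have "(\<integral>z. Z z * dB p u z * dW p u z \<partial>MQ) = (\<integral>\<omega>. (\<integral>x. Z (\<omega>, x) * (B u (fst x) - B p (fst x)) * (W u \<omega> - W p \<omega>) \<partial>Q) \<partial>M)"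
      using PQ.integral_fst'[of "\<lambda>z. Z z * dB p u z * dW p u z"] i4 by (simp add: MQ_def dB_def dW_def)
    also have "\<dots> = 0"
    proof (rule integral_eq_zero_AE)
      have i6: "integrable MQ (\<lambda>z. Z z * dB p u z)"
      proof (rule Bochner_Integration.integrable_bound[OF ib])
        show "AE z in MQ. norm (Z z * dB p u z) \<le> norm (?b z)"
          using y[of "Z _" "dB p u _"] power2_le_fourth[of "dB p u _"] mono4
          by (intro AE_I2) (smt (verit) real_norm_def zero_le_power2)
      qed measurable
      show "AE \<omega> in M. (\<integral>x. Z (\<omega>, x) * (B u (fst x) - B p (fst x)) * (W u \<omega> - W p \<omega>) \<partial>Q) = 0"
        using PQ.AE_integrable_fst'[OF i1[unfolded MQ_def]] PQ.AE_integrable_fst'[OF i6[unfolded MQ_def]] AE_space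
      proof eventually_elim
        case (elim \<omega>)
        have "(\<integral>x. Z (\<omega>, x) * (B u (fst x) - B p (fst x)) \<partial>Q) = 0"
          by (rule integral_Q_mult_incr[where f="\<lambda>h. h", OF Zs[OF elim(3)] elim(1)])
            (use elim(2) B.integral_mult_incr[OF _ _ p] in \<open>auto simp: dB_def\<close>)
        then show ?case by simp
      qed
    qed
    finally show ?thesis .
  qed
  have e3: "(\<integral>z. Z z * ((dW p u z)\<^sup>2 - (u - p)) \<partial>MQ) = 0"
  proof -
    have i5': "integrable (M \<Otimes>\<^sub>M Q) (\<lambda>(\<omega>, x). Z (\<omega>, x) * ((W u \<omega> - W p \<omega>)\<^sup>2 - (u - p)))"
      using i5(2) by (simp add: MQ_def dW_def case_prod_unfold)
    have i1': "integrable (M \<Otimes>\<^sub>M Q) (\<lambda>(\<omega>, x). Z (\<omega>, x))"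
      using i1 by (simp add: MQ_def)
    have "(\<integral>z. Z z * ((dW p u z)\<^sup>2 - (u - p)) \<partial>MQ) = (\<integral>x. (\<integral>\<omega>. Z (\<omega>, x) * ((W u \<omega> - W p \<omega>)\<^sup>2 - (u - p)) \<partial>M) \<partial>Q)"
      using PQ.integral_snd[OF i5'] by (simp add: MQ_def dW_def case_prod_unfold)
    also have "\<dots> = 0"
    proof (rule integral_eq_zero_AE)
      show "AE x in Q. (\<integral>\<omega>. Z (\<omega>, x) * ((W u \<omega> - W p \<omega>)\<^sup>2 - (u - p)) \<partial>M) = 0"
        using PQ.AE_integrable_snd[OF i1'] AE_space
        by eventually_elim (rule W.integral_mult_incr_square[OF Zf _ p])
    qed
    finally show ?thesis .
  qed
  have "(\<integral>z. Z z * ((dX p u z)\<^sup>2 - 2 * \<kappa> * (u - p)) \<partial>MQ) =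
    (\<integral>z. \<sigma>\<^sup>2 * (Z z * ((dB p u z)\<^sup>2 - (u - p))) + \<theta>\<^sup>2 * (Z z * ((dW p u z)\<^sup>2 - (u - p))) + 2 * \<sigma> * \<theta> * (Z z * dB p u z * dW p u z) \<partial>MQ)"
    unfolding variance[symmetric] dX_eq
    by (intro Bochner_Integration.integral_cong refl) (simp add: power2_eq_square algebra_simps)
  also have "\<dots> = 0" using i4 i5 e1 e2 e3 by simp
  finally show ?thesis .
qed

end

section \<open>The discrete Ito formula and its errors\<close>

lemma tendsto_zero_of_eventually_le:
  fixes a :: "nat \<Rightarrow> real"
  assumes "\<And>e. 0 < e \<Longrightarrow> eventually (\<lambda>k. a k \<le> e * K) sequentially" and a: "\<And>k. 0 \<le> a k" and K: "0 \<le> K"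
  shows "a \<longlonglongrightarrow> 0"
proof (rule order_tendstoI)
  fix y :: real assume "y < 0"
  then show "eventually (\<lambda>k. y < a k) sequentially" using less_le_trans[OF _ a] by simp
next
  fix y :: real assume y: "0 < y"
  then have "0 < y / (K + 1)" using K by simp
  then have "eventually (\<lambda>k. a k \<le> y / (K + 1) * K) sequentially" by (rule assms(1))
  moreover have "y / (K + 1) * K < y" using y K by (simp add: field_simps)
  ultimately show "eventually (\<lambda>k. a k < y) sequentially" by (auto elim!: eventually_mono)
qed

lemma C12b_bounded:
  assumes "\<phi> \<in> C12b" "\<psi> \<in> {\<phi>, d_t \<phi>, d_x \<phi>, d_xx \<phi>}"
  shows "\<exists>c. \<forall>r x. 0 \<le> r \<longrightarrow> \<bar>\<psi> r x\<bar> \<le> c"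
proof -
  obtain c where "\<And>\<psi>. \<psi> \<in> {\<phi>, d_t \<phi>, d_x \<phi>, d_xx \<phi>} \<Longrightarrow> continuous_on ({0..} \<times> UNIV) (\<lambda>(r, x). \<psi> r x)"
    and c: "\<And>\<psi> r x. \<psi> \<in> {\<phi>, d_t \<phi>, d_x \<phi>, d_xx \<phi>} \<Longrightarrow> 0 \<le> r \<Longrightarrow> \<bar>\<psi> r x\<bar> \<le> c"
    using C12b_bound[OF assms(1)] by blast
  show ?thesis using c[OF assms(2)] by blast
qed

lemma stopped_telescope_index:
  fixes f :: "nat \<Rightarrow> real"
  assumes "\<And>i j. i \<le> j \<Longrightarrow> A j \<Longrightarrow> A i"
  shows "\<exists>j. (\<Sum>i<n. if A i then f (Suc i) - f i else 0) = f j - f 0"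
proof (induction n)
  case (Suc n)
  show ?case
  proof (cases "A n")
    case True
    have "(\<Sum>i<Suc n. if A i then f (Suc i) - f i else 0) = (\<Sum>i<Suc n. f (Suc i) - f i)"
      using assms[OF _ True] by (intro sum.cong) auto
    also have "\<dots> = f (Suc n) - f 0" by (rule sum_lessThan_telescope)
    finally show ?thesis by blast
  next
    case False then show ?thesis using Suc by simp
  qed
qed auto

context stefan
begin

text \<open>A discretization of \<open>N\<close>: increments of \<open>\<phi>\<close> minus drift
  over the cells that are entered alive. Survival is tested one grid point before the cell, and at
  \<open>0\<close> for the first cell.\<close>

definition Nk :: "(real \<Rightarrow> real \<Rightarrow> real) \<Rightarrow> real \<Rightarrow> nat \<Rightarrow> 'a \<times> 'a \<times> real \<Rightarrow> real" where
  "Nk \<phi> t k z =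
    (\<Sum>i<gn k. if live (fst z) (gp k (i - 1)) (snd z)
       then \<phi> (gq t k (Suc i)) (X (fst z) (gq t k (Suc i)) (snd z)) - \<phi> (gq t k i) (X (fst z) (gq t k i) (snd z)) else 0)
    - (\<Sum>i<gn k. if live (fst z) (gp k (i - 1)) (snd z)
       then (gq t k (Suc i) - gq t k i) * gen \<phi> (gp k i) (X (fst z) (gp k i) (snd z)) else 0)"

definition coef :: "(real \<Rightarrow> real \<Rightarrow> real) \<Rightarrow> nat \<Rightarrow> nat \<Rightarrow> 'a \<times> 'a \<times> real \<Rightarrow> real" where
  "coef \<psi> k i z = (if live (fst z) (gp k (i - 1)) (snd z) then \<psi> (gp k i) (X (fst z) (gp k i) (snd z)) else 0)"

definition Mk :: "(real \<Rightarrow> real \<Rightarrow> real) \<Rightarrow> real \<Rightarrow> nat \<Rightarrow> 'a \<times> 'a \<times> real \<Rightarrow> real" where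
  "Mk \<phi> t k z = (\<Sum>i<gn k. coef (d_x \<phi>) k i z * dX (gq t k i) (gq t k (Suc i)) z)"

text \<open>The quadratic error of a cell, the squared increment minus its mean, weighted with the
  second derivative.\<close>

definition zk :: "(real \<Rightarrow> real \<Rightarrow> real) \<Rightarrow> real \<Rightarrow> nat \<Rightarrow> nat \<Rightarrow> 'a \<times> 'a \<times> real \<Rightarrow> real" where
  "zk \<phi> t k i z = coef (d_xx \<phi>) k i z * ((dX (gq t k i) (gq t k (Suc i)) z)\<^sup>2 - 2 * \<kappa> * (gq t k (Suc i) - gq t k i))"

abbreviation path :: "'a \<times> 'a \<times> real \<Rightarrow> real \<Rightarrow> real" where
  "path z \<equiv> (\<lambda>r. X (fst z) r (snd z))"

text \<open>An exact identity: the drift \<open>\<kappa> * d_xx \<phi>\<close> is half of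
  \<open>2 * \<kappa>\<close> times the second derivative, so it centres the second-order Taylor
  term.\<close>

lemma Nk_minus_Mk:
  "Nk \<phi> t k z - Mk \<phi> t k z =
    (\<Sum>i<gn k. if live (fst z) (gp k (i - 1)) (snd z) then errT \<phi> (path z) t k i + errR \<phi> (path z) t k i else 0)
    + (\<Sum>i<gn k. zk \<phi> t k i z) / 2"
  unfolding Nk_def Mk_def sum_subtractf[symmetric] sum_divide_distrib sum.distrib[symmetric]
proof (intro sum.cong refl)
  fix i
  show "(if live (fst z) (gp k (i - 1)) (snd z)
       then \<phi> (gq t k (Suc i)) (X (fst z) (gq t k (Suc i)) (snd z)) - \<phi> (gq t k i) (X (fst z) (gq t k i) (snd z)) else 0)
    - (if live (fst z) (gp k (i - 1)) (snd z)
       then (gq t k (Suc i) - gq t k i) * gen \<phi> (gp k i) (X (fst z) (gp k i) (snd z)) else 0)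
    - coef (d_x \<phi>) k i z * dX (gq t k i) (gq t k (Suc i)) z =
    (if live (fst z) (gp k (i - 1)) (snd z) then errT \<phi> (path z) t k i + errR \<phi> (path z) t k i else 0) + zk \<phi> t k i z / 2"
  proof (cases "live (fst z) (gp k (i - 1)) (snd z)")
    case True
    then show ?thesis
      by (simp add: errT_def errR_def zk_def coef_def dX_def gen_def field_simps)
  qed (simp add: zk_def coef_def)
qed

lemma coef_measurable:
  assumes "continuous_on ({0..} \<times> UNIV) (\<lambda>(r, x). \<psi> r x)"
  shows "coef \<psi> k i \<in> borel_measurable MQ"
proof -
  have [measurable]: "\<psi> (gp k i) \<in> borel_measurable borel" by (rule measurable_section[OF assms gp_nonneg])
  show ?thesis unfolding coef_def by measurable
qed

text \<open>The lag is used here: survival is tested strictly before \<open>gp k j\<close>, or at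
  time \<open>0\<close>, and so belongs to the history at \<open>gp k j\<close>.\<close>

lemma coef_Hist:
  assumes "continuous_on ({0..} \<times> UNIV) (\<lambda>(r, x). \<psi> r x)" "i \<le> j"
  shows "coef \<psi> k i \<in> borel_measurable (Hist (gp k j))"
proof -
  have [measurable]: "\<psi> (gp k i) \<in> borel_measurable borel" by (rule measurable_section[OF assms(1) gp_nonneg])
  have [measurable]: "(\<lambda>z. X (fst z) (gp k i) (snd z)) \<in> borel_measurable (Hist (gp k j))"
    by (rule X_Hist[OF gp_mono[OF assms(2)]])
  have "gp k (i - 1) < gp k j \<or> gp k (i - 1) = 0"
    using gp_strict_mono[of "i - 1" j k] assms(2) by (cases i) auto
  then have [measurable]: "Measurable.pred (Hist (gp k j)) (\<lambda>z. live (fst z) (gp k (i - 1)) (snd z))"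
    by (rule live_Hist[OF _ gp_nonneg gp_nonneg])
  show ?thesis unfolding coef_def by measurable
qed

lemma coef_bound: "(\<And>r x. 0 \<le> r \<Longrightarrow> \<bar>\<psi> r x\<bar> \<le> c) \<Longrightarrow> \<bar>coef \<psi> k i z\<bar> \<le> c"
  using gp_nonneg[of k i] order_trans[OF abs_ge_zero, of "\<psi> (gp k i) 0" c] by (auto simp: coef_def)

text \<open>Cells that begin at or after \<open>t\<close> contribute nothing, so no information
  beyond \<open>t\<close> enters.\<close>

lemma Nk_FW:
  assumes \<phi>: "\<phi> \<in> C12b" and t: "0 \<le> t"
  shows "Nk \<phi> t k \<in> borel_measurable (FW t \<Otimes>\<^sub>M Q)"
proof -
  have c: "continuous_on ({0..} \<times> UNIV) (\<lambda>(r, x). \<phi> r x)" using C12b_bound[OF \<phi>] by blast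
  have cg: "continuous_on ({0..} \<times> UNIV) (\<lambda>(r, x). gen \<phi> r x)" using C12b_gen[OF \<phi>] by blast
  have 1: "(\<lambda>z. if live (fst z) (gp k (i - 1)) (snd z)
       then \<phi> (gq t k (Suc i)) (X (fst z) (gq t k (Suc i)) (snd z)) - \<phi> (gq t k i) (X (fst z) (gq t k i) (snd z)) else 0)
       \<in> borel_measurable (FW t \<Otimes>\<^sub>M Q) \<and>
    (\<lambda>z. if live (fst z) (gp k (i - 1)) (snd z)
       then (gq t k (Suc i) - gq t k i) * gen \<phi> (gp k i) (X (fst z) (gp k i) (snd z)) else 0)
       \<in> borel_measurable (FW t \<Otimes>\<^sub>M Q)" for i
  proof (cases rule: gq_cases[of t k i])
    case 1
    have le: "gp k (i - 1) \<le> t" using 1(2) gp_mono[of "i - 1" i k] by simp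
    have [measurable]: "Measurable.pred (FW t \<Otimes>\<^sub>M Q) (\<lambda>z. live (fst z) (gp k (i - 1)) (snd z))"
      using live_FW[OF t le] by (simp add: split_beta)
    have X [measurable]: "(\<lambda>z. X (fst z) r (snd z)) \<in> borel_measurable (FW t \<Otimes>\<^sub>M Q)" if "r \<le> t" for r
      using X_FW[OF that] by (simp add: split_beta)
    have [measurable]: "(\<lambda>z. X (fst z) (gq t k (Suc i)) (snd z)) \<in> borel_measurable (FW t \<Otimes>\<^sub>M Q)"
      "(\<lambda>z. X (fst z) (gq t k i) (snd z)) \<in> borel_measurable (FW t \<Otimes>\<^sub>M Q)"
      "(\<lambda>z. X (fst z) (gp k i) (snd z)) \<in> borel_measurable (FW t \<Otimes>\<^sub>M Q)"
      using gq_range(2)[OF t] 1(2) by (auto intro: X)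
    have [measurable]: "\<phi> (gq t k (Suc i)) \<in> borel_measurable borel" "\<phi> (gq t k i) \<in> borel_measurable borel"
      "gen \<phi> (gp k i) \<in> borel_measurable borel"
      by (rule measurable_section[OF c gq_range(1)[OF t]] measurable_section[OF cg gp_nonneg])+
    show ?thesis by (intro conjI) measurable
  next
    case 2
    show ?thesis unfolding 2(1,2) by (simp only: diff_self mult_zero_left if_cancel) simp
  qed
  show ?thesis
    unfolding Nk_def using 1 by (intro borel_measurable_diff borel_measurable_sum) auto
qed

lemma FW_MQ: "f \<in> borel_measurable (FW t \<Otimes>\<^sub>M Q) \<Longrightarrow> f \<in> borel_measurable MQ" for f :: "_ \<Rightarrow> real"
proof -
  assume f: "f \<in> borel_measurable (FW t \<Otimes>\<^sub>M Q)"
  have [measurable]: "(\<lambda>x. x) \<in> measurable M (FW t)" by (rule FW_M[of _ t]) simp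
  have "(\<lambda>z. ((\<lambda>x. x) (fst z), snd z)) \<in> measurable MQ (FW t \<Otimes>\<^sub>M Q)"
    unfolding MQ_def by measurable
  from measurable_compose[OF this f] show ?thesis by simp
qed

lemma stop_live:
  assumes x: "s0 < snd x" and t: "0 \<le> t"
  shows "0 \<le> u \<Longrightarrow> u < stop \<omega> t x \<Longrightarrow> live \<omega> u x" and "stop \<omega> t x \<le> u \<Longrightarrow> stop \<omega> t x < t \<Longrightarrow> \<not> live \<omega> u x"
proof -
  show "0 \<le> u \<Longrightarrow> u < stop \<omega> t x \<Longrightarrow> live \<omega> u x"
    using live_antimono[of u t \<omega> x] live_iff_tau[OF x t, of \<omega> u] x by (auto simp: stop_def absorbed_def split: if_splits)
  show "stop \<omega> t x \<le> u \<Longrightarrow> stop \<omega> t x < t \<Longrightarrow> \<not> live \<omega> u x"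
    using live_iff_tau[OF x t, of \<omega> u] x by (auto simp: stop_def absorbed_def split: if_splits)
qed

lemma X_0: "X \<omega> 0 x = snd x"
  by (simp add: X_def noise_neg)

lemma continuous_on_path:
  assumes "continuous_on ({0..} \<times> UNIV) (\<lambda>(r, x). \<psi> r x)"
  shows "continuous_on {0..} (\<lambda>r. \<psi> r (X \<omega> r x))"
proof -
  have "continuous_on {0..} (\<lambda>r. (\<lambda>(r, x). \<psi> r x) (r, X \<omega> r x))"
    by (rule continuous_on_compose2[OF assms]) (auto intro!: continuous_intros continuous_on_subset[OF X_cont])
  then show ?thesis by simp
qed

lemma Nk_tendsto:
  assumes \<phi>: "\<phi> \<in> C12b" and t: "0 \<le> t"
  shows "(\<lambda>k. Nk \<phi> t k z) \<longlonglongrightarrow> N \<phi> t (fst z) (snd z)"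
proof (cases "s0 < snd (snd z)")
  case True
  let ?\<omega> = "fst z" and ?x = "snd z"
  have c: "continuous_on ({0..} \<times> UNIV) (\<lambda>(r, x). \<phi> r x)" using C12b_bound[OF \<phi>] by blast
  have cg: "continuous_on ({0..} \<times> UNIV) (\<lambda>(r, x). gen \<phi> r x)" using C12b_gen[OF \<phi>] by blast
  note S = stop_range[OF t, of ?\<omega> ?x] and L = stop_live[OF True t]
  have a: "r \<le> u \<Longrightarrow> live ?\<omega> u ?x \<Longrightarrow> live ?\<omega> r ?x" for r u by (rule live_antimono)
  have "(\<lambda>k. Nk \<phi> t k z) \<longlonglongrightarrow> (\<phi> (stop ?\<omega> t ?x) (X ?\<omega> (stop ?\<omega> t ?x) ?x) - \<phi> 0 (X ?\<omega> 0 ?x)) -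
      (LINT r:{0..t}|lborel. if live ?\<omega> r ?x then gen \<phi> r (X ?\<omega> r ?x) else 0)"
    unfolding Nk_def
    using telescoping_stopped_sum[OF t S continuous_on_path[OF c], of "\<lambda>u. live ?\<omega> u ?x"]
      telescoping_riemann_sum[OF t S continuous_on_path[OF cg], of "\<lambda>u. live ?\<omega> u ?x"] L a
    by (intro tendsto_diff) blast+
  then show ?thesis using True by (simp add: N_def X_0)
next
  case False
  then have "\<not> live (fst z) u (snd z)" for u using live_s0 by blast
  then show ?thesis using False by (simp add: Nk_def N_def)
qed

lemma N_FW: "\<phi> \<in> C12b \<Longrightarrow> 0 \<le> t \<Longrightarrow> (\<lambda>z. N \<phi> t (fst z) (snd z)) \<in> borel_measurable (FW t \<Otimes>\<^sub>M Q)"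
  using Nk_tendsto Nk_FW by (rule borel_measurable_LIMSEQ_real)

text \<open>Telescoping bounds the first sum by \<open>2 * c\<close> whatever the number of cells,
  and the drift by its rate times \<open>t\<close>. Uniformity in \<open>k\<close> and
  \<open>z\<close> provides the dominating function of the limits below.\<close>

lemma Nk_bounded:
  assumes \<phi>: "\<phi> \<in> C12b"
  shows "\<exists>c d. 0 \<le> d \<and> (\<forall>t k z. 0 \<le> t \<longrightarrow> \<bar>Nk \<phi> t k z\<bar> \<le> c + d * t)"
proof -
  obtain c where c: "\<And>r x. 0 \<le> r \<Longrightarrow> \<bar>\<phi> r x\<bar> \<le> c" using C12b_bounded[OF \<phi>, of "\<phi>"] by auto
  obtain d where "continuous_on ({0..} \<times> UNIV) (\<lambda>(r, x). gen \<phi> r x)"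
    and d: "\<And>r x. 0 \<le> r \<Longrightarrow> \<bar>gen \<phi> r x\<bar> \<le> d" using C12b_gen[OF \<phi>] by blast
  have d0: "0 \<le> d" using d[of 0 0] by simp
  have "\<bar>Nk \<phi> t k z\<bar> \<le> 2 * c + d * t" if t: "0 \<le> t" for t k z
  proof -
    obtain j where j: "(\<Sum>i<gn k. if live (fst z) (gp k (i - 1)) (snd z)
       then \<phi> (gq t k (Suc i)) (X (fst z) (gq t k (Suc i)) (snd z)) - \<phi> (gq t k i) (X (fst z) (gq t k i) (snd z)) else 0) =
       \<phi> (gq t k j) (X (fst z) (gq t k j) (snd z)) - \<phi> (gq t k 0) (X (fst z) (gq t k 0) (snd z))"
      using stopped_telescope_index[of "\<lambda>i. live (fst z) (gp k (i - 1)) (snd z)" "\<lambda>i. \<phi> (gq t k i) (X (fst z) (gq t k i) (snd z))" "gn k"]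
        live_antimono[OF gp_mono[OF diff_le_mono]] by blast
    have 1: "\<bar>\<Sum>i<gn k. if live (fst z) (gp k (i - 1)) (snd z)
       then \<phi> (gq t k (Suc i)) (X (fst z) (gq t k (Suc i)) (snd z)) - \<phi> (gq t k i) (X (fst z) (gq t k i) (snd z)) else 0\<bar> \<le> 2 * c"
      unfolding j
      using c[OF gq_range(1)[OF t], of k j "X (fst z) (gq t k j) (snd z)"]
        c[OF gq_range(1)[OF t], of k 0 "X (fst z) (gq t k 0) (snd z)"] by linarith
    have "\<bar>\<Sum>i<gn k. if live (fst z) (gp k (i - 1)) (snd z)
       then (gq t k (Suc i) - gq t k i) * gen \<phi> (gp k i) (X (fst z) (gp k i) (snd z)) else 0\<bar>
       \<le> (\<Sum>i<gn k. d * (gq t k (Suc i) - gq t k i))"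
    proof (intro order_trans[OF sum_abs] sum_mono)
      fix i
      have g: "0 \<le> gq t k (Suc i) - gq t k i" using gq_mono[of i "Suc i" t k] by simp
      show "\<bar>if live (fst z) (gp k (i - 1)) (snd z)
       then (gq t k (Suc i) - gq t k i) * gen \<phi> (gp k i) (X (fst z) (gp k i) (snd z)) else 0\<bar> \<le> d * (gq t k (Suc i) - gq t k i)"
        using mult_left_mono[OF d[OF gp_nonneg] g, of k i "X (fst z) (gp k i) (snd z)"] g d0 by (auto simp: abs_mult mult.commute)
    qed
    also have "\<dots> \<le> d * t"
      unfolding sum_distrib_left[symmetric] using sum_gq_le[OF t] d0 by (intro mult_left_mono) auto
    finally show ?thesis using 1 unfolding Nk_def by linarith
  qed
  with d0 show ?thesis by blast
qed

lemma N_bounded_linear: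
  assumes \<phi>: "\<phi> \<in> C12b"
  shows "\<exists>c d. 0 \<le> d \<and> (\<forall>t k z. 0 \<le> t \<longrightarrow> \<bar>Nk \<phi> t k z\<bar> \<le> c + d * t) \<and>
    (\<forall>t \<omega> x. 0 \<le> t \<longrightarrow> \<bar>N \<phi> t \<omega> x\<bar> \<le> c + d * t)"
proof -
  obtain c d where b: "0 \<le> d" "\<forall>t k z. 0 \<le> t \<longrightarrow> \<bar>Nk \<phi> t k z\<bar> \<le> c + d * t"
    using Nk_bounded[OF assms] by blast
  have "\<bar>N \<phi> t \<omega> x\<bar> \<le> c + d * t" if t: "0 \<le> t" for t \<omega> x
    using tendsto_upperbound[OF tendsto_rabs[OF Nk_tendsto[OF \<phi> t, of "(\<omega>, x)"]], of "c + d * t"] b(2) t by simp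
  with b show ?thesis by blast
qed

lemma N_bounded:
  assumes \<phi>: "\<phi> \<in> C12b" and t: "0 \<le> t"
  shows "\<exists>b. (\<forall>k z. \<bar>Nk \<phi> t k z\<bar> \<le> b) \<and> (\<forall>\<omega> x. \<bar>N \<phi> t \<omega> x\<bar> \<le> b)"
  using N_bounded_linear[OF \<phi>] t by blast

lemma err_measurable:
  assumes \<phi>: "\<phi> \<in> C12b" and t: "0 \<le> t"
  shows "(\<lambda>z. errT \<phi> (path z) t k i) \<in> borel_measurable MQ" "(\<lambda>z. errR \<phi> (path z) t k i) \<in> borel_measurable MQ"
proof -
  have c: "continuous_on ({0..} \<times> UNIV) (\<lambda>(r, x). \<psi> r x)" if "\<psi> \<in> {\<phi>, d_t \<phi>, d_x \<phi>, d_xx \<phi>}" for \<psi>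
    using C12b_bound[OF \<phi>] that by blast
  have [measurable]: "\<phi> (gq t k (Suc i)) \<in> borel_measurable borel" "\<phi> (gq t k i) \<in> borel_measurable borel"
      "d_t \<phi> (gp k i) \<in> borel_measurable borel" "d_x \<phi> (gp k i) \<in> borel_measurable borel" "d_xx \<phi> (gp k i) \<in> borel_measurable borel"
    by (rule measurable_section[OF c gq_range(1)[OF t]] measurable_section[OF c gp_nonneg]; simp)+
  show "(\<lambda>z. errT \<phi> (path z) t k i) \<in> borel_measurable MQ" "(\<lambda>z. errR \<phi> (path z) t k i) \<in> borel_measurable MQ"
    unfolding errT_def errR_def by measurable
qed

text \<open>The sum is bounded by a multiple of \<open>t\<close> and tends to \<open>0\<close> along
  every path, so bounded convergence applies.\<close>

lemma time_error_tendsto: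
  assumes \<phi>: "\<phi> \<in> C12b" and t: "0 \<le> t"
  shows "(\<lambda>k. \<integral>z. (\<Sum>i<gn k. \<bar>errT \<phi> (path z) t k i\<bar>) \<partial>MQ) \<longlonglongrightarrow> 0"
    and "integrable MQ (\<lambda>z. \<Sum>i<gn k. \<bar>errT \<phi> (path z) t k i\<bar>)"
proof -
  obtain c where c: "\<And>r x. 0 \<le> r \<Longrightarrow> \<bar>d_t \<phi> r x\<bar> \<le> c" using C12b_bounded[OF \<phi>, of "d_t \<phi>"] by auto
  have c0: "0 \<le> c" using c[of 0 0] by simp
  have b: "(\<Sum>i<gn k. \<bar>errT \<phi> (path z) t k i\<bar>) \<le> 2 * c * t" for k z
  proof -
    have "(\<Sum>i<gn k. \<bar>errT \<phi> (path z) t k i\<bar>) \<le> (\<Sum>i<gn k. 2 * c * (gq t k (Suc i) - gq t k i))"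
      by (intro sum_mono errT_bound[OF \<phi> t c])
    also have "\<dots> \<le> 2 * c * t"
      unfolding sum_distrib_left[symmetric] using sum_gq_le[OF t] c0 by (intro mult_left_mono) auto
    finally show ?thesis .
  qed
  have m: "(\<lambda>z. \<Sum>i<gn k. \<bar>errT \<phi> (path z) t k i\<bar>) \<in> borel_measurable MQ" for k
    using err_measurable(1)[OF assms] by (intro borel_measurable_sum) auto
  show "integrable MQ (\<lambda>z. \<Sum>i<gn k. \<bar>errT \<phi> (path z) t k i\<bar>)"
    using b m by (intro MQ.integrable_const_bound[of _ "2 * c * t"]) (auto simp: sum_nonneg)
  have "(\<lambda>k. \<integral>z. (\<Sum>i<gn k. \<bar>errT \<phi> (path z) t k i\<bar>) \<partial>MQ) \<longlonglongrightarrow> (\<integral>z. 0 \<partial>MQ)"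
  proof (rule integral_dominated_convergence[where w="\<lambda>_. 2 * c * t"])
    show "AE z in MQ. (\<lambda>k. \<Sum>i<gn k. \<bar>errT \<phi> (path z) t k i\<bar>) \<longlonglongrightarrow> 0"
    proof (rule AE_I2, rule tendsto_zero_of_eventually_le[where K=t])
      fix z and e :: real assume e: "0 < e"
      from errors_small[OF \<phi> t X_cont[of "fst z" "snd z"] e]
      show "eventually (\<lambda>k. (\<Sum>i<gn k. \<bar>errT \<phi> (path z) t k i\<bar>) \<le> e * t) sequentially"
      proof eventually_elim
        case (elim k)
        have "(\<Sum>i<gn k. \<bar>errT \<phi> (path z) t k i\<bar>) \<le> (\<Sum>i<gn k. e * (gq t k (Suc i) - gq t k i))"
          using elim by (intro sum_mono) auto
        also have "\<dots> \<le> e * t"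
          unfolding sum_distrib_left[symmetric] using sum_gq_le[OF t] e by (intro mult_left_mono) auto
        finally show ?case .
      qed
    qed (auto simp: t sum_nonneg)
  qed (use b m in \<open>auto simp: sum_nonneg\<close>)
  then show "(\<lambda>k. \<integral>z. (\<Sum>i<gn k. \<bar>errT \<phi> (path z) t k i\<bar>) \<partial>MQ) \<longlonglongrightarrow> 0" by simp
qed

text \<open>The remainder is \<open>\<rho>\<close> times the squared increment, with
  \<open>\<rho>\<close> bounded and tending to \<open>0\<close> along each path, but sums of squared
  increments have no deterministic bound. Young's inequality weighted with the cell length
  \<open>d\<close> gives \<open>d * \<rho>^2 / e\<close> plus \<open>e * dX^4 / d\<close>: the first
  part sums to a bounded quantity that tends to \<open>0\<close>, the second has mean at most
  \<open>e * K4 * t\<close>.\<close>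

lemma space_error_tendsto:
  assumes \<phi>: "\<phi> \<in> C12b" and t: "0 \<le> t"
  shows "(\<lambda>k. \<integral>z. (\<Sum>i<gn k. \<bar>errR \<phi> (path z) t k i\<bar>) \<partial>MQ) \<longlonglongrightarrow> 0"
    and "integrable MQ (\<lambda>z. \<Sum>i<gn k. \<bar>errR \<phi> (path z) t k i\<bar>)"
proof -
  obtain c where c: "\<And>r x. 0 \<le> r \<Longrightarrow> \<bar>d_xx \<phi> r x\<bar> \<le> c" using C12b_bounded[OF \<phi>, of "d_xx \<phi>"] by auto
  have c0: "0 \<le> c" using c[of 0 0] by simp
  let ?d = "\<lambda>k i. gq t k (Suc i) - gq t k i"
  let ?X = "\<lambda>k i. dX (gq t k i) (gq t k (Suc i))"
  have d0: "0 \<le> ?d k i" for k i using gq_mono[of i "Suc i" t k] by simp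
  have R: "\<bar>errR \<phi> (path z) t k i\<bar> \<le> c * (?X k i z)\<^sup>2" for k i z
    using errR_bound[OF \<phi> t c, of "path z" k i] by (simp add: dX_def)
  \<comment> \<open>Division by zero gives \<open>0\<close>, which is right here: the remainder
    vanishes together with the increment.\<close>
  define \<rho> where "\<rho> k i z = \<bar>errR \<phi> (path z) t k i\<bar> / (?X k i z)\<^sup>2" for k i z
  define V where "V k z = (\<Sum>i<gn k. ?d k i * (\<rho> k i z)\<^sup>2)" for k z
  have [measurable]: "(\<lambda>z. errR \<phi> (path z) t k i) \<in> borel_measurable MQ" for k i by (rule err_measurable[OF assms])
  have [measurable]: "\<rho> k i \<in> borel_measurable MQ" for k i unfolding \<rho>_def by measurable
  have [measurable]: "V k \<in> borel_measurable MQ" for k unfolding V_def by measurable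
  have \<rho>_nonneg: "0 \<le> \<rho> k i z" for k i z by (simp add: \<rho>_def)
  have \<rho>_le: "\<rho> k i z \<le> e" if "\<bar>errR \<phi> (path z) t k i\<bar> \<le> e * (?X k i z)\<^sup>2" "0 \<le> e" for k i z e
    using that by (cases "?X k i z = 0") (auto simp: \<rho>_def divide_le_eq)
  have V_le: "V k z \<le> e\<^sup>2 * t" if "\<And>i. \<rho> k i z \<le> e" for k z e
  proof -
    have "V k z \<le> (\<Sum>i<gn k. ?d k i * e\<^sup>2)"
      unfolding V_def using that \<rho>_nonneg by (intro sum_mono mult_left_mono power_mono d0)
    also have "\<dots> \<le> t * e\<^sup>2"
      unfolding sum_distrib_right[symmetric] using sum_gq_le[OF t] by (intro mult_right_mono) auto
    finally show ?thesis by (simp add: mult.commute)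
  qed
  have V_nonneg: "0 \<le> V k z" for k z unfolding V_def using d0 by (intro sum_nonneg) simp
  have Vb: "V k z \<le> c\<^sup>2 * t" for k z by (intro V_le \<rho>_le R c0)
  have V_int: "integrable MQ (V k)" for k
    using Vb V_nonneg by (intro MQ.integrable_const_bound[of _ "c\<^sup>2 * t"]) auto
  have V_lim: "(\<lambda>k. \<integral>z. V k z \<partial>MQ) \<longlonglongrightarrow> 0"
  proof -
    have "(\<lambda>k. \<integral>z. V k z \<partial>MQ) \<longlonglongrightarrow> (\<integral>z. 0 \<partial>MQ)"
    proof (rule integral_dominated_convergence[where w="\<lambda>_. c\<^sup>2 * t"])
      show "AE z in MQ. (\<lambda>k. V k z) \<longlonglongrightarrow> 0"
      proof (rule AE_I2, rule tendsto_zero_of_eventually_le[where K=t])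
        fix z and e :: real assume e: "0 < e"
        then have "0 < sqrt e" by simp
        from errors_small[OF \<phi> t X_cont[of "fst z" "snd z"] this]
        show "eventually (\<lambda>k. V k z \<le> e * t) sequentially"
        proof eventually_elim
          case (elim k)
          have "V k z \<le> (sqrt e)\<^sup>2 * t"
            using elim e by (intro V_le \<rho>_le) (auto simp: dX_def)
          then show ?case using e by simp
        qed
      qed (auto simp: t V_nonneg)
    qed (use Vb V_nonneg in auto)
    then show ?thesis by simp
  qed
  have R_int: "integrable MQ (\<lambda>z. \<bar>errR \<phi> (path z) t k i\<bar>)" for k i
  proof (rule Bochner_Integration.integrable_bound)
    show "integrable MQ (\<lambda>z. c * (?X k i z)\<^sup>2)"
      using dX_square_integrable[OF gq_range(1)[OF t] gq_mono[of i "Suc i" t k]] by simp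
  qed (use R c0 in \<open>auto intro!: AE_I2 simp: abs_mult\<close>)
  show int: "integrable MQ (\<lambda>z. \<Sum>i<gn k. \<bar>errR \<phi> (path z) t k i\<bar>)" for k
    by (intro Bochner_Integration.integrable_sum R_int)
  show "(\<lambda>k. \<integral>z. (\<Sum>i<gn k. \<bar>errR \<phi> (path z) t k i\<bar>) \<partial>MQ) \<longlonglongrightarrow> 0"
  proof (rule tendsto_zero_of_split_bound[OF _ _ V_lim])
    show "0 \<le> (\<integral>z. (\<Sum>i<gn k. \<bar>errR \<phi> (path z) t k i\<bar>) \<partial>MQ)" for k
      by (intro integral_nonneg_AE AE_I2 sum_nonneg) auto
    show "0 \<le> K4 * t" using K4_nonneg t by simp
    fix e :: real and k assume e: "0 < e"
    have one: "\<bar>errR \<phi> (path z) t k i\<bar> \<le> ?d k i * (\<rho> k i z)\<^sup>2 / e + e * (?X k i z ^ 4 / ?d k i)" for z i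
    proof (cases "?d k i = 0")
      case True
      then have "?X k i z = 0" by (simp add: dX_def)
      then show ?thesis using R[of z k i] True by simp
    next
      case False
      then have dp: "0 < ?d k i" using d0[of k i] by simp
      have "\<bar>errR \<phi> (path z) t k i\<bar> = \<rho> k i z * (?X k i z)\<^sup>2"
        using R[of z k i] by (cases "?X k i z = 0") (auto simp: \<rho>_def)
      also have "\<dots> = (sqrt (?d k i) * \<rho> k i z) * ((?X k i z)\<^sup>2 / sqrt (?d k i))" using dp by simp
      also have "\<dots> \<le> (sqrt (?d k i) * \<rho> k i z)\<^sup>2 / e + e * ((?X k i z)\<^sup>2 / sqrt (?d k i))\<^sup>2"
        by (rule order_trans[OF abs_ge_self young[OF e]])
      also have "\<dots> = ?d k i * (\<rho> k i z)\<^sup>2 / e + e * (?X k i z ^ 4 / ?d k i)"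
        using dp by (simp add: power_mult_distrib power_divide)
      finally show ?thesis .
    qed
    have X4: "integrable MQ (\<lambda>z. ?X k i z ^ 4)" "(\<integral>z. ?X k i z ^ 4 \<partial>MQ) \<le> K4 * (?d k i)\<^sup>2" for i
      using dX_fourth_integrable[OF gq_range(1)[OF t] gq_mono[of i "Suc i" t k]]
        dX_fourth[OF gq_range(1)[OF t] gq_mono[of i "Suc i" t k]] by auto
    have "(\<integral>z. (\<Sum>i<gn k. \<bar>errR \<phi> (path z) t k i\<bar>) \<partial>MQ) \<le>
      (\<integral>z. V k z / e + (\<Sum>i<gn k. e * (?X k i z ^ 4 / ?d k i)) \<partial>MQ)"
    proof (rule integral_mono[OF int])
      show "integrable MQ (\<lambda>z. V k z / e + (\<Sum>i<gn k. e * (?X k i z ^ 4 / ?d k i)))"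
        using V_int X4(1) by (intro Bochner_Integration.integrable_add Bochner_Integration.integrable_sum) auto
      show "(\<Sum>i<gn k. \<bar>errR \<phi> (path z) t k i\<bar>) \<le> V k z / e + (\<Sum>i<gn k. e * (?X k i z ^ 4 / ?d k i))" for z
        unfolding V_def sum_divide_distrib sum.distrib[symmetric] by (intro sum_mono one)
    qed
    also have "\<dots> = (\<integral>z. V k z \<partial>MQ) / e + (\<Sum>i<gn k. e * ((\<integral>z. ?X k i z ^ 4 \<partial>MQ) / ?d k i))"
      using V_int X4(1) by (subst Bochner_Integration.integral_add) auto
    also have "(\<Sum>i<gn k. e * ((\<integral>z. ?X k i z ^ 4 \<partial>MQ) / ?d k i)) \<le> (\<Sum>i<gn k. e * (K4 * ?d k i))"
    proof (intro sum_mono mult_left_mono)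
      fix i
      show "(\<integral>z. ?X k i z ^ 4 \<partial>MQ) / ?d k i \<le> K4 * ?d k i"
        using X4(2)[of i] d0[of k i] K4_nonneg by (cases "?d k i = 0") (auto simp: divide_le_eq power2_eq_square mult.assoc)
    qed (use e in simp)
    also have "\<dots> \<le> e * (K4 * t)"
      unfolding sum_distrib_left[symmetric] using sum_gq_le[OF t] e K4_nonneg by (intro mult_left_mono) auto
    finally show "(\<integral>z. (\<Sum>i<gn k. \<bar>errR \<phi> (path z) t k i\<bar>) \<partial>MQ) \<le> (\<integral>z. V k z \<partial>MQ) / e + e * (K4 * t)" by simp
  qed
qed

lemma zk_Hist:
  assumes \<phi>: "\<phi> \<in> C12b" and ij: "i < j" and j: "gp k j \<le> t"
  shows "zk \<phi> t k i \<in> borel_measurable (Hist (gp k j))"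
proof -
  have c: "continuous_on ({0..} \<times> UNIV) (\<lambda>(r, x). d_xx \<phi> r x)" using C12b_bound[OF \<phi>] by blast
  have [measurable]: "coef (d_xx \<phi>) k i \<in> borel_measurable (Hist (gp k j))"
    using ij by (intro coef_Hist[OF c]) simp
  have "gq t k i \<le> gp k j" "gq t k (Suc i) \<le> gp k j"
    using gp_mono[of i j k] gp_mono[of "Suc i" j k] ij by (auto simp: gq_def)
  from this[THEN X_Hist] have [measurable]: "dX (gq t k i) (gq t k (Suc i)) \<in> borel_measurable (Hist (gp k j))"
    unfolding dX_def by measurable
  show ?thesis unfolding zk_def by measurable
qed

text \<open>Fourth moments of the increments make the mean square of order the squared cell length;
  the factor \<open>2\<close> comes from the square of a difference.\<close>

lemma zk_square:
  assumes \<phi>: "\<phi> \<in> C12b" and t: "0 \<le> t" and c: "\<And>r x. 0 \<le> r \<Longrightarrow> \<bar>d_xx \<phi> r x\<bar> \<le> c"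
  shows "integrable MQ (\<lambda>z. (zk \<phi> t k i z)\<^sup>2)"
    and "(\<integral>z. (zk \<phi> t k i z)\<^sup>2 \<partial>MQ) \<le> c\<^sup>2 * (2 * (K4 + 4 * \<kappa>\<^sup>2 * mass)) * (gq t k (Suc i) - gq t k i)\<^sup>2"
    and "zk \<phi> t k i \<in> borel_measurable MQ"
proof -
  let ?d = "gq t k (Suc i) - gq t k i"
  let ?X = "dX (gq t k i) (gq t k (Suc i))"
  have cc: "continuous_on ({0..} \<times> UNIV) (\<lambda>(r, x). d_xx \<phi> r x)" using C12b_bound[OF \<phi>] by blast
  have [measurable]: "coef (d_xx \<phi>) k i \<in> borel_measurable MQ" by (rule coef_measurable[OF cc])
  show m [measurable]: "zk \<phi> t k i \<in> borel_measurable MQ" unfolding zk_def by measurable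
  have c0: "0 \<le> c" using c[of 0 0] by simp
  have co: "\<bar>coef (d_xx \<phi>) k i z\<bar> \<le> c" for z by (rule coef_bound[OF c])
  let ?b = "\<lambda>z. c\<^sup>2 * (2 * (?X z ^ 4 + 4 * \<kappa>\<^sup>2 * ?d\<^sup>2))"
  have b: "(zk \<phi> t k i z)\<^sup>2 \<le> ?b z" for z
  proof -
    have "(coef (d_xx \<phi>) k i z)\<^sup>2 \<le> c\<^sup>2" using co[of z] c0 by (simp add: abs_le_square_iff[symmetric])
    moreover have "((?X z)\<^sup>2 - 2 * \<kappa> * ?d)\<^sup>2 \<le> 2 * (?X z ^ 4 + 4 * \<kappa>\<^sup>2 * ?d\<^sup>2)"
    proof -
      have "0 \<le> ((?X z)\<^sup>2 + 2 * \<kappa> * ?d)\<^sup>2" by simp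
      then show ?thesis by (simp add: power2_sum power2_diff power_mult_distrib)
    qed
    ultimately show ?thesis unfolding zk_def power_mult_distrib by (intro mult_mono) auto
  qed
  have X4: "integrable MQ (\<lambda>z. ?X z ^ 4)" "(\<integral>z. ?X z ^ 4 \<partial>MQ) \<le> K4 * ?d\<^sup>2"
    using dX_fourth_integrable[OF gq_range(1)[OF t] gq_mono[of i "Suc i" t k]]
      dX_fourth[OF gq_range(1)[OF t] gq_mono[of i "Suc i" t k]] by auto
  have ib: "integrable MQ ?b" using X4(1) by simp
  show i: "integrable MQ (\<lambda>z. (zk \<phi> t k i z)\<^sup>2)"
    by (rule Bochner_Integration.integrable_bound[OF ib]) (use b in \<open>auto intro!: AE_I2 order_trans[OF b]\<close>)
  have "(\<integral>z. (zk \<phi> t k i z)\<^sup>2 \<partial>MQ) \<le> (\<integral>z. ?b z \<partial>MQ)" by (rule integral_mono[OF i ib b])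
  also have "\<dots> = c\<^sup>2 * (2 * ((\<integral>z. ?X z ^ 4 \<partial>MQ) + 4 * \<kappa>\<^sup>2 * ?d\<^sup>2 * mass))"
    using X4(1) measure_MQ by simp
  also have "\<dots> \<le> c\<^sup>2 * (2 * (K4 * ?d\<^sup>2 + 4 * \<kappa>\<^sup>2 * ?d\<^sup>2 * mass))"
    using X4(2) by (intro mult_left_mono add_right_mono) auto
  also have "\<dots> = c\<^sup>2 * (2 * (K4 + 4 * \<kappa>\<^sup>2 * mass)) * ?d\<^sup>2" by (simp add: algebra_simps)
  finally show "(\<integral>z. (zk \<phi> t k i z)\<^sup>2 \<partial>MQ) \<le> c\<^sup>2 * (2 * (K4 + 4 * \<kappa>\<^sup>2 * mass)) * ?d\<^sup>2" .
qed

lemma zk_product_integrable: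
  assumes "\<phi> \<in> C12b" "0 \<le> t"
  shows "integrable MQ (\<lambda>z. zk \<phi> t k i z * zk \<phi> t k j z)"
proof -
  obtain c where c: "\<And>r x. 0 \<le> r \<Longrightarrow> \<bar>d_xx \<phi> r x\<bar> \<le> c" using C12b_bounded[OF assms(1), of "d_xx \<phi>"] by auto
  note z = zk_square[OF assms c]
  show ?thesis
    by (rule Bochner_Integration.integrable_bound[OF Bochner_Integration.integrable_add[OF z(1)[of k i] z(1)[of k j]]])
      (use z(3) young[of 1] in \<open>auto intro!: AE_I2 simp: abs_mult[symmetric]\<close>)
qed

text \<open>The earlier error and the later coefficient are both known when the later cell begins,
  and its centred square then has mean zero.\<close>

lemma zk_orthogonal:
  assumes \<phi>: "\<phi> \<in> C12b" and t: "0 \<le> t" and ij: "i < j"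
  shows "(\<integral>z. zk \<phi> t k i z * zk \<phi> t k j z \<partial>MQ) = 0"
proof (cases rule: gq_cases[of t k j])
  case 1
  obtain c where c: "\<And>r x. 0 \<le> r \<Longrightarrow> \<bar>d_xx \<phi> r x\<bar> \<le> c" using C12b_bounded[OF \<phi>, of "d_xx \<phi>"] by auto
  have c0: "0 \<le> c" using c[of 0 0] by simp
  have cc: "continuous_on ({0..} \<times> UNIV) (\<lambda>(r, x). d_xx \<phi> r x)" using C12b_bound[OF \<phi>] by blast
  note z = zk_square[OF \<phi> t c]
  let ?Z = "\<lambda>z. zk \<phi> t k i z * coef (d_xx \<phi>) k j z"
  have Zm: "?Z \<in> borel_measurable (Hist (gp k j))"
    using zk_Hist[OF \<phi> ij] coef_Hist[OF cc order_refl, of k j] 1(2) by (intro borel_measurable_times) auto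
  have Zi: "integrable MQ (\<lambda>z. (?Z z)\<^sup>2)"
  proof (rule Bochner_Integration.integrable_bound[OF integrable_mult_right[OF z(1), of "c\<^sup>2" k i]])
    show "(\<lambda>z. (?Z z)\<^sup>2) \<in> borel_measurable MQ" using Hist_MQ[OF Zm] by measurable
    have "(coef (d_xx \<phi>) k j z)\<^sup>2 \<le> c\<^sup>2" for z
      using coef_bound[where \<psi>="d_xx \<phi>", OF c, of k j z] c0 by (simp add: abs_le_square_iff[symmetric])
    then show "AE z in MQ. norm ((?Z z)\<^sup>2) \<le> norm (c\<^sup>2 * (zk \<phi> t k i z)\<^sup>2)"
      by (intro AE_I2) (simp add: power_mult_distrib mult.commute mult_right_mono)
  qed
  have "(\<integral>z. ?Z z * ((dX (gp k j) (gq t k (Suc j)) z)\<^sup>2 - 2 * \<kappa> * (gq t k (Suc j) - gp k j)) \<partial>MQ) = 0"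
    by (rule integral_mult_dX_square[OF Zm Zi gp_nonneg]) (use gq_mono[of j "Suc j" t k] 1(1) in simp)
  then show ?thesis unfolding zk_def[of \<phi> t k j] 1(1) by (simp add: mult.assoc)
next
  case 2
  then have "zk \<phi> t k j z = 0" for z by (simp add: zk_def dX_def)
  then show ?thesis by simp
qed

text \<open>Orthogonality leaves only the diagonal, of the size of the sum of squared cell lengths,
  which is at most the mesh times \<open>t\<close>. The second moment controls the first.\<close>

lemma quadratic_error_tendsto:
  assumes \<phi>: "\<phi> \<in> C12b" and t: "0 \<le> t"
  shows "(\<lambda>k. \<integral>z. \<bar>\<Sum>i<gn k. zk \<phi> t k i z\<bar> \<partial>MQ) \<longlonglongrightarrow> 0"
    and "integrable MQ (\<lambda>z. \<Sum>i<gn k. zk \<phi> t k i z)"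
proof -
  obtain c where c: "\<And>r x. 0 \<le> r \<Longrightarrow> \<bar>d_xx \<phi> r x\<bar> \<le> c" using C12b_bounded[OF \<phi>, of "d_xx \<phi>"] by auto
  note z = zk_square[OF \<phi> t c]
  define D where "D = c\<^sup>2 * (2 * (K4 + 4 * \<kappa>\<^sup>2 * mass))"
  have D0: "0 \<le> D" unfolding D_def using K4_nonneg by simp
  let ?Y = "\<lambda>k z. \<Sum>i<gn k. zk \<phi> t k i z"
  have sq: "(?Y k z)\<^sup>2 = (\<Sum>i<gn k. \<Sum>j<gn k. zk \<phi> t k i z * zk \<phi> t k j z)" for k z
    by (simp add: power2_eq_square sum_product)
  have Y2i: "integrable MQ (\<lambda>z. (?Y k z)\<^sup>2)" for k
    unfolding sq by (intro Bochner_Integration.integrable_sum zk_product_integrable[OF \<phi> t])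
  have Y2: "(\<integral>z. (?Y k z)\<^sup>2 \<partial>MQ) \<le> D * t * (1 / real (Suc k))" for k
  proof -
    have off: "(\<integral>z. zk \<phi> t k i z * zk \<phi> t k j z \<partial>MQ) = (if i = j then (\<integral>z. (zk \<phi> t k i z)\<^sup>2 \<partial>MQ) else 0)" for i j
      using zk_orthogonal[OF \<phi> t, of i j k] zk_orthogonal[OF \<phi> t, of j i k]
      by (cases i j rule: linorder_cases) (auto simp: mult.commute power2_eq_square)
    have "(\<integral>z. (?Y k z)\<^sup>2 \<partial>MQ) = (\<Sum>i<gn k. \<Sum>j<gn k. (\<integral>z. zk \<phi> t k i z * zk \<phi> t k j z \<partial>MQ))"
      unfolding sq using zk_product_integrable[OF \<phi> t]
      by (simp add: Bochner_Integration.integral_sum Bochner_Integration.integrable_sum)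
    also have "\<dots> = (\<Sum>i<gn k. (\<integral>z. (zk \<phi> t k i z)\<^sup>2 \<partial>MQ))" unfolding off by simp
    also have "\<dots> \<le> (\<Sum>i<gn k. D * t * 0 + D * (1 / real (Suc k)) * (gq t k (Suc i) - gq t k i))"
    proof (rule sum_mono)
      fix i
      have d: "0 \<le> gq t k (Suc i) - gq t k i" "gq t k (Suc i) - gq t k i \<le> 1 / real (Suc k)"
        using gq_mono[of i "Suc i" t k] gq_Suc_le[of t k i] by auto
      have "(\<integral>z. (zk \<phi> t k i z)\<^sup>2 \<partial>MQ) \<le> D * (gq t k (Suc i) - gq t k i)\<^sup>2" using z(2)[of k i] by (simp add: D_def)
      also have "\<dots> \<le> D * (1 / real (Suc k) * (gq t k (Suc i) - gq t k i))"
        unfolding power2_eq_square using d D0 by (intro mult_left_mono mult_right_mono) auto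
      finally show "(\<integral>z. (zk \<phi> t k i z)\<^sup>2 \<partial>MQ) \<le> D * t * 0 + D * (1 / real (Suc k)) * (gq t k (Suc i) - gq t k i)"
        by (simp add: mult.assoc)
    qed
    also have "\<dots> = D * (1 / real (Suc k)) * (\<Sum>i<gn k. gq t k (Suc i) - gq t k i)"
      by (simp add: sum_distrib_left)
    also have "\<dots> \<le> D * (1 / real (Suc k)) * t"
      using D0 sum_gq_le[OF t] by (intro mult_left_mono) auto
    finally show ?thesis by (simp add: mult.commute mult.left_commute)
  qed
  have Ym: "?Y k \<in> borel_measurable MQ" for k using z(3) by (intro borel_measurable_sum) auto
  have le: "\<bar>?Y k z\<bar> \<le> (?Y k z)\<^sup>2 / e + e" if "0 < e" for e k z using young[OF that, of "?Y k z" 1] by simp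
  show Yi: "integrable MQ (?Y k)" for k
    by (rule Bochner_Integration.integrable_bound[of _ "\<lambda>z. (?Y k z)\<^sup>2 + 1"])
      (use Y2i[of k] Ym le[of 1] in \<open>auto intro!: AE_I2\<close>)
  show "(\<lambda>k. \<integral>z. \<bar>?Y k z\<bar> \<partial>MQ) \<longlonglongrightarrow> 0"
  proof (rule tendsto_zero_of_split_bound[where b="\<lambda>k. D * t * (1 / real (Suc k))" and K=mass])
    fix e :: real and k assume e: "0 < e"
    have "(\<integral>z. \<bar>?Y k z\<bar> \<partial>MQ) \<le> (\<integral>z. (?Y k z)\<^sup>2 / e + e \<partial>MQ)"
      using Yi[of k] Y2i[of k] le[OF e] by (intro integral_mono) auto
    also have "\<dots> = (\<integral>z. (?Y k z)\<^sup>2 \<partial>MQ) / e + e * mass"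
      using Y2i[of k] by (simp add: measure_MQ mult.commute)
    also have "\<dots> \<le> D * t * (1 / real (Suc k)) / e + e * mass"
      using Y2[of k] e by (intro add_right_mono divide_right_mono) auto
    finally show "(\<integral>z. \<bar>?Y k z\<bar> \<partial>MQ) \<le> D * t * (1 / real (Suc k)) / e + e * mass" .
  next
    have "(\<lambda>k. D * t * (1 / real (Suc k))) \<longlonglongrightarrow> D * t * 0" by (intro tendsto_mult tendsto_const mesh_tendsto)
    then show "(\<lambda>k. D * t * (1 / real (Suc k))) \<longlonglongrightarrow> 0" by simp
  qed auto
qed

text \<open>\<open>N\<close> is compared with \<open>Nk\<close> by bounded convergence and
  \<open>Nk\<close> with \<open>Mk\<close> through the three errors. The increments of
  \<open>X\<close> in \<open>Mk\<close> are unbounded; its integrability is read off from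
  \<open>Nk\<close> and the difference.\<close>

lemma ito_formula_mean:
  assumes \<phi>: "\<phi> \<in> C12b" and t: "0 \<le> t"
  shows "(\<lambda>k. \<integral>z. \<bar>N \<phi> t (fst z) (snd z) - Mk \<phi> t k z\<bar> \<partial>MQ) \<longlonglongrightarrow> 0"
    and "integrable MQ (\<lambda>z. N \<phi> t (fst z) (snd z))" and "integrable MQ (Mk \<phi> t k)"
proof -
  let ?N = "\<lambda>z. N \<phi> t (fst z) (snd z)"
  obtain b where b: "\<And>k z. \<bar>Nk \<phi> t k z\<bar> \<le> b" "\<And>\<omega> x. \<bar>N \<phi> t \<omega> x\<bar> \<le> b" using N_bounded[OF assms] by blast
  have Nm [measurable]: "?N \<in> borel_measurable MQ" by (rule FW_MQ[OF N_FW[OF assms]])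
  have Nkm [measurable]: "Nk \<phi> t k \<in> borel_measurable MQ" for k by (rule FW_MQ[OF Nk_FW[OF assms]])
  have Nki: "integrable MQ (Nk \<phi> t k)" for k using b by (intro MQ.integrable_const_bound[of _ b]) auto
  show Ni: "integrable MQ ?N" using b by (intro MQ.integrable_const_bound[of _ b]) auto
  have l1: "(\<lambda>k. \<integral>z. \<bar>?N z - Nk \<phi> t k z\<bar> \<partial>MQ) \<longlonglongrightarrow> (\<integral>z. 0 \<partial>MQ)"
  proof (rule integral_dominated_convergence[where w="\<lambda>_. 2 * b"])
    show "AE z in MQ. (\<lambda>k. \<bar>?N z - Nk \<phi> t k z\<bar>) \<longlonglongrightarrow> 0"
    proof (rule AE_I2)
      fix z
      have "(\<lambda>k. \<bar>?N z - Nk \<phi> t k z\<bar>) \<longlonglongrightarrow> \<bar>?N z - ?N z\<bar>"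
        by (intro tendsto_rabs tendsto_diff tendsto_const Nk_tendsto[OF assms])
      then show "(\<lambda>k. \<bar>?N z - Nk \<phi> t k z\<bar>) \<longlonglongrightarrow> 0" by simp
    qed
    show "AE z in MQ. norm \<bar>?N z - Nk \<phi> t k z\<bar> \<le> 2 * b" for k
    proof (rule AE_I2)
      fix z show "norm \<bar>?N z - Nk \<phi> t k z\<bar> \<le> 2 * b"
        using b(1)[of k z] b(2)[of "fst z" "snd z"] by simp
    qed
  qed auto
  define E where "E k z = (\<Sum>i<gn k. \<bar>errT \<phi> (path z) t k i\<bar>) + (\<Sum>i<gn k. \<bar>errR \<phi> (path z) t k i\<bar>) + \<bar>\<Sum>i<gn k. zk \<phi> t k i z\<bar> / 2" for k z
  have Ei: "integrable MQ (E k)" for k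
    unfolding E_def using time_error_tendsto(2)[OF assms] space_error_tendsto(2)[OF assms] quadratic_error_tendsto(2)[OF assms] by auto
  have le: "\<bar>Nk \<phi> t k z - Mk \<phi> t k z\<bar> \<le> E k z" for k z
  proof -
    have "\<bar>\<Sum>i<gn k. if live (fst z) (gp k (i - 1)) (snd z) then errT \<phi> (path z) t k i + errR \<phi> (path z) t k i else 0\<bar> \<le>
      (\<Sum>i<gn k. \<bar>errT \<phi> (path z) t k i\<bar> + \<bar>errR \<phi> (path z) t k i\<bar>)"
      by (intro order_trans[OF sum_abs] sum_mono) auto
    then show ?thesis
      unfolding Nk_minus_Mk E_def sum.distrib
      using abs_triangle_ineq[of "\<Sum>i<gn k. if live (fst z) (gp k (i - 1)) (snd z) then errT \<phi> (path z) t k i + errR \<phi> (path z) t k i else 0" "(\<Sum>i<gn k. zk \<phi> t k i z) / 2"]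
      by (simp add: abs_divide)
  qed
  have dm: "(\<lambda>z. Nk \<phi> t k z - Mk \<phi> t k z) \<in> borel_measurable MQ" for k
    unfolding Nk_minus_Mk
  proof (intro borel_measurable_add borel_measurable_sum borel_measurable_divide)
    fix i
    have [measurable]: "(\<lambda>z. errT \<phi> (path z) t k i) \<in> borel_measurable MQ" "(\<lambda>z. errR \<phi> (path z) t k i) \<in> borel_measurable MQ"
      by (rule err_measurable[OF assms])+
    show "(\<lambda>z. if live (fst z) (gp k (i - 1)) (snd z) then errT \<phi> (path z) t k i + errR \<phi> (path z) t k i else 0) \<in> borel_measurable MQ"
      by measurable
    obtain c where c: "\<And>r x. 0 \<le> r \<Longrightarrow> \<bar>d_xx \<phi> r x\<bar> \<le> c" using C12b_bounded[OF \<phi>, of "d_xx \<phi>"] by auto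
    show "zk \<phi> t k i \<in> borel_measurable MQ" by (rule zk_square(3)[OF \<phi> t c])
  qed auto
  have di: "integrable MQ (\<lambda>z. Nk \<phi> t k z - Mk \<phi> t k z)" for k
    by (rule Bochner_Integration.integrable_bound[OF Ei dm]) (auto intro!: AE_I2 intro: order_trans[OF le abs_ge_self])
  have "integrable MQ (\<lambda>z. Nk \<phi> t k z - (Nk \<phi> t k z - Mk \<phi> t k z))" for k
    by (rule Bochner_Integration.integrable_diff[OF Nki di])
  then show Mi: "integrable MQ (Mk \<phi> t k)" for k by simp
  show "(\<lambda>k. \<integral>z. \<bar>?N z - Mk \<phi> t k z\<bar> \<partial>MQ) \<longlonglongrightarrow> 0"
  proof (rule tendsto_sandwich[OF _ _ tendsto_const])
    show "eventually (\<lambda>k. 0 \<le> (\<integral>z. \<bar>?N z - Mk \<phi> t k z\<bar> \<partial>MQ)) sequentially" by simp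
    show "eventually (\<lambda>k. (\<integral>z. \<bar>?N z - Mk \<phi> t k z\<bar> \<partial>MQ) \<le> (\<integral>z. \<bar>?N z - Nk \<phi> t k z\<bar> \<partial>MQ) + (\<integral>z. E k z \<partial>MQ)) sequentially"
    proof (rule always_eventually, rule allI)
      fix k
      have "(\<integral>z. \<bar>?N z - Mk \<phi> t k z\<bar> \<partial>MQ) \<le> (\<integral>z. \<bar>?N z - Nk \<phi> t k z\<bar> + E k z \<partial>MQ)"
      proof (rule integral_mono)
        show "integrable MQ (\<lambda>z. \<bar>?N z - Mk \<phi> t k z\<bar>)" using Ni Mi by auto
        show "integrable MQ (\<lambda>z. \<bar>?N z - Nk \<phi> t k z\<bar> + E k z)" using Ni Nki Ei by auto
        show "\<bar>?N z - Mk \<phi> t k z\<bar> \<le> \<bar>?N z - Nk \<phi> t k z\<bar> + E k z" for z using le[of k z] by linarith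
      qed
      also have "\<dots> = (\<integral>z. \<bar>?N z - Nk \<phi> t k z\<bar> \<partial>MQ) + (\<integral>z. E k z \<partial>MQ)" using Ni Nki Ei by simp
      finally show "(\<integral>z. \<bar>?N z - Mk \<phi> t k z\<bar> \<partial>MQ) \<le> (\<integral>z. \<bar>?N z - Nk \<phi> t k z\<bar> \<partial>MQ) + (\<integral>z. E k z \<partial>MQ)" .
    qed
    have eE: "(\<integral>z. E k z \<partial>MQ) = (\<integral>z. (\<Sum>i<gn k. \<bar>errT \<phi> (path z) t k i\<bar>) \<partial>MQ) + (\<integral>z. (\<Sum>i<gn k. \<bar>errR \<phi> (path z) t k i\<bar>) \<partial>MQ) + (\<integral>z. \<bar>\<Sum>i<gn k. zk \<phi> t k i z\<bar> \<partial>MQ) / 2" for k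
      unfolding E_def using time_error_tendsto(2)[OF assms, of k] space_error_tendsto(2)[OF assms, of k] integrable_abs[OF quadratic_error_tendsto(2)[OF assms, of k]] by simp
    have "(\<lambda>k. (\<integral>z. \<bar>?N z - Nk \<phi> t k z\<bar> \<partial>MQ) + (\<integral>z. E k z \<partial>MQ)) \<longlonglongrightarrow> 0 + (0 + 0 + 0 / 2)"
      unfolding eE using l1 time_error_tendsto(1)[OF assms] space_error_tendsto(1)[OF assms] quadratic_error_tendsto(1)[OF assms]
      by (intro tendsto_intros) auto
    then show "(\<lambda>k. (\<integral>z. \<bar>?N z - Nk \<phi> t k z\<bar> \<partial>MQ) + (\<integral>z. E k z \<partial>MQ)) \<longlonglongrightarrow> 0" by simp
  qed
qed

end

text \<open>Cells are open on the left and closed on the right, hence the ceiling.\<close>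

definition cell :: "nat \<Rightarrow> real \<Rightarrow> nat" where
  "cell k r = nat (\<lceil>r * real (Suc k)\<rceil> - 1)"

lemma cell_bounds:
  assumes "0 < r"
  shows "gp k (cell k r) < r" "r \<le> gp k (Suc (cell k r))"
proof -
  let ?c = "\<lceil>r * real (Suc k)\<rceil>"
  have pos: "0 < r * real (Suc k)" using assms by simp
  then have c1: "1 \<le> ?c" by (simp add: int_one_le_iff_zero_less)
  then have e: "real (cell k r) = of_int ?c - 1" by (simp add: cell_def)
  have "of_int ?c - 1 < r * real (Suc k)" "r * real (Suc k) \<le> of_int ?c" by linarith+
  then show "gp k (cell k r) < r" "r \<le> gp k (Suc (cell k r))"
    unfolding gp_def by (simp_all only: e pos_divide_less_eq pos_le_divide_eq of_nat_0_less_iff zero_less_Suc of_nat_Suc[of "cell k r"] diff_add_cancel)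
qed

lemma cell_unique:
  assumes "0 < r" "gp k i < r" "r \<le> gp k (Suc i)" shows "i = cell k r"
proof (rule linorder_cases[of i "cell k r"])
  assume "i < cell k r"
  then have "gp k (Suc i) \<le> gp k (cell k r)" by (intro gp_mono) simp
  then show ?thesis using assms(3) cell_bounds(1)[OF assms(1), of k] by linarith
next
  assume "cell k r < i"
  then have "gp k (Suc (cell k r)) \<le> gp k i" by (intro gp_mono) simp
  then show ?thesis using assms(2) cell_bounds(2)[OF assms(1), of k] by linarith
qed

lemma sum_cell:
  fixes f :: "nat \<Rightarrow> real"
  assumes r: "0 < r" "r \<le> real (Suc k)"
  shows "(\<Sum>i<gn k. f i * indicator {gp k i<..gp k (Suc i)} r) = f (cell k r)"
proof -
  have "cell k r < gn k"
    using cell_bounds(1)[OF r(1), of k] r(2) gp_mono[of "gn k" "cell k r" k] gp_gn[of k] by linarith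
  moreover have "f i * indicator {gp k i<..gp k (Suc i)} r = (if i = cell k r then f i else 0)" for i
  proof (cases "i = cell k r")
    case True
    then show ?thesis using cell_bounds[OF r(1), of k] by simp
  next
    case False
    then have "r \<notin> {gp k i<..gp k (Suc i)}" using cell_unique[OF r(1), of k i] by (metis greaterThanAtMost_iff)
    then show ?thesis using False by simp
  qed
  ultimately show ?thesis by simp
qed

lemma cell_tendsto: "0 < r \<Longrightarrow> (\<lambda>k. gp k (cell k r)) \<longlonglongrightarrow> r"
proof -
  assume r: "0 < r"
  have "(\<lambda>k. r - 1 / real (Suc k)) \<longlonglongrightarrow> r - 0" by (intro tendsto_diff tendsto_const mesh_tendsto)
  then have l: "(\<lambda>k. r - 1 / real (Suc k)) \<longlonglongrightarrow> r" by simp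
  have lo: "r - 1 / real (Suc k) \<le> gp k (cell k r)" for k using cell_bounds(2)[OF r, of k] unfolding gp_Suc by linarith
  show ?thesis
    by (rule tendsto_sandwich[OF _ _ l tendsto_const])
      (use lo less_imp_le[OF cell_bounds(1)[OF r]] in \<open>auto simp del: of_nat_Suc\<close>)
qed

lemma cell_lag_tendsto: "0 < r \<Longrightarrow> (\<lambda>k. gp k (cell k r - 1)) \<longlonglongrightarrow> r"
proof -
  assume r: "0 < r"
  have "(\<lambda>k. gp k (cell k r) - 1 / real (Suc k)) \<longlonglongrightarrow> r - 0"
    by (intro tendsto_diff cell_tendsto[OF r] mesh_tendsto)
  then have l: "(\<lambda>k. gp k (cell k r) - 1 / real (Suc k)) \<longlonglongrightarrow> r" by simp
  have lo: "gp k (cell k r) - 1 / real (Suc k) \<le> gp k (cell k r - 1)" for k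
    using gp_Suc[of k "cell k r - 1"] by (cases "cell k r") auto
  have up: "gp k (cell k r - 1) \<le> gp k (cell k r)" for k by (rule gp_mono) simp
  show ?thesis
    by (rule tendsto_sandwich[OF _ _ l cell_tendsto[OF r]]) (use lo up in \<open>auto simp del: of_nat_Suc\<close>)
qed

context stefan
begin

section \<open>The stochastic integral\<close>

definition H :: "(real \<Rightarrow> real \<Rightarrow> real) \<Rightarrow> real \<Rightarrow> 'a \<Rightarrow> real" where
  "H \<phi> r \<omega> = (LINT x:{front \<omega> r..}|lborel. v \<omega> r x * d_x \<phi> r x)"

text \<open>The value on cell \<open>i\<close> of the approximation to \<open>H\<close>, with
  survival tested one grid point earlier. The sign is that of the density \<open>v\<close>.\<close>

definition xi :: "(real \<Rightarrow> real \<Rightarrow> real) \<Rightarrow> nat \<Rightarrow> nat \<Rightarrow> 'a \<Rightarrow> real" where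
  "xi \<phi> k i \<omega> = - (\<integral>x. coef (d_x \<phi>) k i (\<omega>, x) \<partial>Q)"

lemma d_x_cont: "\<phi> \<in> C12b \<Longrightarrow> continuous_on ({0..} \<times> UNIV) (\<lambda>(r, x). d_x \<phi> r x)"
  using C12b_bound by blast

lemma d_x_bound: "\<phi> \<in> C12b \<Longrightarrow> \<exists>c. \<forall>r x. 0 \<le> r \<longrightarrow> \<bar>d_x \<phi> r x\<bar> \<le> c"
  using C12b_bounded[of \<phi> "d_x \<phi>"] by simp

lemma H_eq:
  assumes \<phi>: "\<phi> \<in> C12b" and r: "0 \<le> r"
  shows "H \<phi> r \<omega> = - (\<integral>x. (if live \<omega> r x then d_x \<phi> r (X \<omega> r x) else 0) \<partial>Q)"
proof -
  obtain c where c: "\<forall>r x. 0 \<le> r \<longrightarrow> \<bar>d_x \<phi> r x\<bar> \<le> c" using d_x_bound[OF \<phi>] by blast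
  then show ?thesis
    unfolding H_def using r by (intro front_set_integral(2)[OF measurable_section[OF d_x_cont[OF \<phi>] r] _ r, of c]) auto
qed

lemma integral_Q_bound:
  assumes "f \<in> borel_measurable Q" "\<And>x. \<bar>f x\<bar> \<le> c"
  shows "\<bar>\<integral>x. f x \<partial>Q\<bar> \<le> c * mass"
proof -
  have i: "integrable Q f" using assms by (intro Q.integrable_const_bound[of _ c]) auto
  have "\<bar>\<integral>x. f x \<partial>Q\<bar> \<le> (\<integral>x. \<bar>f x\<bar> \<partial>Q)" by (rule integral_abs_bound)
  also have "\<dots> \<le> (\<integral>x. c \<partial>Q)" using i assms(2) by (intro integral_mono) auto
  finally show ?thesis by (simp add: measure_Q mult.commute)
qed

lemma H_bound:
  assumes \<phi>: "\<phi> \<in> C12b"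
  shows "\<exists>K. (\<forall>r \<omega>. 0 \<le> r \<longrightarrow> \<bar>H \<phi> r \<omega>\<bar> \<le> K) \<and> (\<forall>k i. \<forall>\<omega>\<in>space M. \<bar>xi \<phi> k i \<omega>\<bar> \<le> K)"
proof -
  obtain c where c: "\<forall>r x. 0 \<le> r \<longrightarrow> \<bar>d_x \<phi> r x\<bar> \<le> c" using d_x_bound[OF \<phi>] by blast
  then have c0: "0 \<le> c" using order_trans[OF abs_ge_zero] by blast
  have "\<bar>H \<phi> r \<omega>\<bar> \<le> c * mass" if r: "0 \<le> r" for r \<omega>
  proof -
    have [measurable]: "d_x \<phi> r \<in> borel_measurable borel" by (rule measurable_section[OF d_x_cont[OF \<phi>] r])
    show ?thesis unfolding H_eq[OF \<phi> r] abs_minus_cancel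
      using c c0 r by (intro integral_Q_bound) auto
  qed
  moreover have "\<bar>xi \<phi> k i \<omega>\<bar> \<le> c * mass" if w: "\<omega> \<in> space M" for k i \<omega>
  proof -
    have "(\<lambda>x. coef (d_x \<phi>) k i (\<omega>, x)) \<in> borel_measurable Q"
      using measurable_compose[OF measurable_Pair1'[OF w] coef_measurable[OF d_x_cont[OF \<phi>], of k i, unfolded MQ_def]] by simp
    then show ?thesis
      unfolding xi_def abs_minus_cancel using c by (intro integral_Q_bound coef_bound) auto
  qed
  ultimately show ?thesis by blast
qed

lemma H_FW:
  assumes \<phi>: "\<phi> \<in> C12b" and r: "0 \<le> r"
  shows "H \<phi> r \<in> borel_measurable (FW r)"
proof -
  have "(\<lambda>\<omega>. \<integral>x. (if live \<omega> r x then d_x \<phi> r (X \<omega> r x) else 0) \<partial>Q) \<in> borel_measurable (FW r)"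
    by (rule pairing_FW[OF measurable_section[OF d_x_cont[OF \<phi>] r] r])
  then show ?thesis using H_eq[OF \<phi> r] by (simp add: fun_eq_iff cong: measurable_cong)
qed

lemma H_right_cont:
  assumes \<phi>: "\<phi> \<in> C12b" and r: "0 \<le> r"
  shows "((\<lambda>u. H \<phi> u \<omega>) \<longlongrightarrow> H \<phi> r \<omega>) (at_right r)"
proof -
  obtain c where c: "\<forall>r x. 0 \<le> r \<longrightarrow> \<bar>d_x \<phi> r x\<bar> \<le> c" using d_x_bound[OF \<phi>] by blast
  have "((\<lambda>u. - (\<integral>x. (if live \<omega> u x then d_x \<phi> u (X \<omega> u x) else 0) \<partial>Q)) \<longlongrightarrow> H \<phi> r \<omega>) (at_right r)"
    unfolding H_eq[OF \<phi> r] using c by (intro tendsto_minus pairing_right[OF d_x_cont[OF \<phi>] _ r, of c]) auto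
  then show ?thesis
    by (rule Lim_transform_eventually) (use r H_eq[OF \<phi>] in \<open>auto simp: eventually_at_filter\<close>)
qed

lemma H_progressive:
  assumes \<phi>: "\<phi> \<in> C12b" shows "progressive FW (H \<phi>)"
  unfolding progressive_def
proof (intro allI impI)
  fix T :: real assume T: "0 \<le> T"
  show "(\<lambda>(r, \<omega>). H \<phi> r \<omega>) \<in> borel_measurable (restrict_space borel {0..T} \<Otimes>\<^sub>M FW T)"
    using H_right_cont[OF \<phi>] FW_mono[OF _ H_FW[OF \<phi>]]
    by (intro right_continuous_jointly_measurable T) auto
qed

lemma xi_FW:
  assumes \<phi>: "\<phi> \<in> C12b" shows "xi \<phi> k i \<in> borel_measurable (FW (gp k i))"
proof -
  let ?p = "gp k i"
  have [measurable]: "d_x \<phi> ?p \<in> borel_measurable borel" by (rule measurable_section[OF d_x_cont[OF \<phi>] gp_nonneg])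
  have [measurable]: "(\<lambda>z. X (fst z) ?p (snd z)) \<in> borel_measurable (FW ?p \<Otimes>\<^sub>M Q)"
    using X_FW[of ?p ?p] by (simp add: split_beta)
  have "gp k (i - 1) \<le> ?p" by (rule gp_mono) simp
  from live_FW[OF gp_nonneg this] have [measurable]: "Measurable.pred (FW ?p \<Otimes>\<^sub>M Q) (\<lambda>z. live (fst z) (gp k (i - 1)) (snd z))"
    by (simp add: split_beta)
  have "coef (d_x \<phi>) k i \<in> borel_measurable (FW ?p \<Otimes>\<^sub>M Q)" unfolding coef_def by measurable
  then have "(\<lambda>\<omega>. \<integral>x. coef (d_x \<phi>) k i (\<omega>, x) \<partial>Q) \<in> borel_measurable (FW ?p)"
    by (intro Q.borel_measurable_lebesgue_integral) (simp add: case_prod_eta)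
  then show ?thesis unfolding xi_def[abs_def] by simp
qed

lemma xi_simple_data:
  assumes \<phi>: "\<phi> \<in> C12b" shows "simple_data M FW (gn k) (gp k) (xi \<phi> k)"
  unfolding simple_data_def
proof (intro conjI allI impI gp_nonneg xi_FW[OF \<phi>])
  show "gp k i < gp k (Suc i)" for i by (rule gp_strict_mono) simp
  show "\<exists>C. \<forall>\<omega>\<in>space M. \<bar>xi \<phi> k i \<omega>\<bar> \<le> C" for i using H_bound[OF \<phi>] by blast
qed

text \<open>The lagged grid points approach \<open>r\<close> strictly from the left, so in the limit
  a particle counts when it survives at all times before \<open>r\<close>.\<close>

lemma left_limit_H:
  assumes \<phi>: "\<phi> \<in> C12b" and r: "0 < r" and w: "\<omega> \<in> space M"
  shows "(\<lambda>k. xi \<phi> k (cell k r) \<omega>) \<longlonglongrightarrow> - (\<integral>x. (if \<forall>u<r. live \<omega> u x then d_x \<phi> r (X \<omega> r x) else 0) \<partial>Q)"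
  unfolding xi_def
proof (intro tendsto_minus)
  obtain c where c: "\<forall>r x. 0 \<le> r \<longrightarrow> \<bar>d_x \<phi> r x\<bar> \<le> c" using d_x_bound[OF \<phi>] by blast
  have [measurable]: "d_x \<phi> r \<in> borel_measurable borel" using r by (intro measurable_section[OF d_x_cont[OF \<phi>]]) auto
  have m: "(\<lambda>x. coef (d_x \<phi>) k i (\<omega>, x)) \<in> borel_measurable Q" for k i
    using measurable_compose[OF measurable_Pair1'[OF w] coef_measurable[OF d_x_cont[OF \<phi>], of k i, unfolded MQ_def]] by simp
  show "(\<lambda>k. \<integral>x. coef (d_x \<phi>) k (cell k r) (\<omega>, x) \<partial>Q) \<longlonglongrightarrow> (\<integral>x. (if \<forall>u<r. live \<omega> u x then d_x \<phi> r (X \<omega> r x) else 0) \<partial>Q)"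
  proof (rule integral_dominated_convergence[where w="\<lambda>_. c"])
    show "(\<lambda>x. if \<forall>u<r. live \<omega> u x then d_x \<phi> r (X \<omega> r x) else 0) \<in> borel_measurable Q" by measurable
    show "AE x in Q. norm (coef (d_x \<phi>) k (cell k r) (\<omega>, x)) \<le> c" for k
      using coef_bound[of "d_x \<phi>" c] c by auto
    show "AE x in Q. (\<lambda>k. coef (d_x \<phi>) k (cell k r) (\<omega>, x)) \<longlonglongrightarrow> (if \<forall>u<r. live \<omega> u x then d_x \<phi> r (X \<omega> r x) else 0)"
    proof (rule AE_I2)
      fix x
      have lag: "gp k (cell k r - 1) < r" for k
        using cell_bounds(1)[OF r, of k] gp_mono[of "cell k r - 1" "cell k r" k] by simp
      have XX: "(\<lambda>k. X \<omega> (gp k (cell k r)) x) \<longlonglongrightarrow> X \<omega> r x"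
        by (rule isCont_tendsto_compose[OF X_isCont cell_tendsto[OF r]])
      have d: "(\<lambda>k. (\<lambda>(r, x). d_x \<phi> r x) (gp k (cell k r), X \<omega> (gp k (cell k r)) x)) \<longlonglongrightarrow> (\<lambda>(r, x). d_x \<phi> r x) (r, X \<omega> r x)"
        by (rule continuous_on_tendsto_compose[OF d_x_cont[OF \<phi>] tendsto_Pair[OF cell_tendsto[OF r] XX]])
          (use r gp_nonneg in auto)
      show "(\<lambda>k. coef (d_x \<phi>) k (cell k r) (\<omega>, x)) \<longlonglongrightarrow> (if \<forall>u<r. live \<omega> u x then d_x \<phi> r (X \<omega> r x) else 0)"
      proof (cases "\<forall>u<r. live \<omega> u x")
        case True
        then have "coef (d_x \<phi>) k (cell k r) (\<omega>, x) = d_x \<phi> (gp k (cell k r)) (X \<omega> (gp k (cell k r)) x)" for k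
          using lag by (simp add: coef_def)
        then show ?thesis using d True by simp
      next
        case False
        then obtain u where u: "u < r" "\<not> live \<omega> u x" by blast
        have "eventually (\<lambda>k. u < gp k (cell k r - 1)) sequentially"
          by (rule order_tendstoD(1)[OF cell_lag_tendsto[OF r] u(1)])
        then have "eventually (\<lambda>k. coef (d_x \<phi>) k (cell k r) (\<omega>, x) = 0) sequentially"

        proof eventually_elim
          case (elim k)
          then show ?case using u(2) live_antimono[OF less_imp_le[OF elim], of \<omega> x] unfolding coef_def by (auto simp del: split_paired_All)
        qed
        then show ?thesis using False by (auto intro: tendsto_eventually)
      qed
    qed
  qed (use m in auto)
qed

text \<open>The particles absorbed exactly at \<open>r\<close> have mass at most
  \<open>lam * \<kappa>\<close> times the increment of the front over any interval ending at
  \<open>r\<close>; continuity of the front makes this zero.\<close>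

lemma left_limit_H_eq:
  assumes \<phi>: "\<phi> \<in> C12b" and r: "0 < r" and cont: "isCont (front \<omega>) r"
  shows "- (\<integral>x. (if \<forall>u<r. live \<omega> u x then d_x \<phi> r (X \<omega> r x) else 0) \<partial>Q) = H \<phi> r \<omega>"
proof -
  let ?A = "{x \<in> space Q. (\<forall>u<r. live \<omega> u x) \<and> \<not> live \<omega> r x}"
  have r0: "0 \<le> r" using r by simp
  have Am: "?A \<in> sets Q" by measurable
  have le: "measure Q ?A \<le> lam * \<kappa> * (front \<omega> r - front \<omega> u)" if u: "0 \<le> u" "u < r" for u
  proof -
    have sub: "?A \<subseteq> {x \<in> space Q. absorbed \<omega> r x} - {x \<in> space Q. absorbed \<omega> u x}"
      using u r live_s0 by (auto simp: absorbed_def)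
    have "measure Q ?A \<le> measure Q ({x \<in> space Q. absorbed \<omega> r x} - {x \<in> space Q. absorbed \<omega> u x})"
      by (rule Q.finite_measure_mono[OF sub]) measurable
    also have "\<dots> = measure Q {x \<in> space Q. absorbed \<omega> r x} - measure Q {x \<in> space Q. absorbed \<omega> u x}"
      using live_antimono[of u r \<omega>] u by (intro Q.finite_measure_Diff) (auto simp: absorbed_def)
    also have "\<dots> = lam * \<kappa> * (front \<omega> r - front \<omega> u)"
      using measure_absorbed[OF r0, of \<omega>] measure_absorbed[OF u(1), of \<omega>] by (simp add: algebra_simps)
    finally show ?thesis .
  qed
  have "(front \<omega> \<longlongrightarrow> front \<omega> r) (at_left r)"
    using cont unfolding isCont_def by (rule tendsto_within_subset) simp
  then have "((\<lambda>u. lam * \<kappa> * (front \<omega> r - front \<omega> u)) \<longlongrightarrow> lam * \<kappa> * (front \<omega> r - front \<omega> r)) (at_left r)"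
    by (intro tendsto_mult tendsto_diff tendsto_const)
  moreover have "eventually (\<lambda>u. measure Q ?A \<le> lam * \<kappa> * (front \<omega> r - front \<omega> u)) (at_left r)"
    unfolding eventually_at_left_field using r le by (intro exI[of _ 0]) auto
  ultimately have "measure Q ?A \<le> lam * \<kappa> * (front \<omega> r - front \<omega> r)"
    by (rule tendsto_lowerbound) simp
  then have "measure Q ?A = 0" by (simp add: measure_le_0_iff)
  then have "?A \<in> null_sets Q" using Am by (simp add: null_sets_def Q.emeasure_eq_measure)
  then have ae: "AE x in Q. x \<notin> ?A" by (rule AE_not_in)
  have [measurable]: "d_x \<phi> r \<in> borel_measurable borel" by (rule measurable_section[OF d_x_cont[OF \<phi>] r0])
  have "(\<integral>x. (if \<forall>u<r. live \<omega> u x then d_x \<phi> r (X \<omega> r x) else 0) \<partial>Q) = (\<integral>x. (if live \<omega> r x then d_x \<phi> r (X \<omega> r x) else 0) \<partial>Q)"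
  proof (rule integral_cong_AE)
    show "AE x in Q. (if \<forall>u<r. live \<omega> u x then d_x \<phi> r (X \<omega> r x) else 0) = (if live \<omega> r x then d_x \<phi> r (X \<omega> r x) else 0)"
      using ae AE_space
    proof eventually_elim
      case (elim x)
      have "(\<forall>u<r. live \<omega> u x) \<longleftrightarrow> live \<omega> r x"
      proof
        assume "live \<omega> r x"
        then show "\<forall>u<r. live \<omega> u x" using live_antimono[OF less_imp_le] by blast
      qed (use elim in blast)
      then show ?case by (simp only:)
    qed
  qed measurable
  then show ?thesis by (simp add: H_eq[OF \<phi> r0])
qed

text \<open>The front is monotone, so its discontinuities are countable and form a Lebesgue null
  set.\<close>

lemma simple_process_tendsto:
  assumes \<phi>: "\<phi> \<in> C12b" and w: "\<omega> \<in> space M"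
  shows "AE r in lborel. 0 < r \<longrightarrow> (\<lambda>k. simple_process (gn k) (gp k) (xi \<phi> k) r \<omega>) \<longlonglongrightarrow> H \<phi> r \<omega>"
proof -
  have "countable {a. \<not> isCont (front \<omega>) a}" by (rule mono_ctble_discont[OF front_mono])
  from AE_not_in[OF countable_imp_null_set_lborel[OF this]] have "AE r in lborel. isCont (front \<omega>) r" by simp
  then show ?thesis
  proof eventually_elim
    case (elim r)
    show ?case
    proof
      assume r: "0 < r"
      have "eventually (\<lambda>k. r \<le> real (Suc k)) sequentially"
      proof -
        obtain n where "r \<le> real n" using real_arch_simple by blast
        then show ?thesis by (intro eventually_sequentiallyI[of n]) simp
      qed
      then have "eventually (\<lambda>k. xi \<phi> k (cell k r) \<omega> = simple_process (gn k) (gp k) (xi \<phi> k) r \<omega>) sequentially"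
        by eventually_elim (simp only: simple_process_def sum_cell[OF r])
      moreover have "(\<lambda>k. xi \<phi> k (cell k r) \<omega>) \<longlonglongrightarrow> H \<phi> r \<omega>"
        using left_limit_H[OF \<phi> r w] left_limit_H_eq[OF \<phi> r elim] by simp
      ultimately show "(\<lambda>k. simple_process (gn k) (gp k) (xi \<phi> k) r \<omega>) \<longlonglongrightarrow> H \<phi> r \<omega>"
        by (rule Lim_transform_eventually[rotated])
    qed
  qed
qed

lemma simple_process_bound:
  assumes K: "0 \<le> K" "\<forall>k i. \<bar>x k i\<bar> \<le> K"
  shows "\<bar>\<Sum>i<gn k. x k i * indicator {gp k i<..gp k (Suc i)} r\<bar> \<le> (K :: real)"
proof (cases "0 < r \<and> r \<le> real (Suc k)")
  case True
  then show ?thesis using sum_cell[of r k "x k"] K by simp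
next
  case False
  have "indicator {gp k i<..gp k (Suc i)} r = (0::real)" if "i < gn k" for i
    using False that gp_mono[of "Suc i" "gn k" k] gp_nonneg[of k i] gp_gn[of k] by (auto simp: indicator_def)
  then have "(\<Sum>i<gn k. x k i * indicator {gp k i<..gp k (Suc i)} r) = 0" by (intro sum.neutral) auto
  then show ?thesis using K by simp
qed

lemma H_path_measurable:
  assumes \<phi>: "\<phi> \<in> C12b" and w: "\<omega> \<in> space M"
  shows "(\<lambda>r. H \<phi> r \<omega> * indicator {0..T} r) \<in> borel_measurable borel"
proof (cases "0 \<le> T")
  case T: True
  have "(\<lambda>r. H \<phi> r \<omega>) \<in> borel_measurable (restrict_space borel {0..T})"
    using measurable_Pair1[OF H_progressive[OF \<phi>, unfolded progressive_def, rule_format, of T], of \<omega>] T w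
    by (simp add: space_FW)
  then show ?thesis by (subst (asm) borel_measurable_restrict_space_iff) (auto simp: mult.commute)
qed simp

text \<open>Convergence at almost every time and a common bound give bounded convergence, separately
  for every sample point.\<close>

lemma simple_process_L2:
  assumes \<phi>: "\<phi> \<in> C12b" and T: "0 < T" and w: "\<omega> \<in> space M"
  shows "(\<lambda>k. \<integral>\<^sup>+r\<in>{0..T}. ennreal ((H \<phi> r \<omega> - simple_process (gn k) (gp k) (xi \<phi> k) r \<omega>)\<^sup>2) \<partial>lborel) \<longlonglongrightarrow> 0"
proof -
  obtain K where K: "\<forall>r \<omega>. 0 \<le> r \<longrightarrow> \<bar>H \<phi> r \<omega>\<bar> \<le> K" "\<forall>k i. \<forall>\<omega>\<in>space M. \<bar>xi \<phi> k i \<omega>\<bar> \<le> K"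
    using H_bound[OF \<phi>] by blast
  have K0: "0 \<le> K" using K(1) order_trans[OF abs_ge_zero] by blast
  let ?D = "\<lambda>k r. H \<phi> r \<omega> - simple_process (gn k) (gp k) (xi \<phi> k) r \<omega>"
  have Sm [measurable]: "(\<lambda>r. simple_process (gn k) (gp k) (xi \<phi> k) r \<omega>) \<in> borel_measurable borel" for k
    unfolding simple_process_def by measurable
  have e: "ennreal ((?D k r)\<^sup>2) * indicator {0..T} r = ennreal ((H \<phi> r \<omega> * indicator {0..T} r - simple_process (gn k) (gp k) (xi \<phi> k) r \<omega> * indicator {0..T} r)\<^sup>2)" for k r
    by (auto simp: indicator_def)
  have "(\<lambda>k. \<integral>\<^sup>+r. ennreal ((?D k r)\<^sup>2) * indicator {0..T} r \<partial>lborel) \<longlonglongrightarrow> (\<integral>\<^sup>+(r::real). 0 \<partial>lborel)"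
  proof (rule nn_integral_dominated_convergence[where w="\<lambda>r. ennreal ((2 * K)\<^sup>2) * indicator {0..T} r"])
    show "(\<lambda>r. ennreal ((?D k r)\<^sup>2) * indicator {0..T} r) \<in> borel_measurable lborel" for k
      unfolding e using H_path_measurable[OF \<phi> w] by measurable
    show "AE r in lborel. ennreal ((?D k r)\<^sup>2) * indicator {0..T} r \<le> ennreal ((2 * K)\<^sup>2) * indicator {0..T} r" for k
    proof (rule AE_I2)
      fix r
      show "ennreal ((?D k r)\<^sup>2) * indicator {0..T} r \<le> ennreal ((2 * K)\<^sup>2) * indicator {0..T} r"
      proof (cases "r \<in> {0..T}")
        case True
        have "\<bar>simple_process (gn k) (gp k) (xi \<phi> k) r \<omega>\<bar> \<le> K"
          unfolding simple_process_def by (rule simple_process_bound[OF K0]) (use K(2) w in auto)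
        then have "\<bar>?D k r\<bar> \<le> \<bar>2 * K\<bar>" using K(1) True K0 by (auto intro: order_trans[OF abs_triangle_ineq4])
            (smt (verit) abs_triangle_ineq4)
        then show ?thesis by (intro mult_right_mono ennreal_leI) (auto simp: abs_le_square_iff)
      qed simp
    qed
    show "(\<integral>\<^sup>+r. ennreal ((2 * K)\<^sup>2) * indicator {0..T} r \<partial>lborel) < \<infinity>"
      using T by (subst nn_integral_cmult_indicator) (auto simp: ennreal_mult_less_top)
    show "AE r in lborel. (\<lambda>k. ennreal ((?D k r)\<^sup>2) * indicator {0..T} r) \<longlonglongrightarrow> 0"
      using simple_process_tendsto[OF \<phi> w] AE_lborel_singleton[of 0]
    proof eventually_elim
      case (elim r)
      show ?case
      proof (cases "r \<in> {0..T}")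
        case True
        then have "(\<lambda>k. simple_process (gn k) (gp k) (xi \<phi> k) r \<omega>) \<longlonglongrightarrow> H \<phi> r \<omega>" using elim by auto
        then have "(\<lambda>k. (?D k r)\<^sup>2) \<longlonglongrightarrow> (H \<phi> r \<omega> - H \<phi> r \<omega>)\<^sup>2" by (intro tendsto_power tendsto_diff tendsto_const)
        then have "(\<lambda>k. ennreal ((?D k r)\<^sup>2)) \<longlonglongrightarrow> ennreal 0" by (intro tendsto_ennrealI) simp
        then show ?thesis using True by simp
      qed simp
    qed
  qed auto
  then show ?thesis by simp
qed

text \<open>Almost sure convergence implies convergence in probability. Values in
  \<open>ennreal\<close> cover integrals of squares as well as absolute values.\<close>

lemma tendsto_measure_of_pointwise:
  assumes "finite_measure L" and m: "\<And>k. D k \<in> borel_measurable L" and lim: "AE x in L. (\<lambda>k. D k x) \<longlonglongrightarrow> (0::ennreal)"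
    and e: "0 < e"
  shows "(\<lambda>k. measure L {x \<in> space L. e < D k x}) \<longlonglongrightarrow> 0"
proof -
  interpret finite_measure L by fact
  note [measurable] = m
  have "(\<lambda>k. \<integral>x. indicat_real {x \<in> space L. e < D k x} x \<partial>L) \<longlonglongrightarrow> (\<integral>x. 0 \<partial>L)"
  proof (rule integral_dominated_convergence[where w="\<lambda>_. 1"])
    show "AE x in L. (\<lambda>k. indicator {x \<in> space L. e < D k x} x) \<longlonglongrightarrow> (0::real)"
      using lim
    proof eventually_elim
      case (elim x)
      have "eventually (\<lambda>k. indicator {x \<in> space L. e < D k x} x = (0::real)) sequentially"
        using order_tendstoD(2)[OF elim e] by eventually_elim (auto simp: indicator_def)
      then show ?case by (rule tendsto_eventually)
    qed
  qed (auto simp: indicator_def)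
  then show ?thesis by (simp add: Int_def conj_commute)
qed

lemma simple_process_measure:
  assumes \<phi>: "\<phi> \<in> C12b" and T: "0 < T" and e: "0 < e"
  shows "(\<lambda>k. measure M {\<omega>\<in>space M. ennreal e < (\<integral>\<^sup>+r\<in>{0..T}. ennreal ((H \<phi> r \<omega> - simple_process (gn k) (gp k) (xi \<phi> k) r \<omega>)\<^sup>2) \<partial>lborel)}) \<longlonglongrightarrow> 0"
proof (rule tendsto_measure_of_pointwise[OF W.finite_measure_axioms _ AE_I2[OF simple_process_L2[OF \<phi> T]]])
  fix k
  let ?L = "restrict_space lborel {0..T}"
  have [measurable]: "xi \<phi> k i \<in> borel_measurable M" for i by (rule FW_M[OF xi_FW[OF \<phi>]])
  interpret L: finite_measure ?L
    by (intro finite_measureI) (simp add: emeasure_restrict_space space_restrict_space emeasure_lborel_Icc_eq)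
  have idM: "(\<lambda>x. x) \<in> measurable M (FW T)" by (rule FW_M[of _ T]) simp
  have H1: "(\<lambda>(r, \<omega>). H \<phi> r \<omega>) \<in> borel_measurable (?L \<Otimes>\<^sub>M FW T)"
    using H_progressive[OF \<phi>, unfolded progressive_def, rule_format, of T] T
    by (simp cong: measurable_cong_sets add: sets_pair_measure_cong[OF sets_restrict_space_cong[OF sets_lborel] refl])
  have "(\<lambda>z. (snd z, (\<lambda>x. x) (fst z))) \<in> measurable (M \<Otimes>\<^sub>M ?L) (?L \<Otimes>\<^sub>M FW T)"
    using idM by measurable
  from measurable_compose[OF this H1] have [measurable]: "(\<lambda>z. H \<phi> (snd z) (fst z)) \<in> borel_measurable (M \<Otimes>\<^sub>M ?L)" by simp
  have [measurable]: "snd \<in> borel_measurable (M \<Otimes>\<^sub>M ?L)"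
    by (rule measurable_compose[OF measurable_snd]) (auto intro: measurable_restrict_space1)
  have [measurable]: "(\<lambda>z. simple_process (gn k) (gp k) (xi \<phi> k) (snd z) (fst z)) \<in> borel_measurable (M \<Otimes>\<^sub>M ?L)"
    unfolding simple_process_def by measurable
  have "(\<lambda>\<omega>. \<integral>\<^sup>+r. ennreal ((H \<phi> r \<omega> - simple_process (gn k) (gp k) (xi \<phi> k) r \<omega>)\<^sup>2) \<partial>?L) \<in> borel_measurable M"
    by (rule L.borel_measurable_nn_integral) (simp add: split_beta)
  then show "(\<lambda>\<omega>. \<integral>\<^sup>+r\<in>{0..T}. ennreal ((H \<phi> r \<omega> - simple_process (gn k) (gp k) (xi \<phi> k) r \<omega>)\<^sup>2) \<partial>lborel) \<in> borel_measurable M"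
    by (subst (asm) nn_integral_restrict_space) auto
qed (use e in auto)

text \<open>With \<open>\<omega>\<close> frozen, the increments of \<open>B\<close> are centred
  given the history that determines the coefficients and drop out, while those of \<open>W\<close>
  are constants. What remains is the simple integral; the minus sign is the one in
  \<open>xi\<close>.\<close>

lemma integral_Mk:
  assumes \<phi>: "\<phi> \<in> C12b" and t: "0 \<le> t" and w: "\<omega> \<in> space M"
  shows "(\<integral>x. Mk \<phi> t k (\<omega>, x) \<partial>Q) = - \<theta> * simple_integral W (gn k) (gp k) (xi \<phi> k) t \<omega>"
proof -
  obtain c where c: "\<forall>r x. 0 \<le> r \<longrightarrow> \<bar>d_x \<phi> r x\<bar> \<le> c" using d_x_bound[OF \<phi>] by blast
  have cb: "\<bar>coef (d_x \<phi>) k i z\<bar> \<le> c" for i z using c by (intro coef_bound) auto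
  have m [measurable]: "(\<lambda>x. coef (d_x \<phi>) k i (\<omega>, x)) \<in> borel_measurable Q" for i
    using measurable_compose[OF measurable_Pair1'[OF w] coef_measurable[OF d_x_cont[OF \<phi>], of k i, unfolded MQ_def]] by simp
  have ci: "integrable Q (\<lambda>x. coef (d_x \<phi>) k i (\<omega>, x))" for i
    using cb by (intro Q.integrable_const_bound[of _ c]) auto
  have dBi: "integrable Q (\<lambda>x. coef (d_x \<phi>) k i (\<omega>, x) * (B u (fst x) - B p (fst x)))" if "0 \<le> p" "p \<le> u" for i p u
  proof (rule Bochner_Integration.integrable_bound)
    show "integrable Q (\<lambda>x. c * (B u (fst x) - B p (fst x)))"
      using integrable_pair_fst[OF W.finite_measure_axioms \<nu>.finite_measure_axioms B.integrable_incr_power[OF that, of 1]]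
      by (simp add: Q_def)
    show "(\<lambda>x. coef (d_x \<phi>) k i (\<omega>, x) * (B u (fst x) - B p (fst x))) \<in> borel_measurable Q"
      using m unfolding Q_def by measurable
    show "AE x in Q. norm (coef (d_x \<phi>) k i (\<omega>, x) * (B u (fst x) - B p (fst x))) \<le> norm (c * (B u (fst x) - B p (fst x)))"
      using cb order_trans[OF abs_ge_zero cb] by (intro AE_I2) (auto simp: abs_mult intro!: mult_right_mono)
  qed
  have one: "(\<integral>x. coef (d_x \<phi>) k i (\<omega>, x) * dX (gq t k i) (gq t k (Suc i)) (\<omega>, x) \<partial>Q) =
      - \<theta> * (xi \<phi> k i \<omega> * (W (gq t k (Suc i)) \<omega> - W (gq t k i) \<omega>))"
    and int: "integrable Q (\<lambda>x. coef (d_x \<phi>) k i (\<omega>, x) * dX (gq t k i) (gq t k (Suc i)) (\<omega>, x))" for i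
  proof -
    let ?q = "gq t k i" and ?q' = "gq t k (Suc i)"
    have q: "0 \<le> ?q" "?q \<le> ?q'" using gq_range(1)[OF t] gq_mono[of i "Suc i" t k] by auto
    have e: "coef (d_x \<phi>) k i (\<omega>, x) * dX ?q ?q' (\<omega>, x) =
      \<sigma> * (coef (d_x \<phi>) k i (\<omega>, x) * (B ?q' (fst x) - B ?q (fst x))) + \<theta> * (W ?q' \<omega> - W ?q \<omega>) * coef (d_x \<phi>) k i (\<omega>, x)" for x
      by (simp add: dX_eq dB_def dW_def algebra_simps)
    show "integrable Q (\<lambda>x. coef (d_x \<phi>) k i (\<omega>, x) * dX ?q ?q' (\<omega>, x))"
      unfolding e using dBi[OF q] ci by simp
    have z: "(\<integral>x. coef (d_x \<phi>) k i (\<omega>, x) * (B ?q' (fst x) - B ?q (fst x)) \<partial>Q) = 0"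
    proof (cases rule: gq_cases[of t k i])
      case 1
      have "(\<integral>x. coef (d_x \<phi>) k i (\<omega>, x) * (B ?q' (fst x) - B (gp k i) (fst x)) \<partial>Q) = 0"
      proof (rule integral_Q_mult_incr[where f="\<lambda>h. h"])
        show "(\<lambda>x. coef (d_x \<phi>) k i (\<omega>, x)) \<in> borel_measurable (HB (gp k i) \<Otimes>\<^sub>M borel)"
          using measurable_Pair2[OF coef_Hist[OF d_x_cont[OF \<phi>] order_refl, of k i], of \<omega>] w by (simp add: W.space_H)
        show "(\<integral>\<omega>. Z \<omega> * (B ?q' \<omega> - B (gp k i) \<omega>) \<partial>M) = 0"
          if "Z \<in> borel_measurable (HB (gp k i))" "integrable M Z" for Z
          by (rule B.integral_mult_incr[OF that gp_nonneg]) (use q 1 in simp)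
      qed (use ci dBi[OF q, of i] 1 in auto)
      then show ?thesis using 1 by simp
    next
      case 2
      then show ?thesis by simp
    qed
    show "(\<integral>x. coef (d_x \<phi>) k i (\<omega>, x) * dX ?q ?q' (\<omega>, x) \<partial>Q) = - \<theta> * (xi \<phi> k i \<omega> * (W ?q' \<omega> - W ?q \<omega>))"
      unfolding e using dBi[OF q, of i] ci[of i] z by (simp add: xi_def)
  qed
  have "(\<integral>x. Mk \<phi> t k (\<omega>, x) \<partial>Q) = (\<Sum>i<gn k. - \<theta> * (xi \<phi> k i \<omega> * (W (gq t k (Suc i)) \<omega> - W (gq t k i) \<omega>)))"
    unfolding Mk_def using int by (simp add: Bochner_Integration.integral_sum one)
  then show ?thesis by (simp add: simple_integral_def gq_def sum_distrib_left)
qed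

text \<open>Averaging over \<open>Q\<close> can only decrease the mean absolute error of Ito's
  formula, and the averaged discrete martingale is the simple integral.\<close>

lemma mean_error:
  assumes \<phi>: "\<phi> \<in> C12b" and t: "0 \<le> t"
  shows "(\<lambda>k. \<integral>\<omega>. \<bar>(\<integral>x. N \<phi> t \<omega> x \<partial>Q) + \<theta> * simple_integral W (gn k) (gp k) (xi \<phi> k) t \<omega>\<bar> \<partial>M) \<longlonglongrightarrow> 0"
    and "integrable M (\<lambda>\<omega>. (\<integral>x. N \<phi> t \<omega> x \<partial>Q) + \<theta> * simple_integral W (gn k) (gp k) (xi \<phi> k) t \<omega>)"
proof -
  let ?f = "\<lambda>k \<omega>. (\<integral>x. N \<phi> t \<omega> x \<partial>Q) + \<theta> * simple_integral W (gn k) (gp k) (xi \<phi> k) t \<omega>"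
  have i: "integrable (M \<Otimes>\<^sub>M Q) (\<lambda>z. N \<phi> t (fst z) (snd z) - Mk \<phi> t k z)" for k
    using ito_formula_mean(2,3)[OF assms] by (simp add: MQ_def)
  have Ni: "integrable Q (N \<phi> t \<omega>)" if w: "\<omega> \<in> space M" for \<omega>
  proof -
    obtain b where b: "\<forall>\<omega> x. \<bar>N \<phi> t \<omega> x\<bar> \<le> b" using N_bounded[OF assms] by blast
    have "(\<lambda>x. N \<phi> t (fst (\<omega>, x)) (snd (\<omega>, x))) \<in> borel_measurable Q"
      by (rule measurable_compose[OF measurable_Pair1'[OF w] FW_MQ[OF N_FW[OF assms], unfolded MQ_def]])
    then show ?thesis using b by (intro Q.integrable_const_bound[of _ b]) auto
  qed
  have ae: "AE \<omega> in M. (\<integral>x. N \<phi> t (fst (\<omega>, x)) (snd (\<omega>, x)) - Mk \<phi> t k (\<omega>, x) \<partial>Q) = ?f k \<omega>" for k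
    using PQ.AE_integrable_fst'[OF i[of k]] AE_space
  proof eventually_elim
    case (elim \<omega>)
    have "integrable Q (\<lambda>x. N \<phi> t \<omega> x - (N \<phi> t \<omega> x - Mk \<phi> t k (\<omega>, x)))"
      using Bochner_Integration.integrable_diff[OF Ni[OF elim(2)] elim(1)] by simp
    then have "integrable Q (\<lambda>x. Mk \<phi> t k (\<omega>, x))" by simp
    then show ?case using Ni[OF elim(2)] integral_Mk[OF assms elim(2), of k] by simp
  qed
  have fm: "?f k \<in> borel_measurable M" for k
  proof -
    have 1: "(\<lambda>\<omega>. \<integral>x. N \<phi> t \<omega> x \<partial>Q) \<in> borel_measurable M"
      by (rule Q.borel_measurable_lebesgue_integral) (use FW_MQ[OF N_FW[OF assms]] in \<open>simp add: MQ_def case_prod_unfold\<close>)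
    have [measurable]: "xi \<phi> k i \<in> borel_measurable M" for i by (rule FW_M[OF xi_FW[OF \<phi>]])
    have 2: "simple_integral W (gn k) (gp k) (xi \<phi> k) t \<in> borel_measurable M"
      unfolding simple_integral_def by measurable
    show ?thesis using 1 2 by measurable
  qed
  show fi: "integrable M (?f k)" for k
    using integrable_cong_AE[THEN iffD1, OF _ fm ae PQ.integrable_fst'[OF i]] PQ.integrable_fst'[OF i[of k]] by auto
  have le: "(\<integral>\<omega>. \<bar>?f k \<omega>\<bar> \<partial>M) \<le> (\<integral>z. \<bar>N \<phi> t (fst z) (snd z) - Mk \<phi> t k z\<bar> \<partial>MQ)" for k
  proof -
    have ia: "integrable (M \<Otimes>\<^sub>M Q) (\<lambda>z. \<bar>N \<phi> t (fst z) (snd z) - Mk \<phi> t k z\<bar>)" using i by auto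
    have "(\<integral>\<omega>. \<bar>?f k \<omega>\<bar> \<partial>M) \<le> (\<integral>\<omega>. (\<integral>x. \<bar>N \<phi> t (fst (\<omega>, x)) (snd (\<omega>, x)) - Mk \<phi> t k (\<omega>, x)\<bar> \<partial>Q) \<partial>M)"
    proof (rule integral_mono_AE)
      show "integrable M (\<lambda>\<omega>. \<bar>?f k \<omega>\<bar>)" using fi by auto
      show "integrable M (\<lambda>\<omega>. \<integral>x. \<bar>N \<phi> t (fst (\<omega>, x)) (snd (\<omega>, x)) - Mk \<phi> t k (\<omega>, x)\<bar> \<partial>Q)"
        by (rule PQ.integrable_fst'[OF ia])
      show "AE \<omega> in M. \<bar>?f k \<omega>\<bar> \<le> (\<integral>x. \<bar>N \<phi> t (fst (\<omega>, x)) (snd (\<omega>, x)) - Mk \<phi> t k (\<omega>, x)\<bar> \<partial>Q)"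
        using ae[of k]
      proof eventually_elim
        case (elim \<omega>)
        show ?case unfolding elim[symmetric] by (rule integral_abs_bound)
      qed
    qed
    also have "\<dots> = (\<integral>z. \<bar>N \<phi> t (fst z) (snd z) - Mk \<phi> t k z\<bar> \<partial>MQ)"
      using PQ.integral_fst'[OF ia] by (simp add: MQ_def)
    finally show ?thesis .
  qed
  show "(\<lambda>k. \<integral>\<omega>. \<bar>?f k \<omega>\<bar> \<partial>M) \<longlonglongrightarrow> 0"
    by (rule tendsto_sandwich[OF _ _ tendsto_const ito_formula_mean(1)[OF assms]]) (auto simp: le)
qed

lemma martingale_part_FW:
  assumes "\<phi> \<in> C12b" "0 \<le> t" shows "(\<lambda>\<omega>. \<integral>x. N \<phi> t \<omega> x \<partial>Q) \<in> borel_measurable (FW t)"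
  by (rule Q.borel_measurable_lebesgue_integral) (use N_FW[OF assms] in \<open>simp add: case_prod_unfold\<close>)

lemma stop_cont:
  assumes "s0 < snd x" shows "continuous_on {0..} (\<lambda>t. stop \<omega> t x)"
proof (cases "\<exists>t\<ge>0. \<not> live \<omega> t x")
  case True
  then obtain u where u: "0 \<le> u" "\<not> live \<omega> u x" by blast
  have "stop \<omega> t x = min t (tau \<omega> x)" if "t \<in> {0..}" for t
    using live_iff_tau[OF assms u, of t] assms by (auto simp: stop_def absorbed_def min_def)
  then show ?thesis by (subst continuous_on_cong[OF refl]) (auto intro!: continuous_intros)
next
  case False
  then have "stop \<omega> t x = t" if "t \<in> {0..}" for t using that by (auto simp: stop_def)
  then show ?thesis by (subst continuous_on_cong[OF refl]) (auto intro!: continuous_intros)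
qed

text \<open>The particle is stopped at absorption rather than removed, so no jump occurs; the time
  integral has a bounded integrand.\<close>

lemma N_cont:
  assumes \<phi>: "\<phi> \<in> C12b" and x: "x \<in> space Q" shows "continuous_on {0..} (\<lambda>t. N \<phi> t \<omega> x)"
proof -
  have c: "continuous_on ({0..} \<times> UNIV) (\<lambda>(r, x). \<phi> r x)" using C12b_bound[OF \<phi>] by blast
  obtain d where d: "continuous_on ({0..} \<times> UNIV) (\<lambda>(r, x). gen \<phi> r x)" "\<And>r x. 0 \<le> r \<Longrightarrow> \<bar>gen \<phi> r x\<bar> \<le> d"
    using C12b_gen[OF \<phi>] by blast
  have d0: "0 \<le> d" using d(2)[of 0 0] by simp
  define f where "f r = (if live \<omega> r x then gen \<phi> r (X \<omega> r x) else 0)" for r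
  have fi: "set_integrable lborel {0..t} f" if t: "0 \<le> t" for t
  proof -
    have "(\<lambda>r. f r) \<in> borel_measurable (restrict_space borel {0..t})"
      using measurable_Pair1[OF live_joint[OF d(1) t, of \<omega>] x] by (simp add: f_def)
    then have m: "(\<lambda>r. indicator {0..t} r *\<^sub>R f r) \<in> borel_measurable lborel"
      by (subst (asm) borel_measurable_restrict_space_iff) auto
    show ?thesis
      unfolding set_integrable_def
    proof (rule Bochner_Integration.integrable_bound[OF _ m])
      show "integrable lborel (\<lambda>r. d * indicator {0..t} r)"
        by (intro integrable_mult_right integrable_real_indicator) (auto simp: emeasure_lborel_Icc_eq)
      show "AE r in lborel. norm (indicator {0..t} r *\<^sub>R f r) \<le> norm (d * indicator {0..t} r)"
        using d(2) d0 by (intro AE_I2) (simp add: f_def split: split_indicator)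
    qed
  qed
  have drift: "(LINT r:{0..t}|lborel. f r) = integral {0..t} f" if "0 \<le> t" for t
    by (rule set_borel_integral_eq_integral(2)[OF fi[OF that]])
  have "continuous_on {0..} (\<lambda>t. LINT r:{0..t}|lborel. f r)"
    unfolding continuous_on_def
  proof
    fix t :: real assume "t \<in> {0..}"
    then have t: "0 \<le> t" by simp
    have "continuous_on {0..t + 1} (\<lambda>u. integral {0..u} f)"
      by (rule indefinite_integral_continuous_1[OF set_borel_integral_eq_integral(1)[OF fi]]) (use t in simp)
    then have "((\<lambda>u. integral {0..u} f) \<longlongrightarrow> integral {0..t} f) (at t within {0..t + 1})"
      using t by (simp add: continuous_on_def)
    moreover have "at t within {0..t + 1} = at t within {0..}"
      using t by (intro at_within_nhd[of _ "{..<t + 1}"]) auto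
    ultimately have "((\<lambda>u. integral {0..u} f) \<longlongrightarrow> (LINT r:{0..t}|lborel. f r)) (at t within {0..})"
      by (simp add: drift[OF t])
    then show "((\<lambda>t. LINT r:{0..t}|lborel. f r) \<longlongrightarrow> (LINT r:{0..t}|lborel. f r)) (at t within {0..})"
      by (rule Lim_transform_eventually) (auto simp: eventually_at_filter drift)
  qed
  moreover have "continuous_on {0..} (\<lambda>t. if s0 < snd x then \<phi> (stop \<omega> t x) (X \<omega> (stop \<omega> t x) x) - \<phi> 0 (snd x) else 0)"
  proof (cases "s0 < snd x")
    case True
    have "continuous_on {0..} (\<lambda>t. \<phi> (stop \<omega> t x) (X \<omega> (stop \<omega> t x) x))"
      by (rule continuous_on_compose2[OF continuous_on_path[OF c] stop_cont[OF True]]) (use stop_range(1)[of _ \<omega> x] in auto)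
    then show ?thesis using True by (auto intro!: continuous_intros)
  qed auto
  ultimately show ?thesis unfolding N_def f_def by (intro continuous_on_diff) auto
qed

text \<open>The integrands are continuous in time and bounded on bounded time intervals, so
  continuity holds at every sample point.\<close>

lemma martingale_part_cont:
  assumes \<phi>: "\<phi> \<in> C12b" and w: "\<omega> \<in> space M"
  shows "continuous_on {0..} (\<lambda>t. \<integral>x. N \<phi> t \<omega> x \<partial>Q)"
  unfolding continuous_on_def
proof
  fix t :: real assume "t \<in> {0..}"
  then have t: "0 \<le> t" by simp
  have at: "at t within {0..t + 1} = at t within {0..}"
    using t by (intro at_within_nhd[of _ "{..<t + 1}"]) auto
  obtain c d where b: "0 \<le> d" "\<forall>t \<omega> x. 0 \<le> t \<longrightarrow> \<bar>N \<phi> t \<omega> x\<bar> \<le> c + d * t"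
    using N_bounded_linear[OF \<phi>] by blast
  have "((\<lambda>t. \<integral>x. N \<phi> t \<omega> x \<partial>Q) \<longlongrightarrow> (\<integral>x. N \<phi> t \<omega> x \<partial>Q)) (at t within {0..t + 1})"
  proof (rule tendsto_integral_within[OF Q.finite_measure_axioms, where C="c + d * (t + 1)"])
    fix r assume r: "r \<in> {0..t + 1}"
    then have r0: "0 \<le> r" by simp
    have "(\<lambda>x. N \<phi> r (fst (\<omega>, x)) (snd (\<omega>, x))) \<in> borel_measurable Q"
      by (rule measurable_compose[OF measurable_Pair1'[OF w] FW_MQ[OF N_FW[OF \<phi> r0], unfolded MQ_def]])
    then show "N \<phi> r \<omega> \<in> borel_measurable Q" by simp
    fix x
    have "\<bar>N \<phi> r \<omega> x\<bar> \<le> c + d * r" using b(2) r0 by blast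
    also have "\<dots> \<le> c + d * (t + 1)" using r b(1) by (intro add_left_mono mult_left_mono) auto
    finally show "\<bar>N \<phi> r \<omega> x\<bar> \<le> c + d * (t + 1)" .
  next
    fix x assume "x \<in> space Q"
    then show "((\<lambda>t. N \<phi> t \<omega> x) \<longlongrightarrow> N \<phi> t \<omega> x) (at t within {0..t + 1})"
      unfolding at using N_cont[OF \<phi>] t by (simp add: continuous_on_def)
  qed
  then show "((\<lambda>t. \<integral>x. N \<phi> t \<omega> x \<partial>Q) \<longlongrightarrow> (\<integral>x. N \<phi> t \<omega> x \<partial>Q)) (at t within {0..})" unfolding at .
qed

text \<open>Convergence in mean gives convergence in probability by Markov's inequality, after
  division by \<open>\<theta>\<close>.\<close>

lemma ito_integral_nondegenerate:
  assumes \<phi>: "\<phi> \<in> C12b" and \<theta>: "\<theta> \<noteq> 0"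
  shows "ito_integral M FW W (H \<phi>) (\<lambda>t \<omega>. - (1 / \<theta>) * (\<integral>x. N \<phi> t \<omega> x \<partial>Q))"
  unfolding ito_integral_def
proof (intro conjI allI impI exI[of _ gn] exI[of _ gp] exI[of _ "xi \<phi>"])
  show "progressive FW (H \<phi>)" by (rule H_progressive[OF \<phi>])
  show "(\<lambda>\<omega>. - (1 / \<theta>) * (\<integral>x. N \<phi> t \<omega> x \<partial>Q)) \<in> borel_measurable (FW t)" if "0 \<le> t" for t
    using martingale_part_FW[OF \<phi> that] by measurable
  show "AE \<omega> in M. continuous_on {0..} (\<lambda>t. - (1 / \<theta>) * (\<integral>x. N \<phi> t \<omega> x \<partial>Q))"
    using martingale_part_cont[OF \<phi>] by (intro AE_I2 continuous_intros) auto
  show "simple_data M FW (gn k) (gp k) (xi \<phi> k)" for k by (rule xi_simple_data[OF \<phi>])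
  show "(\<lambda>k. measure M {\<omega>\<in>space M. ennreal e < (\<integral>\<^sup>+r\<in>{0..T}. ennreal ((H \<phi> r \<omega> - simple_process (gn k) (gp k) (xi \<phi> k) r \<omega>)\<^sup>2) \<partial>lborel)}) \<longlonglongrightarrow> 0"
    if "0 < T" "0 < e" for T e by (rule simple_process_measure[OF \<phi> that])
  fix t e :: real assume t: "0 \<le> t" and e: "0 < e"
  let ?f = "\<lambda>k \<omega>. (\<integral>x. N \<phi> t \<omega> x \<partial>Q) + \<theta> * simple_integral W (gn k) (gp k) (xi \<phi> k) t \<omega>"
  have eq: "\<bar>- (1 / \<theta>) * (\<integral>x. N \<phi> t \<omega> x \<partial>Q) - simple_integral W (gn k) (gp k) (xi \<phi> k) t \<omega>\<bar> = \<bar>?f k \<omega>\<bar> / \<bar>\<theta>\<bar>" for k \<omega>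
  proof -
    have "- (1 / \<theta>) * (\<integral>x. N \<phi> t \<omega> x \<partial>Q) - simple_integral W (gn k) (gp k) (xi \<phi> k) t \<omega> = - (?f k \<omega> / \<theta>)"
      using \<theta> by (simp add: field_simps)
    then show ?thesis by (simp add: abs_divide)
  qed
  have le: "measure M {\<omega>\<in>space M. e < \<bar>- (1 / \<theta>) * (\<integral>x. N \<phi> t \<omega> x \<partial>Q) - simple_integral W (gn k) (gp k) (xi \<phi> k) t \<omega>\<bar>}
    \<le> (\<integral>\<omega>. \<bar>?f k \<omega>\<bar> \<partial>M) / (\<bar>\<theta>\<bar> * e)" for k
  proof -
    have i: "integrable M (\<lambda>\<omega>. \<bar>?f k \<omega>\<bar>)" using mean_error(2)[OF \<phi> t] by auto
    have "measure M {\<omega>\<in>space M. e < \<bar>- (1 / \<theta>) * (\<integral>x. N \<phi> t \<omega> x \<partial>Q) - simple_integral W (gn k) (gp k) (xi \<phi> k) t \<omega>\<bar>}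
      \<le> measure M {\<omega>\<in>space M. \<bar>\<theta>\<bar> * e \<le> \<bar>?f k \<omega>\<bar>}"
      unfolding eq using \<theta> e i by (intro W.finite_measure_mono) (auto simp: field_simps)
    also have "\<dots> \<le> (\<integral>\<omega>. \<bar>?f k \<omega>\<bar> \<partial>M) / (\<bar>\<theta>\<bar> * e)"
      using \<theta> e by (intro integral_Markov_inequality_measure[where A="{}", OF i]) auto
    finally show ?thesis .
  qed
  have "(\<lambda>k. (\<integral>\<omega>. \<bar>?f k \<omega>\<bar> \<partial>M) / (\<bar>\<theta>\<bar> * e)) \<longlonglongrightarrow> 0 / (\<bar>\<theta>\<bar> * e)"
    using \<theta> e by (intro tendsto_divide mean_error(1)[OF \<phi> t] tendsto_const) auto
  then have l: "(\<lambda>k. (\<integral>\<omega>. \<bar>?f k \<omega>\<bar> \<partial>M) / (\<bar>\<theta>\<bar> * e)) \<longlonglongrightarrow> 0" by simp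
  show "(\<lambda>k. measure M {\<omega>\<in>space M. e < \<bar>- (1 / \<theta>) * (\<integral>x. N \<phi> t \<omega> x \<partial>Q) - simple_integral W (gn k) (gp k) (xi \<phi> k) t \<omega>\<bar>}) \<longlonglongrightarrow> 0"
    by (rule tendsto_sandwich[OF _ _ tendsto_const l]) (use le in auto)
qed

end

context clean_bm
begin

section \<open>The Wiener integral\<close>

text \<open>Kolmogorov's argument: the event is split by the first time in \<open>P\<close> at which
  the level is reached. On each piece \<open>D t\<close> is known and orthogonal to
  \<open>D T - D t\<close>, so the second moment can only grow from \<open>t\<close> to
  \<open>T\<close>.\<close>

lemma maximal_inequality_finite:
  fixes D :: "real \<Rightarrow> 'a \<Rightarrow> real"
  assumes fin: "finite P" "P \<subseteq> {0..T}" and e: "0 < e"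
    and D: "\<And>t. 0 \<le> t \<Longrightarrow> t \<le> T \<Longrightarrow> D t \<in> borel_measurable (H t)"
    and sq: "\<And>t. 0 \<le> t \<Longrightarrow> t \<le> T \<Longrightarrow> integrable M (\<lambda>\<omega>. (D t \<omega>)\<^sup>2)"
    and orth: "\<And>t Z. 0 \<le> t \<Longrightarrow> t \<le> T \<Longrightarrow> Z \<in> borel_measurable (H t) \<Longrightarrow> integrable M Z \<Longrightarrow>
      integrable M (\<lambda>\<omega>. Z \<omega> * (D T \<omega> - D t \<omega>)) \<and> (\<integral>\<omega>. Z \<omega> * (D T \<omega> - D t \<omega>) \<partial>M) = 0"
  shows "measure M {\<omega>\<in>space M. \<exists>t\<in>P. e \<le> \<bar>D t \<omega>\<bar>} \<le> (\<integral>\<omega>. (D T \<omega>)\<^sup>2 \<partial>M) / e\<^sup>2"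
proof (cases "P = {}")
  case False
  then have T: "0 \<le> T" using fin by force
  \<comment> \<open>The level is reached at \<open>t\<close> and at no earlier point of
    \<open>P\<close>.\<close>
  define A where "A t = {\<omega>\<in>space M. e \<le> \<bar>D t \<omega>\<bar> \<and> (\<forall>u\<in>{u\<in>P. u < t}. \<bar>D u \<omega>\<bar> < e)}" for t
  have P: "0 \<le> t" "t \<le> T" if "t \<in> P" for t using that fin by auto
  have AH: "A t \<in> sets (H t)" if t: "t \<in> P" for t
  proof -
    have [measurable]: "D u \<in> borel_measurable (H t)" if "u \<in> P" "u \<le> t" for u
      using measurable_H_mono[OF that(2) D[OF P[OF that(1)]]] .
    have "{\<omega>\<in>space (H t). e \<le> \<bar>D t \<omega>\<bar> \<and> (\<forall>u\<in>{u\<in>P. u < t}. \<bar>D u \<omega>\<bar> < e)} \<in> sets (H t)"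
      using t fin(1) by (intro sets.sets_Collect_conj sets.sets_Collect_finite_All) auto
    then show ?thesis by (simp add: A_def space_H)
  qed
  have A [measurable]: "A t \<in> sets M" if "t \<in> P" for t using AH[OF that] sets_H by blast
  have Dm: "D t \<in> borel_measurable M" if "t \<in> P" for t by (rule measurable_from_H[OF D[OF P[OF that]]])
  have TI: "integrable M (\<lambda>\<omega>. indicator (A t) \<omega> * (D T \<omega>)\<^sup>2)" if "t \<in> P" for t
    using integrable_mult_indicator[OF A[OF that] sq[OF T order_refl]] by simp
  have one: "e\<^sup>2 * measure M (A t) \<le> (\<integral>\<omega>. indicator (A t) \<omega> * (D T \<omega>)\<^sup>2 \<partial>M)" if t: "t \<in> P" for t
  proof -
    let ?Z = "\<lambda>\<omega>. indicator (A t) \<omega> * D t \<omega>"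
    have Zm: "?Z \<in> borel_measurable (H t)" using AH[OF t] D[OF P[OF t]] by measurable
    have Zi: "integrable M ?Z"
      using integrable_mult_indicator[OF A[OF t] square_integrable_imp_integrable[OF Dm[OF t] sq[OF P[OF t]]]] by simp
    note o = orth[OF P[OF t] Zm Zi]
    have le: "e\<^sup>2 * indicator (A t) \<omega> \<le> indicator (A t) \<omega> * (D T \<omega>)\<^sup>2 - 2 * (?Z \<omega> * (D T \<omega> - D t \<omega>))" for \<omega>
    proof (cases "\<omega> \<in> A t")
      case True
      then have "\<bar>e\<bar> \<le> \<bar>D t \<omega>\<bar>" using e by (simp add: A_def)
      then have "e\<^sup>2 \<le> (D t \<omega>)\<^sup>2" by (simp only: abs_le_square_iff)
      \<comment> \<open>Completing the square: subtracting a term of mean zero turns the final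
        square into at least the square at \<open>t\<close>.\<close>
      moreover have "(D T \<omega>)\<^sup>2 - 2 * (D t \<omega> * (D T \<omega> - D t \<omega>)) = (D t \<omega>)\<^sup>2 + (D T \<omega> - D t \<omega>)\<^sup>2"
        by (simp add: power2_eq_square algebra_simps)
      ultimately have "e\<^sup>2 \<le> (D T \<omega>)\<^sup>2 - 2 * (D t \<omega> * (D T \<omega> - D t \<omega>))"
        using add_increasing2[OF zero_le_power2[of "D T \<omega> - D t \<omega>"]] by metis
      then show ?thesis using True by simp
    qed simp
    have "e\<^sup>2 * measure M (A t) = (\<integral>\<omega>. e\<^sup>2 * indicator (A t) \<omega> \<partial>M)" using A[OF t] by simp
    also have "\<dots> \<le> (\<integral>\<omega>. indicator (A t) \<omega> * (D T \<omega>)\<^sup>2 - 2 * (?Z \<omega> * (D T \<omega> - D t \<omega>)) \<partial>M)"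
      by (rule integral_mono) (use le TI[OF t] o A[OF t] in \<open>auto simp: emeasure_eq_measure\<close>)
    also have "\<dots> = (\<integral>\<omega>. indicator (A t) \<omega> * (D T \<omega>)\<^sup>2 \<partial>M)"
      using TI[OF t] o by simp
    finally show ?thesis .
  qed
  have disj: "disjoint_family_on A P"
    unfolding disjoint_family_on_def A_def by (auto simp: not_le) (metis linorder_neqE_linordered_idom not_le)
  have sub: "{\<omega>\<in>space M. \<exists>t\<in>P. e \<le> \<bar>D t \<omega>\<bar>} \<subseteq> (\<Union>t\<in>P. A t)"
  proof
    fix \<omega> assume w: "\<omega> \<in> {\<omega>\<in>space M. \<exists>t\<in>P. e \<le> \<bar>D t \<omega>\<bar>}"
    let ?R = "{t\<in>P. e \<le> \<bar>D t \<omega>\<bar>}"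
    have R: "finite ?R" "?R \<noteq> {}" using fin w by auto
    have "\<bar>D u \<omega>\<bar> < e" if "u \<in> P" "u < Min ?R" for u
      using that Min_le[OF R(1), of u] by force
    then show "\<omega> \<in> (\<Union>t\<in>P. A t)" using Min_in[OF R] w by (auto simp: A_def intro!: bexI[of _ "Min ?R"])
  qed
  have "e\<^sup>2 * measure M {\<omega>\<in>space M. \<exists>t\<in>P. e \<le> \<bar>D t \<omega>\<bar>} \<le> e\<^sup>2 * (\<Sum>t\<in>P. measure M (A t))"
  proof (intro mult_left_mono order_trans[OF finite_measure_mono[OF sub] finite_measure_subadditive_finite[OF fin(1)]])
    show "(\<Union>t\<in>P. A t) \<in> sets M" using A fin(1) by (intro sets.finite_UN) auto
  qed (use A in auto)
  also have "\<dots> \<le> (\<Sum>t\<in>P. \<integral>\<omega>. indicator (A t) \<omega> * (D T \<omega>)\<^sup>2 \<partial>M)"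
    unfolding sum_distrib_left by (rule sum_mono) (rule one)
  also have "\<dots> = (\<integral>\<omega>. (\<Sum>t\<in>P. indicator (A t) \<omega> * (D T \<omega>)\<^sup>2) \<partial>M)"
    by (rule Bochner_Integration.integral_sum[symmetric]) (rule TI)
  also have "\<dots> \<le> (\<integral>\<omega>. (D T \<omega>)\<^sup>2 \<partial>M)"
  proof (rule integral_mono)
    show "integrable M (\<lambda>\<omega>. \<Sum>t\<in>P. indicator (A t) \<omega> * (D T \<omega>)\<^sup>2)" by (rule Bochner_Integration.integrable_sum) (rule TI)
    show "integrable M (\<lambda>\<omega>. (D T \<omega>)\<^sup>2)" by (rule sq[OF T order_refl])
    show "(\<Sum>t\<in>P. indicator (A t) \<omega> * (D T \<omega>)\<^sup>2) \<le> (D T \<omega>)\<^sup>2" for \<omega>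
      unfolding sum_distrib_right[symmetric] indicator_UN_disjoint[OF fin(1) disj, symmetric]
      by (rule mult_left_le_one_le) auto
  qed
  finally show ?thesis using e by (simp add: pos_le_divide_eq mult.commute)
qed simp

text \<open>By continuity the event with strict inequality is decided on a countable dense set of
  times, which is exhausted by finite sets.\<close>

lemma maximal_inequality:
  fixes D :: "real \<Rightarrow> 'a \<Rightarrow> real"
  assumes T: "0 \<le> T" and e: "0 < e"
    and D: "\<And>t. 0 \<le> t \<Longrightarrow> t \<le> T \<Longrightarrow> D t \<in> borel_measurable (H t)"
    and sq: "\<And>t. 0 \<le> t \<Longrightarrow> t \<le> T \<Longrightarrow> integrable M (\<lambda>\<omega>. (D t \<omega>)\<^sup>2)"
    and orth: "\<And>t Z. 0 \<le> t \<Longrightarrow> t \<le> T \<Longrightarrow> Z \<in> borel_measurable (H t) \<Longrightarrow> integrable M Z \<Longrightarrow>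
      integrable M (\<lambda>\<omega>. Z \<omega> * (D T \<omega> - D t \<omega>)) \<and> (\<integral>\<omega>. Z \<omega> * (D T \<omega> - D t \<omega>) \<partial>M) = 0"
    and cont: "\<And>\<omega>. continuous_on UNIV (\<lambda>t. D t \<omega>)"
  shows "{\<omega>\<in>space M. \<exists>t\<in>{0..T}. e < \<bar>D t \<omega>\<bar>} \<in> sets M" (is "?E \<in> _")
    and "measure M {\<omega>\<in>space M. \<exists>t\<in>{0..T}. e < \<bar>D t \<omega>\<bar>} \<le> (\<integral>\<omega>. (D T \<omega>)\<^sup>2 \<partial>M) / e\<^sup>2"
proof -
  define q where "q = from_nat_into (\<rat> \<inter> {0..1::real})"
  have ne: "\<rat> \<inter> {0..1::real} \<noteq> {}" by auto
  have q: "range q = \<rat> \<inter> {0..1}"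
    unfolding q_def by (rule range_from_nat_into[OF ne]) (auto intro: countable_rat)
  define P where "P m = (\<lambda>i. T * q i) ` {..m::nat}" for m
  have Tq: "T * q i \<in> {0..T}" for i
    using q T by (auto intro!: mult_left_le dest!: equalityD1[THEN subsetD, OF _ rangeI[of q i]])
  \<comment> \<open>Writing the absolute value as the zero barrier minus its negative makes the
    results on running maxima available.\<close>
  have rm: "barrier_path (\<lambda>_. 0) (\<lambda>r. - \<bar>D r \<omega>\<bar>)" for \<omega>
    using cont[of \<omega>] by (intro barrier_path.intro) (auto intro!: continuous_intros monoI)
  have ex: "(\<exists>t\<in>{0..T}. e < \<bar>D t \<omega>\<bar>) \<longleftrightarrow> (\<exists>i. e < \<bar>D (T * q i) \<omega>\<bar>)" for \<omega>
  proof -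
    have bdd: "bdd_above ((\<lambda>x. 0 - - \<bar>D (max 0 T * x) \<omega>\<bar>) ` (\<rat> \<inter> {0..1}))"
      by (rule bdd_above_mono[OF barrier_path.bdd[OF rm[of \<omega>], where t=T]]) (use T in \<open>auto intro!: imageI mult_left_le\<close>)
    have "(\<exists>t\<in>{0..T}. e < \<bar>D t \<omega>\<bar>) \<longleftrightarrow> e < running_max (\<lambda>r. 0 - - \<bar>D r \<omega>\<bar>) T"
      using barrier_path.rm_less_iff[OF rm[of \<omega>], of e T] T by simp
    also have "\<dots> \<longleftrightarrow> (\<exists>x\<in>range q. e < \<bar>D (T * x) \<omega>\<bar>)"
      unfolding barrier_path.rm_rational[OF rm] less_cSUP_iff[OF ne bdd] q using T by simp
    finally show ?thesis by blast
  qed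
  define E where "E m = {\<omega>\<in>space M. \<exists>t\<in>P m. e \<le> \<bar>D t \<omega>\<bar>}" for m
  have [measurable]: "D (T * q i) \<in> borel_measurable M" for i
    using Tq[of i] by (intro measurable_from_H[OF D]) auto
  have E [measurable]: "E m \<in> sets M" for m
  proof -
    have "E m = {\<omega>\<in>space M. \<exists>i\<in>{..m}. e \<le> \<bar>D (T * q i) \<omega>\<bar>}" by (auto simp: E_def P_def)
    then show ?thesis by simp
  qed
  show "?E \<in> sets M" unfolding ex by measurable
  have sub: "?E \<subseteq> (\<Union>m. E m)" unfolding ex E_def P_def by (auto intro: less_imp_le)
  have inc: "incseq E" unfolding E_def P_def incseq_def by fastforce
  have "measure M ?E \<le> measure M (\<Union>m. E m)" by (rule finite_measure_mono[OF sub]) measurable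
  also have "\<dots> \<le> (\<integral>\<omega>. (D T \<omega>)\<^sup>2 \<partial>M) / e\<^sup>2"
  proof (rule LIMSEQ_le_const2[OF finite_Lim_measure_incseq[OF _ inc]])
    show "range E \<subseteq> sets M" using E by auto
    have "measure M (E m) \<le> (\<integral>\<omega>. (D T \<omega>)\<^sup>2 \<partial>M) / e\<^sup>2" for m
      unfolding E_def by (rule maximal_inequality_finite[OF _ _ e D sq orth]) (use Tq in \<open>auto simp: P_def\<close>)
    then show "\<exists>n. \<forall>m\<ge>n. measure M (E m) \<le> (\<integral>\<omega>. (D T \<omega>)\<^sup>2 \<partial>M) / e\<^sup>2" by blast
  qed
  finally show "measure M ?E \<le> (\<integral>\<omega>. (D T \<omega>)\<^sup>2 \<partial>M) / e\<^sup>2" .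
qed

lemma integrable_mult_incr:
  fixes Z :: "'a \<Rightarrow> real"
  assumes Z: "Z \<in> borel_measurable (H p)" "integrable M Z" and p: "0 \<le> p" "p \<le> t"
  shows "integrable M (\<lambda>\<omega>. Z \<omega> * (W t \<omega> - W p \<omega>))"
proof (cases "p = t")
  case False
  then show ?thesis
    using indep_var_integrable[OF indep_var_incr[OF Z(1) p(1), of t] Z(2)] integrable_incr_power[OF p, of 1] p by simp
qed simp

lemma path_square:
  assumes "0 \<le> s"
  shows "integrable M (\<lambda>\<omega>. (W s \<omega>)\<^sup>2)" "(\<integral>\<omega>. (W s \<omega>)\<^sup>2 \<partial>M) = s" "integrable M (W s)"
  using integrable_incr_power[of 0 s 2] integral_incr_square[of 0 s] integrable_incr_power[of 0 s 1] assms
  by (simp_all add: path_neg)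

lemma path_covariance:
  assumes "0 \<le> s" "0 \<le> t"
  shows "integrable M (\<lambda>\<omega>. W s \<omega> * W t \<omega>)" "(\<integral>\<omega>. W s \<omega> * W t \<omega> \<partial>M) = min s t"
proof -
  have le: "integrable M (\<lambda>\<omega>. W s \<omega> * W t \<omega>) \<and> (\<integral>\<omega>. W s \<omega> * W t \<omega> \<partial>M) = s" if s: "0 \<le> s" "s \<le> t" for s t
  proof -
    note i = integrable_mult_incr[OF adapted[OF order_refl] path_square(3)[OF s(1)] s]
    have "W s \<omega> * W t \<omega> = W s \<omega> * (W t \<omega> - W s \<omega>) + (W s \<omega>)\<^sup>2" for \<omega>
      by (simp add: power2_eq_square algebra_simps)
    then show ?thesis
      using i integral_mult_incr[OF adapted[OF order_refl] path_square(3)[OF s(1)] s] path_square[OF s(1)] by simp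
  qed
  show "integrable M (\<lambda>\<omega>. W s \<omega> * W t \<omega>)" "(\<integral>\<omega>. W s \<omega> * W t \<omega> \<partial>M) = min s t"
    using le[of s t] le[of t s] assms by (cases "s \<le> t"; simp add: mult.commute min_def)+
qed

lemma incr_covariance:
  assumes s: "0 \<le> s" "s \<le> t" and s': "0 \<le> s'" "s' \<le> t'"
  shows "integrable M (\<lambda>\<omega>. (W t \<omega> - W s \<omega>) * (W t' \<omega> - W s' \<omega>))"
    and "(\<integral>\<omega>. (W t \<omega> - W s \<omega>) * (W t' \<omega> - W s' \<omega>) \<partial>M) = (\<integral>r. indicator {s<..t} r * indicator {s'<..t'} r \<partial>lborel)"
proof -
  have e: "(W t \<omega> - W s \<omega>) * (W t' \<omega> - W s' \<omega>) = W t \<omega> * W t' \<omega> - W t \<omega> * W s' \<omega> - W s \<omega> * W t' \<omega> + W s \<omega> * W s' \<omega>" for \<omega>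
    by (simp add: algebra_simps)
  have t: "0 \<le> t" "0 \<le> t'" using s s' by auto
  note c = path_covariance[OF t] path_covariance[OF t(1) s'(1)] path_covariance[OF s(1) t(2)] path_covariance[OF s(1) s'(1)]
  show "integrable M (\<lambda>\<omega>. (W t \<omega> - W s \<omega>) * (W t' \<omega> - W s' \<omega>))" unfolding e using c by simp
  have "(\<integral>r. indicator {s<..t} r * indicator {s'<..t'} r \<partial>lborel) = measure lborel {max s s'<..min t t'}"
    by (simp add: indicator_inter_arith[symmetric] Int_greaterThanAtMost)
  also have "\<dots> = max 0 (min t t' - max s s')" by (cases "max s s' \<le> min t t'") auto
  also have "\<dots> = min t t' - min t s' - min s t' + min s s'" using s s' by (auto simp: min_def max_def)
  finally show "(\<integral>\<omega>. (W t \<omega> - W s \<omega>) * (W t' \<omega> - W s' \<omega>) \<partial>M) = (\<integral>r. indicator {s<..t} r * indicator {s'<..t'} r \<partial>lborel)"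
    unfolding e using c by simp
qed

text \<open>Both sides expand into the same double sum of covariances. The intervals may overlap, so
  differences of integrals over unrelated grids are covered without a common refinement.\<close>

lemma wiener_isometry:
  assumes J: "finite J" "\<And>j. j \<in> J \<Longrightarrow> 0 \<le> s j \<and> s j \<le> t j"
  shows "integrable M (\<lambda>\<omega>. (\<Sum>j\<in>J. a j * (W (t j) \<omega> - W (s j) \<omega>))\<^sup>2)"
    and "integrable lborel (\<lambda>r. (\<Sum>j\<in>J. a j * indicator {s j<..t j} r)\<^sup>2)"
    and "(\<integral>\<omega>. (\<Sum>j\<in>J. a j * (W (t j) \<omega> - W (s j) \<omega>))\<^sup>2 \<partial>M) = (\<integral>r. (\<Sum>j\<in>J. a j * indicator {s j<..t j} r)\<^sup>2 \<partial>lborel)"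
proof -
  have e1: "(\<Sum>j\<in>J. a j * (W (t j) \<omega> - W (s j) \<omega>))\<^sup>2 =
      (\<Sum>i\<in>J. \<Sum>j\<in>J. (a i * a j) * ((W (t i) \<omega> - W (s i) \<omega>) * (W (t j) \<omega> - W (s j) \<omega>)))" for \<omega>
    unfolding power2_eq_square sum_product by (simp add: algebra_simps)
  have e2: "(\<Sum>j\<in>J. a j * indicator {s j<..t j} r)\<^sup>2 =
      (\<Sum>i\<in>J. \<Sum>j\<in>J. (a i * a j) * (indicator {s i<..t i} r * indicator {s j<..t j} r))" for r
    unfolding power2_eq_square sum_product by (simp add: algebra_simps)
  have fin: "emeasure lborel {a<..b} < \<infinity>" for a b :: real by (cases "a \<le> b") auto
  have il: "integrable lborel (\<lambda>r. indicator {s i<..t i} r * indicator {s j<..t j} r :: real)" for i j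
    unfolding indicator_inter_arith[symmetric] Int_greaterThanAtMost
    by (intro integrable_real_indicator) (use fin in auto)
  have im: "integrable M (\<lambda>\<omega>. (W (t i) \<omega> - W (s i) \<omega>) * (W (t j) \<omega> - W (s j) \<omega>))" if "i \<in> J" "j \<in> J" for i j
    using J(2) that by (intro incr_covariance) auto
  show "integrable M (\<lambda>\<omega>. (\<Sum>j\<in>J. a j * (W (t j) \<omega> - W (s j) \<omega>))\<^sup>2)"
    unfolding e1 by (intro Bochner_Integration.integrable_sum integrable_mult_right im)
  show "integrable lborel (\<lambda>r. (\<Sum>j\<in>J. a j * indicator {s j<..t j} r)\<^sup>2)"
    unfolding e2 by (intro Bochner_Integration.integrable_sum integrable_mult_right il)
  show "(\<integral>\<omega>. (\<Sum>j\<in>J. a j * (W (t j) \<omega> - W (s j) \<omega>))\<^sup>2 \<partial>M) = (\<integral>r. (\<Sum>j\<in>J. a j * indicator {s j<..t j} r)\<^sup>2 \<partial>lborel)"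
    unfolding e1 e2
    by (simp add: Bochner_Integration.integral_sum Bochner_Integration.integrable_sum im il J(2) incr_covariance(2) cong: sum.cong)
qed

end

lemma continuous_on_nonneg:
  fixes f :: "real \<Rightarrow> real"
  assumes "\<And>T. 0 \<le> T \<Longrightarrow> continuous_on {0..T} f" shows "continuous_on {0..} f"
  unfolding continuous_on_def
proof
  fix t :: real assume t: "t \<in> {0..}"
  have "at t within {0..} = at t within {0..t + 1}"
    using t by (intro at_within_nhd[of _ "{..<t + 1}"]) auto
  then show "(f \<longlongrightarrow> f t) (at t within {0..})"
    using assms[of "t + 1"] t by (auto simp: continuous_on_def)
qed

context clean_bm
begin

abbreviation WI :: "nat \<Rightarrow> (nat \<Rightarrow> real) \<Rightarrow> (nat \<Rightarrow> real) \<Rightarrow> real \<Rightarrow> 'a \<Rightarrow> real" where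
  "WI n p c \<equiv> simple_integral W n p (\<lambda>i _. c i)"

lemma simple_integral_H: "WI n p c t \<in> borel_measurable (H t)"
proof -
  have [measurable]: "W (min t q) \<in> borel_measurable (H t)" for q by (rule adapted) simp
  show ?thesis unfolding simple_integral_def[abs_def] by measurable
qed

lemma simple_integral_cont: "continuous_on UNIV (\<lambda>t. WI n p c t \<omega>)"
  unfolding simple_integral_def
  by (intro continuous_intros continuous_on_compose2[OF path_cont]) auto

text \<open>What a simple integral with constant coefficients gains between \<open>t\<close> and
  \<open>T\<close> is a combination of increments after \<open>t\<close>, which are orthogonal to
  the history at \<open>t\<close>.\<close>

lemma simple_integral_orth:
  assumes t: "0 \<le> t" "t \<le> T" and Z: "Z \<in> borel_measurable (H t)" "integrable M Z"
  shows "integrable M (\<lambda>\<omega>. Z \<omega> * (WI n p c T \<omega> - WI n p c t \<omega>))"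
    and "(\<integral>\<omega>. Z \<omega> * (WI n p c T \<omega> - WI n p c t \<omega>) \<partial>M) = 0"
proof -
  \<comment> \<open>Grid points moved into \<open>[t,T]\<close>; the gain between \<open>t\<close>
    and \<open>T\<close> is a sum over increments between these points.\<close>
  let ?b = "\<lambda>i. max t (min T (p i))"
  have m: "W (min T q) \<omega> - W (min t q) \<omega> = W (max t (min T q)) \<omega> - W t \<omega>" for q \<omega>
    using t by (auto simp: min_def max_def)
  have "W (min T (p (Suc i))) \<omega> - W (min T (p i)) \<omega> - (W (min t (p (Suc i))) \<omega> - W (min t (p i)) \<omega>)
      = (W (?b (Suc i)) \<omega> - W t \<omega>) - (W (?b i) \<omega> - W t \<omega>)" for i \<omega>
    using m[of "p (Suc i)" \<omega>] m[of "p i" \<omega>] by linarith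
  then have e: "Z \<omega> * (WI n p c T \<omega> - WI n p c t \<omega>) =
      (\<Sum>i<n. c i * (Z \<omega> * (W (?b (Suc i)) \<omega> - W t \<omega>) - Z \<omega> * (W (?b i) \<omega> - W t \<omega>)))" for \<omega>
    unfolding simple_integral_def sum_subtractf[symmetric] right_diff_distrib[symmetric]
    by (simp only: sum_distrib_left mult.left_commute)
  have i: "integrable M (\<lambda>\<omega>. Z \<omega> * (W (?b i) \<omega> - W t \<omega>))" "(\<integral>\<omega>. Z \<omega> * (W (?b i) \<omega> - W t \<omega>) \<partial>M) = 0" for i
    using integrable_mult_incr[OF Z t(1), of "?b i"] integral_mult_incr[OF Z t(1), of "?b i"] by auto
  show "integrable M (\<lambda>\<omega>. Z \<omega> * (WI n p c T \<omega> - WI n p c t \<omega>))"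
    "(\<integral>\<omega>. Z \<omega> * (WI n p c T \<omega> - WI n p c t \<omega>) \<partial>M) = 0"
    unfolding e using i by (simp_all add: Bochner_Integration.integral_sum)
qed

text \<open>The two sums are joined over the disjoint union of their index sets, the second with
  negated coefficients, into a single sum for the isometry.\<close>

lemma simple_integral_isometry:
  assumes p: "\<And>i. i < n \<Longrightarrow> 0 \<le> p i \<and> p i \<le> p (Suc i)" and p': "\<And>i. i < n' \<Longrightarrow> 0 \<le> p' i \<and> p' i \<le> p' (Suc i)" and T: "0 \<le> T"
  shows "integrable M (\<lambda>\<omega>. (WI n p c T \<omega> - WI n' p' c' T \<omega>)\<^sup>2)"
    and "ennreal (\<integral>\<omega>. (WI n p c T \<omega> - WI n' p' c' T \<omega>)\<^sup>2 \<partial>M) =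
      (\<integral>\<^sup>+r\<in>{0..T}. ennreal ((simple_process n p (\<lambda>i _. c i) r \<omega> - simple_process n' p' (\<lambda>i _. c' i) r \<omega>)\<^sup>2) \<partial>lborel)"
proof -
  let ?J = "{..<n} <+> {..<n'}"
  let ?s = "case_sum (\<lambda>i. min T (p i)) (\<lambda>i. min T (p' i))"
  let ?t = "case_sum (\<lambda>i. min T (p (Suc i))) (\<lambda>i. min T (p' (Suc i)))"
  let ?a = "case_sum c (\<lambda>i. - c' i)"
  have J: "finite ?J" "\<And>j. j \<in> ?J \<Longrightarrow> 0 \<le> ?s j \<and> ?s j \<le> ?t j" using p p' T by (auto simp: min_def) fastforce+
  have e1: "WI n p c T \<omega> - WI n' p' c' T \<omega> = (\<Sum>j\<in>?J. ?a j * (W (?t j) \<omega> - W (?s j) \<omega>))" for \<omega>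
    by (simp add: simple_integral_def sum.Plus sum_negf)
  have ind: "indicator {min T a<..min T b} r = indicator {a<..b} r * indicat_real {0..T} r" if "0 \<le> a" for a b r
    using that by (auto simp: indicator_def)
  have e2: "ennreal ((simple_process n p (\<lambda>i _. c i) r \<omega> - simple_process n' p' (\<lambda>i _. c' i) r \<omega>)\<^sup>2) * indicator {0..T} r
      = ennreal ((\<Sum>j\<in>?J. ?a j * indicator {?s j<..?t j} r)\<^sup>2)" for r
  proof -
    have "(\<Sum>j\<in>?J. ?a j * indicator {?s j<..?t j} r) =
        (\<Sum>i<n. c i * indicator {p i<..p (Suc i)} r * indicator {0..T} r) - (\<Sum>i<n'. c' i * indicator {p' i<..p' (Suc i)} r * indicator {0..T} r)"
    proof -
      have "(\<Sum>i<n. c i * indicator {min T (p i)<..min T (p (Suc i))} r) = (\<Sum>i<n. c i * indicator {p i<..p (Suc i)} r * indicator {0..T} r)"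
        "(\<Sum>i<n'. c' i * indicator {min T (p' i)<..min T (p' (Suc i))} r) = (\<Sum>i<n'. c' i * indicator {p' i<..p' (Suc i)} r * indicator {0..T} r)"
        unfolding mult.assoc using p p' by (auto intro!: sum.cong simp only: ind lessThan_iff)
      then show ?thesis
        by (subst sum.Plus) (simp_all only: comp_def sum.case minus_mult_left[symmetric] sum_negf add_uminus_conv_diff finite_lessThan)
    qed
    also have "\<dots> = (simple_process n p (\<lambda>i _. c i) r \<omega> - simple_process n' p' (\<lambda>i _. c' i) r \<omega>) * indicator {0..T} r"
      by (simp only: simple_process_def sum_distrib_right left_diff_distrib)
    finally show ?thesis by (auto simp: indicator_def)
  qed
  note iso = wiener_isometry[where s="?s" and t="?t", OF J, where a="?a"]
  show "integrable M (\<lambda>\<omega>. (WI n p c T \<omega> - WI n' p' c' T \<omega>)\<^sup>2)" unfolding e1 by (rule iso(1))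
  show "ennreal (\<integral>\<omega>. (WI n p c T \<omega> - WI n' p' c' T \<omega>)\<^sup>2 \<partial>M) =
      (\<integral>\<^sup>+r\<in>{0..T}. ennreal ((simple_process n p (\<lambda>i _. c i) r \<omega> - simple_process n' p' (\<lambda>i _. c' i) r \<omega>)\<^sup>2) \<partial>lborel)"
    unfolding e1 e2 by (subst iso(3), assumption) (rule nn_integral_eq_integral[symmetric, OF iso(2)], auto)
qed

text \<open>Along a subsequence the integrals are so close in mean square that the maximal
  inequality and the Borel-Cantelli lemma make the successive differences uniformly summable on
  compact time intervals, almost surely; hence the limit is continuous. The coefficients are
  deterministic, so any sample point may be used in \<open>sp\<close>.\<close>

theorem wiener_integral:
  fixes n :: "nat \<Rightarrow> nat" and p c :: "nat \<Rightarrow> nat \<Rightarrow> real" and h :: "real \<Rightarrow> real"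
  defines "sp k r \<equiv> simple_process (n k) (p k) (\<lambda>i (_::'a). c k i) r undefined"
  assumes p: "\<And>k i. i < n k \<Longrightarrow> 0 \<le> p k i \<and> p k i \<le> p k (Suc i)"
    and h: "\<And>T. (\<lambda>r. h r * indicator {0..T} r) \<in> borel_measurable borel"
    and lim: "\<And>T. 0 < T \<Longrightarrow> (\<lambda>k. \<integral>\<^sup>+r\<in>{0..T}. ennreal ((h r - sp k r)\<^sup>2) \<partial>lborel) \<longlonglongrightarrow> 0"
  shows "\<exists>\<kappa> I. strict_mono \<kappa> \<and> (\<forall>t\<ge>0. I t \<in> borel_measurable (H t)) \<and>
    (AE \<omega> in M. continuous_on {0..} (\<lambda>t. I t \<omega>)) \<and>
    (\<forall>t\<ge>0. AE \<omega> in M. (\<lambda>j. WI (n (\<kappa> j)) (p (\<kappa> j)) (c (\<kappa> j)) t \<omega>) \<longlonglongrightarrow> I t \<omega>)"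
proof -
  define \<rho> where "\<rho> k T = (\<integral>\<^sup>+r\<in>{0..T}. ennreal ((h r - sp k r)\<^sup>2) \<partial>lborel)" for k T
  \<comment> \<open>The rate \<open>1/8\<close> is divided later: the level \<open>(1/2)^j\<close>
    enters the maximal inequality squared, as \<open>(1/4)^j\<close>, which leaves a probability of
    at most \<open>(1/2)^j\<close>. The divisor \<open>4\<close> absorbs the constants from the
    square of a sum.\<close>
  have "\<exists>g. \<forall>k\<ge>g. \<rho> k (real (Suc j)) < ennreal ((1/8) ^ j / 4)" for j
    unfolding eventually_sequentially[symmetric] \<rho>_def by (rule order_tendstoD(2)[OF lim]) auto
  then obtain g where g: "\<And>j k. g j \<le> k \<Longrightarrow> \<rho> k (real (Suc j)) < ennreal ((1/8) ^ j / 4)" by metis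
  define \<kappa> where "\<kappa> j = j + sum g {..j}" for j
  have mono: "strict_mono \<kappa>" by (simp add: strict_mono_Suc_iff \<kappa>_def)
  have gk: "g j \<le> \<kappa> j" for j unfolding \<kappa>_def using member_le_sum[of j "{..j}" g] by simp
  let ?I = "\<lambda>j. WI (n (\<kappa> j)) (p (\<kappa> j)) (c (\<kappa> j))"
  define D where "D j t \<omega> = ?I j t \<omega> - ?I (Suc j) t \<omega>" for j t \<omega>
  have DH: "D j t \<in> borel_measurable (H t)" for j t
    using simple_integral_H by (auto simp: D_def[abs_def])
  have Dc: "continuous_on UNIV (\<lambda>t. D j t \<omega>)" for j \<omega>
    unfolding D_def by (intro continuous_on_diff simple_integral_cont)
  have D2: "integrable M (\<lambda>\<omega>. (D j t \<omega>)\<^sup>2)" if "0 \<le> t" for j t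
    unfolding D_def using p that by (intro simple_integral_isometry) auto
  have Do: "integrable M (\<lambda>\<omega>. Z \<omega> * (D j T \<omega> - D j t \<omega>)) \<and> (\<integral>\<omega>. Z \<omega> * (D j T \<omega> - D j t \<omega>) \<partial>M) = 0"
    if "0 \<le> t" "t \<le> T" "Z \<in> borel_measurable (H t)" "integrable M Z" for j t T Z
  proof -
    note o = simple_integral_orth[OF that]
    have e: "Z \<omega> * (D j T \<omega> - D j t \<omega>) = Z \<omega> * (?I j T \<omega> - ?I j t \<omega>) - Z \<omega> * (?I (Suc j) T \<omega> - ?I (Suc j) t \<omega>)" for \<omega>
      by (simp add: D_def algebra_simps)
    show ?thesis unfolding e using o by simp
  qed
  have tri: "(\<integral>\<^sup>+r\<in>{0..T}. ennreal ((sp k r - sp l r)\<^sup>2) \<partial>lborel) \<le> 2 * \<rho> k T + 2 * \<rho> l T" for k l T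
  proof -
    have [measurable]: "sp k \<in> borel_measurable borel" for k unfolding sp_def[abs_def] simple_process_def by measurable
    have m: "(\<lambda>r. ennreal ((h r - sp k r)\<^sup>2) * indicator {0..T} r) \<in> borel_measurable lborel" for k
    proof -
      have "ennreal ((h r - sp k r)\<^sup>2) * indicator {0..T} r = ennreal ((h r * indicator {0..T} r - sp k r * indicator {0..T} r)\<^sup>2)" for r
        by (auto simp: indicator_def)
      then show ?thesis using h[of T] by simp
    qed
    have "ennreal ((sp k r - sp l r)\<^sup>2) * indicator {0..T} r \<le>
        2 * (ennreal ((h r - sp k r)\<^sup>2) * indicator {0..T} r) + 2 * (ennreal ((h r - sp l r)\<^sup>2) * indicator {0..T} r)" for r
    proof -
      have "(sp k r - sp l r)\<^sup>2 \<le> 2 * (h r - sp k r)\<^sup>2 + 2 * (h r - sp l r)\<^sup>2"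
        using zero_le_power2[of "(h r - sp k r) + (h r - sp l r)"] by (simp add: power2_eq_square algebra_simps)
      then have "ennreal ((sp k r - sp l r)\<^sup>2) \<le> ennreal (2 * (h r - sp k r)\<^sup>2 + 2 * (h r - sp l r)\<^sup>2)" by (rule ennreal_leI)
      also have "\<dots> = 2 * ennreal ((h r - sp k r)\<^sup>2) + 2 * ennreal ((h r - sp l r)\<^sup>2)"
        by (simp add: ennreal_plus ennreal_mult)
      finally show ?thesis by (auto simp: indicator_def)
    qed
    then have "(\<integral>\<^sup>+r\<in>{0..T}. ennreal ((sp k r - sp l r)\<^sup>2) \<partial>lborel) \<le>
      (\<integral>\<^sup>+r. 2 * (ennreal ((h r - sp k r)\<^sup>2) * indicator {0..T} r) + 2 * (ennreal ((h r - sp l r)\<^sup>2) * indicator {0..T} r) \<partial>lborel)"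
      by (rule nn_integral_mono)
    also have "\<dots> = 2 * \<rho> k T + 2 * \<rho> l T"
      unfolding \<rho>_def using m by (simp add: nn_integral_add nn_integral_cmult)
    finally show ?thesis .
  qed
  have E2: "(\<integral>\<omega>. (D j (real (Suc j)) \<omega>)\<^sup>2 \<partial>M) \<le> (1/8) ^ j" for j
  proof -
    have "ennreal (\<integral>\<omega>. (D j (real (Suc j)) \<omega>)\<^sup>2 \<partial>M) = (\<integral>\<^sup>+r\<in>{0..real (Suc j)}. ennreal ((sp (\<kappa> j) r - sp (\<kappa> (Suc j)) r)\<^sup>2) \<partial>lborel)"
      unfolding D_def sp_def using p by (intro simple_integral_isometry) auto
    also have "\<dots> \<le> 2 * \<rho> (\<kappa> j) (real (Suc j)) + 2 * \<rho> (\<kappa> (Suc j)) (real (Suc j))" by (rule tri)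
    also have "\<dots> \<le> 2 * ennreal ((1/8) ^ j / 4) + 2 * ennreal ((1/8) ^ j / 4)"
    proof (intro add_mono mult_left_mono less_imp_le[OF g])
      show "g j \<le> \<kappa> (Suc j)" using gk[of j] strict_monoD[OF mono, of j "Suc j"] by simp
    qed (use gk in auto)
    also have "\<dots> = ennreal (2 * ((1/8) ^ j / 4) + 2 * ((1/8) ^ j / 4))"
    proof -
      have e: "2 * ennreal x + 2 * ennreal x = ennreal (2 * x + 2 * x)" if "0 \<le> x" for x :: real
      proof -
        have "2 * ennreal x = ennreal (2 * x)" using that by (simp add: ennreal_mult)
        then show ?thesis using that by (simp only: ennreal_plus[symmetric] mult_nonneg_nonneg zero_le_numeral)
      qed
      show ?thesis by (rule e) simp
    qed
    finally show ?thesis by (subst (asm) ennreal_le_iff) auto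
  qed
  define bad where "bad j = {\<omega>\<in>space M. \<exists>t\<in>{0..real (Suc j)}. (1/2) ^ j < \<bar>D j t \<omega>\<bar>}" for j
  note max = maximal_inequality[of "real (Suc j)" "(1/2) ^ j" "D j" for j, OF _ _ DH D2 Do Dc, folded bad_def]
  have bad: "bad j \<in> sets M" "measure M (bad j) \<le> (1/2) ^ j" for j
  proof -
    show "bad j \<in> sets M" by (rule max(1)) auto
    have "measure M (bad j) \<le> (\<integral>\<omega>. (D j (real (Suc j)) \<omega>)\<^sup>2 \<partial>M) / ((1/2) ^ j)\<^sup>2" by (rule max(2)) auto
    also have "\<dots> \<le> (1/8) ^ j / ((1/2) ^ j)\<^sup>2" by (intro divide_right_mono E2) auto
    also have "\<dots> = (1/2) ^ j" by (simp add: power2_eq_square power_mult_distrib[symmetric] power_divide[symmetric])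
    finally show "measure M (bad j) \<le> (1/2) ^ j" .
  qed
  have sb: "summable (\<lambda>j. measure M (bad j))"
    by (rule summable_comparison_test'[where N=0 and g="\<lambda>j. (1/2) ^ j"]) (use bad(2) in \<open>auto intro: summable_geometric\<close>)
  have good: "AE \<omega> in M. eventually (\<lambda>j. \<omega> \<in> space M - bad j) sequentially"
    by (rule borel_cantelli_AE1[OF bad(1) _ sb]) (simp add: emeasure_eq_measure)
  have ul: "uniform_limit {0..T} (\<lambda>m t. \<Sum>i<m. D i t \<omega>) (\<lambda>t. \<Sum>i. D i t \<omega>) sequentially"
    if "eventually (\<lambda>j. \<omega> \<in> space M - bad j) sequentially" for \<omega> T
  proof (rule Weierstrass_m_test_ev[where M="\<lambda>j. (1/2) ^ j"])
    obtain m where "T \<le> real m" using real_arch_simple by blast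
    then have "eventually (\<lambda>j. T \<le> real (Suc j)) sequentially" by (intro eventually_sequentiallyI[of m]) simp
    with that show "eventually (\<lambda>j. \<forall>t\<in>{0..T}. norm (D j t \<omega>) \<le> (1/2) ^ j) sequentially"
      by eventually_elim (fastforce simp: bad_def not_less)
  qed (auto intro: summable_geometric)
  have tele: "(\<Sum>i<m. D i t \<omega>) = ?I 0 t \<omega> - ?I m t \<omega>" for m t \<omega>
    unfolding D_def by (rule sum_lessThan_telescope')
  \<comment> \<open>The limit in telescoped form, which is measurable in the history at
    \<open>t\<close> also where the series diverges.\<close>
  define I where "I t \<omega> = ?I 0 t \<omega> - (\<Sum>i. D i t \<omega>)" for t \<omega>
  have "I t \<in> borel_measurable (H t)" for t
    unfolding I_def[abs_def] using DH simple_integral_H by (intro borel_measurable_diff borel_measurable_suminf)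
  moreover have "AE \<omega> in M. continuous_on {0..} (\<lambda>t. I t \<omega>)"
    using good
  proof eventually_elim
    case (elim \<omega>)
    show ?case
    proof (rule continuous_on_nonneg)
      fix T :: real
      have "continuous_on {0..T} (\<lambda>t. \<Sum>i. D i t \<omega>)"
        by (rule uniform_limit_theorem[OF _ ul[OF elim]])
          (use Dc in \<open>auto intro!: always_eventually continuous_on_sum intro: continuous_on_subset\<close>)
      then show "continuous_on {0..T} (\<lambda>t. I t \<omega>)"
        unfolding I_def by (intro continuous_on_diff continuous_on_subset[OF simple_integral_cont]) auto
    qed
  qed
  moreover have "AE \<omega> in M. (\<lambda>j. ?I j t \<omega>) \<longlonglongrightarrow> I t \<omega>" if "0 \<le> t" for t
    using good
  proof eventually_elim
    case (elim \<omega>)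
    have "(\<lambda>m. \<Sum>i<m. D i t \<omega>) \<longlonglongrightarrow> (\<Sum>i. D i t \<omega>)"
      by (rule tendsto_uniform_limitI[OF ul[OF elim, of t]]) (use that in simp)
    from tendsto_diff[OF tendsto_const[of "?I 0 t \<omega>"] this] show ?case by (simp add: tele I_def)
  qed
  ultimately show ?thesis using mono by blast
qed

end

section \<open>Vanishing transport noise, and the weak solution in both cases\<close>

context stefan
begin

text \<open>For \<open>\<theta> = 0\<close> the path of \<open>W\<close> has no effect on the noise,
  hence none on the iteration or on anything derived from it.\<close>

lemma degenerate:
  assumes "\<theta> = 0"
  shows "front \<omega> = front \<omega>'" "X \<omega> = X \<omega>'" "live \<omega> = live \<omega>'" "v \<omega> = v \<omega>'"
proof -
  have n: "noise r \<omega> = noise r \<omega>'" for r unfolding noise_def[abs_def] using assms by simp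
  have "S n \<omega> = S n \<omega>'" for n by (induction n) (simp_all add: n)
  then show f: "front \<omega> = front \<omega>'" by (simp add: front_def s_inf_def fun_eq_iff)
  show "X \<omega> = X \<omega>'" by (simp add: X_def n fun_eq_iff)
  show l: "live \<omega> = live \<omega>'" by (simp add: live_def mx_def n f fun_eq_iff)
  show "v \<omega> = v \<omega>'" by (simp add: v_def n l fun_eq_iff)
qed

lemma degenerate_data:
  assumes "\<theta> = 0"
  shows "N \<phi> t \<omega> = N \<phi> t \<omega>'" "H \<phi> r \<omega> = H \<phi> r \<omega>'" "xi \<phi> k i \<omega> = xi \<phi> k i \<omega>'"
  unfolding N_def[abs_def] stop_def absorbed_def tau_def H_def xi_def coef_def fst_conv snd_conv
    degenerate[OF assms, of \<omega> \<omega>'] by (rule refl)+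

text \<open>With the simple integrals multiplied by \<open>0\<close>, the mean error is a constant
  sequence that tends to \<open>0\<close>; the integral of \<open>N\<close> does not depend on the
  sample point, so it vanishes everywhere.\<close>

lemma martingale_part_degenerate:
  assumes \<theta>: "\<theta> = 0" and \<phi>: "\<phi> \<in> C12b" and t: "0 \<le> t"
  shows "(\<integral>x. N \<phi> t \<omega> x \<partial>Q) = 0"
proof -
  have "(\<lambda>k::nat. \<integral>\<omega>'. \<bar>\<integral>x. N \<phi> t \<omega>' x \<partial>Q\<bar> \<partial>M) \<longlonglongrightarrow> 0" using mean_error(1)[OF \<phi> t] \<theta> by simp
  then have "(\<integral>\<omega>'. \<bar>\<integral>x. N \<phi> t \<omega>' x \<partial>Q\<bar> \<partial>M) = 0" by (simp add: LIMSEQ_const_iff)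
  moreover have "(\<integral>\<omega>'. \<bar>\<integral>x. N \<phi> t \<omega>' x \<partial>Q\<bar> \<partial>M) = (\<integral>\<omega>'. \<bar>\<integral>x. N \<phi> t \<omega> x \<partial>Q\<bar> \<partial>M)"
    by (rule Bochner_Integration.integral_cong[OF refl]) (rule arg_cong[OF degenerate_data(1)[OF \<theta>]])
  ultimately show ?thesis by (simp add: W.prob_space)
qed

text \<open>The coefficients do not depend on the sample point and may be read off at one of them,
  which makes the integral a Wiener integral. The approximating processes are passed to the same
  subsequence.\<close>

theorem ito_integral_degenerate:
  assumes \<theta>: "\<theta> = 0" and \<phi>: "\<phi> \<in> C12b"
  shows "\<exists>I. ito_integral M FW W (H \<phi>) I"
proof -
  obtain \<omega>0 where w0: "\<omega>0 \<in> space M" using W.not_empty by blast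
  define c where "c k i = xi \<phi> k i \<omega>0" for k i
  have xi: "xi \<phi> k = (\<lambda>i _. c k i)" for k
    using degenerate_data(3)[OF \<theta>, of \<phi> k _ _ \<omega>0] by (simp add: c_def fun_eq_iff)
  have "\<exists>\<iota> I. strict_mono \<iota> \<and> (\<forall>t\<ge>0. I t \<in> borel_measurable (HW t)) \<and>
    (AE \<omega> in M. continuous_on {0..} (\<lambda>t. I t \<omega>)) \<and>
    (\<forall>t\<ge>0. AE \<omega> in M. (\<lambda>j. simple_integral W (gn (\<iota> j)) (gp (\<iota> j)) (\<lambda>i _. c (\<iota> j) i) t \<omega>) \<longlonglongrightarrow> I t \<omega>)"
  proof (rule W.wiener_integral[where h="\<lambda>r. H \<phi> r \<omega>0"])
    show "0 \<le> gp k i \<and> gp k i \<le> gp k (Suc i)" for k i by (simp add: gp_nonneg gp_mono)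
    show "(\<lambda>k. \<integral>\<^sup>+r\<in>{0..T}. ennreal ((H \<phi> r \<omega>0 - simple_process (gn k) (gp k) (\<lambda>i _. c k i) r undefined)\<^sup>2) \<partial>lborel) \<longlonglongrightarrow> 0" if "0 < T" for T
      using simple_process_L2[OF \<phi> that w0] unfolding xi by (simp add: simple_process_def)
  qed (rule H_path_measurable[OF \<phi> w0])
  then obtain \<iota> I where mono: "strict_mono \<iota>" and IH: "\<And>t. 0 \<le> t \<Longrightarrow> I t \<in> borel_measurable (HW t)"
    and cont: "AE \<omega> in M. continuous_on {0..} (\<lambda>t. I t \<omega>)"
    and lim: "\<And>t. 0 \<le> t \<Longrightarrow> AE \<omega> in M. (\<lambda>j. simple_integral W (gn (\<iota> j)) (gp (\<iota> j)) (xi \<phi> (\<iota> j)) t \<omega>) \<longlonglongrightarrow> I t \<omega>"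
    unfolding xi by blast
  have IF: "I t \<in> borel_measurable (FW t)" if "0 \<le> t" for t
  proof (rule measurable_from_subalg[OF _ IH[OF that]])
    show "subalgebra (FW t) (HW t)"
      using W.H_mono[OF less_imp_le] unfolding subalgebra_def space_FW W.space_H sets_FW by blast
  qed
  have "ito_integral M FW W (H \<phi>) I"
    unfolding ito_integral_def
  proof (intro conjI allI impI exI[of _ "\<lambda>k. gn (\<iota> k)"] exI[of _ "\<lambda>k. gp (\<iota> k)"] exI[of _ "\<lambda>k. xi \<phi> (\<iota> k)"] cont IF)
    show "progressive FW (H \<phi>)" by (rule H_progressive[OF \<phi>])
    show "simple_data M FW (gn (\<iota> k)) (gp (\<iota> k)) (xi \<phi> (\<iota> k))" for k by (rule xi_simple_data[OF \<phi>])
    show "(\<lambda>k. measure M {\<omega>\<in>space M. ennreal e < (\<integral>\<^sup>+r\<in>{0..T}. ennreal ((H \<phi> r \<omega> - simple_process (gn (\<iota> k)) (gp (\<iota> k)) (xi \<phi> (\<iota> k)) r \<omega>)\<^sup>2) \<partial>lborel)}) \<longlonglongrightarrow> 0"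
      if "0 < T" "0 < e" for T e
      using LIMSEQ_subseq_LIMSEQ[OF simple_process_measure[OF \<phi> that] mono] by (simp add: comp_def)
    show "(\<lambda>k. measure M {\<omega>\<in>space M. e < \<bar>I t \<omega> - simple_integral W (gn (\<iota> k)) (gp (\<iota> k)) (xi \<phi> (\<iota> k)) t \<omega>\<bar>}) \<longlonglongrightarrow> 0"
      if t: "0 \<le> t" and e: "0 < e" for t e
    proof -
      let ?D = "\<lambda>k \<omega>. ennreal \<bar>I t \<omega> - simple_integral W (gn (\<iota> k)) (gp (\<iota> k)) (xi \<phi> (\<iota> k)) t \<omega>\<bar>"
      have "(\<lambda>k. measure M {\<omega>\<in>space M. ennreal e < ?D k \<omega>}) \<longlonglongrightarrow> 0"
      proof (rule tendsto_measure_of_pointwise[OF W.finite_measure_axioms])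
        show "?D k \<in> borel_measurable M" for k
        proof -
          have [measurable]: "xi \<phi> k i \<in> borel_measurable M" for k i by (rule FW_M[OF xi_FW[OF \<phi>]])
          have [measurable]: "I t \<in> borel_measurable M" by (rule W.measurable_from_H[OF IH[OF t]])
          show ?thesis unfolding simple_integral_def by measurable
        qed
        show "AE \<omega> in M. (\<lambda>k. ?D k \<omega>) \<longlonglongrightarrow> 0"
          using lim[OF t]
        proof eventually_elim
          case (elim \<omega>)
          have "(\<lambda>k. \<bar>I t \<omega> - simple_integral W (gn (\<iota> k)) (gp (\<iota> k)) (xi \<phi> (\<iota> k)) t \<omega>\<bar>) \<longlonglongrightarrow> \<bar>I t \<omega> - I t \<omega>\<bar>"
            by (intro tendsto_rabs tendsto_diff tendsto_const elim)
          then show ?case using tendsto_ennrealI by fastforce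
        qed
      qed (use e in simp)
      then show ?thesis using e by (simp add: ennreal_less_iff)
    qed
  qed
  then show ?thesis by blast
qed

text \<open>For \<open>\<theta> = 0\<close> the identity holds with any version of the stochastic
  integral; otherwise the identity itself dictates the version.\<close>

theorem weak_solution:
  assumes u0: "AE x in lborel. v0 x = u0 x" "u0 \<in> borel_measurable borel"
  shows "\<exists>J. (\<forall>\<phi>\<in>C12b. ito_integral M FW W (H \<phi>) (J \<phi>)) \<and>
    (\<forall>\<omega>. \<forall>t>0. \<forall>\<phi>\<in>C12b. weak_identity \<kappa> lam \<theta> u0 s0 (v \<omega>) (front \<omega>) \<phi> t (J \<phi> t \<omega>))"
proof (cases "\<theta> = 0")
  case True
  obtain J where J: "\<And>\<phi>. \<phi> \<in> C12b \<Longrightarrow> ito_integral M FW W (H \<phi>) (J \<phi>)"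
    using ito_integral_degenerate[OF True] by metis
  have "weak_identity \<kappa> lam \<theta> u0 s0 (v \<omega>) (front \<omega>) \<phi> t (J \<phi> t \<omega>)" if "\<phi> \<in> C12b" "0 < t" for \<phi> t \<omega>
    by (rule weak_identity_if_martingale_part[OF that u0]) (use martingale_part_degenerate[OF True that(1)] that True in simp)
  with J show ?thesis by blast
next
  case False
  have "weak_identity \<kappa> lam \<theta> u0 s0 (v \<omega>) (front \<omega>) \<phi> t (- (1 / \<theta>) * (\<integral>x. N \<phi> t \<omega> x \<partial>Q))" if "\<phi> \<in> C12b" "0 < t" for \<phi> t \<omega>
    by (rule weak_identity_if_martingale_part[OF that u0]) (use False in simp)
  then show ?thesis
    using ito_integral_nondegenerate[OF _ False]
    by (intro exI[of _ "\<lambda>\<phi> t \<omega>. - (1 / \<theta>) * (\<integral>x. N \<phi> t \<omega> x \<partial>Q)"]) blast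
qed

end

section \<open>The probabilistic representation\<close>

lemma measurable_ident_subalgebra:
  assumes "space G = space M" "sets G \<subseteq> sets M" shows "(\<lambda>x. x) \<in> measurable M G"
  using assms by (intro measurable_from_subalg[of M G]) (auto simp: subalgebra_def)

text \<open>For independent \<open>G\<close> and \<open>K\<close> the diagonal map sends
  \<open>M\<close> to the product of its restrictions, so the two arguments may be given separate
  sample points.\<close>

lemma (in prob_space) integral_freeze:
  fixes f :: "'a \<times> 'a \<Rightarrow> real"
  assumes G: "space G = space M" "sets G \<subseteq> sets M" and K: "space K = space M" "sets K \<subseteq> sets M"
    and ind: "\<And>A D. A \<in> sets G \<Longrightarrow> D \<in> sets K \<Longrightarrow> prob (A \<inter> D) = prob A * prob D"
    and f: "f \<in> borel_measurable (G \<Otimes>\<^sub>M K)" "\<And>z. \<bar>f z\<bar> \<le> c"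
  shows "(\<integral>\<omega>. f (\<omega>, \<omega>) \<partial>M) = (\<integral>\<omega>. \<integral>\<omega>'. f (\<omega>, \<omega>') \<partial>M \<partial>M)"
    and "(\<lambda>\<omega>. \<integral>\<omega>'. f (\<omega>, \<omega>') \<partial>M) \<in> borel_measurable G"
proof -
  have id [measurable]: "(\<lambda>x. x) \<in> measurable M G" "(\<lambda>x. x) \<in> measurable M K"
    by (rule measurable_ident_subalgebra[OF G], rule measurable_ident_subalgebra[OF K])
  have gen: "sigma_sets (space M) {(\<lambda>x. x) -` A \<inter> space M |A. A \<in> sets L} = sets L" if "space L = space M" for L
  proof -
    have "{(\<lambda>x. x) -` A \<inter> space M |A. A \<in> sets L} = sets L"
      using sets.sets_into_space[of _ L] that by (auto simp: Int_absorb2)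
    then show ?thesis using sets.sigma_sets_eq[of L] that by simp
  qed
  have "indep_set (sets G) (sets K)" unfolding indep_sets2_eq using G K ind by auto
  then have "indep_var G (\<lambda>x. x) K (\<lambda>x. x)" unfolding indep_var_eq gen[OF G(1)] gen[OF K(1)] using id by simp
  then have d: "distr M G (\<lambda>x. x) \<Otimes>\<^sub>M distr M K (\<lambda>x. x) = distr M (G \<Otimes>\<^sub>M K) (\<lambda>x. (x, x))"
    unfolding indep_var_distribution_eq by simp
  interpret G: prob_space "distr M G (\<lambda>x. x)" by (rule prob_space_distr) measurable
  interpret K: prob_space "distr M K (\<lambda>x. x)" by (rule prob_space_distr) measurable
  interpret GK: pair_prob_space "distr M G (\<lambda>x. x)" "distr M K (\<lambda>x. x)" ..
  have fm: "f \<in> borel_measurable (distr M G (\<lambda>x. x) \<Otimes>\<^sub>M distr M K (\<lambda>x. x))" using f(1) by simp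
  have fi: "integrable (distr M G (\<lambda>x. x) \<Otimes>\<^sub>M distr M K (\<lambda>x. x)) f"
    using f(2) by (intro GK.P.integrable_const_bound[of _ c] fm) auto
  have sec: "f \<circ> Pair \<omega> \<in> borel_measurable K" if "\<omega> \<in> space M" for \<omega>
    using measurable_Pair2[OF f(1), of \<omega>] that G(1) by (simp add: comp_def)
  have "(\<lambda>\<omega>. \<integral>\<omega>'. f (\<omega>, \<omega>') \<partial>distr M K (\<lambda>x. x)) \<in> borel_measurable G"
    using fm by (intro K.borel_measurable_lebesgue_integral) simp
  moreover have inner: "(\<integral>\<omega>'. f (\<omega>, \<omega>') \<partial>distr M K (\<lambda>x. x)) = (\<integral>\<omega>'. f (\<omega>, \<omega>') \<partial>M)" if "\<omega> \<in> space M" for \<omega>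
    using integral_distr[OF id(2), of "f \<circ> Pair \<omega>"] sec[OF that] by (simp add: comp_def)
  ultimately show m: "(\<lambda>\<omega>. \<integral>\<omega>'. f (\<omega>, \<omega>') \<partial>M) \<in> borel_measurable G"
    by (subst measurable_cong[where g="\<lambda>\<omega>. \<integral>\<omega>'. f (\<omega>, \<omega>') \<partial>distr M K (\<lambda>x. x)"]) (auto simp: G(1))
  have "(\<integral>\<omega>. f (\<omega>, \<omega>) \<partial>M) = (\<integral>z. f z \<partial>distr M (G \<Otimes>\<^sub>M K) (\<lambda>x. (x, x)))"
    by (rule integral_distr[symmetric]) (use f(1) in auto)
  also have "\<dots> = (\<integral>\<omega>. \<integral>\<omega>'. f (\<omega>, \<omega>') \<partial>distr M K (\<lambda>x. x) \<partial>distr M G (\<lambda>x. x))"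
    unfolding d[symmetric] by (rule GK.integral_fst'[OF fi, symmetric])
  also have "\<dots> = (\<integral>\<omega>. \<integral>\<omega>'. f (\<omega>, \<omega>') \<partial>M \<partial>distr M G (\<lambda>x. x))"
    by (rule Bochner_Integration.integral_cong[OF refl]) (simp add: inner G(1))
  also have "\<dots> = (\<integral>\<omega>. \<integral>\<omega>'. f (\<omega>, \<omega>') \<partial>M \<partial>M)"
    by (rule integral_distr[OF id(1) m])
  finally show "(\<integral>\<omega>. f (\<omega>, \<omega>) \<partial>M) = (\<integral>\<omega>. \<integral>\<omega>'. f (\<omega>, \<omega>') \<partial>M \<partial>M)" .
qed

text \<open>Multiplying \<open>f\<close> by the indicator of an event of \<open>G\<close> in the
  first argument reduces the defining property of conditional expectation to the previous
  formula.\<close>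

lemma (in prob_space) real_cond_exp_freeze:
  fixes f :: "'a \<times> 'a \<Rightarrow> real"
  assumes G: "space G = space M" "sets G \<subseteq> sets M" and K: "space K = space M" "sets K \<subseteq> sets M"
    and ind: "\<And>A D. A \<in> sets G \<Longrightarrow> D \<in> sets K \<Longrightarrow> prob (A \<inter> D) = prob A * prob D"
    and f: "f \<in> borel_measurable (G \<Otimes>\<^sub>M K)" "\<And>z. \<bar>f z\<bar> \<le> c"
  shows "AE \<omega> in M. real_cond_exp M G (\<lambda>\<omega>. f (\<omega>, \<omega>)) \<omega> = (\<integral>\<omega>'. f (\<omega>, \<omega>') \<partial>M)"
proof -
  interpret finite_measure_subalgebra M G
    by standard (use G in \<open>auto simp: subalgebra_def\<close>)
  have id [measurable]: "(\<lambda>x. x) \<in> measurable M G" "(\<lambda>x. x) \<in> measurable M K"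
    by (rule measurable_ident_subalgebra[OF G], rule measurable_ident_subalgebra[OF K])
  have c0: "0 \<le> c" using f(2) order_trans[OF abs_ge_zero] by blast
  note fr = integral_freeze[OF G K ind f]
  have fd: "(\<lambda>\<omega>. f (\<omega>, \<omega>)) \<in> borel_measurable M" by (rule measurable_compose[OF _ f(1)]) measurable
  have fb: "\<bar>\<integral>\<omega>'. f (\<omega>, \<omega>') \<partial>M\<bar> \<le> c" if "\<omega> \<in> space M" for \<omega>
  proof -
    have "(\<lambda>\<omega>'. f (\<omega>, \<omega>')) \<in> borel_measurable M"
      by (rule measurable_compose[OF id(2) measurable_Pair2[OF f(1)]]) (use that G(1) in simp)
    then have "integrable M (\<lambda>\<omega>'. f (\<omega>, \<omega>'))" using f(2) by (intro integrable_const_bound[of _ c]) auto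
    then have "(\<integral>\<omega>'. \<bar>f (\<omega>, \<omega>')\<bar> \<partial>M) \<le> (\<integral>\<omega>'. c \<partial>M)" using f(2) by (intro integral_mono) auto
    then show ?thesis by (intro order_trans[OF integral_abs_bound]) (simp add: prob_space)
  qed
  show ?thesis
  proof (rule real_cond_exp_charact)
    show "integrable M (\<lambda>\<omega>. f (\<omega>, \<omega>))" using f(2) by (intro integrable_const_bound[of _ c] fd) auto
    show "integrable M (\<lambda>\<omega>. \<integral>\<omega>'. f (\<omega>, \<omega>') \<partial>M)"
      using fb by (intro integrable_const_bound[of _ c] AE_I2 measurable_compose[OF id(1) fr(2)]) auto
    show "(\<lambda>\<omega>. \<integral>\<omega>'. f (\<omega>, \<omega>') \<partial>M) \<in> borel_measurable G" by (rule fr(2))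
    fix A assume A [measurable]: "A \<in> sets G"
    have "(\<integral>\<omega>. indicator A (fst (\<omega>, \<omega>)) * f (\<omega>, \<omega>) \<partial>M) = (\<integral>\<omega>. \<integral>\<omega>'. indicator A (fst (\<omega>, \<omega>')) * f (\<omega>, \<omega>') \<partial>M \<partial>M)"
    proof (rule integral_freeze[where f="\<lambda>z. indicator A (fst z) * f z", OF G K ind])
      show "(\<lambda>z. indicator A (fst z) * f z) \<in> borel_measurable (G \<Otimes>\<^sub>M K)" using f(1) by measurable
      show "\<bar>indicator A (fst z) * f z\<bar> \<le> c" for z using f(2)[of z] c0 by (auto simp: indicator_def)
    qed
    then show "(\<integral>\<omega>\<in>A. f (\<omega>, \<omega>) \<partial>M) = (\<integral>\<omega>\<in>A. (\<integral>\<omega>'. f (\<omega>, \<omega>') \<partial>M) \<partial>M)"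
      by (simp add: set_lebesgue_integral_def)
  qed
qed

text \<open>Back to a single sample point: \<open>W'\<close> and \<open>B'\<close> are the given
  Brownian motions, \<open>W\<close> and \<open>B\<close> their regular versions. Independence of
  the histories links the average over a second sample point with conditioning on the
  filtration.\<close>

locale stefan_particles = stefan + complete_measure M +
  fixes W' B' :: "real \<Rightarrow> 'a \<Rightarrow> real"
  assumes indep_histories: "A \<in> sets (HW u) \<Longrightarrow> D \<in> sets (HB u) \<Longrightarrow> measure M (A \<inter> D) = measure M A * measure M D"
    and versions: "AE \<omega> in M. \<forall>t\<ge>0. W' t \<omega> = W t \<omega> \<and> B' t \<omega> = B t \<omega>"
    and \<sigma>_def: "\<sigma> = sqrt (2 * \<kappa> - \<theta>\<^sup>2)"
begin

lemma particle_eq: "AE \<omega> in M. \<forall>y. \<forall>t\<ge>0. particle \<kappa> \<theta> B' W' y t \<omega> = X \<omega> t (\<omega>, y)"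
  using versions
  by eventually_elim (simp only: particle_def X_def noise_def \<sigma>_def[symmetric] fst_conv snd_conv, simp)

text \<open>A dead particle has met the front, because the running maximum is attained. Conversely,
  survival at \<open>t\<close> persists for a short time, so the infimum exceeds \<open>t\<close>
  whether or not it is attained.\<close>

lemma hitting_time_le_iff:
  assumes "\<And>t. 0 \<le> t \<Longrightarrow> P t \<omega> = X \<omega> t (\<omega>, y)" and t: "0 \<le> t"
  shows "hitting_time P front \<omega> \<le> ereal t \<longleftrightarrow> \<not> live \<omega> t (\<omega>, y)"
proof
  assume "\<not> live \<omega> t (\<omega>, y)"
  then have le: "y \<le> mx \<omega> \<omega> t" by (simp add: live_def)
  obtain r where r: "0 \<le> r" "r \<le> t" "front \<omega> r - noise r \<omega> \<omega> = mx \<omega> \<omega> t" using mx_attained[OF t] .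
  then have "P r \<omega> \<le> front \<omega> r" using le assms(1)[OF r(1)] by (simp add: X_def)
  then have "hitting_time P front \<omega> \<le> ereal r"
    unfolding hitting_time_def using r(1) by (intro Inf_lower) blast
  then show "hitting_time P front \<omega> \<le> ereal t" using r(2) by (simp add: order_trans)
next
  assume hit: "hitting_time P front \<omega> \<le> ereal t"
  show "\<not> live \<omega> t (\<omega>, y)"
  proof
    assume "live \<omega> t (\<omega>, y)"
    then have "eventually (\<lambda>u. live \<omega> u (\<omega>, y)) (at_right t)"
      using live_right[OF t, of \<omega> "(\<omega>, y)"] by (auto elim: eventually_mono)
    then obtain u where u: "t < u" "\<And>r. t < r \<Longrightarrow> r < u \<Longrightarrow> live \<omega> r (\<omega>, y)"
      unfolding eventually_at_right_field by blast
    have "ereal u \<le> hitting_time P front \<omega>"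
      unfolding hitting_time_def
    proof (intro Inf_greatest, elim CollectE exE conjE)
      fix z r assume z: "z = ereal r" "0 \<le> r" "P r \<omega> \<le> front \<omega> r"
      have "\<not> live \<omega> r (\<omega>, y)"
        using z(2,3) assms(1)[OF z(2)] mx_upper[of r r \<omega> \<omega>] by (simp add: X_def live_def)
      then have "\<not> r < u" using u(2)[of r] live_antimono[of r t \<omega> "(\<omega>, y)"] \<open>live \<omega> t (\<omega>, y)\<close> by force
      then show "ereal u \<le> z" using z(1) by simp
    qed
    then have "ereal u \<le> ereal t" using hit by (rule order_trans)
    then show False using u(1) by simp
  qed
qed

text \<open>\<open>e \<omega> (\<omega>', y)\<close> separates the two sources of randomness: the
  first argument enters through \<open>FW t\<close>, the second through the history of
  \<open>B\<close>. On the diagonal it is the event in question; freezing identifies the conditional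
  probability with the measure of a slice, and this is jointly measurable in \<open>\<omega>\<close>
  and \<open>y\<close>.\<close>

lemma cond_prob_version_slice:
  assumes t: "0 \<le> t" and e: "Measurable.pred (FW t \<Otimes>\<^sub>M (HB t \<Otimes>\<^sub>M borel)) (\<lambda>(\<omega>, x). e \<omega> x)"
    and E: "\<And>y. AE \<omega> in M. E y \<omega> \<longleftrightarrow> e \<omega> (\<omega>, y)"
  shows "cond_prob_version M (FW t) E (\<lambda>\<omega> y. measure M {\<omega>' \<in> space M. e \<omega> (\<omega>', y)})"
  unfolding cond_prob_version_def
proof (intro conjI allI)
  have G: "space (FW t) = space M" "sets (FW t) \<subseteq> sets M"
    using sets_FW[of t] W.sets_H[of "t + 1"] by (auto simp: space_FW)
  have K: "space (HB t) = space M" "sets (HB t) \<subseteq> sets M" by (rule B.space_H, rule B.sets_H)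
  \<comment> \<open>Events of \<open>FW t\<close> and of \<open>HB t\<close> both belong to the
    histories at \<open>t + 1\<close>, for which independence is available.\<close>
  have ind: "measure M (A \<inter> D) = measure M A * measure M D" if "A \<in> sets (FW t)" "D \<in> sets (HB t)" for A D
    using that B.H_mono[of t "t + 1"] sets_FW[of t] by (intro indep_histories[of _ "t + 1"]) auto
  have [measurable]: "(\<lambda>x. x) \<in> measurable M (HB t)"
    by (rule B.measurable_from_H[of _ t]) simp
  have slice: "(\<integral>\<omega>'. indicator {z. e (fst z) (snd z, y)} (\<omega>, \<omega>') \<partial>M) = measure M {\<omega>' \<in> space M. e \<omega> (\<omega>', y)}" for \<omega> y
  proof -
    have "(\<integral>\<omega>'. indicat_real {z. e (fst z) (snd z, y)} (\<omega>, \<omega>') \<partial>M) = (\<integral>\<omega>'. indicat_real {\<omega>' \<in> space M. e \<omega> (\<omega>', y)} \<omega>' \<partial>M)"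
      by (rule Bochner_Integration.integral_cong) (auto simp: indicator_def)
    then show ?thesis by (simp add: Int_def conj_commute)
  qed
  have m1: "(\<lambda>z. indicat_real {z. e (fst z) (snd z, y)} z) \<in> borel_measurable (FW t \<Otimes>\<^sub>M HB t)" for y
  proof -
    have "(\<lambda>z. (fst z, (snd z, y))) \<in> measurable (FW t \<Otimes>\<^sub>M HB t) (FW t \<Otimes>\<^sub>M (HB t \<Otimes>\<^sub>M borel))" by measurable
    from measurable_compose[OF this e] have "Measurable.pred (FW t \<Otimes>\<^sub>M HB t) (\<lambda>z. e (fst z) (snd z, y))" by simp
    then show ?thesis by (intro borel_measurable_indicator') simp
  qed
  have "(\<lambda>z. ((fst (fst z)), ((\<lambda>x. x) (snd z), snd (fst z)))) \<in> measurable ((FW t \<Otimes>\<^sub>M borel) \<Otimes>\<^sub>M M) (FW t \<Otimes>\<^sub>M (HB t \<Otimes>\<^sub>M borel))"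
    by measurable
  from measurable_compose[OF this e]
  have "Measurable.pred ((FW t \<Otimes>\<^sub>M borel) \<Otimes>\<^sub>M M) (\<lambda>z. e (fst (fst z)) (snd z, snd (fst z)))" by simp
  then have "(\<lambda>z. indicat_real {z. e (fst (fst z)) (snd z, snd (fst z))} z) \<in> borel_measurable ((FW t \<Otimes>\<^sub>M borel) \<Otimes>\<^sub>M M)"
    by (intro borel_measurable_indicator') simp
  then have "(\<lambda>z. \<integral>\<omega>'. indicat_real {z. e (fst (fst z)) (snd z, snd (fst z))} (z, \<omega>') \<partial>M) \<in> borel_measurable (FW t \<Otimes>\<^sub>M borel)"
    by (intro W.borel_measurable_lebesgue_integral) (simp add: case_prod_unfold)
  moreover have "(\<integral>\<omega>'. indicat_real {z. e (fst (fst z)) (snd z, snd (fst z))} (z, \<omega>') \<partial>M) = measure M {\<omega>' \<in> space M. e (fst z) (\<omega>', snd z)}" for z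
    using slice[of "snd z" "fst z"] by (simp add: indicator_def)
  ultimately show "(\<lambda>(\<omega>, y). measure M {\<omega>' \<in> space M. e \<omega> (\<omega>', y)}) \<in> borel_measurable (FW t \<Otimes>\<^sub>M borel)"
    by (simp add: case_prod_unfold)
  fix y :: real
  have [measurable]: "(\<lambda>x. x) \<in> measurable M (FW t)" by (rule FW_M[of _ t]) simp
  have "(\<lambda>\<omega>. ((\<lambda>x. x) \<omega>, ((\<lambda>x. x) \<omega>, y))) \<in> measurable M (FW t \<Otimes>\<^sub>M (HB t \<Otimes>\<^sub>M borel))" by measurable
  from measurable_compose[OF this e] have em [measurable]: "Measurable.pred M (\<lambda>\<omega>. e \<omega> (\<omega>, y))" by simp
  show Em: "{\<omega>\<in>space M. E y \<omega>} \<in> sets M"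
  proof (rule in_sets_AE)
    show "AE \<omega> in M. \<omega> \<in> {\<omega>\<in>space M. e \<omega> (\<omega>, y)} \<longleftrightarrow> \<omega> \<in> {\<omega>\<in>space M. E y \<omega>}"
      using E[of y] by eventually_elim simp
    show "{\<omega>\<in>space M. e \<omega> (\<omega>, y)} \<in> sets M" by measurable
  qed auto
  interpret finite_measure_subalgebra M "FW t"
    by standard (use G in \<open>auto simp: subalgebra_def\<close>)
  have c: "AE \<omega> in M. real_cond_exp M (FW t) (indicator {\<omega>\<in>space M. E y \<omega>}) \<omega> =
      real_cond_exp M (FW t) (\<lambda>\<omega>. indicator {z. e (fst z) (snd z, y)} (\<omega>, \<omega>)) \<omega>"
  proof (rule real_cond_exp_cong)
    show "AE \<omega> in M. indicat_real {\<omega>\<in>space M. E y \<omega>} \<omega> = indicator {z. e (fst z) (snd z, y)} (\<omega>, \<omega>)"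
      using E[of y] AE_space by eventually_elim (simp add: indicator_def)
    show "(\<lambda>\<omega>. indicat_real {z. e (fst z) (snd z, y)} (\<omega>, \<omega>)) \<in> borel_measurable M"
      using em by (simp add: indicator_def)
  qed (use Em in measurable)
  show "AE \<omega> in M. measure M {\<omega>' \<in> space M. e \<omega> (\<omega>', y)} = real_cond_exp M (FW t) (indicator {\<omega>\<in>space M. E y \<omega>}) \<omega>"
  proof -
    have "AE \<omega> in M. real_cond_exp M (FW t) (\<lambda>\<omega>. indicator {z. e (fst z) (snd z, y)} (\<omega>, \<omega>)) \<omega> =
        measure M {\<omega>' \<in> space M. e \<omega> (\<omega>', y)}"
      unfolding slice[symmetric] by (rule W.real_cond_exp_freeze[where c=1, OF G K ind m1]) auto
    with c show ?thesis by eventually_elim simp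
  qed
qed

lemma live_FW_HB: "0 \<le> t \<Longrightarrow> Measurable.pred (FW t \<Otimes>\<^sub>M (HB t \<Otimes>\<^sub>M borel)) (\<lambda>(\<omega>, x). live \<omega> t x)"
  by (rule live_measurable_general[of t]) (auto intro: W_FW B.adapted FW_mono[OF _ front_FW])

lemma X_FW_HB: "(\<lambda>(\<omega>, x). X \<omega> t x) \<in> borel_measurable (FW t \<Otimes>\<^sub>M (HB t \<Otimes>\<^sub>M borel))"
  by (rule X_measurable_general[of t]) (auto intro: W_FW B.adapted)

text \<open>Fubini's theorem with the starting point as the outer variable; the minus sign is that
  of the density of \<open>\<nu>\<close>.\<close>

lemma measure_Q_slices:
  assumes e: "Measurable.pred Q e" and u0: "AE x in lborel. v0 x = u0 x" "u0 \<in> borel_measurable borel"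
  shows "(LINT y:{s0..}|lborel. measure M {\<omega>' \<in> space M. e (\<omega>', y)} * u0 y) = - measure Q {x \<in> space Q. e x}"
proof -
  have m [measurable]: "{x \<in> space Q. e x} \<in> sets Q" by (rule predE[OF e])
  let ?f = "\<lambda>x. indicat_real {x \<in> space Q. e x} x"
  have fi: "integrable (M \<Otimes>\<^sub>M \<nu>) ?f"
    unfolding Q_def[symmetric] by (rule integrable_real_indicator[OF m]) (simp add: Q.emeasure_eq_measure)
  have slice: "(\<integral>\<omega>'. ?f (\<omega>', y) \<partial>M) = measure M {\<omega>' \<in> space M. e (\<omega>', y)}" for y
  proof -
    have "(\<integral>\<omega>'. ?f (\<omega>', y) \<partial>M) = (\<integral>\<omega>'. indicat_real {\<omega>' \<in> space M. e (\<omega>', y)} \<omega>' \<partial>M)"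
      by (rule Bochner_Integration.integral_cong) (auto simp: indicator_def space_Q)
    then show ?thesis by (simp add: Int_def conj_commute)
  qed
  have sm [measurable]: "(\<lambda>y. measure M {\<omega>' \<in> space M. e (\<omega>', y)}) \<in> borel_measurable borel"
  proof -
    have "(\<lambda>z. ?f (snd z, fst z)) \<in> borel_measurable (\<nu> \<Otimes>\<^sub>M M)"
      by (rule measurable_compose[OF measurable_Pair[OF measurable_snd measurable_fst]]) (use fi in auto)
    then have "(\<lambda>y. \<integral>\<omega>'. ?f (\<omega>', y) \<partial>M) \<in> borel_measurable \<nu>"
      by (intro W.borel_measurable_lebesgue_integral) (simp add: case_prod_unfold)
    then show ?thesis by (simp add: slice)
  qed
  have "measure Q {x \<in> space Q. e x} = (\<integral>x. ?f x \<partial>(M \<Otimes>\<^sub>M \<nu>))" using sets.sets_into_space[OF m] unfolding Q_def by (simp add: Int_absorb2)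
  also have "\<dots> = (\<integral>y. measure M {\<omega>' \<in> space M. e (\<omega>', y)} \<partial>\<nu>)"
    using M\<nu>.integral_snd[of "\<lambda>x y. ?f (x, y)"] fi by (simp add: slice)
  also have "\<dots> = - (\<integral>y. v0 y * measure M {\<omega>' \<in> space M. e (\<omega>', y)} \<partial>lborel)"
    by (rule integral_\<nu>) measurable
  also have "(\<integral>y. v0 y * measure M {\<omega>' \<in> space M. e (\<omega>', y)} \<partial>lborel) = (LINT y:{s0..}|lborel. measure M {\<omega>' \<in> space M. e (\<omega>', y)} * u0 y)"
    unfolding set_lebesgue_integral_def
  proof (rule integral_cong_AE)
    show "AE y in lborel. v0 y * measure M {\<omega>' \<in> space M. e (\<omega>', y)} =
        indicator {s0..} y *\<^sub>R (measure M {\<omega>' \<in> space M. e (\<omega>', y)} * u0 y)"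
      using u0(1) by eventually_elim (auto simp: indicator_def v0_zero)
  qed (use u0(2) in measurable)
  finally show ?thesis by simp
qed

text \<open>The mass balance for dead particles, read through the slices that represent the
  conditional probabilities of absorption.\<close>

theorem front_representation_front:
  assumes t: "0 \<le> t" and u0: "AE x in lborel. v0 x = u0 x" "u0 \<in> borel_measurable borel"
    and FW: "FW t = brownian_filtration M W' t"
  shows "front_representation M W' B' \<kappa> lam \<theta> u0 s0 front t"
  unfolding front_representation_def
proof (intro exI[of _ "\<lambda>\<omega> y. measure M {\<omega>' \<in> space M. \<not> live \<omega> t (\<omega>', y)}"] conjI AE_I2)
  show "cond_prob_version M (brownian_filtration M W' t)
      (\<lambda>y \<omega>. hitting_time (particle \<kappa> \<theta> B' W' y) front \<omega> \<le> ereal t) (\<lambda>\<omega> y. measure M {\<omega>' \<in> space M. \<not> live \<omega> t (\<omega>', y)})"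
    unfolding FW[symmetric]
  proof (rule cond_prob_version_slice[OF t])
    show "Measurable.pred (FW t \<Otimes>\<^sub>M (HB t \<Otimes>\<^sub>M borel)) (\<lambda>(\<omega>, x). \<not> live \<omega> t x)"
      using live_FW_HB[OF t] by (simp add: case_prod_unfold)
    show "AE \<omega> in M. (hitting_time (particle \<kappa> \<theta> B' W' y) front \<omega> \<le> ereal t) = (\<not> live \<omega> t (\<omega>, y))" for y
      using particle_eq by eventually_elim (rule hitting_time_le_iff, simp, rule t)
  qed
  fix \<omega>
  have "measure Q {x \<in> space Q. \<not> live \<omega> t x} = lam * \<kappa> * (front \<omega> t - s0)"
    using measure_absorbed[OF t, of \<omega>] AE_start
    by (subst (asm) measure_eq_AE[where B="{x \<in> space Q. \<not> live \<omega> t x}"]) (auto simp: absorbed_def elim: eventually_mono)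
  then show "front \<omega> t = s0 - 1 / (lam * \<kappa>) * (LINT y:{s0..}|lborel. measure M {\<omega>' \<in> space M. \<not> live \<omega> t (\<omega>', y)} * u0 y)"
    using lam_pos kappa_pos by (subst measure_Q_slices[OF _ u0]) (auto simp: field_simps)
qed

text \<open>The law of the position on the event of survival, for frozen \<open>\<omega>\<close> and
  starting point. Built as an image measure, it is countably additive by construction, without
  choosing versions set by set.\<close>

definition kernel :: "real \<Rightarrow> 'a \<Rightarrow> real \<Rightarrow> real measure" where
  "kernel t \<omega> y = distr (density M (indicator {\<omega>' \<in> space M. live \<omega> t (\<omega>', y)})) borel (\<lambda>\<omega>'. X \<omega> t (\<omega>', y))"

lemma emeasure_kernel:
  assumes A: "A \<in> sets borel"
  shows "emeasure (kernel t \<omega> y) A = ennreal (measure M {\<omega>' \<in> space M. X \<omega> t (\<omega>', y) \<in> A \<and> live \<omega> t (\<omega>', y)})"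
proof -
  have [measurable]: "(\<lambda>\<omega>'. X \<omega> t (\<omega>', y)) \<in> borel_measurable M" unfolding X_def by simp
  have [measurable]: "Measurable.pred M (\<lambda>\<omega>'. live \<omega> t (\<omega>', y))" unfolding live_def by simp
  have "emeasure (kernel t \<omega> y) A = (\<integral>\<^sup>+\<omega>'. indicator {\<omega>' \<in> space M. live \<omega> t (\<omega>', y)} \<omega>' * indicator ((\<lambda>\<omega>'. X \<omega> t (\<omega>', y)) -` A \<inter> space M) \<omega>' \<partial>M)"
    unfolding kernel_def using A by (simp add: emeasure_distr emeasure_density)
  also have "\<dots> = (\<integral>\<^sup>+\<omega>'. indicator {\<omega>' \<in> space M. X \<omega> t (\<omega>', y) \<in> A \<and> live \<omega> t (\<omega>', y)} \<omega>' \<partial>M)"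
    by (rule nn_integral_cong) (auto simp: indicator_def)
  also have "\<dots> = emeasure M {\<omega>' \<in> space M. X \<omega> t (\<omega>', y) \<in> A \<and> live \<omega> t (\<omega>', y)}"
    by (rule nn_integral_indicator) (use A in measurable)
  finally show ?thesis by (simp add: W.emeasure_eq_measure)
qed

text \<open>Pairing \<open>v\<close> with an indicator function counts the surviving particles in a
  set, and the slices of this event are the values of the kernel.\<close>

theorem density_representation_v:
  assumes t: "0 \<le> t" and u0: "AE x in lborel. v0 x = u0 x" "u0 \<in> borel_measurable borel"
    and FW: "FW t = brownian_filtration M W' t"
  shows "density_representation M W' B' \<kappa> \<theta> u0 s0 v front t"
  unfolding density_representation_def
proof (intro exI[of _ "kernel t"] conjI AE_I2 ballI)
  let ?e = "\<lambda>A \<omega> x. X \<omega> t x \<in> A \<and> live \<omega> t x"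
  have mk: "measure (kernel t \<omega> y) A = measure M {\<omega>' \<in> space M. ?e A \<omega> (\<omega>', y)}" if "A \<in> sets borel" for \<omega> y A
    using emeasure_kernel[OF that] by (simp add: measure_def)
  have ver: "cond_prob_version M (FW t)
      (\<lambda>y \<omega>. particle \<kappa> \<theta> B' W' y t \<omega> \<in> A \<and> ereal t < hitting_time (particle \<kappa> \<theta> B' W' y) front \<omega>)
      (\<lambda>\<omega> y. measure M {\<omega>' \<in> space M. ?e A \<omega> (\<omega>', y)})" if A: "A \<in> sets borel" for A
  proof (rule cond_prob_version_slice[OF t])
    show "Measurable.pred (FW t \<Otimes>\<^sub>M (HB t \<Otimes>\<^sub>M borel)) (\<lambda>(\<omega>, x). ?e A \<omega> x)"
      using live_FW_HB[OF t] X_FW_HB[of t] A by (simp add: case_prod_unfold)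
    show "AE \<omega> in M. (particle \<kappa> \<theta> B' W' y t \<omega> \<in> A \<and> ereal t < hitting_time (particle \<kappa> \<theta> B' W' y) front \<omega>) = ?e A \<omega> (\<omega>, y)" for y
      using particle_eq
    proof eventually_elim
      case (elim \<omega>)
      then have "\<not> ereal t < hitting_time (particle \<kappa> \<theta> B' W' y) front \<omega> \<longleftrightarrow> \<not> live \<omega> t (\<omega>, y)"
        unfolding not_less by (intro hitting_time_le_iff t) auto
      then show ?case using elim t by auto
    qed
  qed
  show "cond_kernel M (brownian_filtration M W' t) (\<lambda>y. particle \<kappa> \<theta> B' W' y t)
      (\<lambda>y \<omega>. ereal t < hitting_time (particle \<kappa> \<theta> B' W' y) front \<omega>) (kernel t)"
    unfolding cond_kernel_def FW[symmetric]
  proof (intro conjI ballI)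
    show "(\<lambda>(\<omega>, y). kernel t \<omega> y) \<in> measurable (FW t \<Otimes>\<^sub>M borel) (subprob_algebra borel)"
    proof (rule measurable_subprob_algebra)
      fix z :: "'a \<times> real"
      show "sets (case z of (\<omega>, y) \<Rightarrow> kernel t \<omega> y) = sets borel" by (auto simp: kernel_def split: prod.split)
      have "subprob_space (kernel t \<omega> y)" for \<omega> y
      proof
        show "space (kernel t \<omega> y) \<noteq> {}" by (simp add: kernel_def)
        show "emeasure (kernel t \<omega> y) (space (kernel t \<omega> y)) \<le> 1"
          using emeasure_kernel[of UNIV t \<omega> y] W.prob_le_1 by (simp add: kernel_def)
      qed
      then show "subprob_space (case z of (\<omega>, y) \<Rightarrow> kernel t \<omega> y)" by (simp split: prod.split)
    next
      fix A :: "real set" assume A: "A \<in> sets borel"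
      have "(\<lambda>z. ennreal (measure M {\<omega>' \<in> space M. ?e A (fst z) (\<omega>', snd z)})) \<in> borel_measurable (FW t \<Otimes>\<^sub>M borel)"
        using ver[OF A] by (simp add: cond_prob_version_def case_prod_unfold)
      then show "(\<lambda>a. emeasure (case a of (\<omega>, y) \<Rightarrow> kernel t \<omega> y) A) \<in> borel_measurable (FW t \<Otimes>\<^sub>M borel)"
        by (simp add: case_prod_unfold emeasure_kernel[OF A])
    qed
    show "cond_prob_version M (FW t)
      (\<lambda>y \<omega>. particle \<kappa> \<theta> B' W' y t \<omega> \<in> A \<and> ereal t < hitting_time (particle \<kappa> \<theta> B' W' y) front \<omega>)
      (\<lambda>\<omega> y. measure (kernel t \<omega> y) A)" if "A \<in> sets borel" for A
      using ver[OF that] by (simp add: mk[OF that])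
  qed
  fix \<omega> and A :: "real set" assume A: "A \<in> sets borel"
  have "(LINT x:A|lborel. v \<omega> t x) = (\<integral>x. v \<omega> t x * indicator A x \<partial>lborel)"
    by (simp add: set_lebesgue_integral_def mult.commute)
  also have "\<dots> = - (\<integral>x. (if live \<omega> t x then indicator A (X \<omega> t x) else 0) \<partial>Q)"
    by (rule integral_v[where c=1]) (use A in \<open>auto simp: indicator_def\<close>)
  also have "(\<integral>x. (if live \<omega> t x then indicat_real A (X \<omega> t x) else 0) \<partial>Q) = (\<integral>x. indicat_real {x \<in> space Q. ?e A \<omega> x} x \<partial>Q)"
    by (rule Bochner_Integration.integral_cong) (auto simp: indicator_def)
  also have "\<dots> = measure Q {x \<in> space Q. ?e A \<omega> x}" by (simp add: Int_def conj_commute)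
  also have "- \<dots> = (LINT y:{s0..}|lborel. measure (kernel t \<omega> y) A * u0 y)"
    unfolding mk[OF A] by (rule measure_Q_slices[OF _ u0, symmetric]) (use A in measurable)
  finally show "(LINT x:A|lborel. v \<omega> t x) = (LINT y:{s0..}|lborel. measure (kernel t \<omega> y) A * u0 y)" .
qed

end

section \<open>Existence of a solution\<close>

text \<open>Simple integrals read the integrator only at times from \<open>0\<close> on, where the
  two processes agree almost surely. This passes from the regular version back to the given Brownian
  motion.\<close>

lemma ito_integral_cong:
  assumes ito: "ito_integral M F W H I"
    and F: "\<And>t. 0 \<le> t \<Longrightarrow> space (F t) = space M \<and> sets (F t) \<subseteq> sets M"
    and W: "\<And>t. W t \<in> borel_measurable M" and W': "\<And>t. 0 \<le> t \<Longrightarrow> W' t \<in> borel_measurable M"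
    and ae: "AE \<omega> in M. \<forall>t\<ge>0. W' t \<omega> = W t \<omega>"
  shows "ito_integral M F W' H I"
proof -
  have FM: "f \<in> borel_measurable M" if "0 \<le> t" "f \<in> borel_measurable (F t)" for t and f :: "'a \<Rightarrow> real"
    using F[OF that(1)] by (intro measurable_from_subalg[OF _ that(2)]) (auto simp: subalgebra_def)
  obtain n p \<xi> where *: "(\<forall>k. simple_data M F (n k) (p k) (\<xi> k)) \<and>
    (\<forall>T>0. \<forall>e>0. (\<lambda>k. measure M {\<omega>\<in>space M.
      ennreal e < (\<integral>\<^sup>+r\<in>{0..T}. ennreal ((H r \<omega> - simple_process (n k) (p k) (\<xi> k) r \<omega>)\<^sup>2) \<partial>lborel)}) \<longlonglongrightarrow> 0) \<and>
    (\<forall>t\<ge>0. \<forall>e>0. (\<lambda>k. measure M {\<omega>\<in>space M. e < \<bar>I t \<omega> - simple_integral W (n k) (p k) (\<xi> k) t \<omega>\<bar>}) \<longlonglongrightarrow> 0)"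
    using ito unfolding ito_integral_def by blast
  then have d: "simple_data M F (n k) (p k) (\<xi> k)" for k by blast
  have nonneg: "0 \<le> p k i" if "i \<le> n k" for k i
    using that
  proof (induction i)
    case 0 show ?case using d[of k] by (simp add: simple_data_def)
  next
    case (Suc i)
    then have "0 \<le> p k i" "p k i < p k (Suc i)" using d[of k] by (auto simp: simple_data_def)
    then show ?case by simp
  qed
  have eq: "measure M {\<omega>\<in>space M. e < \<bar>I t \<omega> - simple_integral W' (n k) (p k) (\<xi> k) t \<omega>\<bar>} =
      measure M {\<omega>\<in>space M. e < \<bar>I t \<omega> - simple_integral W (n k) (p k) (\<xi> k) t \<omega>\<bar>}" if t: "0 \<le> t" for t e k
  proof (rule measure_eq_AE)
    have Im [measurable]: "I t \<in> borel_measurable M" using ito t by (intro FM[OF t]) (simp add: ito_integral_def)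
    have m: "simple_integral V (n k) (p k) (\<xi> k) t \<in> borel_measurable M"
      if V: "\<And>t. 0 \<le> t \<Longrightarrow> V t \<in> borel_measurable M" for V
      unfolding simple_integral_def[abs_def]
    proof (intro borel_measurable_sum borel_measurable_times borel_measurable_diff V)
      fix i assume "i \<in> {..<n k}"
      then have i: "i < n k" by simp
      show "\<xi> k i \<in> borel_measurable M" using d[of k] i nonneg[of i k] by (intro FM[of "p k i"]) (auto simp: simple_data_def)
      show "0 \<le> min t (p k i)" "0 \<le> min t (p k (Suc i))" using t nonneg[of i k] nonneg[of "Suc i" k] i by auto
    qed
    note [measurable] = m[OF W] m[OF W']
    show "{\<omega>\<in>space M. e < \<bar>I t \<omega> - simple_integral W' (n k) (p k) (\<xi> k) t \<omega>\<bar>} \<in> sets M"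
      "{\<omega>\<in>space M. e < \<bar>I t \<omega> - simple_integral W (n k) (p k) (\<xi> k) t \<omega>\<bar>} \<in> sets M" by measurable
    show "AE \<omega> in M. \<omega> \<in> {\<omega>\<in>space M. e < \<bar>I t \<omega> - simple_integral W' (n k) (p k) (\<xi> k) t \<omega>\<bar>} \<longleftrightarrow>
        \<omega> \<in> {\<omega>\<in>space M. e < \<bar>I t \<omega> - simple_integral W (n k) (p k) (\<xi> k) t \<omega>\<bar>}"
      using ae
    proof eventually_elim
      case (elim \<omega>)
      have "simple_integral W' (n k) (p k) (\<xi> k) t \<omega> = simple_integral W (n k) (p k) (\<xi> k) t \<omega>"
        unfolding simple_integral_def using elim t nonneg[of _ k] by (intro sum.cong) auto
      then show ?case by simp
    qed
  qed
  have "\<forall>t\<ge>0. \<forall>e>0. (\<lambda>k. measure M {\<omega>\<in>space M. e < \<bar>I t \<omega> - simple_integral W' (n k) (p k) (\<xi> k) t \<omega>\<bar>}) \<longlonglongrightarrow> 0"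
    using * by (simp add: eq)
  then show ?thesis
    using ito * unfolding ito_integral_def by blast
qed

theorem (in stefan_particles) solution:
  assumes u0: "AE x in lborel. v0 x = u0 x" "u0 \<in> borel_measurable borel" and C: "ereal C \<le> Linf_norm u0"
    and FW: "FW = brownian_filtration M W'" and W': "\<And>t. 0 \<le> t \<Longrightarrow> W' t \<in> borel_measurable M"
  shows "cadlag_weak_solution M W' \<kappa> lam \<theta> u0 s0 v front"
proof -
  obtain J where J: "\<And>\<phi>. \<phi> \<in> C12b \<Longrightarrow> ito_integral M FW W (H \<phi>) (J \<phi>)"
    "\<And>\<omega> t \<phi>. 0 < t \<Longrightarrow> \<phi> \<in> C12b \<Longrightarrow> weak_identity \<kappa> lam \<theta> u0 s0 (v \<omega>) (front \<omega>) \<phi> t (J \<phi> t \<omega>)"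
    using weak_solution[OF u0] by metis
  have "ito_integral M FW W' (\<lambda>r \<omega>. LINT x:{front \<omega> r..}|lborel. v \<omega> r x * d_x \<phi> r x) (J \<phi>)" if "\<phi> \<in> C12b" for \<phi>
  proof (rule ito_integral_cong)
    show "ito_integral M FW W (\<lambda>r \<omega>. LINT x:{front \<omega> r..}|lborel. v \<omega> r x * d_x \<phi> r x) (J \<phi>)"
      using J(1)[OF that] unfolding H_def[abs_def] .
    show "space (FW t) = space M \<and> sets (FW t) \<subseteq> sets M" for t
      using sets_FW[of t] W.sets_H[of "t + 1"] by (auto simp: space_FW)
    show "AE \<omega> in M. \<forall>t\<ge>0. W' t \<omega> = W t \<omega>" using versions by eventually_elim blast
  qed (use W' in auto)
  then show ?thesis
    unfolding cadlag_weak_solution_def FW[symmetric] using v_front_D_processes[OF C u0(1)] J(2) by blast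
qed

text \<open>An intersection of sigma-algebras is already one, so generating adds nothing.\<close>

lemma sets_brownian_filtration:
  "sets (brownian_filtration M W t) = (\<Inter>u\<in>{t<..}. sets (completed_history M W u))"
proof -
  let ?A = "\<Inter>u\<in>{t<..}. sets (completed_history M W u)"
  have "A \<subseteq> space M" if "A \<in> ?A" for A
    using that gt_ex[of t] sets.sets_into_space[of A "completed_history M W _"] by auto
  then have "sets (brownian_filtration M W t) = sigma_sets (space M) ?A"
    unfolding brownian_filtration_def by (intro sets_measure_of) blast
  also have "\<dots> = ?A"
  proof
    have "sigma_sets (space M) ?A \<subseteq> sets (completed_history M W u)" if "t < u" for u
      using sets.sigma_sets_subset[of ?A "completed_history M W u"] that by auto
    then show "sigma_sets (space M) ?A \<subseteq> ?A" by blast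
  qed auto
  finally show ?thesis .
qed

lemma space_brownian_filtration: "space (brownian_filtration M W t) = space M"
  by (simp add: brownian_filtration_def space_measure_of_conv)

text \<open>Up to null sets the events of a history are events of the whole path, for which
  independence is given.\<close>

lemma (in prob_space) independent_completed_histories:
  assumes ind: "independent_processes M W B"
    and A: "A \<in> sets (completed_history M W u)" and D: "D \<in> sets (completed_history M B u)"
  shows "prob (A \<inter> D) = prob A * prob D"
proof -
  let ?P = "\<Pi>\<^sub>M t\<in>{0::real..}. (borel :: real measure)"
  define path where "path V \<omega> = (\<lambda>t\<in>{0..}. V t \<omega> :: real)" for V :: "real \<Rightarrow> 'a \<Rightarrow> real" and \<omega>
  define \<A> where "\<A> V = {path V -` C \<inter> space M |C. C \<in> sets ?P}" for V
  have iv: "indep_var ?P (path W) ?P (path B)"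
    using ind by (simp add: independent_processes_def path_def[abs_def])
  have alg: "sigma_algebra (space M) (\<A> V)" "\<A> V \<subseteq> events" "sets (completed_history M V u) \<subseteq> almost_sets M (\<A> V)"
    if m: "path V \<in> measurable M ?P" for V
  proof -
    have "sets (vimage_algebra (space M) (path V) ?P) = \<A> V"
      unfolding \<A>_def by (rule sets_vimage_algebra2) (use measurable_space[OF m] in auto)
    then show 1: "sigma_algebra (space M) (\<A> V)"
      using sets.sigma_algebra_axioms[of "vimage_algebra (space M) (path V) ?P"] by simp
    show 2: "\<A> V \<subseteq> events" using measurable_sets[OF m] by (auto simp: \<A>_def)
    show "sets (completed_history M V u) \<subseteq> almost_sets M (\<A> V)"
    proof (rule completed_history_subset_almost[OF 1 2])
      fix r :: real and A :: "real set" assume r: "0 \<le> r" and A: "A \<in> sets borel"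
      have "V r -` A \<inter> space M = path V -` ((\<lambda>f. f r) -` A \<inter> space ?P) \<inter> space M"
        using r measurable_space[OF m] by (auto simp: path_def)
      moreover have "(\<lambda>f. f r) -` A \<inter> space ?P \<in> sets ?P"
        using r A measurable_sets[OF measurable_component_singleton[of r "{0..}" "\<lambda>_. borel"], of A] by simp
      ultimately have "V r -` A \<inter> space M \<in> \<A> V" unfolding \<A>_def by blast
      then show "V r -` A \<inter> space M \<in> almost_sets M (\<A> V)" by (rule in_almost_sets[OF _ 2])
    qed
  qed
  have m: "path W \<in> measurable M ?P" "path B \<in> measurable M ?P" using iv by (auto dest: indep_var_rv1 indep_var_rv2)
  show ?thesis
  proof (rule indep_almost_sets[OF alg(2)[OF m(1)] alg(2)[OF m(2)]])
    show "A \<in> almost_sets M (\<A> W)" using A alg(3)[OF m(1)] by blast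
    show "D \<in> almost_sets M (\<A> B)" using D alg(3)[OF m(2)] by blast
    fix a b assume "a \<in> \<A> W" "b \<in> \<A> B"
    then obtain Ca Cb where ab: "a = path W -` Ca \<inter> space M" "Ca \<in> sets ?P" "b = path B -` Cb \<inter> space M" "Cb \<in> sets ?P"
      by (auto simp: \<A>_def)
    have "a \<inter> b = (\<lambda>x. (path W x, path B x)) -` (Ca \<times> Cb) \<inter> space M" using ab by auto
    then show "prob (a \<inter> b) = prob a * prob b" using indep_varD[OF iv ab(2,4)] ab by simp
  qed
qed

text \<open>The complement of the support is a union of possibly uncountably many open sets on which
  \<open>f\<close> vanishes almost everywhere; by Lindelof's theorem countably many of them
  suffice.\<close>

lemma AE_zero_below_ess_support:
  assumes "ess_support f \<subseteq> {s..}" shows "AE x in lborel. x \<le> s \<longrightarrow> f x = 0"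
proof -
  let ?\<U> = "{U. open U \<and> (AE x in lborel. x \<in> U \<longrightarrow> f x = 0)}"
  obtain \<F> where F: "\<F> \<subseteq> ?\<U>" "countable \<F>" "\<Union>\<F> = \<Union>?\<U>"
    by (rule Lindelof[of ?\<U>]) auto
  have "AE x in lborel. \<forall>U\<in>\<F>. x \<in> U \<longrightarrow> f x = 0"
    using F(1) by (subst AE_ball_countable[OF F(2)]) blast
  then show ?thesis
    using AE_lborel_singleton[of s]
  proof eventually_elim
    case (elim x)
    show ?case
    proof
      assume "x \<le> s"
      then have "x \<notin> ess_support f" using assms elim(2) by force
      then show "f x = 0" using elim(1) F(3) unfolding ess_support_def by blast
    qed
  qed
qed

theorem theorem3p1:
  fixes M :: "'a measure" and W B :: "real \<Rightarrow> 'a \<Rightarrow> real"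
    and \<kappa> lam \<theta> s0 :: real and v0 :: "real \<Rightarrow> real"
  assumes "prob_space M" and "complete_measure M"
    and "brownian_motion M W" and "brownian_motion M B" and "independent_processes M W B"
    and "0 < \<kappa>" and "0 < lam" and "\<bar>\<theta>\<bar> < sqrt (2 * \<kappa>)"
    and "0 \<le> s0"
    and "integrable lborel v0" and "Linf_norm v0 < \<infinity>"
    and "ess_support v0 \<subseteq> {s0..}"
    and "AE x in lborel. v0 x \<le> 0"
    and "\<exists>\<^sub>F y in at_right 0. - (1 / (lam * \<kappa>)) * (LINT x:{s0..s0 + y}|lborel. v0 x) < y"
  shows "\<exists>v s. cadlag_weak_solution M W \<kappa> lam \<theta> v0 s0 v s \<and>
           (\<forall>t\<ge>0. density_representation M W B \<kappa> \<theta> v0 s0 v s t \<and>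
                  front_representation M W B \<kappa> lam \<theta> v0 s0 s t)"
proof -
  interpret prob_space M by fact
  define C where "C = real_of_ereal (Linf_norm v0)"
  \<comment> \<open>A representative of the datum with sign, bound and support at every point; it is
    altered on a null set only.\<close>
  define w0 where "w0 x = (if v0 x \<le> 0 \<and> - C \<le> v0 x \<and> s0 < x then v0 x else 0)" for x
  have [measurable]: "v0 \<in> borel_measurable borel" using assms(10) by auto
  \<comment> \<open>Nonnegativity excludes the value minus infinity, so the norm is the real number
    \<open>C\<close>.\<close>
  have "esssup lborel (\<lambda>x::real. 0) \<le> Linf_norm v0" unfolding Linf_norm_def by (rule esssup_mono) auto
  then have "0 \<le> Linf_norm v0" by (simp add: esssup_const)
  then have C: "ereal C = Linf_norm v0" using assms(11) unfolding C_def by (intro ereal_real') auto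
  have "AE x in lborel. ereal \<bar>v0 x\<bar> \<le> ereal C" unfolding C Linf_norm_def by (rule esssup_AE)
  then have ae: "AE x in lborel. w0 x = v0 x"
    using AE_zero_below_ess_support[OF assms(12)] assms(13) by eventually_elim (auto simp: w0_def)
  have w0m [measurable]: "w0 \<in> borel_measurable borel" unfolding w0_def by measurable
  have w0_int: "(LINT x:A|lborel. w0 x) = (LINT x:A|lborel. v0 x)" if "A \<in> sets borel" for A
    using that ae by (intro set_lebesgue_integral_cong_AE) (auto elim: eventually_mono)
  have good: "AE \<omega> in M. good_path (\<lambda>t. W t \<omega>)" "AE \<omega> in M. good_path (\<lambda>t. B t \<omega>)"
    using good_path_AE[OF assms(3)] good_path_AE[OF assms(4)] .
  have "\<theta>\<^sup>2 < 2 * \<kappa>"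
    using power_strict_mono[OF assms(8), of 2] assms(6) by simp
  interpret stefan_particles M "clean W" "completed_history M W" "clean B" "completed_history M B" "brownian_filtration M W"
    \<kappa> lam \<theta> "sqrt (2 * \<kappa> - \<theta>\<^sup>2)" s0 C w0 W B
  proof (intro stefan_particles.intro stefan.intro stefan_axioms.intro stefan_particles_axioms.intro)
    show "clean_bm M (clean W) (completed_history M W)" by (rule clean_bm_clean[OF assms(1,2,3)])
    show "clean_bm M (clean B) (completed_history M B)" by (rule clean_bm_clean[OF assms(1,2,4)])
    show "(sqrt (2 * \<kappa> - \<theta>\<^sup>2))\<^sup>2 + \<theta>\<^sup>2 = 2 * \<kappa>" using \<open>\<theta>\<^sup>2 < 2 * \<kappa>\<close> by simp
    show "integrable lborel w0" using integrable_cong_AE[OF _ _ ae] assms(10) by auto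
    show "w0 x \<le> 0" for x by (simp add: w0_def)
    show "- C \<le> w0 x" for x
      using \<open>0 \<le> Linf_norm v0\<close> unfolding C[symmetric] by (simp add: w0_def)
    show "x \<le> s0 \<Longrightarrow> w0 x = 0" for x by (simp add: w0_def)
    show "\<exists>\<^sub>F y in at_right 0. - (1 / (lam * \<kappa>)) * (LINT x:{s0..s0 + y}|lborel. w0 x) < y"
      using assms(14) by (simp add: w0_int)
    show "AE \<omega> in M. \<forall>t\<ge>0. W t \<omega> = clean W t \<omega> \<and> B t \<omega> = clean B t \<omega>"
      using good by eventually_elim (simp add: clean_eq)
    show "prob (A \<inter> D) = prob A * prob D" if "A \<in> sets (completed_history M W u)" "D \<in> sets (completed_history M B u)" for A D u
      by (rule independent_completed_histories[OF assms(5) that])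
    show "space (brownian_filtration M W t) = space M" for t by (rule space_brownian_filtration)
    show "sets (brownian_filtration M W t) = (\<Inter>u\<in>{t<..}. sets (completed_history M W u))" for t
      by (rule sets_brownian_filtration)
  qed (use assms in auto)
  have W: "W t \<in> borel_measurable M" if "0 \<le> t" for t using assms(3) that by (auto simp: brownian_motion_def)
  have "cadlag_weak_solution M W \<kappa> lam \<theta> v0 s0 v front"
    by (rule solution[OF ae _ _ refl W]) (use C in auto)
  moreover have "density_representation M W B \<kappa> \<theta> v0 s0 v front t" "front_representation M W B \<kappa> lam \<theta> v0 s0 front t" if "0 \<le> t" for t
    by (rule density_representation_v[OF that ae _ refl], simp, rule front_representation_front[OF that ae _ refl], simp)
  ultimately show ?thesis by blast
qed

end
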